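(* Let $\Phi$ be a reduced irreducible root system with fundamental alcove $\mathcal{A}$ and Weyl chamber $\mathcal{C}$. Then: (i) $\mathrm{Aut}(\mathcal{C})=\mathrm{Aut}(C)$. (ii) The linear-part projection $\pi:\mathrm{E}(V)\to \mathrm{O}(V)$ restricts to a group isomorphism $\mathrm{Aut}(\mathcal{A})\to\mathrm{Aut}(\widetilde D)$ which is the identity on $\mathrm{Aut}(D)$. (iii) $\mathrm{Aut}(\mathcal{A})=\Omega\rtimes \mathrm{Aut}(D)$ (internal semidirect product, $\Omega$ normal). (iv) $\mathrm{Aut}(\mathcal{A})$ is an abstract Coxeter group (i.e. isomorphic to a Coxeter group), generated by the following affine involutions of $V$, according to the type of $\Phi$: $A_1$: $\omega_1$; $A_n$ $(n\ge 2)$: $\phi_0$ and $\omega_1\phi_0$; $B_2$: $\omega_2$; $B_n$ $(n\ge 3)$: $\omega_1$; $C_n$ $(n\ge3)$: $\omega_n$; $D_4$: $\phi_0,\ \phi_1,\ \omega_1$; $D_{2n}$ $(n>2)$: $\phi_0$ and $\omega_{2n-1}$; $D_{2n+1}$ $(n\ge2)$: $\phi_0$ and $\phi_0\omega_{2n+1}$; $E_6$: $\phi_0$ and $\phi_0\omega_6$; $E_7$: $\omega_7$; $E_8,F_4,G_2$: no generators (the group is trivial).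
   Context: $V$ is a finite-dimensional real Euclidean space with inner product $(\cdot,\cdot)$, $\mathrm{E}(V)=V\rtimes \mathrm{O}(V)$ is its group of rigid motions, $\pi:\mathrm{E}(V)\to\mathrm{O}(V)$ is the projection to the linear part, and $t_\gamma$ denotes translation by $\gamma\in V$. $\Phi\subset V$ is a reduced irreducible crystallographic root system spanning $V$, with Weyl group $W$, simple roots $\Pi=\{\alpha_1,\dots,\alpha_n\}$, $I=\{1,\dots,n\}$, and highest root $\alpha_0=\sum_{i\in I}m_i\alpha_i$. The root $\alpha_j$ is minuscule if $m_j=1$. The fundamental coweights $\varpi_i^\vee\in V$ are given by $(\varpi_i^\vee,\alpha_j)=\delta_{ij}$; $P^\vee=\bigoplus_i\mathbb{Z}\varpi^\vee_i$ is the coweight lattice, and $W_{\mathrm{ext}}=P^\vee\rtimes W\subset \mathrm{E}(V)$. The Weyl chamber is $\mathcal{C}=\{x\in V: (\alpha_i,x)\ge 0\ \forall i\in I\}$ and the fundamental alcove is $\mathcal{A}=\{x\in V:(\alpha_i,x)\ge0\ \forall i\in I,\ (\alpha_0,x)\le 1\}$. For $X=\mathcal{A}$ or $X=\mathcal{C}$, $\mathrm{Aut}(X)=\{\zeta\in\mathrm{E}(V):\zeta(X)=X\}$. The fundamental group is $\Omega=\{\zeta\in W_{\mathrm{ext}}:\zeta(\mathcal{A})=\mathcal{A}\}$. $\mathrm{Aut}(\Phi)=\{\phi\in\mathrm{O}(V):\phi(\Phi)=\Phi\}$. $\mathrm{Aut}(D)$ (automorphisms of the Dynkin diagram $D$)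 is the subgroup of $\mathrm{Aut}(\Phi)$ stabilizing $\Pi$; $\mathrm{Aut}(\widetilde D)$ (automorphisms of the affine Dynkin diagram $\widetilde D$) is the subgroup of $\mathrm{Aut}(\Phi)$ stabilizing $\{-\alpha_0\}\cup\Pi$. $\mathrm{Aut}(C)$ (automorphisms of the Coxeter diagram $C$ of $W$) is realized as the group of $\phi\in\mathrm{O}(V)$ that permute the normalized simple roots $\{\alpha_i/\|\alpha_i\| : i\in I\}$. For a minuscule $\alpha_j$, $v_j$ is the unique element of $W$ with $v_j\Pi=\{-\alpha_0\}\cup\{\alpha_i: i\ne j\}$, and $\omega_j=t_{\varpi_j^\vee}v_j\in\Omega$. Simple roots are numbered as in Bourbaki, except that for $B_2$ they are numbered so that $\alpha_0=2\alpha_1+\alpha_2$. The elements $\phi_0,\phi_1\in\mathrm{Aut}(D)$ are: for $A_n$ ($n\ge2$), $\phi_0(\alpha_i)=\alpha_{n+1-i}$; for $D_m$ of rank $m\ge 4$, $\phi_0$ swaps $\alpha_{m-1}$ and $\alpha_m$ and fixes the other simple roots; for $D_4$, $\phi_1$ swaps $\alpha_1$ and $\alpha_3$ and fixes $\alpha_2,\alpha_4$; for $E_6$, $\phi_0$ swaps $\alpha_1\leftrightarrow\alpha_6$, $\alpha_3\leftrightarrow\alpha_5$ and fixes $\alpha_2,\alpha_4$. *)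

theory Defs
  imports "HOL-Analysis.Analysis" "HOL-Algebra.Coset" "HOL-Algebra.Generated_Groups"
begin

section \<open>Rigid motions\<close>

text \<open>The Euclidean space \<open>V\<close> is the type \<open>'a::euclidean_space\<close>. Elements of \<open>E(V)\<close> and of
  \<open>O(V)\<close> are both represented as maps \<open>V \<Rightarrow> V\<close>, so \<open>O(V)\<close> is literally a subset of \<open>E(V)\<close>.\<close>

definition motions :: "('a::euclidean_space \<Rightarrow> 'a) set" where
  "motions = {\<zeta>. \<exists>\<gamma> \<phi>. orthogonal_transformation \<phi> \<and> \<zeta> = (\<lambda>x. \<gamma> + \<phi> x)}"

text \<open>For \<open>\<zeta> = t\<^sub>\<gamma> \<circ> \<phi>\<close> in \<open>E(V)\<close> this is \<open>\<phi>\<close>, as \<open>\<zeta> 0 = \<gamma>\<close>.\<close>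

definition linear_part :: "('a::euclidean_space \<Rightarrow> 'a) \<Rightarrow> 'a \<Rightarrow> 'a" where
  "linear_part \<zeta> = (\<lambda>x. \<zeta> x - \<zeta> 0)"

definition comp_group :: "('a \<Rightarrow> 'a) set \<Rightarrow> ('a \<Rightarrow> 'a) monoid" where
  "comp_group S = \<lparr>carrier = S, mult = (\<circ>), one = id\<rparr>"

definition Aut_region :: "'a::euclidean_space set \<Rightarrow> ('a \<Rightarrow> 'a) set" where
  "Aut_region X = {\<zeta> \<in> motions. \<zeta> ` X = X}"

definition internal_semidirect :: "('g, 'm) monoid_scheme \<Rightarrow> 'g set \<Rightarrow> 'g set \<Rightarrow> bool" where
  "internal_semidirect G N H \<longleftrightarrow>
     N \<lhd> G \<and> subgroup H G \<and> N \<inter> H = {\<one>\<^bsub>G\<^esub>} \<and> N <#>\<^bsub>G\<^esub> H = carrier G"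

definition generated_by_involutions :: "('g, 'm) monoid_scheme \<Rightarrow> 'g set \<Rightarrow> bool" where
  "generated_by_involutions G R \<longleftrightarrow>
     (\<forall>r\<in>R. r \<in> carrier G \<and> r \<noteq> \<one>\<^bsub>G\<^esub> \<and> r \<otimes>\<^bsub>G\<^esub> r = \<one>\<^bsub>G\<^esub>) \<and>
     generate G R = carrier G"


section \<open>Abstract Coxeter groups\<close>

text \<open>The entry \<open>0\<close> of a Coxeter matrix stands for \<open>\<infinity>\<close>.\<close>

definition coxeter_matrix :: "'s set \<Rightarrow> ('s \<Rightarrow> 's \<Rightarrow> nat) \<Rightarrow> bool" where
  "coxeter_matrix S m \<longleftrightarrow>
     (\<forall>s\<in>S. m s s = 1) \<and> (\<forall>s\<in>S. \<forall>t\<in>S. m s t = m t s \<and> (s \<noteq> t \<longrightarrow> m s t \<noteq> 1))"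

text \<open>The congruence on words over \<open>S\<close> generated by \<open>(s t)\<^bsup>m s t\<^esup> = 1\<close>. The case \<open>s = t\<close> reads
  \<open>s s = 1\<close>, so the quotient of the free monoid is already a group, and no formal inverses are
  needed. The relation is empty when \<open>m s t = 0\<close>.\<close>

inductive coxeter_eq :: "'s set \<Rightarrow> ('s \<Rightarrow> 's \<Rightarrow> nat) \<Rightarrow> 's list \<Rightarrow> 's list \<Rightarrow> bool"
  for S m where
  relator: "s \<in> S \<Longrightarrow> t \<in> S \<Longrightarrow> coxeter_eq S m (concat (replicate (m s t) [s, t])) []"
| refl: "w \<in> lists S \<Longrightarrow> coxeter_eq S m w w"
| sym: "coxeter_eq S m u w \<Longrightarrow> coxeter_eq S m w u"
| trans: "coxeter_eq S m u v \<Longrightarrow> coxeter_eq S m v w \<Longrightarrow> coxeter_eq S m u w"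
| append: "coxeter_eq S m u v \<Longrightarrow> coxeter_eq S m u' v' \<Longrightarrow> coxeter_eq S m (u @ u') (v @ v')"

definition coxeter_rel :: "'s set \<Rightarrow> ('s \<Rightarrow> 's \<Rightarrow> nat) \<Rightarrow> ('s list \<times> 's list) set" where
  "coxeter_rel S m = {(u, v). coxeter_eq S m u v}"

definition coxeter_group :: "'s set \<Rightarrow> ('s \<Rightarrow> 's \<Rightarrow> nat) \<Rightarrow> 's list set monoid" where
  "coxeter_group S m =
     \<lparr>carrier = lists S // coxeter_rel S m,
      mult = (\<lambda>X Y. \<Union>u\<in>X. \<Union>v\<in>Y. coxeter_rel S m `` {u @ v}),
      one = coxeter_rel S m `` {[]}\<rparr>"

text \<open>Coxeter groups are of finite rank here; their generators are labelled by natural numbers.\<close>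

definition is_coxeter_group :: "('g, 'm) monoid_scheme \<Rightarrow> bool" where
  "is_coxeter_group G \<longleftrightarrow>
     (\<exists>(S :: nat set) m. finite S \<and> coxeter_matrix S m \<and> G \<cong> coxeter_group S m)"


section \<open>Root systems\<close>

definition reflection :: "'a::euclidean_space \<Rightarrow> 'a \<Rightarrow> 'a" where
  "reflection \<alpha> x = x - (2 * (x \<bullet> \<alpha>) / (\<alpha> \<bullet> \<alpha>)) *\<^sub>R \<alpha>"

definition crystallographic_root_system :: "'a::euclidean_space set \<Rightarrow> bool" where
  "crystallographic_root_system \<Phi> \<longleftrightarrow>
     finite \<Phi> \<and> 0 \<notin> \<Phi> \<and> span \<Phi> = UNIV \<and>
     (\<forall>\<alpha>\<in>\<Phi>. reflection \<alpha> ` \<Phi> = \<Phi>) \<and>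
     (\<forall>\<alpha>\<in>\<Phi>. \<forall>\<beta>\<in>\<Phi>. 2 * (\<beta> \<bullet> \<alpha>) / (\<alpha> \<bullet> \<alpha>) \<in> \<int>)"

definition reduced_system :: "'a::euclidean_space set \<Rightarrow> bool" where
  "reduced_system \<Phi> \<longleftrightarrow> (\<forall>\<alpha>\<in>\<Phi>. \<forall>c. c *\<^sub>R \<alpha> \<in> \<Phi> \<longrightarrow> c = 1 \<or> c = - 1)"

definition irreducible_system :: "'a::euclidean_space set \<Rightarrow> bool" where
  "irreducible_system \<Phi> \<longleftrightarrow> \<Phi> \<noteq> {} \<and>
     \<not> (\<exists>\<Phi>1 \<Phi>2. \<Phi>1 \<noteq> {} \<and> \<Phi>2 \<noteq> {} \<and> \<Phi> = \<Phi>1 \<union> \<Phi>2 \<and> (\<forall>\<alpha>\<in>\<Phi>1. \<forall>\<beta>\<in>\<Phi>2. \<alpha> \<bullet> \<beta> = 0))"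

text \<open>\<open>\<alpha> 1, \<dots>, \<alpha> n\<close> is an enumeration of a base of \<open>\<Phi>\<close>; values of \<open>\<alpha>\<close> outside \<open>{1..n}\<close> play
  no role. As \<open>\<Phi>\<close> spans, \<open>n\<close> is the dimension of the space.\<close>

definition simple_roots :: "'a::euclidean_space set \<Rightarrow> nat \<Rightarrow> (nat \<Rightarrow> 'a) \<Rightarrow> bool" where
  "simple_roots \<Phi> n \<alpha> \<longleftrightarrow>
     inj_on \<alpha> {1..n} \<and> independent (\<alpha> ` {1..n}) \<and> \<alpha> ` {1..n} \<subseteq> \<Phi> \<and>
     (\<forall>\<beta>\<in>\<Phi>. \<exists>c :: nat \<Rightarrow> nat. \<beta> = (\<Sum>i\<in>{1..n}. real (c i) *\<^sub>R \<alpha> i) \<or>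
                              \<beta> = - (\<Sum>i\<in>{1..n}. real (c i) *\<^sub>R \<alpha> i))"

definition highest_root :: "'a::euclidean_space set \<Rightarrow> nat \<Rightarrow> (nat \<Rightarrow> 'a) \<Rightarrow> 'a" where
  "highest_root \<Phi> n \<alpha> =
     (THE \<theta>. \<theta> \<in> \<Phi> \<and> (\<forall>\<beta>\<in>\<Phi>. \<exists>c :: nat \<Rightarrow> nat. \<theta> - \<beta> = (\<Sum>i\<in>{1..n}. real (c i) *\<^sub>R \<alpha> i)))"

definition weyl_group :: "'a::euclidean_space set \<Rightarrow> ('a \<Rightarrow> 'a) set" where
  "weyl_group \<Phi> = generate (comp_group motions) (reflection ` \<Phi>)"

definition fund_coweight :: "nat \<Rightarrow> (nat \<Rightarrow> 'a::euclidean_space) \<Rightarrow> nat \<Rightarrow> 'a" where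
  "fund_coweight n \<alpha> i = (THE v. \<forall>j\<in>{1..n}. v \<bullet> \<alpha> j = (if i = j then 1 else 0))"

definition coweight_lattice :: "nat \<Rightarrow> (nat \<Rightarrow> 'a::euclidean_space) \<Rightarrow> 'a set" where
  "coweight_lattice n \<alpha> =
     {\<gamma>. \<exists>k :: nat \<Rightarrow> int. \<gamma> = (\<Sum>i\<in>{1..n}. of_int (k i) *\<^sub>R fund_coweight n \<alpha> i)}"

definition extended_weyl_group ::
    "'a::euclidean_space set \<Rightarrow> nat \<Rightarrow> (nat \<Rightarrow> 'a) \<Rightarrow> ('a \<Rightarrow> 'a) set" where
  "extended_weyl_group \<Phi> n \<alpha> =
     {\<zeta>. \<exists>\<gamma>\<in>coweight_lattice n \<alpha>. \<exists>w\<in>weyl_group \<Phi>. \<zeta> = (\<lambda>x. \<gamma> + w x)}"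

definition weyl_chamber :: "nat \<Rightarrow> (nat \<Rightarrow> 'a::euclidean_space) \<Rightarrow> 'a set" where
  "weyl_chamber n \<alpha> = {x. \<forall>i\<in>{1..n}. \<alpha> i \<bullet> x \<ge> 0}"

definition fund_alcove :: "'a::euclidean_space set \<Rightarrow> nat \<Rightarrow> (nat \<Rightarrow> 'a) \<Rightarrow> 'a set" where
  "fund_alcove \<Phi> n \<alpha> = {x. (\<forall>i\<in>{1..n}. \<alpha> i \<bullet> x \<ge> 0) \<and> highest_root \<Phi> n \<alpha> \<bullet> x \<le> 1}"

definition fund_group ::
    "'a::euclidean_space set \<Rightarrow> nat \<Rightarrow> (nat \<Rightarrow> 'a) \<Rightarrow> ('a \<Rightarrow> 'a) set" where
  "fund_group \<Phi> n \<alpha> =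
     {\<zeta> \<in> extended_weyl_group \<Phi> n \<alpha>. \<zeta> ` fund_alcove \<Phi> n \<alpha> = fund_alcove \<Phi> n \<alpha>}"


section \<open>Diagram automorphisms, realized in the orthogonal group\<close>

definition Aut_roots :: "'a::euclidean_space set \<Rightarrow> ('a \<Rightarrow> 'a) set" where
  "Aut_roots \<Phi> = {\<phi>. orthogonal_transformation \<phi> \<and> \<phi> ` \<Phi> = \<Phi>}"

definition Aut_dynkin :: "'a::euclidean_space set \<Rightarrow> nat \<Rightarrow> (nat \<Rightarrow> 'a) \<Rightarrow> ('a \<Rightarrow> 'a) set" where
  "Aut_dynkin \<Phi> n \<alpha> = {\<phi> \<in> Aut_roots \<Phi>. \<phi> ` (\<alpha> ` {1..n}) = \<alpha> ` {1..n}}"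

definition Aut_affine_dynkin ::
    "'a::euclidean_space set \<Rightarrow> nat \<Rightarrow> (nat \<Rightarrow> 'a) \<Rightarrow> ('a \<Rightarrow> 'a) set" where
  "Aut_affine_dynkin \<Phi> n \<alpha> =
     {\<phi> \<in> Aut_roots \<Phi>. \<phi> ` insert (- highest_root \<Phi> n \<alpha>) (\<alpha> ` {1..n})
                         = insert (- highest_root \<Phi> n \<alpha>) (\<alpha> ` {1..n})}"

definition Aut_coxeter_diagram :: "nat \<Rightarrow> (nat \<Rightarrow> 'a::euclidean_space) \<Rightarrow> ('a \<Rightarrow> 'a) set" where
  "Aut_coxeter_diagram n \<alpha> =
     {\<phi>. orthogonal_transformation \<phi> \<and>
         \<phi> ` ((\<lambda>i. \<alpha> i /\<^sub>R norm (\<alpha> i)) ` {1..n}) = (\<lambda>i. \<alpha> i /\<^sub>R norm (\<alpha> i)) ` {1..n}}"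

text \<open>The element \<open>v\<^sub>j\<close> exists if \<open>\<alpha> j\<close> is minuscule, that is, if \<open>\<alpha> j\<close> has coefficient 1 in the
  highest root; \<open>omega_elt\<close> is only used for such \<open>j\<close>.\<close>

definition v_elt :: "'a::euclidean_space set \<Rightarrow> nat \<Rightarrow> (nat \<Rightarrow> 'a) \<Rightarrow> nat \<Rightarrow> 'a \<Rightarrow> 'a" where
  "v_elt \<Phi> n \<alpha> j =
     (THE v. v \<in> weyl_group \<Phi> \<and>
             v ` (\<alpha> ` {1..n}) = insert (- highest_root \<Phi> n \<alpha>) (\<alpha> ` ({1..n} - {j})))"

definition omega_elt :: "'a::euclidean_space set \<Rightarrow> nat \<Rightarrow> (nat \<Rightarrow> 'a) \<Rightarrow> nat \<Rightarrow> 'a \<Rightarrow> 'a" where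
  "omega_elt \<Phi> n \<alpha> j = (\<lambda>x. fund_coweight n \<alpha> j + v_elt \<Phi> n \<alpha> j x)"

definition dynkin_aut ::
    "'a::euclidean_space set \<Rightarrow> nat \<Rightarrow> (nat \<Rightarrow> 'a) \<Rightarrow> (nat \<Rightarrow> nat) \<Rightarrow> 'a \<Rightarrow> 'a" where
  "dynkin_aut \<Phi> n \<alpha> \<sigma> =
     (THE \<phi>. \<phi> \<in> Aut_dynkin \<Phi> n \<alpha> \<and> (\<forall>i\<in>{1..n}. \<phi> (\<alpha> i) = \<alpha> (\<sigma> i)))"


section \<open>Types of root systems, with Bourbaki's numbering of the simple roots\<close>

datatype dynkin_family = Type_A | Type_B | Type_C | Type_D | Type_E | Type_F | Type_G

text \<open>Each edge is listed once, in the order \<open>(i, j)\<close> with \<open>i < j\<close>.\<close>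

fun dynkin_edges :: "dynkin_family \<Rightarrow> nat \<Rightarrow> (nat \<times> nat) set" where
  "dynkin_edges Type_D n = {(i, i + 1) | i. 1 \<le> i \<and> i + 1 < n} \<union> {(n - 2, n)}"
| "dynkin_edges Type_E n = {(1, 3), (2, 4)} \<union> {(i, i + 1) | i. 3 \<le> i \<and> i < n}"
| "dynkin_edges _ n = {(i, i + 1) | i. 1 \<le> i \<and> i < n}"

text \<open>A multiple edge is listed as (long root, short root). For \<open>B\<^sub>2\<close> the numbering is opposite to
  Bourbaki's: \<open>\<alpha> 1\<close> is short, so that the highest root is \<open>2 \<alpha> 1 + \<alpha> 2\<close>.\<close>

fun double_bonds :: "dynkin_family \<Rightarrow> nat \<Rightarrow> (nat \<times> nat) set" where
  "double_bonds Type_B n = (if n = 2 then {(2, 1)} else {(n - 1, n)})"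
| "double_bonds Type_C n = {(n, n - 1)}"
| "double_bonds Type_F n = {(2, 3)}"
| "double_bonds _ n = {}"

fun triple_bonds :: "dynkin_family \<Rightarrow> nat \<Rightarrow> (nat \<times> nat) set" where
  "triple_bonds Type_G n = {(2, 1)}"
| "triple_bonds _ n = {}"

definition cartan_entry :: "dynkin_family \<Rightarrow> nat \<Rightarrow> nat \<Rightarrow> nat \<Rightarrow> int" where
  "cartan_entry X n i j =
     (if i = j then 2
      else if (i, j) \<in> triple_bonds X n then - 3
      else if (i, j) \<in> double_bonds X n then - 2
      else if (i, j) \<in> dynkin_edges X n \<or> (j, i) \<in> dynkin_edges X n then - 1
      else 0)"

text \<open>The Dynkin diagram of \<open>\<alpha> 1, \<dots>, \<alpha> n\<close> is the one of type \<open>X\<^sub>n\<close>. Only meaningful for \<open>A\<^sub>n\<close>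
  (\<open>n \<ge> 1\<close>), \<open>B\<^sub>n\<close> (\<open>n \<ge> 2\<close>), \<open>C\<^sub>n\<close> (\<open>n \<ge> 3\<close>), \<open>D\<^sub>n\<close> (\<open>n \<ge> 4\<close>), \<open>E\<^sub>6\<close>, \<open>E\<^sub>7\<close>, \<open>E\<^sub>8\<close>, \<open>F\<^sub>4\<close>, \<open>G\<^sub>2\<close>.\<close>

definition has_type :: "nat \<Rightarrow> (nat \<Rightarrow> 'a::euclidean_space) \<Rightarrow> dynkin_family \<Rightarrow> bool" where
  "has_type n \<alpha> X \<longleftrightarrow>
     (\<forall>i\<in>{1..n}. \<forall>j\<in>{1..n}. 2 * (\<alpha> i \<bullet> \<alpha> j) / (\<alpha> j \<bullet> \<alpha> j) = of_int (cartan_entry X n i j))"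

end

theory Submission imports Defs begin

text \<open>A rigid motion preserving the chamber or the alcove permutes its walls, which gives (i) and
  (ii). It moves the vertex \<open>0\<close> of the alcove to \<open>0\<close> or to a minuscule coweight, so that composing
  it with some \<open>\<omega>\<^sub>j\<close> leads to \<open>Aut(D)\<close>, whence (iii). An element of \<open>\<Omega>\<close> is determined by the image of
  \<open>0\<close> modulo the coroot lattice, so for the generators in (iv) it suffices to reach every
  fundamental coweight modulo this lattice. That the group is a Coxeter group is read off the
  affine diagram without using the type: a weak form of the classification shows that its
  automorphism group has order at most 2, is dihedral, or is the symmetric group on 4 letters.\<close>

text \<open>The walls of the alcove determine the affine nodes only up to positive factors, so a
  rigid motion could a priori rescale them by a quotient of two marks. Marks are integers, and the
  squared length ratios of roots allow no rational factor other than 1; this places the linear part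
  in \<open>Aut_affine_dynkin\<close> and makes the image of 0 a vertex of mark 1.

  The inner product may be scaled arbitrarily, so descent in the coweight lattice uses the form
  \<open>kf\<close>, a sum over all roots, which is integral there.

  The Coxeter property is claimed without a given type, so part of the classification is
  unavoidable. The weights put on a subdiagram are the marks of the affine diagrams of types A, D
  and E6: the weighted sum of normalized nodes has norm at most 0, hence is a linear relation.
  Relations are unique up to a factor and involve all nodes, so no node is left outside. What
  remains is a path, or a diagram with a single node of degree three. There a symmetry group of
  order above 2 would need three equivalent arms, and only arms of one node are possible;
  integrality of the Cartan numbers excludes these.\<close>

lemmas ivl_iff = atLeastAtMost_iff

declare One_nat_def [simp del]

section \<open>Groups of transformations and reflections\<close>

lemma group_comp_group:
 assumes "id : S" and "!!f g. f : S ==> g : S ==> f o g : S"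
  and "!!f. f : S ==> EX g:S. g o f = id"
 shows "group (comp_group S)"
 by (rule groupI) (use assms in \<open>auto simp: comp_group_def fun.map_comp\<close>)

lemma inv_comp_group:
 assumes "group (comp_group S)" "f : S" "g : S" "g o f = id"
 shows "inv\<^bsub>comp_group S\<^esub> f = g"
 using group.inv_equality[OF assms(1), of g f] assms by (simp add: comp_group_def)

lemma comp_group_simps [simp]:
 "carrier (comp_group S) = S" "f \<otimes>\<^bsub>comp_group S\<^esub> g = f o g" "\<one>\<^bsub>comp_group S\<^esub> = id"
 by (simp_all add: comp_group_def)

definition coroot :: "'a::euclidean_space => 'a" where
 "coroot a = (2 / (a \<bullet> a)) *\<^sub>R a"

lemma reflection_coroot: "reflection a x = x - (x \<bullet> coroot a) *\<^sub>R a"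
 by (simp add: reflection_def coroot_def)

lemma reflection_coroot': "reflection a x = x - (x \<bullet> a) *\<^sub>R coroot a"
 by (simp add: reflection_def coroot_def)

lemma inner_coroot: "x \<bullet> coroot a = 2 * (x \<bullet> a) / (a \<bullet> a)"
 by (simp add: coroot_def)

lemma coroot_self: "a ~= 0 ==> a \<bullet> coroot a = 2" "a ~= 0 ==> coroot a \<bullet> a = 2"
 by (simp_all add: coroot_def)

lemma coroot_eq_0_iff [simp]: "coroot a = 0 \<longleftrightarrow> a = 0"
 by (simp add: coroot_def)

lemma coroot_minus [simp]: "coroot (- a) = - coroot a"
 by (simp add: coroot_def)

lemma coroot_orthogonal:
 "orthogonal_transformation f ==> coroot (f a) = f (coroot a)"
 by (simp add: coroot_def orthogonal_transformation_def linear_scale)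

lemma linear_reflection: "linear (reflection a)"
 unfolding reflection_coroot by (rule linearI) (simp_all add: inner_add_left algebra_simps)

lemma reflection_self: "reflection a a = - a"
 by (cases "a = 0") (simp_all add: reflection_coroot coroot_self scaleR_2)

lemma orthogonal_reflection: "orthogonal_transformation (reflection a)"
proof (cases "a = 0")
 case True
 then have "reflection a = id"
  by (auto simp: reflection_def)
 then show ?thesis
  by (simp add: id_def)
next
 case False
 have "reflection a x \<bullet> reflection a y = x \<bullet> y" for x y
 proof -
  define s t where "s = x \<bullet> coroot a" and "t = y \<bullet> coroot a"
  have "reflection a x \<bullet> reflection a y
    = x \<bullet> y - t * (x \<bullet> a) - s * (y \<bullet> a) + t * (s * (a \<bullet> a))"
   by (simp add: reflection_coroot inner_diff_left inner_diff_right s_def t_def inner_commute)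
  moreover have "s * (a \<bullet> a) = 2 * (x \<bullet> a)"
   using False by (simp add: inner_coroot s_def)
  moreover have "s * (y \<bullet> a) = t * (x \<bullet> a)"
   by (simp add: s_def t_def inner_coroot)
  ultimately show ?thesis by simp
 qed
 then show ?thesis
  by (simp add: orthogonal_transformation_def linear_reflection)
qed

lemma reflection_involution [simp]: "reflection a (reflection a x) = x"
proof -
 have l: "linear (reflection a)" by (rule linear_reflection)
 have "reflection a (reflection a x) = reflection a x - (x \<bullet> coroot a) *\<^sub>R reflection a a"
  by (subst (2) reflection_coroot) (simp add: linear_diff[OF l] linear_scale[OF l])
 then show ?thesis
  by (simp add: reflection_self reflection_coroot)
qed

lemma reflection_comp_self [simp]: "reflection a o reflection a = id"
 by auto

lemma reflection_conj:
 assumes "orthogonal_transformation f"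
 shows "f (reflection a x) = reflection (f a) (f x)"
 using assms by (simp add: reflection_coroot coroot_orthogonal orthogonal_transformation_def
   linear_diff linear_scale)

lemma orthogonal_inner: "orthogonal_transformation f ==> f v \<bullet> f w = v \<bullet> w"
 by (simp add: orthogonal_transformation_def)

lemma orthogonal_inv_inner:
 fixes f :: "'a::euclidean_space => 'a"
 assumes "orthogonal_transformation f" shows "inv_into UNIV f v \<bullet> w = v \<bullet> f w"
proof -
 have "f (inv_into UNIV f v) \<bullet> f w = v \<bullet> f w"
  using orthogonal_transformation_surj[OF assms] by (simp add: surj_f_inv_f)
 then show ?thesis
  using orthogonal_inner[OF assms] by metis
qed

lemma motions_id: "id : motions"
 unfolding motions_def by (auto intro!: exI[of _ 0] exI[of _ id] simp: orthogonal_transformation_id id_def)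

lemma orthogonal_in_motions: "orthogonal_transformation f ==> f : motions"
 unfolding motions_def by (auto intro!: exI[of _ 0] exI[of _ f])

lemma motions_comp:
 assumes "f : motions" "g : motions" shows "f o g : motions"
proof -
 obtain c p d q where *: "orthogonal_transformation p" "f = (%x. c + p x)"
  "orthogonal_transformation q" "g = (%x. d + q x)"
  using assms by (auto simp: motions_def)
 then have "f o g = (%x. (c + p d) + (p o q) x)"
  by (auto simp: linear_add[OF orthogonal_transformation_linear] fun_eq_iff)
 then show ?thesis
  using * orthogonal_transformation_compose[of p q] unfolding motions_def by blast
qed

lemma motions_inverse:
 fixes f :: "'a::euclidean_space => 'a"
 assumes "f : motions" shows "EX g:motions. g o f = id & f o g = id"
proof -
 obtain c p where *: "orthogonal_transformation p" "f = (%x. c + p x)"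
  using assms by (auto simp: motions_def)
 note bij = orthogonal_transformation_bij[OF *(1)]
 have inv: "orthogonal_transformation (inv_into UNIV p)"
  by (rule orthogonal_transformation_inv[OF *(1)])
 have l: "linear (inv_into UNIV p)" by (rule orthogonal_transformation_linear[OF inv])
 have "(%x. - inv_into UNIV p c + inv_into UNIV p x) : motions"
  using inv unfolding motions_def by blast
 moreover have "(%x. - inv_into UNIV p c + inv_into UNIV p x) o f = id"
  using bij by (auto simp: * linear_add[OF l] bij_is_inj)
 moreover have "f o (%x. - inv_into UNIV p c + inv_into UNIV p x) = id"
  using surj_f_inv_f[OF bij_is_surj[OF bij]] orthogonal_transformation_linear[OF *(1)]
  by (auto simp: * linear_add linear_neg linear_diff)
 ultimately show ?thesis by blast
qed

lemma group_motions: "group (comp_group motions)"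
 by (rule group_comp_group) (use motions_id motions_comp motions_inverse in blast)+

lemma weyl_group_step:
 assumes "a : \<Phi>" "w : weyl_group \<Phi>" shows "reflection a o w : weyl_group \<Phi>"
 using generate.eng[OF generate.incl, of "reflection a" "reflection ` \<Phi>" w "comp_group motions"] assms
 by (simp add: weyl_group_def)

lemma id_in_weyl_group: "id : weyl_group \<Phi>"
 using generate.one[of "comp_group motions"] by (simp add: weyl_group_def)

lemma weyl_group_comp:
 "w : weyl_group \<Phi> ==> w' : weyl_group \<Phi> ==> w o w' : weyl_group \<Phi>"
 unfolding weyl_group_def by (metis comp_group_simps(2) generate.eng)

lemma weyl_group_reflection: "a : \<Phi> ==> reflection a : weyl_group \<Phi>"
 using weyl_group_step[OF _ id_in_weyl_group] by (metis comp_id)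

text \<open>A reflection is its own inverse, so the case of \<open>generate\<close> for inverses of
  generators falls under \<open>reflection\<close>.\<close>

lemma weyl_group_induct [consumes 1, case_names id comp reflection]:
 assumes "w : weyl_group \<Phi>"
  and "P id" "!!v w. P v ==> P w ==> P (v o w)" "!!a. a : \<Phi> ==> P (reflection a)"
 shows "P w"
 using assms(1) unfolding weyl_group_def
proof (induction rule: generate.induct)
 case (inv h)
 then obtain a where "a : \<Phi>" "h = reflection a" by auto
 then have "inv\<^bsub>comp_group motions\<^esub> h = reflection a"
  by (intro inv_comp_group[OF group_motions]) (auto intro: orthogonal_in_motions orthogonal_reflection)
 then show ?case
  using assms(4) \<open>a : \<Phi>\<close> by simp
next
 case one
 show ?case unfolding comp_group_simps by (rule assms(2))
next
 case (eng v w)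
 show ?case unfolding comp_group_simps by (rule assms(3)) (rule eng.IH)+
qed (use assms in auto)

lemma weyl_group_orthogonal: "w : weyl_group \<Phi> ==> orthogonal_transformation w"
proof (induction rule: weyl_group_induct)
 case id
 show ?case by (simp add: id_def)
next
 case (comp v w)
 then show ?case by (rule orthogonal_transformation_compose)
next
 case (reflection a)
 show ?case by (rule orthogonal_reflection)
qed

lemma weyl_group_inverse:
 assumes "w : weyl_group \<Phi>" shows "EX v:weyl_group \<Phi>. v o w = id & w o v = id"
 using assms
proof (induction rule: weyl_group_induct)
 case (comp v w)
 then obtain v' w' where *: "v' : weyl_group \<Phi>" "w' : weyl_group \<Phi>" "v' o v = id" "v o v' = id"
  "w' o w = id" "w o w' = id" by blast
 then have "(w' o v') o (v o w) = id" "(v o w) o (w' o v') = id"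
  by (simp_all add: fun_eq_iff)
 then show ?case using * weyl_group_comp by blast
next
 case id
 show ?case using id_in_weyl_group comp_id by blast
next
 case (reflection a)
 show ?case using weyl_group_reflection[OF reflection] reflection_comp_self by blast
qed

section \<open>Roots and simple roots\<close>

locale root_base =
 fixes \<Phi> :: "'a::euclidean_space set" and n :: nat and al :: "nat => 'a"
 assumes crystallographic: "crystallographic_root_system \<Phi>" and reduced: "reduced_system \<Phi>"
  and irreducible: "irreducible_system \<Phi>" and simple: "simple_roots \<Phi> n al"
begin

abbreviation "I \<equiv> {1..n}"
abbreviation "W \<equiv> weyl_group \<Phi>"
abbreviation "AutDyn \<equiv> Aut_dynkin \<Phi> n al"
abbreviation "AutAff \<equiv> Aut_affine_dynkin \<Phi> n al"
abbreviation "omega \<equiv> omega_elt \<Phi> n al"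
abbreviation "dyn \<equiv> dynkin_aut \<Phi> n al"
abbreviation "cartan X \<equiv> cartan_entry X n"

abbreviation "cw \<equiv> fund_coweight n al"

lemma finite_roots [simp]: "finite \<Phi>"
 and zero_notin: "0 ~: \<Phi>"
 and span_roots: "span \<Phi> = UNIV"
 and reflection_root_image: "a : \<Phi> ==> reflection a ` \<Phi> = \<Phi>"
 and cartan_Ints': "a : \<Phi> ==> b : \<Phi> ==> 2 * (b \<bullet> a) / (a \<bullet> a) : \<int>"
 using crystallographic by (auto simp: crystallographic_root_system_def)

lemma cartan_Ints: "a : \<Phi> ==> b : \<Phi> ==> b \<bullet> coroot a : \<int>"
 using cartan_Ints' by (simp add: inner_coroot)

lemma reflection_root: "a : \<Phi> ==> b : \<Phi> ==> reflection a b : \<Phi>"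
 using reflection_root_image by blast

lemma minus_root: "a : \<Phi> ==> - a : \<Phi>"
 using reflection_root[of a a] by (simp add: reflection_self)

lemma root_nonzero: "a : \<Phi> ==> a ~= 0"
 using zero_notin by blast

lemma inner_root_pos: "a : \<Phi> ==> a \<bullet> a > 0"
 using root_nonzero by simp

lemma inj_simple: "inj_on al I"
 and independent_simple: "independent (al ` I)"
 and simple_root: "i : I ==> al i : \<Phi>"
 using simple by (auto simp: simple_roots_def)

lemma root_combination:
 assumes "b : \<Phi>"
 obtains c :: "nat => nat" and e :: real
 where "e = 1 | e = - 1" "b = e *\<^sub>R (\<Sum>i\<in>I. real (c i) *\<^sub>R al i)"
proof -
 obtain c :: "nat => nat" where "b = (\<Sum>i\<in>I. real (c i) *\<^sub>R al i) |
   b = - (\<Sum>i\<in>I. real (c i) *\<^sub>R al i)"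
  using simple assms unfolding simple_roots_def by blast
 then show ?thesis
  by (elim disjE) (rule that[of 1 c], simp, simp, rule that[of "-1" c], simp, simp)
qed

lemma span_simple: "span (al ` I) = UNIV"
proof -
 have "b : span (al ` I)" if b: "b : \<Phi>" for b
 proof -
  obtain c :: "nat => nat" and e :: real
   where "b = e *\<^sub>R (\<Sum>i\<in>I. real (c i) *\<^sub>R al i)"
   using root_combination[OF b] by blast
  then show ?thesis
   by (simp only:) (intro span_scale span_sum span_base imageI)
 qed
 then have "span \<Phi> \<subseteq> span (al ` I)"
  by (simp add: span_minimal subsetI)
 then show ?thesis
  using span_roots by blast
qed

lemma eq_by_simple:
 assumes "!!j. j : I ==> v \<bullet> al j = w \<bullet> al j" shows "v = w"
proof -
 have "orthogonal (v - w) x" if "x : span (al ` I)" for x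
  using that by (rule orthogonal_to_span) (auto simp: orthogonal_def inner_diff_left assms)
 then have "orthogonal (v - w) (v - w)"
  using span_simple by blast
 then show ?thesis
  by (simp add: orthogonal_def)
qed

lemma coweight_simple:
 assumes "i : I" "j : I"
 shows "cw i \<bullet> al j = (if i = j then 1 else 0)"
proof -
 obtain f :: "'a => real" where f: "linear f" "ALL x:al ` I. f x = (if x = al i then 1 else 0)"
  using linear_independent_extend[OF independent_simple, of "%x. if x = al i then 1 else 0 :: real"] by auto
 \<comment> \<open>A functional is the inner product with the image of 1 under its adjoint; this
   produces the dual basis vector.\<close>
 have "adjoint f 1 \<bullet> x = f x" for x
  using adjoint_works[OF f(1), of x 1] by (simp add: inner_commute)
 then have ex: "ALL j:I. adjoint f 1 \<bullet> al j = (if i = j then 1 else 0)"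
  using f(2) inj_on_eq_iff[OF inj_simple] assms(1) by force
 have "ALL j:I. cw i \<bullet> al j = (if i = j then 1 else 0)"
  unfolding fund_coweight_def
 proof (rule theI[where a = "adjoint f 1"])
  show "ALL j:I. adjoint f 1 \<bullet> al j = (if i = j then 1 else 0)" by (rule ex)
  show "v = adjoint f 1" if "ALL j:I. v \<bullet> al j = (if i = j then 1 else 0)" for v
   by (rule eq_by_simple) (use that ex in simp)
 qed
 then show ?thesis using assms by blast
qed

lemma coweight_unique:
 assumes "!!j. j : I ==> v \<bullet> al j = (if i = j then 1 else 0)"
 shows "cw i = v"
 unfolding fund_coweight_def
proof (rule the_equality)
 show "ALL j:I. v \<bullet> al j = (if i = j then 1 else 0)" using assms by blast
 show "u = v" if "ALL j:I. u \<bullet> al j = (if i = j then 1 else 0)" for u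
  by (rule eq_by_simple) (use that assms in simp)
qed

lemma coweight_sum:
 assumes "i : I"
 shows "cw i \<bullet> (\<Sum>j\<in>I. c j *\<^sub>R al j) = c i"
proof -
 have "cw i \<bullet> (\<Sum>j\<in>I. c j *\<^sub>R al j) = (\<Sum>j\<in>I. if j = i then c j else 0)"
  unfolding inner_sum_right by (rule sum.cong) (use coweight_simple assms in auto)
 then show ?thesis using assms by simp
qed

lemma simple_expansion: "v = (\<Sum>i\<in>I. (cw i \<bullet> v) *\<^sub>R al i)"
proof -
 have "v : range (%u. \<Sum>x\<in>al ` I. u x *\<^sub>R x)"
  using span_simple span_finite[of "al ` I"] by auto
 then obtain u where "v = (\<Sum>x\<in>al ` I. u x *\<^sub>R x)" by blast
 then have "v = (\<Sum>i\<in>I. u (al i) *\<^sub>R al i)"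
  using inj_simple by (simp add: sum.reindex)
 moreover from this have "cw i \<bullet> v = u (al i)" if "i : I" for i
  using coweight_sum[OF that, of "%i. u (al i)"] by simp
 ultimately show ?thesis by simp
qed

lemma coweight_expansion: "v = (\<Sum>i\<in>I. (v \<bullet> al i) *\<^sub>R cw i)"
proof (rule eq_by_simple)
 fix j assume j: "j : I"
 have "(\<Sum>i\<in>I. (v \<bullet> al i) *\<^sub>R cw i) \<bullet> al j = (\<Sum>i\<in>I. if i = j then v \<bullet> al i else 0)"
  unfolding inner_sum_left by (rule sum.cong) (use coweight_simple j in auto)
 then show "v \<bullet> al j = (\<Sum>i\<in>I. (v \<bullet> al i) *\<^sub>R cw i) \<bullet> al j"
  using j by simp
qed

text \<open>Splits an inner product into products of a root coordinate and a pairing with a simple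
  root; most sign arguments below read off the signs of these terms.\<close>

lemma inner_expansion: "v \<bullet> w = (\<Sum>i\<in>I. (cw i \<bullet> v) * (al i \<bullet> w))"
proof -
 have "v \<bullet> w = (\<Sum>i\<in>I. (cw i \<bullet> v) *\<^sub>R al i) \<bullet> w"
  using simple_expansion[of v] by simp
 then show ?thesis by (simp add: inner_sum_left)
qed

lemma eq_by_coweights:
 assumes "!!i. i : I ==> cw i \<bullet> v = cw i \<bullet> w" shows "v = w"
 using simple_expansion[of v] simple_expansion[of w] assms by simp

text \<open>As \<open>cw i\<close> extracts the coefficient at \<open>al i\<close>, this is the cone
  of nonnegative combinations of simple roots. It contains 0, so it is a sign on roots only, by
  \<open>root_sign\<close> and \<open>not_pos_both\<close>.\<close>

definition pos :: "'a => bool" where "pos v \<longleftrightarrow> (ALL i:I. 0 <= cw i \<bullet> v)"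

lemma root_sign: "b : \<Phi> ==> pos b | pos (- b)"
 by (erule root_combination) (auto simp: pos_def coweight_sum)

lemma root_coeff_Ints: "b : \<Phi> ==> i : I ==> cw i \<bullet> b : \<int>"
 by (erule root_combination) (auto simp: coweight_sum)

lemma not_pos_both: "b : \<Phi> ==> pos b ==> ~ pos (- b)"
proof
 assume "b : \<Phi>" "pos b" "pos (- b)"
 then have "cw i \<bullet> b = cw i \<bullet> 0" if "i : I" for i
  using that by (force simp: pos_def)
 then show False
  using eq_by_coweights root_nonzero \<open>b : \<Phi>\<close> by blast
qed

lemma pos_simple: "i : I ==> pos (al i)"
 by (simp add: pos_def coweight_simple)

lemma proportional_root:
 assumes "a : \<Phi>" "c *\<^sub>R a : \<Phi>" shows "c = 1 | c = - 1"
 using reduced assms by (auto simp: reduced_system_def)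

text \<open>The product of the Cartan integers of two non-proportional roots is less than 4 by
  Cauchy--Schwarz, so if it is positive one of them is 1.\<close>

lemma cartan_one:
 assumes "a : \<Phi>" "b : \<Phi>" "a \<bullet> b > 0" "a ~= b"
 shows "a \<bullet> coroot b = 1 | b \<bullet> coroot a = 1" "(a \<bullet> coroot b) * (b \<bullet> coroot a) < 4"
proof -
 obtain k where k: "a \<bullet> coroot b = of_int k"
  using cartan_Ints[OF assms(2,1)] by (auto elim: Ints_cases)
 obtain l where l: "b \<bullet> coroot a = of_int l"
  using cartan_Ints[OF assms(1,2)] by (auto elim: Ints_cases)
 have aa: "a \<bullet> a > 0" and bb: "b \<bullet> b > 0" using assms inner_root_pos by auto
 have "a \<bullet> coroot b > 0" "b \<bullet> coroot a > 0"
  using assms aa bb by (simp_all add: inner_coroot inner_commute)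
 then have kl: "k >= 1" "l >= 1" using k l by auto
 \<comment> \<open>Equality would make \<open>b\<close> a positive multiple of \<open>a\<close>; as
   the system is reduced, the two would coincide.\<close>
 have "(a \<bullet> b)\<^sup>2 < (a \<bullet> a) * (b \<bullet> b)"
 proof (rule ccontr)
  assume "~ ?thesis"
  then have "(a \<bullet> b)\<^sup>2 = (a \<bullet> a) * (b \<bullet> b)"
   using Cauchy_Schwarz_ineq[of a b] by simp
  then have "(a \<bullet> b)\<^sup>2 = (norm a * norm b)\<^sup>2"
   by (simp add: power_mult_distrib power2_norm_eq_inner)
  then have "a \<bullet> b = norm a * norm b"
   by (rule power2_eq_imp_eq) (use assms(3) in auto)
  then have eq: "norm a *\<^sub>R b = norm b *\<^sub>R a"
   using norm_cauchy_schwarz_eq[of a b] by simp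
  have "b = inverse (norm a) *\<^sub>R (norm a *\<^sub>R b)"
   using assms(1) root_nonzero by simp
  then have b: "b = (norm b / norm a) *\<^sub>R a"
   unfolding eq by (simp add: divide_inverse mult.commute)
  have "norm b / norm a = 1 | norm b / norm a = -1"
   by (rule proportional_root[OF assms(1)]) (use b assms(2) in simp)
  moreover have "norm b / norm a >= 0" by simp
  ultimately have "norm b / norm a = 1" by linarith
  then show False using b assms(4) by (metis scaleR_one)
 qed
 moreover have "of_int (k * l) = 4 * (a \<bullet> b)\<^sup>2 / ((a \<bullet> a) * (b \<bullet> b))"
  using k l by (simp add: inner_coroot inner_commute power2_eq_square flip: k l)
 moreover have "4 * (a \<bullet> b)\<^sup>2 / ((a \<bullet> a) * (b \<bullet> b)) < 4" if "(a \<bullet> b)\<^sup>2 < (a \<bullet> a) * (b \<bullet> b)"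
  using that mult_pos_pos[OF aa bb] by (subst pos_divide_less_eq) auto
 ultimately have "real_of_int (k * l) < 4" by linarith
 then show "(a \<bullet> coroot b) * (b \<bullet> coroot a) < 4"
  by (simp add: k l)
 have "k * l < 4" using \<open>real_of_int (k * l) < 4\<close> by linarith
 have "k = 1 | l = 1"
 proof (rule ccontr)
  assume "~ ?thesis"
  then have "k >= 2" "l >= 2" using kl by auto
  then have "2 * 2 <= k * l" by (intro mult_mono) auto
  then show False using \<open>k * l < 4\<close> by simp
 qed
 then show "a \<bullet> coroot b = 1 | b \<bullet> coroot a = 1" using k l by auto
qed

text \<open>When one of the two Cartan integers is 1, a reflection sends one root to its difference
  with the other.\<close>

lemma root_diff:
 assumes "a : \<Phi>" "b : \<Phi>" "a \<bullet> b > 0" "a ~= b"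
 shows "a - b : \<Phi>"
 using cartan_one(1)[OF assms]
proof
 assume "a \<bullet> coroot b = 1"
 then show ?thesis using reflection_root[OF assms(2,1)] by (simp add: reflection_coroot)
next
 assume "b \<bullet> coroot a = 1"
 then show ?thesis using minus_root[OF reflection_root[OF assms(1,2)]] by (simp add: reflection_coroot)
qed

text \<open>Otherwise the difference of the two simple roots would be a root with coefficients of
  both signs.\<close>

lemma simple_inner_nonpos:
 assumes "i : I" "j : I" "i ~= j" shows "al i \<bullet> al j <= 0"
proof (rule ccontr)
 assume *: "~ ?thesis"
 have "al i ~= al j" using assms inj_simple by (auto dest: inj_onD)
 then have "al i - al j : \<Phi>" using * root_diff simple_root assms by simp
 then have "pos (al i - al j) | pos (al j - al i)"
  using root_sign by (metis minus_diff_eq)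
 then show False
  unfolding pos_def by (elim disjE; elim ballE[of _ _ i] ballE[of _ _ j])
   (use assms in \<open>auto simp: inner_diff_right coweight_simple\<close>)
qed

text \<open>A positive root supported on \<open>i\<close> alone is a multiple of
  \<open>al i\<close>, hence equal to it in a reduced system.\<close>

lemma pos_not_simple:
 assumes "b : \<Phi>" "pos b" "i : I" "b ~= al i"
 shows "EX k:I. k ~= i & cw k \<bullet> b > 0"
proof (rule ccontr)
 assume neg: "~ ?thesis"
 have "cw k \<bullet> b = 0" if k: "k : I" "k ~= i" for k
 proof -
  have "~ cw k \<bullet> b > 0" using neg k by blast
  then show ?thesis using assms(2) k by (force simp: pos_def)
 qed
 then have "cw k \<bullet> b = cw k \<bullet> ((cw i \<bullet> b) *\<^sub>R al i)" if "k : I" for k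
  using that coweight_simple[OF that assms(3)] by (cases "k = i") auto
 then have b: "b = (cw i \<bullet> b) *\<^sub>R al i"
  by (rule eq_by_coweights)
 have "cw i \<bullet> b = 1 | cw i \<bullet> b = - 1"
  by (rule proportional_root[OF simple_root[OF assms(3)]]) (use b assms(1) in simp)
 moreover have "cw i \<bullet> b >= 0" using assms by (simp add: pos_def)
 ultimately have "cw i \<bullet> b = 1" by linarith
 then show False using b assms(4) by (metis scaleR_one)
qed

lemma simple_reflection_coeff:
 assumes "i : I" "k : I" "k ~= i"
 shows "cw k \<bullet> reflection (al i) v = cw k \<bullet> v"
 using assms by (simp add: reflection_coroot inner_diff_right coweight_simple)

text \<open>The reflection alters only the coefficient at \<open>i\<close>, so a positive
  coefficient elsewhere survives and determines the sign.\<close>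

lemma simple_reflection_pos:
 assumes "b : \<Phi>" "pos b" "i : I" "b ~= al i"
 shows "pos (reflection (al i) b)"
proof -
 obtain k where k: "k : I" "k ~= i" "cw k \<bullet> b > 0"
  using pos_not_simple[OF assms] by blast
 then have "cw k \<bullet> reflection (al i) b > 0"
  using simple_reflection_coeff assms by simp
 then have "~ pos (- reflection (al i) b)"
  using k unfolding pos_def by force
 then show ?thesis
  using root_sign reflection_root assms simple_root by blast
qed

section \<open>The Weyl group\<close>

text \<open>Products of simple reflections are kept as lists of indices, so that induction on word
  length and deletion of letters are available.\<close>

definition wd :: "nat list => 'a => 'a" where
 "wd xs = foldr (%i f. reflection (al i) o f) xs id"

lemma wd_Nil [simp]: "wd [] = id"
 and wd_Cons [simp]: "wd (i # xs) = reflection (al i) o wd xs"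
 by (simp_all add: wd_def)

lemma wd_append: "wd (xs @ ys) = wd xs o wd ys"
 by (induction xs) auto

lemma wd_rev: "wd (rev xs) o wd xs = id" "wd xs o wd (rev xs) = id"
 by (induction xs) (auto simp: wd_append fun_eq_iff)

lemma wd_orthogonal: "orthogonal_transformation (wd xs)"
proof (induction xs)
 case (Cons i xs)
 then show ?case
  unfolding wd_Cons by (rule orthogonal_transformation_compose[OF orthogonal_reflection])
qed (simp add: id_def)

lemma wd_root: "xs : lists I ==> b : \<Phi> ==> wd xs b : \<Phi>"
proof (induction xs)
 case (Cons i xs)
 then show ?case using reflection_root[OF simple_root, of i "wd xs b"] by simp
qed simp

text \<open>Induction on the height: having positive norm, \<open>b\<close> pairs positively with
  some simple root, and reflecting in that root lowers the height by a positive integer.\<close>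

lemma pos_root_conj_simple:
 assumes "b : \<Phi>" "pos b"
 shows "EX xs:lists I. EX i:I. b = wd xs (al i)"
 using assms
proof (induction "nat \<lfloor>\<Sum>i\<in>I. cw i \<bullet> b\<rfloor>" arbitrary: b rule: less_induct)
 case less
 have "EX i:I. al i \<bullet> b > 0"
 proof (rule ccontr)
  assume "~ ?thesis"
  then have "(\<Sum>i\<in>I. (cw i \<bullet> b) * (al i \<bullet> b)) <= 0"
   using less.prems(2) by (intro sum_nonpos mult_nonneg_nonpos) (auto simp: pos_def not_less)
  then show False using inner_root_pos[OF less.prems(1)] inner_expansion[of b b] by simp
 qed
 then obtain i where i: "i : I" "al i \<bullet> b > 0" by blast
 show ?case
 proof (cases "b = al i")
  case True
  then show ?thesis using i by (intro bexI[of _ "[]"] bexI[of _ i]) auto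
 next
  case False
  define b' where "b' = reflection (al i) b"
  have b': "b' : \<Phi>" "pos b'"
   using False less.prems i simple_reflection_pos reflection_root simple_root by (auto simp: b'_def)
  have c: "b \<bullet> coroot (al i) > 0"
   using i inner_root_pos[OF simple_root[OF i(1)]] by (simp add: inner_coroot inner_commute)
  moreover have "b \<bullet> coroot (al i) : \<int>"
   using cartan_Ints simple_root i less.prems by blast
  ultimately have "b \<bullet> coroot (al i) >= 1"
   by (auto elim!: Ints_cases)
  moreover have "(\<Sum>k\<in>I. cw k \<bullet> b') = (\<Sum>k\<in>I. cw k \<bullet> b) - (\<Sum>k\<in>I. (b \<bullet> coroot (al i)) * (cw k \<bullet> al i))"
   by (simp add: b'_def reflection_coroot inner_diff_right sum_subtractf)
  moreover have "(\<Sum>k\<in>I. (b \<bullet> coroot (al i)) * (cw k \<bullet> al i)) = b \<bullet> coroot (al i)"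
  proof -
   have "(\<Sum>k\<in>I. (b \<bullet> coroot (al i)) * (cw k \<bullet> al i))
     = (\<Sum>k\<in>I. if k = i then b \<bullet> coroot (al i) else 0)"
    by (rule sum.cong) (use i coweight_simple in auto)
   then show ?thesis using i by simp
  qed
  moreover have "(\<Sum>k\<in>I. cw k \<bullet> b') >= 0"
   using b'(2) by (auto simp: pos_def intro: sum_nonneg)
  ultimately have "nat \<lfloor>\<Sum>i\<in>I. cw i \<bullet> b'\<rfloor> < nat \<lfloor>\<Sum>i\<in>I. cw i \<bullet> b\<rfloor>"
   by linarith
  then obtain xs k where "xs : lists I" "k : I" "b' = wd xs (al k)"
   using less.hyps b' by blast
  moreover have "b = reflection (al i) b'" by (simp add: b'_def)
  ultimately show ?thesis
   using i by (intro bexI[of _ "i # xs"] bexI[of _ k]) auto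
 qed
qed

lemma root_conj_simple:
 assumes "b : \<Phi>"
 shows "EX xs:lists I. EX i:I. b = wd xs (al i)"
proof (cases "pos b")
 case False
 then obtain xs i where *: "xs : lists I" "i : I" "- b = wd xs (al i)"
  using pos_root_conj_simple[of "- b"] root_sign minus_root assms by blast
 \<comment> \<open>One more reflection in \<open>al i\<close> supplies the sign.\<close>
 then have "b = wd (xs @ [i]) (al i)"
  using linear_neg[OF orthogonal_transformation_linear[OF wd_orthogonal]]
  by (simp add: wd_append reflection_self) (metis minus_equation_iff)
 then show ?thesis using * by (intro bexI[of _ "xs @ [i]"] bexI[of _ i]) auto
qed (use pos_root_conj_simple assms in blast)

lemma weyl_group_wd: "W = wd ` lists I"
proof
 show "wd ` lists I \<subseteq> W"
 proof
  fix w assume "w : wd ` lists I"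
  then obtain xs where "xs : lists I" "w = wd xs" by blast
  moreover have "wd xs : W" if "xs : lists I" for xs
   using that
  proof (induction xs)
   case (Cons i xs)
   then show ?case unfolding wd_Cons by (intro weyl_group_step simple_root)
  next
   case Nil
   show ?case unfolding wd_Nil by (rule id_in_weyl_group)
  qed
  ultimately show "w : W" by simp
 qed
 show "W \<subseteq> wd ` lists I"
 proof (rule subsetI)
  fix w assume "w : W"
  then show "w : wd ` lists I"
  proof (induction rule: weyl_group_induct)
   case id
   show ?case by (rule image_eqI[of _ _ "[]"]) auto
  next
   case (comp v w)
   then obtain xs ys where *: "v = wd xs" "w = wd ys" "xs : lists I" "ys : lists I" by blast
   show ?case
    unfolding *(1,2) wd_append[symmetric] by (rule imageI) (use *(3,4) in simp)
  next
   case (reflection a)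
   then obtain xs i where *: "xs : lists I" "i : I" "a = wd xs (al i)"
    using root_conj_simple[OF reflection] by blast
   \<comment> \<open>The reflection in a conjugate of \<open>al i\<close> is the conjugate of the
     simple reflection; reversing a word inverts it.\<close>
   have "wd (xs @ [i] @ rev xs) x = reflection a x" for x
   proof -
    have "wd (xs @ [i] @ rev xs) x = reflection a ((wd xs o wd (rev xs)) x)"
     unfolding wd_append *(3) by (simp add: reflection_conj[OF wd_orthogonal])
    then show ?thesis unfolding wd_rev(2) by simp
   qed
   then have "reflection a = wd (xs @ [i] @ rev xs)" by (simp add: fun_eq_iff)
   moreover have "xs @ [i] @ rev xs : lists I"
    using * by (simp add: in_lists_conv_set)
   ultimately show ?case by (rule image_eqI)
  qed
 qed
qed

lemma weyl_group_root_image: "w : W ==> w ` \<Phi> = \<Phi>"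
proof (induction rule: weyl_group_induct)
 case (comp v w)
 then show ?case by (metis image_comp)
qed (simp_all add: reflection_root_image)

text \<open>Apply the letters from right to left: the image changes sign first at some letter
  \<open>j\<close>, and \<open>al j\<close> is the only positive root that its own reflection makes
  negative.\<close>

lemma exchange:
 assumes "xs : lists I" "v : \<Phi>" "pos v" "~ pos (wd xs v)"
 shows "EX ys j zs. xs = ys @ j # zs & wd zs v = al j"
 using assms
proof (induction xs rule: list.induct)
 case (Cons j xs)
 have j: "j : I" and xs: "xs : lists I" using Cons.prems(1) by auto
 show ?case
 proof (cases "pos (wd xs v)")
  case True
  then have "wd xs v = al j"
   using simple_reflection_pos[OF wd_root[OF xs Cons.prems(2)] True j] Cons.prems(4) by auto
  then have "j # xs = [] @ j # xs & wd xs v = al j" by simp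
  then show ?thesis by blast
 next
  case False
  then obtain ys i zs where *: "xs = ys @ i # zs" "wd zs v = al i"
   using Cons.IH[OF xs Cons.prems(2,3)] by blast
  then have "j # xs = (j # ys) @ i # zs & wd zs v = al i" by simp
  then show ?thesis by blast
 qed
qed simp

text \<open>The word without its last letter \<open>k\<close> makes \<open>al k\<close> negative,
  and \<open>exchange\<close> finds the letter \<open>j\<close> where this happens. Conjugated by
  the letters in between, that letter becomes the reflection in \<open>al k\<close> and cancels with
  the last one, leaving a word shorter by two.\<close>

lemma wd_fixes_base:
 assumes "xs : lists I" "wd xs ` (al ` I) = al ` I"
 shows "wd xs = id"
 using assms
proof (induction "length xs" arbitrary: xs rule: less_induct)
 case less
 show ?case
 proof (cases xs rule: rev_cases)
  case (snoc ys k)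
  have k: "k : I" "ys : lists I" using less.prems snoc by auto
  have "wd xs (al k) : al ` I" using less.prems(2) k by blast
  then have "pos (wd xs (al k))" using pos_simple by auto
  moreover have "wd xs (al k) = - wd ys (al k)"
   using linear_neg[OF orthogonal_transformation_linear[OF wd_orthogonal]]
   by (simp add: snoc wd_append reflection_self)
  ultimately have "~ pos (wd ys (al k))"
   using not_pos_both wd_root k simple_root by metis
  then obtain as j bs where *: "ys = as @ j # bs" "wd bs (al k) = al j"
   using exchange[OF k(2) simple_root[OF k(1)] pos_simple[OF k(1)]] by blast
  have "wd xs = wd (as @ bs)"
   by (auto simp: snoc * wd_append fun_eq_iff reflection_conj[OF wd_orthogonal] simp flip: *(2))
  moreover have "as @ bs : lists I" "length (as @ bs) < length xs"
   using k * snoc by auto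
  ultimately show ?thesis using less by metis
 qed simp
qed

lemma weyl_group_fixes_base:
 "w : W ==> w ` (al ` I) = al ` I ==> w = id"
 using wd_fixes_base unfolding weyl_group_wd by blast

text \<open>Lets a base be moved by reflections in the induction of
  \<open>weyl_group_transitive_on_bases\<close>.\<close>

lemma simple_roots_reflection:
 assumes "a : \<Phi>" shows "simple_roots \<Phi> n (reflection a o al)"
proof -
 have inj: "inj (reflection a)"
  using orthogonal_transformation_inj[OF orthogonal_reflection] .
 have 1: "inj_on (reflection a o al) I"
  using inj inj_simple by (simp add: comp_inj_on inj_on_subset[OF inj])
 have 2: "independent ((reflection a o al) ` I)"
  using linear_independent_injective_image[OF linear_reflection independent_simple, of a] inj
  by (simp add: image_comp inj_on_subset)
 have 3: "EX c :: nat => nat. b = (\<Sum>i\<in>I. real (c i) *\<^sub>R (reflection a o al) i) |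
   b = - (\<Sum>i\<in>I. real (c i) *\<^sub>R (reflection a o al) i)" if "b : \<Phi>" for b
 proof -
  have rb: "reflection a b : \<Phi>" using reflection_root[OF assms that] .
  obtain c :: "nat => nat" and e :: real where e: "e = 1 | e = - 1"
   and eq: "reflection a b = e *\<^sub>R (\<Sum>i\<in>I. real (c i) *\<^sub>R al i)"
   using root_combination[OF rb] by blast
  have "b = reflection a (e *\<^sub>R (\<Sum>i\<in>I. real (c i) *\<^sub>R al i))"
   unfolding eq[symmetric] by simp
  also have "\<dots> = e *\<^sub>R (\<Sum>i\<in>I. real (c i) *\<^sub>R (reflection a o al) i)"
   using linear_reflection[of a] by (simp add: linear_scale linear_sum)
  finally show ?thesis using e by (intro exI[of _ c]) auto
 qed
 have 4: "(reflection a o al) ` I \<subseteq> \<Phi>"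
  using assms reflection_root simple_root by auto
 show ?thesis
  unfolding simple_roots_def using 1 2 3 4 by blast
qed

lemma root_base_reflection: "a : \<Phi> ==> root_base \<Phi> n (reflection a o al)"
 using crystallographic reduced irreducible simple_roots_reflection by (simp add: root_base_def)

end

text \<open>Simple roots are indecomposable: \<open>al i\<close> is a nonnegative combination of the
  second base, whose members are positive for the first, so a member occurring in it can only be
  supported on \<open>i\<close>.\<close>

lemma base_subset_if_pos_subset:
 assumes "root_base \<Phi> n al" "root_base \<Phi> n al'"
  and "!!b. b : \<Phi> ==> root_base.pos n al b ==> root_base.pos n al' b"
 shows "al ` {1..n} \<subseteq> al' ` {1..n}"
proof
 interpret r: root_base \<Phi> n al by fact
 interpret r': root_base \<Phi> n al' by fact
 \<comment> \<open>Inclusion of positive systems is equality, since exactly one of a root and its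
   negative is positive.\<close>
 have pp: "r.pos b" if "b : \<Phi>" "r'.pos b" for b
  using that assms(3) r.root_sign r'.not_pos_both r.minus_root by blast
 fix a assume "a : al ` {1..n}"
 then obtain i where i: "i : {1..n}" "a = al i" by blast
 have d: "r'.cw k \<bullet> al i >= 0" if "k : {1..n}" for k
  using that assms(3)[OF r.simple_root r.pos_simple] i by (simp add: r'.pos_def)
 have "EX k:{1..n}. r'.cw k \<bullet> al i ~= 0"
 proof (rule ccontr)
  assume "~ ?thesis"
  then have "al i = 0" by (intro r'.eq_by_coweights) simp
  then show False using r.root_nonzero[OF r.simple_root[OF i(1)]] by simp
 qed
 then obtain k where k: "k : {1..n}" "r'.cw k \<bullet> al i ~= 0" by blast
 have "r.cw j \<bullet> al' k = 0" if j: "j : {1..n}" "j ~= i" for j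
 proof -
  have "(\<Sum>l\<in>{1..n}. (r'.cw l \<bullet> al i) * (r.cw j \<bullet> al' l)) = r.cw j \<bullet> al i"
   using r'.inner_expansion[of "al i" "r.cw j"] by (simp add: inner_commute)
  also have "\<dots> = 0" using j i by (simp add: r.coweight_simple)
  finally have "ALL l:{1..n}. (r'.cw l \<bullet> al i) * (r.cw j \<bullet> al' l) = 0"
  proof (subst (asm) sum_nonneg_eq_0_iff)
   fix l assume l: "l : {1..n}"
   have "r.pos (al' l)" using pp l r'.simple_root r'.pos_simple by blast
   then show "0 <= (r'.cw l \<bullet> al i) * (r.cw j \<bullet> al' l)"
    using d[OF l] j by (simp add: r.pos_def)
  qed auto
  then show ?thesis using k by auto
 qed
 moreover have "al' k : \<Phi>" "r.pos (al' k)"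
  using pp k r'.simple_root r'.pos_simple by blast+
 ultimately have "al' k = al i"
  using r.pos_not_simple[of "al' k" i] i by force
 then show "a : al' ` {1..n}" using k i by force
qed

text \<open>Induction on the number of roots positive for \<open>al\<close> but not for
  \<open>al'\<close>. If a simple root \<open>al i\<close> is among them, reflecting
  \<open>al'\<close> in it removes it from the count and permutes the other roots positive for
  \<open>al\<close>.\<close>

lemma weyl_group_transitive_on_bases:
 assumes "root_base \<Phi> n al" "root_base \<Phi> n al'"
 shows "EX w:weyl_group \<Phi>. w ` (al ` {1..n}) = al' ` {1..n}"
 using assms(2)
proof (induction "card {b\<in>\<Phi>. root_base.pos n al b & ~ root_base.pos n al' b}"
  arbitrary: al' rule: less_induct)
 case less
 interpret r: root_base \<Phi> n al by (rule assms(1))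
 interpret r': root_base \<Phi> n al' by (rule less.prems)
 show ?case
 proof (cases "ALL i:{1..n}. r'.pos (al i)")
  case True
  have "r'.pos b" if "b : \<Phi>" "r.pos b" for b
   unfolding r'.pos_def
  proof
   fix k assume k: "k : {1..n}"
   have "r'.cw k \<bullet> b = (\<Sum>i\<in>{1..n}. (r.cw i \<bullet> b) * (al i \<bullet> r'.cw k))"
    using r.inner_expansion[of b "r'.cw k"] by (simp add: inner_commute)
   also have "\<dots> >= 0"
    using True k that by (intro sum_nonneg mult_nonneg_nonneg) (auto simp: r.pos_def r'.pos_def inner_commute)
   finally show "0 <= r'.cw k \<bullet> b" .
  qed
  then have "al ` {1..n} \<subseteq> al' ` {1..n}"
   using base_subset_if_pos_subset[OF assms(1) less.prems] by blast
  then have "al ` {1..n} = al' ` {1..n}"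
   using card_image[OF r.inj_simple] card_image[OF r'.inj_simple] by (simp add: card_subset_eq)
  then show ?thesis using id_in_weyl_group[of \<Phi>] by (metis image_id id_apply)
 next
  case False
  then obtain i where i: "i : {1..n}" "~ r'.pos (al i)" by blast
  define a where "a = al i"
  have a: "a : \<Phi>" using i r.simple_root by (simp add: a_def)
  interpret s: root_base \<Phi> n "reflection a o al'" by (rule r'.root_base_reflection[OF a])
  have cws: "s.cw k = reflection a (r'.cw k)" if "k : {1..n}" for k
   by (rule s.coweight_unique)
    (use that in \<open>simp add: orthogonal_inner[OF orthogonal_reflection] r'.coweight_simple\<close>)
  have ps: "s.pos b \<longleftrightarrow> r'.pos (reflection a b)" for b
  proof -
   have "s.cw k \<bullet> b = r'.cw k \<bullet> reflection a b" if "k : {1..n}" for k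
    using cws[OF that] orthogonal_inner[OF orthogonal_reflection, of a "r'.cw k" "reflection a b"] by simp
   then show ?thesis by (simp add: s.pos_def r'.pos_def)
  qed
  have "card (reflection a ` {b\<in>\<Phi>. r.pos b & ~ s.pos b})
    <= card ({b\<in>\<Phi>. r.pos b & ~ r'.pos b} - {a})"
  proof (rule card_mono)
   show "reflection a ` {b : \<Phi>. r.pos b & ~ s.pos b} \<subseteq> {b : \<Phi>. r.pos b & ~ r'.pos b} - {a}"
   proof (clarify, intro DiffI CollectI conjI)
    fix b assume b: "b : \<Phi>" "r.pos b" "~ s.pos b"
    have "~ s.pos a ==> False"
     using ps[of a] i a r'.root_sign by (auto simp: reflection_self a_def)
    then have "b ~= a" using b by blast
    show "reflection a b : \<Phi>" using b a r.reflection_root by blast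
    show "r.pos (reflection a b)"
     using r.simple_reflection_pos[of b i] b i \<open>b ~= a\<close> by (simp add: a_def)
    show "~ r'.pos (reflection a b)" using b ps by blast
    show "reflection a b ~: {a}"
    proof
     assume "reflection a b : {a}"
     then have "b = - a" by (metis reflection_involution reflection_self singletonD)
     then show False using b r.not_pos_both[OF a] r.pos_simple[OF i(1)] by (simp add: a_def)
    qed
   qed
  qed simp
  also have "\<dots> < card {b\<in>\<Phi>. r.pos b & ~ r'.pos b}"
   using a i r.pos_simple by (intro card_Diff1_less) (auto simp: a_def)
  also have "card (reflection a ` {b\<in>\<Phi>. r.pos b & ~ s.pos b}) = card {b\<in>\<Phi>. r.pos b & ~ s.pos b}"
   by (rule card_image)
    (rule inj_on_subset[OF orthogonal_transformation_inj[OF orthogonal_reflection] subset_UNIV])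
  finally have "EX w:weyl_group \<Phi>. w ` al ` {1..n} = (reflection a o al') ` {1..n}"
   by (rule less.hyps[OF _ s.root_base_axioms])
  then obtain w where w: "w : weyl_group \<Phi>" "w ` al ` {1..n} = (reflection a o al') ` {1..n}"
   by blast
  have "(reflection a o w) ` al ` {1..n} = reflection a ` (reflection a o al') ` {1..n}"
   unfolding w(2)[symmetric] by (simp only: image_comp comp_assoc)
  also have "\<dots> = al' ` {1..n}"
   unfolding image_comp comp_assoc[symmetric] reflection_comp_self by simp
  finally show ?thesis using weyl_group_step[OF a w(1)] by (rule bexI)
 qed
qed

section \<open>The highest root\<close>

declare atLeastAtMost_iff [simp del]

context root_base begin

abbreviation "hr \<equiv> highest_root \<Phi> n al"

text \<open>The height of a root, extended linearly to all vectors.\<close>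

definition ht :: "'a => real" where "ht v = (\<Sum>i\<in>I. cw i \<bullet> v)"

lemma ht_add: "ht (v + w) = ht v + ht w"
 and ht_diff: "ht (v - w) = ht v - ht w"
 and ht_minus: "ht (- v) = - ht v"
 and ht_scale: "ht (c *\<^sub>R v) = c * ht v"
 by (simp_all add: ht_def inner_add_right inner_diff_right sum.distrib sum_subtractf sum_negf sum_distrib_left)

lemma ht_simple: "i : I ==> ht (al i) = 1"
proof -
 assume i: "i : I"
 have "ht (al i) = (\<Sum>k\<in>I. if k = i then 1 else 0)"
  unfolding ht_def by (rule sum.cong[OF HOL.refl]) (simp add: coweight_simple i)
 then show ?thesis using i by simp
qed

lemma roots_nonempty: "\<Phi> ~= {}"
 using irreducible by (simp add: irreducible_system_def)

lemma no_orthogonal_splitting: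
 assumes "\<Phi> = X \<union> Y" "X ~= {}" "!!a b. a : X ==> b : Y ==> a \<bullet> b = 0"
 shows "Y = {}"
proof (rule ccontr)
 assume "Y ~= {}"
 have "X ~= {} & Y ~= {} & \<Phi> = X \<union> Y & (ALL a:X. ALL b:Y. a \<bullet> b = 0)"
  using assms(3) by (simp only: assms(2) \<open>Y ~= {}\<close> assms(1)[symmetric]) simp
 then have "EX X Y. X ~= {} & Y ~= {} & \<Phi> = X \<union> Y & (ALL a:X. ALL b:Y. a \<bullet> b = 0)"
  by (intro exI)
 then show False using irreducible by (simp only: irreducible_system_def simp_thms)
qed

text \<open>Otherwise the two parts span orthogonal subspaces preserved by all simple reflections;
  each root, being conjugate to a simple root, lies in one of them, and the root system
  splits.\<close>

lemma simple_connected: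
 assumes S: "S \<subseteq> I" "S ~= {}" "S ~= I"
 shows "EX i:S. EX j:I - S. al i \<bullet> al j ~= 0"
proof (rule ccontr)
 assume "~ ?thesis"
 then have orth: "al i \<bullet> al j = 0" if "i : S" "j : I - S" for i j
  using that by blast
 let ?U = "span (al ` S)" and ?T = "span (al ` (I - S))"
 have 1: "u \<bullet> al j = 0" if "u : ?U" "j : I - S" for u j
 proof -
  have "orthogonal (al j) u"
   by (rule orthogonal_to_span[OF that(1)]) (use orth that(2) in \<open>auto simp: orthogonal_def inner_commute\<close>)
  then show ?thesis by (simp add: orthogonal_def inner_commute)
 qed
 have 2: "t \<bullet> al i = 0" if "t : ?T" "i : S" for t i
 proof -
  have "orthogonal (al i) t"
   by (rule orthogonal_to_span[OF that(1)]) (use orth that(2) in \<open>auto simp: orthogonal_def\<close>)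
  then show ?thesis by (simp add: orthogonal_def inner_commute)
 qed
 have 3: "u \<bullet> t = 0" if "u : ?U" "t : ?T" for u t
 proof -
  have "orthogonal u t"
   by (rule orthogonal_to_span[OF that(2)]) (use 1[OF that(1)] in \<open>auto simp: orthogonal_def\<close>)
  then show ?thesis by (simp add: orthogonal_def)
 qed
 have word: "wd xs (al i) : ?U \<union> ?T" if "xs : lists I" "i : I" for xs i
  using that
 proof (induction xs rule: list.induct)
  case Nil
  have "al i : al ` S | al i : al ` (I - S)" using Nil by blast
  then have "al i : ?U | al i : ?T" by (meson span_base)
  then show ?case by simp
 next
  case (Cons j xs)
  have j: "j : I" and "wd xs (al i) : ?U \<union> ?T" using Cons by simp_all
  moreover have "reflection (al j) u : ?U" if "u : ?U" for u
  proof (cases "j : S")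
   case True
   then show ?thesis unfolding reflection_coroot
    by (intro span_diff that span_scale span_base imageI)
  next
   case False
   then show ?thesis using 1[OF that, of j] j that by (simp add: reflection_coroot')
  qed
  moreover have "reflection (al j) u : ?T" if "u : ?T" for u
  proof (cases "j : S")
   case True
   then show ?thesis using 2[OF that, of j] j that by (simp add: reflection_coroot')
  next
   case False
   with j have "j : I - S" by blast
   then show ?thesis unfolding reflection_coroot
    by (intro span_diff that span_scale span_base imageI)
  qed
  ultimately show ?case by auto
 qed
 have all: "b : ?U \<union> ?T" if b: "b : \<Phi>" for b
 proof -
  obtain xs i where *: "xs : lists I" "i : I" "b = wd xs (al i)"
   using root_conj_simple[OF b] by blast
  show ?thesis unfolding *(3) by (rule word[OF *(1,2)])
 qed
 obtain i where i: "i : S" using S by blast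
 obtain j where j: "j : I - S" using S by blast
 have "\<Phi> \<inter> ?T = {}"
 proof (rule no_orthogonal_splitting)
  show "\<Phi> = (\<Phi> \<inter> ?U) \<union> (\<Phi> \<inter> ?T)" using all by blast
  have "al i : \<Phi> \<inter> ?U" using i S simple_root span_base[of "al i" "al ` S"] by blast
  then show "\<Phi> \<inter> ?U ~= {}" by blast
 qed (use 3 in blast)
 moreover have "al j : \<Phi> \<inter> ?T"
  using j simple_root[of j] span_base[of "al j" "al ` (I - S)"] by blast
 ultimately show False by blast
qed

text \<open>Otherwise expanding the squared norm of \<open>g\<close> along the simple roots gives a
  nonpositive number.\<close>

lemma dominant_pos:
 assumes "g : \<Phi>" "!!i. i : I ==> 0 <= g \<bullet> al i" shows "pos g"
proof (rule ccontr)
 assume "~ pos g"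
 then have "pos (- g)" using root_sign assms(1) by blast
 then have "(\<Sum>i\<in>I. (cw i \<bullet> g) * (al i \<bullet> g)) <= 0"
  using assms(2) by (intro sum_nonpos mult_nonpos_nonneg) (auto simp: pos_def inner_commute)
 then show False using inner_expansion[of g g] inner_root_pos[OF assms(1)] by simp
qed

lemma reflection_ht:
 "i : I ==> ht (reflection (al i) v) = ht v - v \<bullet> coroot (al i)"
 by (simp add: reflection_coroot ht_diff ht_scale ht_simple)

lemma coroot_sign:
 assumes "a : \<Phi>"
 shows "v \<bullet> coroot a > 0 \<longleftrightarrow> v \<bullet> a > 0" "v \<bullet> coroot a < 0 \<longleftrightarrow> v \<bullet> a < 0"
  "v \<bullet> coroot a >= 0 \<longleftrightarrow> v \<bullet> a >= 0" "v \<bullet> coroot a = 0 \<longleftrightarrow> v \<bullet> a = 0"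
proof -
 define c where "c = 2 / (a \<bullet> a)"
 have c: "c > 0" "v \<bullet> coroot a = c * (v \<bullet> a)"
  using inner_root_pos[OF assms] by (simp_all add: c_def inner_coroot)
 show "v \<bullet> coroot a > 0 \<longleftrightarrow> v \<bullet> a > 0" "v \<bullet> coroot a < 0 \<longleftrightarrow> v \<bullet> a < 0"
  "v \<bullet> coroot a >= 0 \<longleftrightarrow> v \<bullet> a >= 0" "v \<bullet> coroot a = 0 \<longleftrightarrow> v \<bullet> a = 0"
  using c(1) unfolding c(2) by (simp_all add: zero_less_mult_iff mult_less_0_iff zero_le_mult_iff)
qed

lemma ex_max_ht:
 assumes "X \<subseteq> \<Phi>" "X ~= {}"
 shows "EX g:X. ALL b:X. ht b <= ht g"
proof -
 have "finite X" using assms(1) finite_roots finite_subset by blast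
 then have "Max (ht ` X) : ht ` X" using assms(2) by simp
 then obtain g where "g : X" "Max (ht ` X) = ht g" by blast
 then have "ALL b:X. ht b <= ht g" using \<open>finite X\<close> by (metis Max_ge finite_imageI imageI)
 then show ?thesis using \<open>g : X\<close> by blast
qed

text \<open>A root \<open>th\<close> of maximal height is dominant. Every root \<open>b\<close> lies
  below some dominant root \<open>g\<close>, and if \<open>g\<close> were different from
  \<open>th\<close> their difference would be a root, which maximality of heights excludes.\<close>

lemma ex_highest:
 "EX th:\<Phi>. ALL b:\<Phi>. ALL i:I. cw i \<bullet> b <= cw i \<bullet> th"
proof -
 obtain th where th: "th : \<Phi>" and max: "!!b. b : \<Phi> ==> ht b <= ht th"
  using ex_max_ht[of \<Phi>] roots_nonempty by blast
 have dom: "th \<bullet> al i >= 0" if "i : I" for i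
  using max[OF reflection_root[OF simple_root[OF that] th]]
  by (simp add: reflection_ht[OF that] coroot_sign[OF simple_root[OF that]])
 have pos: "pos th" by (rule dominant_pos[OF th dom])
 define S where "S = {i\<in>I. cw i \<bullet> th > 0}"
 \<comment> \<open>Full support: by connectedness some \<open>al j\<close> outside the support meets
   it, and all terms of the pairing of \<open>th\<close> with \<open>al j\<close> would be
   nonpositive, one of them negative.\<close>
 have "S = I"
 proof (rule ccontr)
  assume "S ~= I"
  moreover have "S ~= {}"
  proof
   assume "S = {}"
   then have "cw i \<bullet> th = cw i \<bullet> 0" if "i : I" for i
    using that pos unfolding S_def pos_def by force
   then have "th = 0" by (rule eq_by_coweights)
   then show False using root_nonzero[OF th] by simp
  qed
  moreover have "S \<subseteq> I" by (auto simp: S_def)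
  ultimately obtain i j where ij: "i : S" "j : I - S" "al i \<bullet> al j ~= 0"
   using simple_connected by blast
  have term_nonpos: "(cw k \<bullet> th) * (al k \<bullet> al j) <= 0" if "k : I" for k
  proof (cases "k = j")
   case True
   have "cw j \<bullet> th = 0" using ij(2) pos unfolding S_def pos_def by force
   then show ?thesis using True by simp
  next
   case False
   then show ?thesis
    using simple_inner_nonpos[of k j] that ij(2) pos
    by (auto simp: pos_def intro: mult_nonneg_nonpos)
  qed
  have "th \<bullet> al j = (\<Sum>k\<in>I. (cw k \<bullet> th) * (al k \<bullet> al j))" by (rule inner_expansion)
  also have "\<dots> < (\<Sum>k\<in>I. 0)"
  proof (rule sum_strict_mono_ex1)
   show "EX k:I. (cw k \<bullet> th) * (al k \<bullet> al j) < 0"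
   proof (rule bexI[of _ i])
    have "al i \<bullet> al j < 0" using simple_inner_nonpos[of i j] ij by (force simp: S_def)
    then show "(cw i \<bullet> th) * (al i \<bullet> al j) < 0" using ij(1) by (simp add: S_def mult_pos_neg)
   qed (use ij(1) in \<open>simp add: S_def\<close>)
  qed (use term_nonpos in auto)
  finally show False using dom[of j] ij(2) by simp
 qed
 then have full: "cw i \<bullet> th > 0" if "i : I" for i using that by (auto simp: S_def)
 have "cw k \<bullet> b <= cw k \<bullet> th" if b: "b : \<Phi>" and k: "k : I" for b k
 proof -
  define X where "X = {g\<in>\<Phi>. ALL i:I. cw i \<bullet> b <= cw i \<bullet> g}"
  obtain g where g: "g : X" and gmax: "!!c. c : X ==> ht c <= ht g"
   using ex_max_ht[of X] b by (auto simp: X_def)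
  have g\<Phi>: "g : \<Phi>" using g by (simp add: X_def)
  have gdom: "g \<bullet> al i >= 0" if i: "i : I" for i
  proof (rule ccontr)
   assume "~ ?thesis"
   then have neg: "g \<bullet> coroot (al i) < 0" using coroot_sign[OF simple_root[OF i]] by simp
   \<comment> \<open>A negative pairing with \<open>al i\<close> raises the coefficient at
     \<open>i\<close> and leaves the others, so the reflected root stays above \<open>b\<close> but
     is higher than \<open>g\<close>.\<close>
   have "reflection (al i) g : X"
    unfolding X_def
   proof (intro CollectI conjI ballI)
    show "reflection (al i) g : \<Phi>" by (rule reflection_root[OF simple_root[OF i] g\<Phi>])
    fix l assume l: "l : I"
    have "cw l \<bullet> b <= cw l \<bullet> g" using g l by (simp add: X_def)
    then show "cw l \<bullet> b <= cw l \<bullet> reflection (al i) g"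
     using neg by (auto simp: reflection_coroot inner_diff_right coweight_simple[OF l i])
   qed
   then show False using gmax reflection_ht[OF i, of g] neg by fastforce
  qed
  have gpos: "pos g" by (rule dominant_pos[OF g\<Phi> gdom])
  have "th = g"
  proof (rule ccontr)
   assume ne: "th ~= g"
   have nn: "(cw i \<bullet> th) * (al i \<bullet> g) >= 0" if "i : I" for i
    using full[OF that] gdom[OF that] by (simp add: inner_commute)
   \<comment> \<open>All coefficients of \<open>th\<close> are positive, and \<open>g\<close> is
     dominant and nonzero.\<close>
   have "th \<bullet> g > 0"
   proof (rule ccontr)
    assume "~ ?thesis"
    moreover have "th \<bullet> g >= 0" unfolding inner_expansion[of th g] by (rule sum_nonneg) (use nn in auto)
    ultimately have "(\<Sum>i\<in>I. (cw i \<bullet> th) * (al i \<bullet> g)) = 0"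
     using inner_expansion[of th g] by simp
    then have "ALL i:I. (cw i \<bullet> th) * (al i \<bullet> g) = 0"
     using nn by (subst (asm) sum_nonneg_eq_0_iff) auto
    then have "g \<bullet> al i = 0 \<bullet> al i" if "i : I" for i
     using full[OF that] that by (auto simp: inner_commute)
    then show False using eq_by_simple[of g 0] root_nonzero[OF g\<Phi>] by blast
   qed
   then have d: "th - g : \<Phi>" using root_diff[OF th g\<Phi>] ne by blast
   show False
   proof (cases "pos (th - g)")
    case True
    then have "th : X" using th g by (force simp: X_def pos_def inner_diff_right)
    then have "ht th <= ht g" by (rule gmax)
    moreover have "ht (th - g) > 0"
    proof -
     have "ht (th - g) >= 0" unfolding ht_def by (rule sum_nonneg) (use True in \<open>simp add: pos_def\<close>)
     moreover have "ht (th - g) ~= 0"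
     proof
      assume "ht (th - g) = 0"
      then have "ALL i:I. cw i \<bullet> (th - g) = 0"
       unfolding ht_def using True by (subst (asm) sum_nonneg_eq_0_iff) (auto simp: pos_def)
      then have "th - g = 0" by (intro eq_by_coweights) simp
      then show False using ne by simp
     qed
     ultimately show ?thesis by simp
    qed
    ultimately show False by (simp add: ht_diff)
   next
    case False
    then have gt: "pos (g - th)" using root_sign[OF d] by simp
    have "ht (g - th) = 0"
    proof -
     have "ht (g - th) >= 0" unfolding ht_def by (rule sum_nonneg) (use gt in \<open>simp add: pos_def\<close>)
     then show ?thesis using max[OF g\<Phi>] by (simp add: ht_diff)
    qed
    then have "ALL i:I. cw i \<bullet> (g - th) = 0"
     unfolding ht_def using gt by (subst (asm) sum_nonneg_eq_0_iff) (auto simp: pos_def)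
    then have "g - th = 0" by (intro eq_by_coweights) simp
    then show False using ne by simp
   qed
  qed
  then show ?thesis using g k by (simp add: X_def)
 qed
 then show ?thesis using th by blast
qed

lemma highest_unique:
 assumes "th : \<Phi>" "!!b i. b : \<Phi> ==> i : I ==> cw i \<bullet> b <= cw i \<bullet> th"
 shows "hr = th"
 unfolding highest_root_def
proof (rule the_equality)
 have "EX c :: nat => nat. th - b = (\<Sum>i\<in>I. real (c i) *\<^sub>R al i)" if b: "b : \<Phi>" for b
 proof -
  have "real (nat \<lfloor>cw i \<bullet> (th - b)\<rfloor>) = cw i \<bullet> (th - b)" if i: "i : I" for i
  proof -
   have "cw i \<bullet> (th - b) : \<int>"
    using root_coeff_Ints[OF assms(1) i] root_coeff_Ints[OF b i] by (simp add: inner_diff_right)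
   moreover have "cw i \<bullet> (th - b) >= 0" using assms(2)[OF b i] by (simp add: inner_diff_right)
   ultimately show ?thesis by (auto elim!: Ints_cases)
  qed
  then have "(\<Sum>i\<in>I. real (nat \<lfloor>cw i \<bullet> (th - b)\<rfloor>) *\<^sub>R al i) = (\<Sum>i\<in>I. (cw i \<bullet> (th - b)) *\<^sub>R al i)"
   by (intro sum.cong) auto
  then have "th - b = (\<Sum>i\<in>I. real (nat \<lfloor>cw i \<bullet> (th - b)\<rfloor>) *\<^sub>R al i)"
   using simple_expansion[of "th - b"] by simp
  then show ?thesis by (rule exI[of _ "%i. nat \<lfloor>cw i \<bullet> (th - b)\<rfloor>"])
 qed
 then show "th : \<Phi> & (ALL b:\<Phi>. EX c :: nat => nat. th - b = (\<Sum>i\<in>I. real (c i) *\<^sub>R al i))"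
  using assms(1) by blast
 fix \<eta> assume \<eta>: "\<eta> : \<Phi> & (ALL b:\<Phi>. EX c :: nat => nat. \<eta> - b = (\<Sum>i\<in>I. real (c i) *\<^sub>R al i))"
 then obtain c :: "nat => nat" where "\<eta> - th = (\<Sum>i\<in>I. real (c i) *\<^sub>R al i)"
  using assms(1) by blast
 then have "cw i \<bullet> (\<eta> - th) >= 0" if "i : I" for i
  using coweight_sum[OF that] by simp
 moreover have "cw i \<bullet> \<eta> <= cw i \<bullet> th" if "i : I" for i
  using assms(2) \<eta> that by blast
 ultimately show "\<eta> = th"
  by (intro eq_by_coweights) (simp add: inner_diff_right order_antisym)
qed

lemma hr_root: "hr : \<Phi>"
 and coeff_le_hr: "b : \<Phi> ==> i : I ==> cw i \<bullet> b <= cw i \<bullet> hr"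
proof -
 obtain th where "th : \<Phi>" "!!b i. b : \<Phi> ==> i : I ==> cw i \<bullet> b <= cw i \<bullet> th"
  using ex_highest by blast
 moreover from this have "hr = th" by (rule highest_unique)
 ultimately show "hr : \<Phi>" "b : \<Phi> ==> i : I ==> cw i \<bullet> b <= cw i \<bullet> hr" by auto
qed

lemma hr_coeff_ge_1: "i : I ==> 1 <= cw i \<bullet> hr"
 using coeff_le_hr[OF simple_root, of i i] by (simp add: coweight_simple)

lemma pos_hr: "pos hr"
 using hr_coeff_ge_1 by (force simp: pos_def)

lemma coeff_ge_minus_hr: "b : \<Phi> ==> i : I ==> - (cw i \<bullet> hr) <= cw i \<bullet> b"
 using coeff_le_hr[OF minus_root, of b i] by simp

section \<open>Ratios of root lengths\<close>

text \<open>The roots orthogonal to the whole orbit of \<open>a\<close> are orthogonal to the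
  remaining roots as well, so they would split off.\<close>

lemma ex_weyl_nonorthogonal:
 assumes a: "a : \<Phi>" and b: "b : \<Phi>"
 shows "EX xs:lists I. wd xs a \<bullet> b ~= 0"
proof -
 define Y where "Y = {y\<in>\<Phi>. ALL w:W. w a \<bullet> y = 0}"
 have "Y = {}"
 proof (rule no_orthogonal_splitting)
  show "\<Phi> = (\<Phi> - Y) \<union> Y" by (auto simp: Y_def)
  have "a ~: Y"
   using id_in_weyl_group[of \<Phi>] inner_root_pos[OF a] by (force simp: Y_def)
  then show "\<Phi> - Y ~= {}" using a by blast
  fix x y assume x: "x : \<Phi> - Y" and y: "y : Y"
  then obtain w where w: "w : W" "w a \<bullet> x ~= 0" by (auto simp: Y_def)
  \<comment> \<open>Reflecting in \<open>x\<close> changes the pairing of \<open>w a\<close> with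
    \<open>y\<close> by a nonzero multiple of the pairing of \<open>x\<close> with
    \<open>y\<close>.\<close>
  have "w a \<bullet> y = 0" "(reflection x o w) a \<bullet> y = 0"
   using y w weyl_group_step[of x \<Phi> w] x unfolding Y_def by blast+
  then have "(w a \<bullet> coroot x) * (x \<bullet> y) = 0"
   by (simp add: reflection_coroot inner_diff_left)
  moreover have "w a \<bullet> coroot x ~= 0" using w x coroot_sign(4)[of x] by blast
  ultimately show "x \<bullet> y = 0" by simp
 qed
 then obtain w where "w : W" "w a \<bullet> b ~= 0" using b unfolding Y_def by blast
 then show ?thesis unfolding weyl_group_wd by blast
qed

end

text \<open>Infinite descent: \<open>p\<close> divides both numbers, and dividing both by
  \<open>p\<close> gives a smaller solution.\<close>

lemma square_not_prime_times_square:
 fixes m k p :: nat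
 assumes "prime p" "m\<^sup>2 = p * k\<^sup>2" shows "k = 0"
 using assms(2)
proof (induction k arbitrary: m rule: less_induct)
 case (less k)
 have "p dvd m\<^sup>2" using less.prems by simp
 then have "p dvd m" using assms(1) prime_dvd_power by blast
 then obtain m' where m': "m = p * m'" by blast
 have p0: "p > 1" using assms(1) prime_gt_1_nat by blast
 have "p * (p * m'\<^sup>2) = p * k\<^sup>2" using less.prems by (simp add: m' power2_eq_square ac_simps)
 then have k: "k\<^sup>2 = p * m'\<^sup>2" using p0 by simp
 then have "p dvd k" using assms(1) prime_dvd_power by (metis dvd_triv_left)
 then obtain k' where k': "k = p * k'" by blast
 have "p * (p * k'\<^sup>2) = p * m'\<^sup>2" using k by (simp add: k' power2_eq_square ac_simps)
 then have "m'\<^sup>2 = p * k'\<^sup>2" using p0 by simp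
 then have "k' < k ==> k' = 0" using less.IH by blast
 then show ?case using k' p0 by (cases "k' = 0") auto
qed

context root_base begin

text \<open>The squared length ratio of two roots is one of 1, 2, 3, 1/2, 1/3, so it is the square of a
  rational number only if it is 1.\<close>

lemma rational_length_ratio:
 fixes m k :: nat
 assumes a: "a : \<Phi>" and b: "b : \<Phi>" and "m > 0" "k > 0"
  and eq: "(real k)\<^sup>2 * (b \<bullet> b) = (real m)\<^sup>2 * (a \<bullet> a)"
 shows "m = k"
proof -
 obtain xs where xs: "xs : lists I" "wd xs a \<bullet> b ~= 0"
  using ex_weyl_nonorthogonal[OF a b] by blast
 \<comment> \<open>Replacing the conjugate by its negative if necessary makes the angle with
   \<open>b\<close> acute, as \<open>cartan_one\<close> requires.\<close>
 define c where "c = (if wd xs a \<bullet> b > 0 then wd xs a else - wd xs a)"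
 have c: "c : \<Phi>" using wd_root[OF xs(1) a] minus_root by (simp add: c_def)
 have cb: "c \<bullet> b > 0" using xs(2) by (simp add: c_def)
 have cc: "c \<bullet> c = a \<bullet> a" by (simp add: c_def orthogonal_inner[OF wd_orthogonal])
 have aa: "a \<bullet> a > 0" and bb: "b \<bullet> b > 0" using a b inner_root_pos by auto
 have *: "m = k" if "a \<bullet> a = b \<bullet> b"
 proof -
  have "(real k)\<^sup>2 = (real m)\<^sup>2" using eq that aa by simp
  then show ?thesis by (simp add: power2_eq_iff_nonneg)
 qed
 show ?thesis
 proof (cases "c = b")
  case False
  obtain p where p: "c \<bullet> coroot b = of_int p"
   using cartan_Ints[OF b c] by (auto elim: Ints_cases)
  obtain q where q: "b \<bullet> coroot c = of_int q"
   using cartan_Ints[OF c b] by (auto elim: Ints_cases)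
  have pq: "p > 0" "q > 0"
   using cb p q coroot_sign(1)[OF b, of c] coroot_sign(1)[OF c, of b] by (simp_all add: inner_commute)
  have one: "p = 1 | q = 1" using cartan_one(1)[OF c b cb False] p q by auto
  have "real_of_int (p * q) < 4" using cartan_one(2)[OF c b cb False] p q by simp
  then have lt: "p * q < 4" by linarith
  \<comment> \<open>Both Cartan integers have the same numerator, so the ratio of \<open>p\<close>
    to \<open>q\<close> is that of the squared lengths of \<open>a\<close> and
    \<open>b\<close>.\<close>
  have ratio: "of_int p * (b \<bullet> b) = of_int q * (a \<bullet> a)"
   using aa bb by (simp add: p[symmetric] q[symmetric] inner_coroot cc inner_commute)
  have "of_int p * ((real m)\<^sup>2 * (a \<bullet> a)) = of_int q * ((real k)\<^sup>2 * (a \<bullet> a))"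
   unfolding eq[symmetric] using ratio by (simp add: algebra_simps)
  then have "real_of_int p * (real m)\<^sup>2 = of_int q * (real k)\<^sup>2" using aa by simp
  then have "real_of_int (p * int (m\<^sup>2)) = real_of_int (q * int (k\<^sup>2))" by simp
  then have nat: "p * int (m\<^sup>2) = q * int (k\<^sup>2)" by linarith
  have hit: "k = 0" if "prime r" "p = 1" "q = int r" for r
  proof -
   have "int (m\<^sup>2) = int (r * k\<^sup>2)" using nat that by simp
   then have "m\<^sup>2 = r * k\<^sup>2" by linarith
   then show ?thesis by (rule square_not_prime_times_square[OF that(1)])
  qed
  have hit': "m = 0" if "prime r" "q = 1" "p = int r" for r
  proof -
   have "int (k\<^sup>2) = int (r * m\<^sup>2)" using nat that by simp
   then have "k\<^sup>2 = r * m\<^sup>2" by linarith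
   then show ?thesis by (rule square_not_prime_times_square[OF that(1)])
  qed
  have "p = 1 & q = 1 | p = 1 & (q = 2 | q = 3) | q = 1 & (p = 2 | p = 3)"
   using one lt pq by force
  moreover have "prime (2::nat)" "prime (3::nat)" by (simp_all add: prime_nat_numeral_eq)
  moreover have "p = 1 & q = 1 ==> m = k" using ratio * by simp
  ultimately show ?thesis
   using hit[of 2] hit[of 3] hit'[of 2] hit'[of 3] \<open>m > 0\<close> \<open>k > 0\<close> by auto
 qed (use * cc in simp)
qed

section \<open>Automorphisms of the Weyl chamber\<close>

abbreviation "C \<equiv> weyl_chamber n al"

lemma mem_chamber: "x : C \<longleftrightarrow> (ALL i:I. 0 <= al i \<bullet> x)"
 by (simp add: weyl_chamber_def)

lemma linear_coweight_expansion:
 "linear f ==> f v = (\<Sum>i\<in>I. (v \<bullet> al i) *\<^sub>R f (cw i))"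
 by (subst coweight_expansion[of v]) (simp add: linear_sum linear_scale)

lemma coweight_nonzero: "i : I ==> cw i ~= 0"
 using coweight_simple[of i i] by auto

text \<open>The fundamental coweights span the extremal rays of the chamber, and a linear
  automorphism permutes these.\<close>

lemma chamber_ray:
 assumes ph: "orthogonal_transformation ph" and img: "ph ` C = C" and k: "k : I"
 shows "EX l:I. EX t>0. ph (cw k) = t *\<^sub>R cw l"
proof -
 define ps where "ps = inv_into UNIV ph"
 have bij: "bij ph" by (rule orthogonal_transformation_bij[OF ph])
 have ps: "linear ps" unfolding ps_def
  by (rule orthogonal_transformation_linear[OF orthogonal_transformation_inv[OF ph]])
 have inv: "ps (ph x) = x" "ph (ps x) = x" for x
  using bij by (simp_all add: ps_def bij_is_inj bij_is_surj surj_f_inv_f)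
 have psC: "ps x : C" if "x : C" for x using that img inv by (metis imageE)
 have cwC: "cw l : C" if "l : I" for l
  using that coweight_simple by (simp add: mem_chamber inner_commute)
 define y where "y = ph (cw k)"
 have yC: "y : C" using cwC[OF k] img by (auto simp: y_def)
 have nn: "0 <= y \<bullet> al l" if "l : I" for l using yC that by (simp add: mem_chamber inner_commute)
 have "ps 0 = 0" using linear_0[OF ps] .
 then have "y ~= 0" using coweight_nonzero[OF k] inv(1) by (metis y_def)
 have "EX l:I. y \<bullet> al l ~= 0"
 proof (rule ccontr)
  assume "~ ?thesis"
  then have "y = 0" by (intro eq_by_simple) simp
  then show False using \<open>y ~= 0\<close> by simp
 qed
 then obtain l where l: "l : I" "y \<bullet> al l > 0" using nn by force
 \<comment> \<open>The inverse maps \<open>y\<close> to \<open>cw k\<close>, whose coordinates off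
   \<open>k\<close> vanish. The images of all \<open>cw j\<close> lie in the chamber, so each
   summand vanishes there, in particular the one with the positive weight at
   \<open>l\<close>.\<close>
 have zero: "ps (cw l) \<bullet> al i = 0" if i: "i : I" "i ~= k" for i
 proof -
  have "(\<Sum>j\<in>I. (y \<bullet> al j) * (ps (cw j) \<bullet> al i)) = ps y \<bullet> al i"
   by (subst linear_coweight_expansion[OF ps, of y]) (simp add: inner_sum_left)
  also have "\<dots> = 0" using coweight_simple[OF k i(1)] i(2) by (simp add: y_def inv)
  finally have "ALL j:I. (y \<bullet> al j) * (ps (cw j) \<bullet> al i) = 0"
  proof (subst (asm) sum_nonneg_eq_0_iff)
   fix j assume j: "j : I"
   show "0 <= (y \<bullet> al j) * (ps (cw j) \<bullet> al i)"
    using nn[OF j] psC[OF cwC[OF j]] i(1) by (simp add: mem_chamber inner_commute)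
  qed auto
  then show ?thesis using l by auto
 qed
 define \<mu> where "\<mu> = ps (cw l) \<bullet> al k"
 have eq: "ps (cw l) = \<mu> *\<^sub>R cw k"
 proof (rule eq_by_simple)
  fix j assume j: "j : I"
  show "ps (cw l) \<bullet> al j = (\<mu> *\<^sub>R cw k) \<bullet> al j"
   using zero[OF j] coweight_simple[OF k j] by (cases "j = k") (auto simp: \<mu>_def)
 qed
 have "\<mu> >= 0" using psC[OF cwC[OF l(1)]] k by (simp add: mem_chamber inner_commute \<mu>_def)
 moreover have "\<mu> ~= 0"
 proof
  assume "\<mu> = 0"
  then have "ph (ps (cw l)) = 0" using eq linear_0[OF orthogonal_transformation_linear[OF ph]] by simp
  then show False using inv coweight_nonzero[OF l(1)] by simp
 qed
 ultimately have \<mu>: "\<mu> > 0" by simp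
 have "cw l = \<mu> *\<^sub>R ph (cw k)"
  using eq inv(2)[of "cw l"] linear_scale[OF orthogonal_transformation_linear[OF ph]] by metis
 then have "ph (cw k) = (1 / \<mu>) *\<^sub>R cw l" using \<mu> by simp
 then show ?thesis using l(1) \<mu> by (intro bexI[of _ l] exI[of _ "1 / \<mu>"]) auto
qed

lemma Aut_chamber_subset:
 assumes "ze : Aut_region C" shows "ze : Aut_coxeter_diagram n al"
proof -
 let ?N = "%i. al i /\<^sub>R norm (al i)"
 from assms obtain g ph where ph: "orthogonal_transformation ph" and ze: "ze = (%x. g + ph x)" and img: "ze ` C = C"
  by (auto simp: Aut_region_def motions_def)
 note lin = orthogonal_transformation_linear[OF ph]
 have 0: "0 : C" by (simp add: mem_chamber)
 \<comment> \<open>The translation part vanishes: the preimage \<open>c\<close> of 0 satisfies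
   \<open>ph c = - g\<close>, and doubling \<open>c\<close> shows that \<open>- g\<close> lies in
   the chamber together with \<open>g\<close>.\<close>
 then obtain c where c: "c : C" "g + ph c = 0" using img ze by (metis imageE)
 have "2 *\<^sub>R c : C" using c(1) by (simp add: mem_chamber)
 then have "ze (2 *\<^sub>R c) : C" using img by blast
 moreover have "ph c = - g" using c(2) by (simp add: add_eq_0_iff)
 then have "ze (2 *\<^sub>R c) = - g"
  by (simp add: ze linear_add[OF lin] scaleR_2)
 ultimately have "- g : C" by simp
 moreover have "g : C" using img 0 linear_0[OF lin] ze by (metis add.right_neutral imageI)
 ultimately have "g \<bullet> al i = 0 \<bullet> al i" if "i : I" for i
  using that by (force simp: mem_chamber inner_commute)
 then have "g = 0" by (rule eq_by_simple)
 then have zeph: "ze = ph" by (simp add: ze)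
 have "ALL k:I. EX l. l : I & (EX t>0. ph (cw k) = t *\<^sub>R cw l)"
  using chamber_ray[OF ph] img zeph by blast
 then obtain sg where sg: "!!k. k : I ==> sg k : I"
  and "ALL k:I. EX t>0. ph (cw k) = t *\<^sub>R cw (sg k)" by metis
 then obtain t where t: "!!k. k : I ==> t k > (0::real)"
  "!!k. k : I ==> ph (cw k) = t k *\<^sub>R cw (sg k)" by metis
 have inj: "inj_on sg I"
 proof (rule inj_onI)
  fix k l assume k: "k : I" and l: "l : I" and "sg k = sg l"
  then have "ph (t l *\<^sub>R cw k) = ph (t k *\<^sub>R cw l)"
   by (simp add: linear_scale[OF lin] t)
  then have eq: "t l *\<^sub>R cw k = t k *\<^sub>R cw l"
   using orthogonal_transformation_inj[OF ph] by (simp add: inj_eq)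
  have "t l * (cw k \<bullet> al k) = t k * (cw l \<bullet> al k)" using arg_cong[OF eq, of "%v. v \<bullet> al k"] by simp
  then show "k = l" using coweight_simple[OF k k] coweight_simple[OF l k] t(1)[OF l] by (auto split: if_splits)
 qed
 have onto: "sg ` I = I" by (rule endo_inj_surj[OF _ _ inj]) (use sg in auto)
 \<comment> \<open>The simple roots are dual to the coweights, so they are scaled by the inverse
   factors; comparing norms below turns these factors into quotients of root lengths.\<close>
 have imgal: "ph (al k) = (1 / t k) *\<^sub>R al (sg k)" if k: "k : I" for k
 proof -
  have "inv_into UNIV ph (ph (al k)) = inv_into UNIV ph ((1 / t k) *\<^sub>R al (sg k))"
  proof (rule eq_by_coweights)
   fix j assume j: "j : I"
   have "cw j \<bullet> inv_into UNIV ph v = v \<bullet> ph (cw j)" for v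
    using orthogonal_inv_inner[OF ph] by (simp add: inner_commute)
   moreover have "ph (al k) \<bullet> ph (cw j) = (if k = j then 1 else 0)"
    using coweight_simple[OF j k] by (simp add: orthogonal_inner[OF ph] inner_commute)
   moreover have "((1 / t k) *\<^sub>R al (sg k)) \<bullet> ph (cw j) = (if k = j then 1 else 0)"
    using coweight_simple[OF sg[OF j] sg[OF k]] t(1)[OF k] inj_on_eq_iff[OF inj j k]
    by (auto simp: t(2)[OF j] inner_commute)
   ultimately show "cw j \<bullet> inv_into UNIV ph (ph (al k)) = cw j \<bullet> inv_into UNIV ph ((1 / t k) *\<^sub>R al (sg k))"
    by simp
  qed
  then show ?thesis
   using surj_f_inv_f[OF orthogonal_transformation_surj[OF ph]] by metis
 qed
 have "ph (?N k) = ?N (sg k)" if k: "k : I" for k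
 proof -
  have "norm (al k) = norm (ph (al k))" using orthogonal_transformation_norm[OF ph] by simp
  also have "\<dots> = norm (al (sg k)) / t k" using t(1)[OF k] by (simp add: imgal[OF k])
  finally show ?thesis using t(1)[OF k] by (simp add: linear_scale[OF lin] imgal[OF k] inverse_eq_divide)
 qed
 note img_N = this
 have "ph ` ?N ` I = (%k. ph (?N k)) ` I" by (rule image_image)
 also have "\<dots> = (%k. ?N (sg k)) ` I" by (rule image_cong[OF HOL.refl]) (rule img_N)
 also have "\<dots> = ?N ` sg ` I" by (simp only: image_image)
 also have "\<dots> = ?N ` I" by (simp only: onto)
 finally show "ze : Aut_coxeter_diagram n al" using ph zeph by (simp add: Aut_coxeter_diagram_def)
qed

lemma Aut_chamber_superset:
 assumes "ze : Aut_coxeter_diagram n al" shows "ze : Aut_region C"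
proof -
 let ?N = "%i. al i /\<^sub>R norm (al i)"
 have norm_pos: "norm (al i) > 0" if "i : I" for i
 using root_nonzero[OF simple_root[OF that]] by simp
 from assms have ze: "orthogonal_transformation ze" and img: "ze ` ?N ` I = ?N ` I"
  by (auto simp: Aut_coxeter_diagram_def)
 \<comment> \<open>Only the signs of the pairings with simple roots matter, so normalizing is
   harmless.\<close>
 have C: "x : C \<longleftrightarrow> (ALL u:?N ` I. 0 <= u \<bullet> x)" for x
  using norm_pos by (auto simp: mem_chamber zero_le_mult_iff)
 have iff: "ze x : C \<longleftrightarrow> x : C" for x
 proof -
  have "ze x : C \<longleftrightarrow> (ALL u:ze ` ?N ` I. 0 <= u \<bullet> ze x)" unfolding img by (rule C)
  also have "\<dots> \<longleftrightarrow> (ALL u:?N ` I. 0 <= ze u \<bullet> ze x)" by blast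
  also have "\<dots> \<longleftrightarrow> x : C" unfolding orthogonal_inner[OF ze] by (rule C[symmetric])
  finally show ?thesis .
 qed
 have "C \<subseteq> ze ` C"
 proof
  fix y assume "y : C"
  moreover obtain x where "y = ze x" using orthogonal_transformation_surj[OF ze] by (metis surjD)
  ultimately show "y : ze ` C" using iff by blast
 qed
 then have "ze ` C = C" using iff by blast
 then show "ze : Aut_region C" using orthogonal_in_motions[OF ze] by (simp add: Aut_region_def)
qed

theorem Aut_chamber: "Aut_region C = Aut_coxeter_diagram n al"
 using Aut_chamber_subset Aut_chamber_superset by (intro equalityI subsetI)

end

section \<open>Automorphisms of the fundamental alcove\<close>

context root_base begin

text \<open>The nodes of the affine diagram are numbered \<open>0, \<dots>, n\<close>, with \<open>- \<alpha>\<^sub>0\<close> at \<open>0\<close>; the mark of the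
  node \<open>i\<close> is the coefficient \<open>m\<^sub>i\<close>, where \<open>m\<^sub>0 = 1\<close>.\<close>

definition nd :: "nat => 'a" where "nd i = (if i = 0 then - hr else al i)"

definition mk :: "nat => real" where "mk i = (if i = 0 then 1 else cw i \<bullet> hr)"

text \<open>The affine functionals cutting out the alcove. Multiplied by the marks they become its
  barycentric coordinates.\<close>

definition wall :: "nat => 'a => real" where "wall i x = nd i \<bullet> x + (if i = 0 then 1 else 0)"

text \<open>The vertex of the alcove opposite to the wall \<open>k\<close>.\<close>

definition vx :: "nat => 'a" where "vx k = (if k = 0 then 0 else (1 / mk k) *\<^sub>R cw k)"

abbreviation "A \<equiv> fund_alcove \<Phi> n al"

lemma nodes_split: "{..n} = insert 0 I"
 by (auto simp: ivl_iff)

lemma sum_nodes: "(\<Sum>i\<in>{..n}. f i) = f 0 + (\<Sum>i\<in>I. f i)" for f :: "nat => 'b::comm_monoid_add"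
 unfolding nodes_split by (simp add: ivl_iff)

lemma simple_index: "i : I ==> i ~= 0 & i : {..n}"
 by (auto simp: ivl_iff)

lemma node_cases:
 assumes "i : {..n}" obtains "i = 0" | "i ~= 0" "i : I"
 using assms by (auto simp: ivl_iff)

lemma nd_simple: "i : I ==> nd i = al i"
 and mk_simple: "i : I ==> mk i = cw i \<bullet> hr"
 and nd_0: "nd 0 = - hr" and mk_0: "mk 0 = 1" and vx_0: "vx 0 = 0"
 and vx_simple: "i : I ==> vx i = (1 / mk i) *\<^sub>R cw i"
 using simple_index by (auto simp: nd_def mk_def vx_def)

lemma nd_image: "nd ` {..n} = insert (- hr) (al ` I)"
 unfolding nodes_split image_insert nd_0 by (metis (no_types, lifting) image_cong nd_simple)

lemma nd_root: "i : {..n} ==> nd i : \<Phi>"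
 by (erule node_cases) (simp_all add: nd_def minus_root hr_root simple_root)

lemma hr_neq_minus_simple: "i : I ==> - hr ~= al i"
 using pos_hr pos_simple not_pos_both[OF hr_root] by metis

lemma inj_nd: "inj_on nd {..n}"
proof (rule inj_onI)
 fix i j assume "i : {..n}" "j : {..n}" "nd i = nd j"
 then show "i = j"
  using hr_neq_minus_simple[of i] hr_neq_minus_simple[of j] inj_onD[OF inj_simple, of i j]
  by (elim node_cases) (auto simp: nd_def)
qed

lemma mk_ge_1: "i : {..n} ==> 1 <= mk i"
 by (erule node_cases) (simp_all add: mk_def hr_coeff_ge_1)

lemma mk_pos: "i : {..n} ==> 0 < mk i"
 using mk_ge_1 by fastforce

lemma mk_nat: assumes "i : {..n}" obtains m :: nat where "mk i = real m" "m > 0"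
proof -
 have "mk i : \<int>" using assms
  by (elim node_cases) (simp_all add: mk_def root_coeff_Ints[OF hr_root])
 then obtain z where "mk i = of_int z" by (auto elim: Ints_cases)
 then show ?thesis using that[of "nat z"] mk_ge_1[OF assms] by simp
qed

lemma mk_nd_relation: "(\<Sum>i\<in>{..n}. mk i *\<^sub>R nd i) = 0"
proof -
 have "(\<Sum>i\<in>I. mk i *\<^sub>R nd i) = (\<Sum>i\<in>I. (cw i \<bullet> hr) *\<^sub>R al i)"
  by (intro sum.cong) (auto simp: mk_simple nd_simple)
 then show ?thesis using simple_expansion[of hr] by (simp add: sum_nodes mk_0 nd_0)
qed

text \<open>The simple roots are independent, so a relation is determined by its coefficient at the
  node 0.\<close>

lemma nd_relation_unique:
 assumes "(\<Sum>i\<in>{..n}. c i *\<^sub>R nd i) = 0" "i : {..n}" shows "c i = c 0 * mk i"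
 using assms(2)
proof (cases rule: node_cases)
 case 2
 have "(\<Sum>k\<in>I. c k *\<^sub>R nd k) = (\<Sum>k\<in>I. c k *\<^sub>R al k)"
  by (intro sum.cong) (auto simp: nd_simple)
 then have "(\<Sum>k\<in>I. c k *\<^sub>R al k) = c 0 *\<^sub>R hr"
  using assms(1) by (simp add: sum_nodes nd_0)
 then have "c i = cw i \<bullet> (c 0 *\<^sub>R hr)" using coweight_sum[OF 2(2), of c] by simp
 then show ?thesis by (simp add: mk_simple[OF 2(2)])
qed (simp add: mk_0)

lemma mem_alcove: "x : A \<longleftrightarrow> (ALL i:{..n}. 0 <= wall i x)"
proof -
 have "wall i x = al i \<bullet> x" if "i : I" for i
  using simple_index[OF that] nd_simple[OF that] by (simp add: wall_def)
 moreover have "wall 0 x = 1 - hr \<bullet> x" by (simp add: wall_def nd_0)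
 ultimately show ?thesis unfolding nodes_split fund_alcove_def by auto
qed

text \<open>The linear parts cancel by \<open>mk_nd_relation\<close>; what is left is the constant
  of the node 0.\<close>

lemma wall_sum: "(\<Sum>i\<in>{..n}. mk i * wall i x) = 1"
proof -
 have "(\<Sum>i\<in>{..n}. mk i * wall i x) = (\<Sum>i\<in>{..n}. mk i * (nd i \<bullet> x)) + (\<Sum>i\<in>{..n}. if i = 0 then 1 else 0)"
  unfolding sum.distrib[symmetric]
  by (rule sum.cong) (auto simp: wall_def algebra_simps mk_0)
 also have "(\<Sum>i\<in>{..n}. mk i * (nd i \<bullet> x)) = (\<Sum>i\<in>{..n}. mk i *\<^sub>R nd i) \<bullet> x"
  by (simp add: inner_sum_left)
 finally show ?thesis by (simp add: mk_nd_relation)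
qed

lemma wall_vertex:
 assumes "i : {..n}" "k : {..n}" shows "wall i (vx k) = (if i = k then 1 / mk k else 0)"
 using assms(2)
proof (cases rule: node_cases)
 case 1
 then show ?thesis by (simp add: wall_def vx_0 mk_0)
next
 case k: 2
 have "mk k > 0" by (rule mk_pos[OF assms(2)])
 moreover have "al i \<bullet> cw k = (if k = i then 1 else 0)" if "i : I"
  using coweight_simple[OF k(2) that] by (simp add: inner_commute)
 ultimately show ?thesis using assms(1) k
  by (elim node_cases)
   (auto simp: wall_def vx_simple nd_0 nd_simple mk_simple inner_commute[of hr])
qed

lemma barycentric: "x = (\<Sum>k\<in>{..n}. (mk k * wall k x) *\<^sub>R vx k)"
proof -
 have "(mk k * wall k x) *\<^sub>R vx k = (x \<bullet> al k) *\<^sub>R cw k" if "k : I" for k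
  using mk_pos[of k] simple_index[OF that] nd_simple[OF that]
  by (simp add: vx_simple[OF that] wall_def inner_commute)
 then have "(\<Sum>k\<in>I. (mk k * wall k x) *\<^sub>R vx k) = (\<Sum>k\<in>I. (x \<bullet> al k) *\<^sub>R cw k)"
  by (intro sum.cong) auto
 then show ?thesis using coweight_expansion[of x] by (simp add: sum_nodes vx_0)
qed

lemma vx_in_alcove: "k : {..n} ==> vx k : A"
 using wall_vertex mk_pos by (force simp: mem_alcove)

lemma inj_vx: "inj_on vx {..n}"
proof (rule inj_onI)
 fix k l assume k: "k : {..n}" and l: "l : {..n}" and "vx k = vx l"
 then have "wall k (vx k) = wall k (vx l)" by simp
 then show "k = l" using wall_vertex[OF k k] wall_vertex[OF k l] mk_pos[OF k] by (auto split: if_splits)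
qed

lemma affine_barycentric:
 assumes "linear f"
 shows "g + f x = (\<Sum>k\<in>{..n}. (mk k * wall k x) *\<^sub>R (g + f (vx k)))"
proof -
 have "(\<Sum>k\<in>{..n}. (mk k * wall k x) *\<^sub>R (g + f (vx k)))
   = (\<Sum>k\<in>{..n}. mk k * wall k x) *\<^sub>R g + (\<Sum>k\<in>{..n}. (mk k * wall k x) *\<^sub>R f (vx k))"
  by (simp add: scaleR_add_right sum.distrib scaleR_sum_left)
 also have "(\<Sum>k\<in>{..n}. (mk k * wall k x) *\<^sub>R f (vx k)) = f (\<Sum>k\<in>{..n}. (mk k * wall k x) *\<^sub>R vx k)"
  using assms by (simp add: linear_sum linear_scale)
 finally show ?thesis using barycentric[of x] wall_sum[of x] by simp
qed

text \<open>Affine maps respect barycentric coordinates; this transfers information at the vertices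
  to all points.\<close>

lemma wall_affine_barycentric:
 assumes "linear f"
 shows "wall i (g + f x) = (\<Sum>k\<in>{..n}. (mk k * wall k x) * wall i (g + f (vx k)))"
proof -
 let ?e = "if i = 0 then 1 else 0 :: real"
 have "(\<Sum>k\<in>{..n}. (mk k * wall k x) * wall i (g + f (vx k)))
   = (\<Sum>k\<in>{..n}. nd i \<bullet> ((mk k * wall k x) *\<^sub>R (g + f (vx k)))) + (\<Sum>k\<in>{..n}. (mk k * wall k x) * ?e)"
  unfolding sum.distrib[symmetric] by (rule sum.cong) (auto simp: wall_def algebra_simps)
 also have "(\<Sum>k\<in>{..n}. nd i \<bullet> ((mk k * wall k x) *\<^sub>R (g + f (vx k)))) = nd i \<bullet> (g + f x)"
  unfolding affine_barycentric[OF assms, of g x] by (simp only: inner_sum_right)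
 also have "(\<Sum>k\<in>{..n}. (mk k * wall k x) * ?e) = ?e"
  unfolding sum_distrib_right[symmetric] wall_sum by simp
 finally show ?thesis by (simp add: wall_def)
qed

text \<open>The argument of \<open>chamber_ray\<close> in barycentric coordinates; their sum is 1,
  so a point with a single nonzero coordinate is a vertex.\<close>

lemma alcove_vertex:
 assumes ph: "orthogonal_transformation ph" and img: "(%x. g + ph x) ` A = A" and k: "k : {..n}"
 shows "EX l:{..n}. g + ph (vx k) = vx l"
proof -
 define ps where "ps = inv_into UNIV ph"
 have bij: "bij ph" by (rule orthogonal_transformation_bij[OF ph])
 have ps: "linear ps" unfolding ps_def
  by (rule orthogonal_transformation_linear[OF orthogonal_transformation_inv[OF ph]])
 have inv: "ps (ph x) = x" "ph (ps x) = x" for x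
  using bij by (simp_all add: ps_def bij_is_inj bij_is_surj surj_f_inv_f)
 define h where "h = - ps g"
 have bck: "h + ps (g + ph x) = x" "g + ph (h + ps x) = x" for x
  using linear_add[OF ps] linear_add[OF orthogonal_transformation_linear[OF ph]]
   linear_neg[OF orthogonal_transformation_linear[OF ph]]
   linear_diff[OF orthogonal_transformation_linear[OF ph]]
  by (simp_all add: h_def inv)
 have bckA: "h + ps x : A" if x: "x : A" for x
 proof -
  have "x : (%x. g + ph x) ` A" unfolding img by (rule x)
  then obtain z where "z : A" "x = g + ph z" by (rule imageE)
  then show ?thesis using bck(1) by simp
 qed
 define y where "y = g + ph (vx k)"
 have yA: "y : A" using img vx_in_alcove[OF k] unfolding y_def by blast
 have "EX l:{..n}. mk l * wall l y > 0"
 proof (rule ccontr)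
  assume "~ ?thesis"
  then have "(\<Sum>l\<in>{..n}. mk l * wall l y) <= 0" by (intro sum_nonpos) (simp add: not_less)
  then show False using wall_sum[of y] by simp
 qed
 then obtain l where l: "l : {..n}" "mk l * wall l y > 0" by blast
 have zero: "wall i (h + ps (vx l)) = 0" if i: "i : {..n}" "i ~= k" for i
 proof -
  have "(\<Sum>j\<in>{..n}. (mk j * wall j y) * wall i (h + ps (vx j))) = wall i (h + ps y)"
   by (rule wall_affine_barycentric[OF ps, symmetric])
  also have "\<dots> = 0" using wall_vertex[OF i(1) k] i(2) by (simp add: y_def bck)
  finally have "ALL j:{..n}. (mk j * wall j y) * wall i (h + ps (vx j)) = 0"
  proof (subst (asm) sum_nonneg_eq_0_iff)
   fix j assume j: "j : {..n}"
   have "0 <= wall j y" "0 <= wall i (h + ps (vx j))"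
    using yA bckA[OF vx_in_alcove[OF j]] j i(1) unfolding mem_alcove by blast+
   then show "0 <= (mk j * wall j y) * wall i (h + ps (vx j))"
    using mk_pos[OF j] by simp
  qed auto
  then show ?thesis using l by force
 qed
 let ?z = "h + ps (vx l)"
 have "(\<Sum>i\<in>{..n}. (mk i * wall i ?z) *\<^sub>R vx i) = (\<Sum>i\<in>{k}. (mk i * wall i ?z) *\<^sub>R vx i)"
  by (rule sum.mono_neutral_right) (use k zero in auto)
 moreover have "(\<Sum>i\<in>{..n}. mk i * wall i ?z) = (\<Sum>i\<in>{k}. mk i * wall i ?z)"
  by (rule sum.mono_neutral_right) (use k zero in auto)
 ultimately have "?z = vx k"
  using barycentric[of ?z] wall_sum[of ?z] by simp
 then have "vx l = g + ph (vx k)" using bck(2)[of "vx l"] by simp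
 then show ?thesis using l(1) by metis
qed

text \<open>Every root comes from a simple root by simple reflections, and conjugating these by
  \<open>ph\<close> gives reflections in roots.\<close>

lemma orthogonal_root_image:
 assumes ph: "orthogonal_transformation ph" and s: "!!i. i : I ==> ph (al i) : \<Phi>"
 shows "ph ` \<Phi> = \<Phi>"
proof -
 have word: "ph (wd xs (al i)) : \<Phi>" if "xs : lists I" "i : I" for xs i
  using that
 proof (induction xs rule: list.induct)
  case (Cons j xs)
  then have "j : I" "ph (wd xs (al i)) : \<Phi>" by simp_all
  then show ?case
   using reflection_root[OF s[of j], of "ph (wd xs (al i))"] by (simp add: reflection_conj[OF ph])
 qed (simp add: s)
 have "ph b : \<Phi>" if b: "b : \<Phi>" for b
 proof -
  obtain xs i where *: "xs : lists I" "i : I" "b = wd xs (al i)"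
   using root_conj_simple[OF b] by blast
  show ?thesis unfolding *(3) by (rule word[OF *(1,2)])
 qed
 then show ?thesis
  by (intro endo_inj_surj inj_on_subset[OF orthogonal_transformation_inj[OF ph]]) auto
qed

text \<open>The vertices are permuted by some \<open>sg\<close>. Each wall is then carried to the
  wall \<open>sg i\<close> up to the factor \<open>mk i / mk (sg i)\<close>, which is 1 because it
  is a rational ratio of root lengths.\<close>

lemma Aut_alcove_cases:
 assumes "ze : Aut_region A"
 obtains ph sg where "orthogonal_transformation ph" "ze = (%x. vx (sg 0) + ph x)"
  "bij_betw sg {..n} {..n}" "!!i. i : {..n} ==> ph (nd i) = nd (sg i)"
  "!!i. i : {..n} ==> mk (sg i) = mk i" "ph : AutAff"
proof -
 obtain g ph where ph: "orthogonal_transformation ph" and ze: "ze = (%x. g + ph x)"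
  and img: "(%x. g + ph x) ` A = A"
  using assms by (auto simp: Aut_region_def motions_def)
 note lin = orthogonal_transformation_linear[OF ph]
 have "ALL k:{..n}. EX l. l : {..n} & g + ph (vx k) = vx l"
  using alcove_vertex[OF ph img] by blast
 from bchoice[OF this] obtain sg where *: "ALL k:{..n}. sg k : {..n} & g + ph (vx k) = vx (sg k)" ..
 then have sg: "!!k. k : {..n} ==> sg k : {..n}"
  and sgv: "!!k. k : {..n} ==> g + ph (vx k) = vx (sg k)" by blast+
 have inj: "inj_on sg {..n}"
 proof (rule inj_onI)
  fix k l assume "k : {..n}" "l : {..n}" "sg k = sg l"
  then have "g + ph (vx k) = g + ph (vx l)" using sgv by simp
  then have "vx k = vx l" using orthogonal_transformation_inj[OF ph] by (simp add: inj_eq)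
  then show "k = l" using inj_onD[OF inj_vx] \<open>k : {..n}\<close> \<open>l : {..n}\<close> by blast
 qed
 have bij: "bij_betw sg {..n} {..n}"
  unfolding bij_betw_def using inj sg by (intro conjI endo_inj_surj) auto
 have wall_sg: "wall (sg i) (g + ph x) = mk i / mk (sg i) * wall i x" if i: "i : {..n}" for i x
 proof -
  have "wall (sg i) (g + ph x) = (\<Sum>k\<in>{..n}. (mk k * wall k x) * wall (sg i) (g + ph (vx k)))"
   by (rule wall_affine_barycentric[OF lin])
  also have "\<dots> = (\<Sum>k\<in>{..n}. if k = i then mk i * wall i x / mk (sg i) else 0)"
  proof (rule sum.cong[OF HOL.refl])
   fix k assume k: "k : {..n}"
   show "(mk k * wall k x) * wall (sg i) (g + ph (vx k)) = (if k = i then mk i * wall i x / mk (sg i) else 0)"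
    unfolding sgv[OF k] wall_vertex[OF sg[OF i] sg[OF k]] inj_on_eq_iff[OF inj i k] by auto
  qed
  finally show ?thesis using i by simp
 qed
 \<comment> \<open>Subtracting the value at 0 removes the constants and leaves the linear
   parts.\<close>
 have nd_sg: "nd (sg i) = (mk i / mk (sg i)) *\<^sub>R ph (nd i)" if i: "i : {..n}" for i
 proof -
  have "nd (sg i) \<bullet> y = ((mk i / mk (sg i)) *\<^sub>R ph (nd i)) \<bullet> y" for y
  proof -
   obtain x where x: "y = ph x" using orthogonal_transformation_surj[OF ph] by (metis surjD)
   have "nd (sg i) \<bullet> ph x = wall (sg i) (g + ph x) - wall (sg i) (g + ph 0)"
    by (simp add: wall_def linear_0[OF lin] inner_add_right)
   also have "\<dots> = mk i / mk (sg i) * (wall i x - wall i 0)"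
    unfolding wall_sg[OF i] by (simp add: right_diff_distrib)
   also have "wall i x - wall i 0 = nd i \<bullet> x" by (simp add: wall_def)
   finally show ?thesis by (simp add: x orthogonal_inner[OF ph])
  qed
  then show ?thesis by (rule vector_eq_rdot[THEN iffD1, OF allI])
 qed
 have mk_sg: "mk (sg i) = mk i" if i: "i : {..n}" for i
 proof -
  obtain m where m: "mk i = real m" "m > 0" using mk_nat[OF i] by blast
  obtain k where k: "mk (sg i) = real k" "k > 0" using mk_nat[OF sg[OF i]] by blast
  have "real k *\<^sub>R nd (sg i) = real m *\<^sub>R ph (nd i)"
   using k(2) unfolding nd_sg[OF i] m k by simp
  then have "(real k *\<^sub>R nd (sg i)) \<bullet> (real k *\<^sub>R nd (sg i)) = (real m *\<^sub>R ph (nd i)) \<bullet> (real m *\<^sub>R ph (nd i))"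
   by simp
  then have "(real k)\<^sup>2 * (nd (sg i) \<bullet> nd (sg i)) = (real m)\<^sup>2 * (nd i \<bullet> nd i)"
   by (simp add: orthogonal_inner[OF ph] power2_eq_square ac_simps)
  then have "m = k"
   using rational_length_ratio[OF nd_root[OF i] nd_root[OF sg[OF i]] m(2) k(2)] by simp
  then show ?thesis using m k by simp
 qed
 have phnd: "ph (nd i) = nd (sg i)" if i: "i : {..n}" for i
  using nd_sg[OF i] mk_pos[OF i] unfolding mk_sg[OF i] by simp
 have "ph (al i) : \<Phi>" if i: "i : I" for i
  using phnd[of i] nd_root[OF sg[of i]] simple_index[OF i] nd_simple[OF i] by simp
 then have roots: "ph ` \<Phi> = \<Phi>" by (rule orthogonal_root_image[OF ph])
 have "ph ` nd ` {..n} = (%i. ph (nd i)) ` {..n}" by (rule image_image)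
 also have "\<dots> = (%i. nd (sg i)) ` {..n}" by (rule image_cong[OF HOL.refl]) (rule phnd)
 also have "\<dots> = nd ` sg ` {..n}" by (simp only: image_image)
 also have "\<dots> = nd ` {..n}" using bij by (simp only: bij_betw_def)
 finally have aff: "ph : AutAff"
  using ph roots unfolding nd_image by (simp add: Aut_affine_dynkin_def Aut_roots_def)
 have "g = vx (sg 0)" using sgv[of 0] linear_0[OF lin] by (simp add: vx_0)
 with ze have "ze = (%x. vx (sg 0) + ph x)" by simp
 from that[OF ph this bij phnd mk_sg aff] show ?thesis .
qed

text \<open>Conversely, a permutation of the nodes preserves the marks because the relation between
  the nodes is unique up to a factor. The translation by \<open>vx (sg 0)\<close> moves the constant
  1 from the wall 0 to the wall \<open>sg 0\<close>.\<close>

lemma Aut_affine_cases: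
 assumes "ph : AutAff"
 obtains sg where "bij_betw sg {..n} {..n}" "!!i. i : {..n} ==> ph (nd i) = nd (sg i)"
  "!!i. i : {..n} ==> mk (sg i) = mk i" "(%x. vx (sg 0) + ph x) : Aut_region A"
proof -
 have ph: "orthogonal_transformation ph" and img: "ph ` nd ` {..n} = nd ` {..n}"
  using assms unfolding nd_image by (auto simp: Aut_affine_dynkin_def Aut_roots_def)
 note lin = orthogonal_transformation_linear[OF ph]
 define sg where "sg i = the_inv_into {..n} nd (ph (nd i))" for i
 have mem: "ph (nd i) : nd ` {..n}" if "i : {..n}" for i using that img by blast
 have sg: "sg i : {..n}" and phnd: "ph (nd i) = nd (sg i)" if i: "i : {..n}" for i
  using the_inv_into_into[OF inj_nd mem[OF i] subset_refl] f_the_inv_into_f[OF inj_nd mem[OF i]]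
  by (simp_all add: sg_def)
 have inj: "inj_on sg {..n}"
 proof (rule inj_onI)
  fix i j assume ij: "i : {..n}" "j : {..n}" "sg i = sg j"
  then have "ph (nd i) = ph (nd j)" using phnd by simp
  then have "nd i = nd j" using orthogonal_transformation_inj[OF ph] by (simp add: inj_eq)
  then show "i = j" using inj_onD[OF inj_nd] ij by blast
 qed
 have bij: "bij_betw sg {..n} {..n}"
  unfolding bij_betw_def using inj sg by (intro conjI endo_inj_surj) auto
 define ta where "ta = the_inv_into {..n} sg"
 have ta: "ta (sg i) = i" if "i : {..n}" for i
  using that inj by (simp add: ta_def the_inv_into_f_f)

 have "(\<Sum>i\<in>{..n}. mk (ta i) *\<^sub>R nd i) = (\<Sum>i\<in>{..n}. mk (ta (sg i)) *\<^sub>R nd (sg i))"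
  by (rule sum.reindex_bij_betw[OF bij, symmetric])
 also have "\<dots> = (\<Sum>i\<in>{..n}. mk i *\<^sub>R ph (nd i))"
  by (rule sum.cong) (auto simp: ta phnd)
 also have "\<dots> = ph (\<Sum>i\<in>{..n}. mk i *\<^sub>R nd i)"
  by (simp add: linear_sum[OF lin] linear_scale[OF lin])
 also have "\<dots> = 0" by (simp add: mk_nd_relation linear_0[OF lin])
 finally have rel: "(\<Sum>i\<in>{..n}. mk (ta i) *\<^sub>R nd i) = 0" .
 have prp: "mk (ta i) = mk (ta 0) * mk i" if "i : {..n}" for i
  by (rule nd_relation_unique[OF rel that])
 \<comment> \<open>The factor of proportionality is 1, since both families of marks have the same
   positive sum.\<close>
 have "(\<Sum>i\<in>{..n}. mk (ta i)) = (\<Sum>i\<in>{..n}. mk i)"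
  unfolding sum.reindex_bij_betw[OF bij, of "%i. mk (ta i)", symmetric] by (rule sum.cong) (auto simp: ta)
 moreover have "(\<Sum>i\<in>{..n}. mk (ta i)) = mk (ta 0) * (\<Sum>i\<in>{..n}. mk i)"
  unfolding sum_distrib_left by (rule sum.cong[OF HOL.refl]) (rule prp)
 moreover have "(\<Sum>i\<in>{..n}. mk i) > 0" by (rule sum_pos) (auto simp: mk_pos)
 ultimately have "mk (ta 0) = 1" by simp
 then have mk_sg: "mk (sg i) = mk i" if "i : {..n}" for i
  using prp[OF sg[OF that]] unfolding ta[OF that] by simp
 have wall_sg: "wall (sg i) (vx (sg 0) + ph x) = wall i x" if i: "i : {..n}" for i x
 proof -
  have "wall (sg i) (vx (sg 0) + ph x) = wall (sg i) (vx (sg 0)) + nd (sg i) \<bullet> ph x"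
   by (simp add: wall_def inner_add_right)
  also have "wall (sg i) (vx (sg 0)) = (if i = 0 then 1 else 0)"
   using wall_vertex[OF sg[OF i] sg[of 0]] inj_on_eq_iff[OF inj i, of 0] mk_sg[of 0] by (simp add: mk_0)
  also have "nd (sg i) \<bullet> ph x = nd i \<bullet> x"
   unfolding phnd[OF i, symmetric] by (rule orthogonal_inner[OF ph])
  finally show ?thesis by (simp add: wall_def)
 qed
 have iff: "vx (sg 0) + ph x : A \<longleftrightarrow> x : A" for x
 proof -
  have "vx (sg 0) + ph x : A \<longleftrightarrow> (ALL i:sg ` {..n}. 0 <= wall i (vx (sg 0) + ph x))"
   using bij unfolding mem_alcove by (simp only: bij_betw_def)
  also have "\<dots> \<longleftrightarrow> (ALL i:{..n}. 0 <= wall i x)" using wall_sg by simp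
  finally show ?thesis unfolding mem_alcove .
 qed
 have "A \<subseteq> (%x. vx (sg 0) + ph x) ` A"
 proof
  fix y assume y: "y : A"
  obtain x where x: "y - vx (sg 0) = ph x" using orthogonal_transformation_surj[OF ph] by (metis surjD)
  then have "y = vx (sg 0) + ph x" by (simp add: algebra_simps)
  then show "y : (%x. vx (sg 0) + ph x) ` A" using y iff by blast
 qed
 then have "(%x. vx (sg 0) + ph x) ` A = A" using iff by blast
 moreover have "(%x. vx (sg 0) + ph x) : motions" using ph unfolding motions_def by blast
 ultimately have "(%x. vx (sg 0) + ph x) : Aut_region A" by (simp add: Aut_region_def)
 from that[OF bij phnd mk_sg this] show ?thesis .
qed

lemma linear_part_affine: "linear f ==> linear_part (%x. g + f x) = f"
 by (simp add: linear_part_def linear_0)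

lemma group_Aut_region: "group (comp_group (Aut_region X))" for X :: "'a set"
proof (rule group_comp_group)
 show "id : Aut_region X" using motions_id by (simp add: Aut_region_def)
next
 fix f g assume "f : Aut_region X" "g : Aut_region X"
 then have "f o g : motions" "f ` g ` X = X" by (simp_all add: Aut_region_def motions_comp)
 then show "f o g : Aut_region X" unfolding Aut_region_def by (simp only: mem_Collect_eq image_comp[symmetric])
next
 fix f assume f: "f : Aut_region X"
 then obtain g where g: "g : motions" "g o f = id" using motions_inverse[of f] by (auto simp: Aut_region_def)
 have "g ` f ` X = X" unfolding image_comp g(2) by simp
 then have "g : Aut_region X" using f g(1) by (simp add: Aut_region_def)
 then show "EX g:Aut_region X. g o f = id" using g(2) by blast
qed

lemma group_stabilizer:
 "group (comp_group {f::'a => 'a. orthogonal_transformation f & f ` X = X & f ` Y = Y})"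
proof (rule group_comp_group)
 let ?S = "{f::'a => 'a. orthogonal_transformation f & f ` X = X & f ` Y = Y}"
 show "id : ?S" by (simp add: id_def)
 fix f assume f: "f : ?S"
 define g where "g = inv_into UNIV f"
 have g: "orthogonal_transformation g" "g o f = id"
  using f orthogonal_transformation_inv[of f] orthogonal_transformation_inj[of f] by (simp_all add: g_def)
 have "g ` f ` X = X" "g ` f ` Y = Y" unfolding image_comp g(2) by simp_all
 then have "g : ?S" using f g(1) by simp
 then show "EX g:?S. g o f = id" using g(2) by blast
next
 fix f g :: "'a => 'a"
 assume "f : {f. orthogonal_transformation f & f ` X = X & f ` Y = Y}"
  "g : {f. orthogonal_transformation f & f ` X = X & f ` Y = Y}"
 then show "f o g : {f. orthogonal_transformation f & f ` X = X & f ` Y = Y}"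
  using orthogonal_transformation_compose[of f g] by (simp only: mem_Collect_eq image_comp[symmetric])
qed

lemma group_Aut_affine: "group (comp_group (AutAff))"
proof -
 have "AutAff = {f. orthogonal_transformation f & f ` \<Phi> = \<Phi> &
   f ` insert (- hr) (al ` I) = insert (- hr) (al ` I)}"
  by (simp add: Aut_affine_dynkin_def Aut_roots_def)
 then show ?thesis using group_stabilizer[of \<Phi> "insert (- hr) (al ` I)"] by simp
qed

lemma linear_part_Aut: "ze : Aut_region A ==> linear_part ze : AutAff"
 by (erule Aut_alcove_cases) (simp add: linear_part_affine orthogonal_transformation_linear)

lemma linear_part_comp:
 fixes f g :: "'a => 'a"
 assumes "f : motions" "g : motions" shows "linear_part (f o g) = linear_part f o linear_part g"
proof -
 obtain c p d q where *: "orthogonal_transformation p" "f = (%x. c + p x)"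
  "orthogonal_transformation q" "g = (%x. d + q x)"
  using assms by (auto simp: motions_def)
 note l = orthogonal_transformation_linear[OF *(1)] orthogonal_transformation_linear[OF *(3)]
 have "f o g = (%x. (c + p d) + (p o q) x)"
  using linear_add[OF l(1)] by (simp add: * fun_eq_iff)
 then show ?thesis using linear_part_affine[OF linear_compose[OF l(2,1)], of "c + p d"]
  by (simp add: * linear_part_affine l)
qed

lemma Aut_region_motions: "f : Aut_region X ==> f : motions"
 by (simp add: Aut_region_def)

text \<open>The translation part is \<open>vx (sg 0)\<close>, and \<open>sg 0\<close> is visible in
  the linear part as the image of the node 0.\<close>

lemma linear_part_eq_imp_eq:
 assumes "ze : Aut_region A" "xi : Aut_region A" "linear_part ze = linear_part xi"
 shows "ze = xi"
proof -
 obtain ph sg where 1: "orthogonal_transformation ph" "ze = (%x. vx (sg 0) + ph x)"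
  "bij_betw sg {..n} {..n}" "ph (nd 0) = nd (sg 0)"
  using assms(1) by (rule Aut_alcove_cases) simp
 obtain ps ta where 2: "orthogonal_transformation ps" "xi = (%x. vx (ta 0) + ps x)"
  "bij_betw ta {..n} {..n}" "ps (nd 0) = nd (ta 0)"
  using assms(2) by (rule Aut_alcove_cases) simp
 have eq: "ph = ps" using assms(3) 1 2 by (simp add: linear_part_affine orthogonal_transformation_linear)
 have "sg 0 : {..n}" "ta 0 : {..n}" using 1(3) 2(3) by (auto simp: bij_betw_def)
 then have "sg 0 = ta 0" using 1(4) 2(4) eq inj_onD[OF inj_nd, of "sg 0" "ta 0"] by simp
 then show ?thesis using 1 2 eq by simp
qed

theorem linear_part_iso:
 "linear_part : iso (comp_group (Aut_region A)) (comp_group (AutAff))"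
proof (rule isoI)
 show "linear_part : hom (comp_group (Aut_region A)) (comp_group (AutAff))"
  unfolding hom_def comp_group_simps
  by (intro CollectI conjI ballI Pi_I linear_part_Aut linear_part_comp Aut_region_motions)
 show "bij_betw linear_part (carrier (comp_group (Aut_region A))) (carrier (comp_group (AutAff)))"
  unfolding bij_betw_def comp_group_simps
 proof (intro conjI inj_onI equalityI subsetI)
  fix ph assume ph: "ph : AutAff"
  then obtain sg where sg: "(%x. vx (sg 0) + ph x) : Aut_region A" by (rule Aut_affine_cases)
  have "linear ph"
   using ph by (simp add: Aut_affine_dynkin_def Aut_roots_def orthogonal_transformation_linear)
  then show "ph : linear_part ` Aut_region A"
   by (intro image_eqI[OF _ sg]) (simp add: linear_part_affine)
 next
  fix ph assume "ph : linear_part ` Aut_region A"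
  then show "ph : AutAff" by (elim imageE) (simp add: linear_part_Aut)
 qed (rule linear_part_eq_imp_eq)
qed

lemma simple_roots_bij:
 assumes "orthogonal_transformation ph" "ph ` al ` I = al' ` I" "inj_on al' I"
 obtains ta where "bij_betw ta I I" "!!i. i : I ==> ph (al i) = al' (ta i)"
proof -
 define ta where "ta i = the_inv_into I al' (ph (al i))" for i
 have mem: "ph (al i) : al' ` I" if "i : I" for i using that assms(2) by blast
 have ta: "ta i : I" and eq: "ph (al i) = al' (ta i)" if i: "i : I" for i
  using the_inv_into_into[OF assms(3) mem[OF i] subset_refl] f_the_inv_into_f[OF assms(3) mem[OF i]]
  by (simp_all add: ta_def)
 have "inj_on ta I"
 proof (rule inj_onI)
  fix i j assume ij: "i : I" "j : I" "ta i = ta j"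
  then have "ph (al i) = ph (al j)" using eq by simp
  then have "al i = al j" using orthogonal_transformation_inj[OF assms(1)] by (simp add: inj_eq)
  then show "i = j" using inj_onD[OF inj_simple] ij by blast
 qed
 then have "bij_betw ta I I"
  unfolding bij_betw_def using ta by (intro conjI endo_inj_surj) auto
 from that[OF this eq] show ?thesis .
qed

end

text \<open>Two bases are allowed because \<open>v_elt\<close> moves the base; with a single base
  this says that diagram automorphisms fix the highest root.\<close>

lemma highest_root_transport:
 assumes "root_base \<Phi> n al" "root_base \<Phi> n al'" and ph: "ph : Aut_roots \<Phi>"
  and img: "ph ` al ` {1..n} = al' ` {1..n}"
 shows "ph (highest_root \<Phi> n al) = highest_root \<Phi> n al'"
proof -
 interpret r: root_base \<Phi> n al by (rule assms(1))
 interpret r': root_base \<Phi> n al' by (rule assms(2))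
 have orth: "orthogonal_transformation ph" and roots: "ph ` \<Phi> = \<Phi>" using ph by (auto simp: Aut_roots_def)
 obtain ta where ta: "bij_betw ta {1..n} {1..n}" "!!i. i : {1..n} ==> ph (al i) = al' (ta i)"
  using r.simple_roots_bij[OF orth img r'.inj_simple] by blast
 have cw: "r'.cw (ta i) = ph (r.cw i)" if i: "i : {1..n}" for i
 proof (rule r'.coweight_unique)
  fix j assume j: "j : {1..n}"
  then obtain k where k: "k : {1..n}" "j = ta k" using ta(1) by (auto simp: bij_betw_def)
  have "ta i = ta k \<longleftrightarrow> i = k" using ta(1) i k(1) by (auto simp: bij_betw_def inj_on_eq_iff)
  then show "ph (r.cw i) \<bullet> al' j = (if ta i = j then 1 else 0)"
   unfolding k(2) ta(2)[OF k(1), symmetric] orthogonal_inner[OF orth] r.coweight_simple[OF i k(1)] by simp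
 qed
 have "r'.hr = ph r.hr"
 proof (rule r'.highest_unique)
  show "ph r.hr : \<Phi>" using roots r.hr_root by blast
  fix b i assume b: "b : \<Phi>" and i: "i : {1..n}"
  obtain c where c: "c : \<Phi>" "b = ph c" using b roots by blast
  obtain k where k: "k : {1..n}" "i = ta k" using ta(1) i by (auto simp: bij_betw_def)
  show "r'.cw i \<bullet> b <= r'.cw i \<bullet> ph r.hr"
   unfolding k(2) cw[OF k(1)] c(2) orthogonal_inner[OF orth] by (rule r.coeff_le_hr[OF c(1) k(1)])
 qed
 then show ?thesis by simp
qed

context root_base begin

lemma base_axioms: "root_base \<Phi> n al" by unfold_locales

lemma Aut_dynkin_D:
 assumes "ph : AutDyn"
 shows "orthogonal_transformation ph" "ph ` \<Phi> = \<Phi>" "ph ` al ` I = al ` I" "ph : Aut_roots \<Phi>"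
 using assms by (auto simp: Aut_dynkin_def Aut_roots_def)

lemma Aut_dynkin_hr: "ph : AutDyn ==> ph hr = hr"
 using highest_root_transport[OF base_axioms base_axioms] Aut_dynkin_D by blast

lemma Aut_dynkin_affine: "ph : AutDyn ==> ph : AutAff"
 using Aut_dynkin_hr[of ph] Aut_dynkin_D[of ph] linear_neg[OF orthogonal_transformation_linear, of ph hr]
 by (simp add: Aut_affine_dynkin_def)

lemma Aut_dynkin_alcove:
 assumes "ph : AutDyn" shows "ph : Aut_region A"
proof -
 obtain sg where sg: "bij_betw sg {..n} {..n}" "ph (nd 0) = nd (sg 0)"
  "(%x. vx (sg 0) + ph x) : Aut_region A"
  using Aut_dynkin_affine[OF assms] by (rule Aut_affine_cases) simp
 have "nd (sg 0) = nd 0"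
  using sg(2) Aut_dynkin_hr[OF assms] linear_neg[OF orthogonal_transformation_linear[OF Aut_dynkin_D(1)[OF assms]]]
  by (simp add: nd_0)
 moreover have "sg 0 : {..n}" using sg(1) by (auto simp: bij_betw_def)
 ultimately have "sg 0 = 0" using inj_onD[OF inj_nd, of "sg 0" 0] by simp
 then show ?thesis using sg(3) by (simp add: vx_0)
qed

lemma linear_part_dynkin: "ph : AutDyn ==> linear_part ph = ph"
 using linear_part_affine[OF orthogonal_transformation_linear[OF Aut_dynkin_D(1)], of ph 0] by simp

text \<open>When the vertex 0 is fixed, so is the node 0, and the other nodes, which are the simple
  roots, are permuted.\<close>

lemma Aut_alcove_fixes_0:
 assumes "ze : Aut_region A" "ze 0 = 0" shows "ze : AutDyn"
proof -
 obtain ph sg where 1: "orthogonal_transformation ph" "ze = (%x. vx (sg 0) + ph x)"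
  "bij_betw sg {..n} {..n}" "!!i. i : {..n} ==> ph (nd i) = nd (sg i)" "ph : AutAff"
  using assms(1) by (rule Aut_alcove_cases) blast
 have "vx (sg 0) = vx 0" using assms(2) 1 by (simp add: linear_0 orthogonal_transformation_linear vx_0)
 moreover have "sg 0 : {..n}" using 1(3) by (auto simp: bij_betw_def)
 ultimately have sg0: "sg 0 = 0" using inj_onD[OF inj_vx, of "sg 0" 0] by simp
 have ze: "ze = ph" using 1(2) sg0 by (simp add: vx_0)
 have "ph (al i) : al ` I" if i: "i : I" for i
 proof -
  have i': "i : {..n}" "i ~= 0" using simple_index[OF i] by auto
  have "sg i ~= sg 0" using inj_on_eq_iff[of sg "{..n}" i 0] 1(3) i' by (simp add: bij_betw_def)
  moreover have "sg i : {..n}" using 1(3) i' by (auto simp: bij_betw_def)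
  ultimately have sgi: "sg i : I" using sg0 by (auto simp: ivl_iff)
  have "ph (al i) = al (sg i)" using 1(4)[OF i'(1)] nd_simple[OF i] nd_simple[OF sgi] by simp
  then show ?thesis using sgi by simp
 qed
 then have "ph ` al ` I = al ` I"
  by (intro endo_inj_surj inj_on_subset[OF orthogonal_transformation_inj[OF 1(1)]]) auto
 then show ?thesis using 1(5) ze by (simp add: Aut_dynkin_def Aut_affine_dynkin_def)
qed

section \<open>The fundamental group\<close>

abbreviation "P \<equiv> coweight_lattice n al"
abbreviation "\<Omega> \<equiv> fund_group \<Phi> n al"

lemma mem_coweight_lattice: "x : P \<longleftrightarrow> (ALL i:I. x \<bullet> al i : \<int>)"
proof
 assume "x : P"
 then obtain k :: "nat => int" where x: "x = (\<Sum>i\<in>I. of_int (k i) *\<^sub>R cw i)"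
  by (auto simp: coweight_lattice_def)
 show "ALL i:I. x \<bullet> al i : \<int>"
 proof
  fix j assume j: "j : I"
  show "x \<bullet> al j : \<int>" unfolding x inner_sum_left
   by (rule Ints_sum) (use coweight_simple j in auto)
 qed
next
 assume *: "ALL i:I. x \<bullet> al i : \<int>"
 have "(\<Sum>i\<in>I. of_int \<lfloor>x \<bullet> al i\<rfloor> *\<^sub>R cw i) = (\<Sum>i\<in>I. (x \<bullet> al i) *\<^sub>R cw i)"
  by (rule sum.cong[OF HOL.refl]) (use * in \<open>auto elim!: Ints_cases\<close>)
 then have "x = (\<Sum>i\<in>I. of_int \<lfloor>x \<bullet> al i\<rfloor> *\<^sub>R cw i)" using coweight_expansion[of x] by simp
 then show "x : P" unfolding coweight_lattice_def
  by (intro CollectI exI[of _ "%i. \<lfloor>x \<bullet> al i\<rfloor>"])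
qed

lemma coweight_in_lattice: "i : I ==> cw i : P"
 by (simp add: mem_coweight_lattice coweight_simple)

lemma lattice_root_Ints: "x : P ==> b : \<Phi> ==> x \<bullet> b : \<int>"
 unfolding inner_commute[of x b] inner_expansion[of b x]
 by (intro Ints_sum Ints_mult root_coeff_Ints) (auto simp: mem_coweight_lattice inner_commute)

lemma lattice_add: "x : P ==> y : P ==> x + y : P"
 and lattice_diff: "x : P ==> y : P ==> x - y : P"
 and lattice_0: "0 : P"
 by (simp_all add: mem_coweight_lattice inner_add_left inner_diff_left)

lemma vx_in_lattice: "k : {..n} ==> mk k = 1 ==> vx k : P"
 by (erule node_cases) (simp_all add: vx_0 lattice_0 vx_simple coweight_in_lattice)

text \<open>The image of 0 is a vertex of mark 1, thus 0 or a fundamental coweight; so the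
  translation part lies in the coweight lattice.\<close>

lemma mem_fund_group: "ze : \<Omega> \<longleftrightarrow> ze : Aut_region A & linear_part ze : W"
proof
 assume "ze : \<Omega>"
 then obtain g w where *: "w : W" "ze = (%x. g + w x)" "ze ` A = A"
  by (auto simp: fund_group_def extended_weyl_group_def)
 have w: "orthogonal_transformation w" by (rule weyl_group_orthogonal[OF *(1)])
 then have "ze : motions" using *(2) unfolding motions_def by blast
 then show "ze : Aut_region A & linear_part ze : W"
  using * w by (simp add: Aut_region_def linear_part_affine orthogonal_transformation_linear)
next
 assume *: "ze : Aut_region A & linear_part ze : W"
 then obtain ph sg where 1: "orthogonal_transformation ph" "ze = (%x. vx (sg 0) + ph x)"
  "bij_betw sg {..n} {..n}" "mk (sg 0) = mk 0"
  by (elim conjE Aut_alcove_cases) simp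
 have "sg 0 : {..n}" using 1(3) by (auto simp: bij_betw_def)
 then have "vx (sg 0) : P" using vx_in_lattice 1(4) by (simp add: mk_0)
 moreover have "ph : W"
  using * 1 by (simp add: linear_part_affine orthogonal_transformation_linear)
 ultimately have "ze : extended_weyl_group \<Phi> n al"
  using 1(2) unfolding extended_weyl_group_def by blast
 then show "ze : \<Omega>" using * by (simp add: fund_group_def Aut_region_def)
qed

lemma Aut_roots_conj_weyl:
 assumes "ph : Aut_roots \<Phi>" "ph o ps = id" "w : W"
 shows "ph o w o ps : W"
 using assms(3)
proof (induction rule: weyl_group_induct)
 case id
 show ?case unfolding comp_id assms(2) by (rule id_in_weyl_group)
next
 case (comp v w)
 have orth: "orthogonal_transformation ph" using assms(1) by (simp add: Aut_roots_def)
 have psph: "ps (ph x) = x" for x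
 proof -
  have "ph (ps (ph x)) = ph x" using fun_cong[OF assms(2), of "ph x"] by simp
  then show ?thesis using orthogonal_transformation_inj[OF orth] by (simp add: inj_eq)
 qed
 have "ph o (v o w) o ps = (ph o v o ps) o (ph o w o ps)"
  by (simp add: fun_eq_iff psph)
 then show ?case using weyl_group_comp[OF comp] by metis
next
 case (reflection a)
 have orth: "orthogonal_transformation ph" and "ph a : \<Phi>"
  using assms(1) reflection by (auto simp: Aut_roots_def)
 have "ph (ps x) = x" for x using fun_cong[OF assms(2), of x] by simp
 then have "ph o reflection a o ps = reflection (ph a)"
  by (simp add: fun_eq_iff reflection_conj[OF orth])
 then show ?case using weyl_group_reflection[OF \<open>ph a : \<Phi>\<close>] by metis
qed

lemma Aut_region_inverse:
 fixes X :: "'a set"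
 assumes "ze : Aut_region X"
 obtains xi where "xi : Aut_region X" "xi o ze = id" "ze o xi = id" "inv\<^bsub>comp_group (Aut_region X)\<^esub> ze = xi"
proof -
 have c: "ze : carrier (comp_group (Aut_region X))" using assms by simp
 from group.inv_closed[OF group_Aut_region c] group.l_inv[OF group_Aut_region c]
  group.r_inv[OF group_Aut_region c]
 show ?thesis unfolding comp_group_simps by (rule that) (rule HOL.refl)
qed

lemma linear_part_id: "linear_part (id :: 'a => 'a) = id"
 by (simp add: linear_part_def fun_eq_iff)

lemma weyl_inverse_unique:
 assumes "w : W" "v o w = id" shows "v : W"
proof -
 obtain u where u: "u : W" "w o u = id" using weyl_group_inverse[OF assms(1)] by blast
 have "v x = u x" for x
  using fun_cong[OF assms(2), of "u x"] fun_cong[OF u(2), of x] by simp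
 then have "v = u" by (simp add: fun_eq_iff)
 then show ?thesis using u(1) by simp
qed

lemma fund_group_normal: "\<Omega> \<lhd> comp_group (Aut_region A)"
proof -
 interpret G: group "comp_group (Aut_region A)" by (rule group_Aut_region)
 have inv_lin: "linear_part xi o linear_part ze = id" if "xi : Aut_region A" "ze : Aut_region A" "xi o ze = id" for xi ze
  using linear_part_comp[of xi ze] that Aut_region_motions linear_part_id by metis
 have sub: "subgroup \<Omega> (comp_group (Aut_region A))"
 proof (rule G.subgroupI)
  show "\<Omega> \<subseteq> carrier (comp_group (Aut_region A))" using mem_fund_group by auto
  have "id : \<Omega>" using G.one_closed id_in_weyl_group by (simp add: mem_fund_group linear_part_id)
  then show "\<Omega> ~= {}" by blast
  fix ze assume ze: "ze : \<Omega>"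
  then have zeA: "ze : Aut_region A" using mem_fund_group by blast
  obtain xi where xi: "xi : Aut_region A" "xi o ze = id" "inv\<^bsub>comp_group (Aut_region A)\<^esub> ze = xi"
   using Aut_region_inverse[OF zeA] by blast
  have "linear_part xi : W"
   using weyl_inverse_unique[OF _ inv_lin[OF xi(1) zeA xi(2)]] ze mem_fund_group by blast
  then show "inv\<^bsub>comp_group (Aut_region A)\<^esub> ze : \<Omega>" using xi by (simp add: mem_fund_group)
 next
  fix ze xi assume "ze : \<Omega>" "xi : \<Omega>"
  then show "ze \<otimes>\<^bsub>comp_group (Aut_region A)\<^esub> xi : \<Omega>"
   using G.m_closed[of ze xi] linear_part_comp[of ze xi] Aut_region_motions weyl_group_comp
   unfolding mem_fund_group comp_group_simps by metis
 qed
 have conj: "ze o \<omega> o xi : \<Omega>"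
  if that: "ze : Aut_region A" "\<omega> : \<Omega>" "xi : Aut_region A" "ze o xi = id" for ze \<omega> xi
 proof -
  have \<omega>: "\<omega> : Aut_region A" "linear_part \<omega> : W" using that(2) mem_fund_group by auto
  have 1: "ze o \<omega> : Aut_region A" using G.m_closed[of ze \<omega>] that(1) \<omega>(1) by simp
  have 2: "ze o \<omega> o xi : Aut_region A" using G.m_closed[of "ze o \<omega>" xi] that(3) 1 by simp
  have "linear_part (ze o \<omega> o xi) = linear_part ze o linear_part \<omega> o linear_part xi"
   using linear_part_comp[OF Aut_region_motions[OF 1] Aut_region_motions[OF that(3)]]
    linear_part_comp[OF Aut_region_motions[OF that(1)] Aut_region_motions[OF \<omega>(1)]] by simp
  moreover have "linear_part ze : Aut_roots \<Phi>"
   using linear_part_Aut[OF that(1)] by (simp add: Aut_affine_dynkin_def)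
  ultimately have "linear_part (ze o \<omega> o xi) : W"
   using Aut_roots_conj_weyl[OF _ inv_lin[OF that(1,3,4)] \<omega>(2)] by simp
  then show ?thesis using 2 by (simp add: mem_fund_group)
 qed
 show ?thesis
  unfolding G.normal_inv_iff
 proof (intro conjI ballI sub)
  fix ze \<omega> assume "ze : carrier (comp_group (Aut_region A))" and \<omega>: "\<omega> : \<Omega>"
  then have ze: "ze : Aut_region A" by simp
  obtain xi where xi: "xi : Aut_region A" "ze o xi = id" "inv\<^bsub>comp_group (Aut_region A)\<^esub> ze = xi"
   using Aut_region_inverse[OF ze] by blast
  show "ze \<otimes>\<^bsub>comp_group (Aut_region A)\<^esub> \<omega> \<otimes>\<^bsub>comp_group (Aut_region A)\<^esub> inv\<^bsub>comp_group (Aut_region A)\<^esub> ze : \<Omega>"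
   unfolding comp_group_simps xi(3) by (rule conj[OF ze \<omega> xi(1,2)])
 qed
qed

lemma subgroup_Aut_dynkin: "subgroup (AutDyn) (comp_group (Aut_region A))"
proof -
 interpret G: group "comp_group (Aut_region A)" by (rule group_Aut_region)
 have fix0: "ph 0 = 0" if "ph : AutDyn" for ph
  using linear_0[OF orthogonal_transformation_linear[OF Aut_dynkin_D(1)[OF that]]] .
 show ?thesis
 proof (rule G.subgroupI)
  show "AutDyn \<subseteq> carrier (comp_group (Aut_region A))" using Aut_dynkin_alcove by auto
  have "id : AutDyn" using Aut_alcove_fixes_0[of id] G.one_closed by simp
  then show "AutDyn ~= {}" by blast
  fix ph assume ph: "ph : AutDyn"
  obtain xi where xi: "xi : Aut_region A" "xi o ph = id" "inv\<^bsub>comp_group (Aut_region A)\<^esub> ph = xi"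
   using Aut_region_inverse[OF Aut_dynkin_alcove[OF ph]] by blast
  have "xi 0 = 0" using fun_cong[OF xi(2), of 0] fix0[OF ph] by simp
  then show "inv\<^bsub>comp_group (Aut_region A)\<^esub> ph : AutDyn"
   using Aut_alcove_fixes_0[OF xi(1)] xi(3) by simp
 next
  fix ph ps assume *: "ph : AutDyn" "ps : AutDyn"
  have "ph o ps : Aut_region A" using G.m_closed[of ph ps] * Aut_dynkin_alcove by simp
  then show "ph \<otimes>\<^bsub>comp_group (Aut_region A)\<^esub> ps : AutDyn"
   unfolding comp_group_simps by (rule Aut_alcove_fixes_0) (simp add: fix0[OF *(1)] fix0[OF *(2)])
 qed
qed

text \<open>Such an element is a Weyl group element permuting the simple roots.\<close>

lemma fund_group_fixes_0:
 assumes "ze : \<Omega>" "ze 0 = 0" shows "ze = id"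
proof -
 have "ze : AutDyn" using assms Aut_alcove_fixes_0 mem_fund_group by blast
 then show ?thesis
  using weyl_group_fixes_base[of ze] assms mem_fund_group linear_part_dynkin Aut_dynkin_D(3) by metis
qed

text \<open>If \<open>\<alpha>\<^sub>j\<close> is minuscule, then \<open>\<Pi>\<close> with \<open>\<alpha>\<^sub>j\<close> replaced by \<open>- \<alpha>\<^sub>0\<close> is again a base.\<close>

definition swapped :: "nat => nat => 'a" where "swapped j = al(j := - hr)"

lemma swapped_image:
 assumes "j : I" shows "swapped j ` I = insert (- hr) (al ` (I - {j}))"
 using assms by (auto simp: swapped_def)

text \<open>Coordinates for the new base, obtained by solving the expansion of the highest root for
  \<open>al j\<close>; this is possible over the integers since its coefficient is 1.\<close>

lemma swapped_expansion:
 assumes j: "j : I" and mkj: "mk j = 1"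
 shows "v = (\<Sum>i\<in>I. (if i = j then - (cw j \<bullet> v) else cw i \<bullet> v - (cw j \<bullet> v) * mk i) *\<^sub>R swapped j i)"
proof (rule eq_by_coweights)
 fix k assume k: "k : I"
 let ?d = "%i. if i = j then - (cw j \<bullet> v) else cw i \<bullet> v - (cw j \<bullet> v) * mk i"
 have "cw k \<bullet> (\<Sum>i\<in>I. ?d i *\<^sub>R swapped j i) = (\<Sum>i\<in>I. ?d i * (cw k \<bullet> swapped j i))"
  by (simp add: inner_sum_right)
 also have "\<dots> = ?d j * (cw k \<bullet> swapped j j) + (\<Sum>i\<in>I - {j}. ?d i * (cw k \<bullet> swapped j i))"
  by (rule sum.remove) (use j in auto)
 also have "(\<Sum>i\<in>I - {j}. ?d i * (cw k \<bullet> swapped j i)) = (\<Sum>i\<in>I - {j}. if i = k then ?d k else 0)"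
  by (rule sum.cong) (auto simp: swapped_def coweight_simple k)
 also have "\<dots> = (if k = j then 0 else ?d k)"
  using k by simp
 also have "?d j * (cw k \<bullet> swapped j j) = (cw j \<bullet> v) * mk k"
  by (simp add: swapped_def mk_simple[OF k])
 finally show "cw k \<bullet> v = cw k \<bullet> (\<Sum>i\<in>I. ?d i *\<^sub>R swapped j i)"
  using mkj by auto
qed

lemma minuscule_coeff:
 assumes "j : I" "mk j = 1" "b : \<Phi>"
 shows "cw j \<bullet> b = - 1 | cw j \<bullet> b = 0 | cw j \<bullet> b = 1"
proof -
 obtain z where z: "cw j \<bullet> b = of_int z" using root_coeff_Ints[OF assms(3,1)] by (auto elim: Ints_cases)
 have "cw j \<bullet> b <= 1" "- 1 <= cw j \<bullet> b"
  using coeff_le_hr[OF assms(3,1)] coeff_ge_minus_hr[OF assms(3,1)] assms(2) mk_simple[OF assms(1)] by simp_all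
 then have "z <= 1" "- 1 <= z" using z by linarith+
 then have "z = -1 | z = 0 | z = 1" by linarith
 then show ?thesis using z by auto
qed

lemma pos_if_coeff_pos:
 assumes "b : \<Phi>" "i : I" "cw i \<bullet> b > 0" shows "pos b"
 using root_sign[OF assms(1)] assms(2,3) unfolding pos_def by force

text \<open>The coefficient at \<open>j\<close> of a root is -1, 0 or 1. In the outer cases,
  comparing the root with the highest root or its negative gives all new coordinates one sign; in
  the middle case they are the old ones.\<close>

lemma root_base_swapped:
 assumes j: "j : I" and mkj: "mk j = 1"
 shows "root_base \<Phi> n (swapped j)"
proof -
 have inj: "inj_on (swapped j) I"
 proof (rule inj_onI)
  fix i k assume "i : I" "k : I" "swapped j i = swapped j k"
  then show "i = k"
   using hr_neq_minus_simple hr_neq_minus_simple[THEN not_sym] inj_onD[OF inj_simple, of i k]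
   by (auto simp: swapped_def split: if_splits)
 qed
 have span: "span (swapped j ` I) = UNIV"
 proof -
  have "v : span (swapped j ` I)" for v
   by (subst swapped_expansion[OF j mkj, of v]) (intro span_sum span_scale span_base imageI)
  then show ?thesis by blast
 qed
 have "dim (UNIV :: 'a set) = n"
  using dim_span[of "al ` I"] dim_eq_card_independent[OF independent_simple] card_image[OF inj_simple]
  unfolding span_simple by simp
 then have indep: "independent (swapped j ` I)"
  using card_image[OF inj] by (intro card_le_dim_spanning[of _ UNIV]) (simp_all add: span)
 have roots: "swapped j ` I \<subseteq> \<Phi>"
  using simple_root hr_root minus_root by (auto simp: swapped_def)
 have "EX c :: nat => nat. b = (\<Sum>i\<in>I. real (c i) *\<^sub>R swapped j i) |
   b = - (\<Sum>i\<in>I. real (c i) *\<^sub>R swapped j i)" if b: "b : \<Phi>" for b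
 proof -
  define d where "d i = (if i = j then - (cw j \<bullet> b) else cw i \<bullet> b - (cw j \<bullet> b) * mk i)" for i
  have bd: "b = (\<Sum>i\<in>I. d i *\<^sub>R swapped j i)"
   unfolding d_def by (rule swapped_expansion[OF j mkj])
  have int: "d i : \<int>" if "i : I" for i
   using root_coeff_Ints[OF b that] root_coeff_Ints[OF b j] root_coeff_Ints[OF hr_root that]
   by (auto simp: d_def mk_simple[OF that])
  have sign: "(ALL i:I. 0 <= d i) | (ALL i:I. d i <= 0)"
  proof -
   consider "cw j \<bullet> b = - 1" | "cw j \<bullet> b = 0" | "cw j \<bullet> b = 1"
    using minuscule_coeff[OF j mkj b] by blast
   then show ?thesis
   proof cases
    case 1
    have "0 <= d i" if i: "i : I" for i
     using coeff_ge_minus_hr[OF b i] mk_simple[OF i] 1 by (auto simp: d_def)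
    then show ?thesis by blast
   next
    case 2
    then show ?thesis using root_sign[OF b] by (auto simp: d_def pos_def)
   next
    case 3
    have "d i <= 0" if i: "i : I" for i
     using coeff_le_hr[OF b i] mk_simple[OF i] 3 by (auto simp: d_def)
    then show ?thesis by blast
   qed
  qed
  then show ?thesis
  proof
   assume nn: "ALL i:I. 0 <= d i"
   have "(\<Sum>i\<in>I. real (nat \<lfloor>d i\<rfloor>) *\<^sub>R swapped j i) = b"
    unfolding bd by (rule sum.cong[OF HOL.refl]) (use int nn in \<open>auto elim!: Ints_cases\<close>)
   then show ?thesis by (intro exI[of _ "%i. nat \<lfloor>d i\<rfloor>"]) simp
  next
   assume np: "ALL i:I. d i <= 0"
   have "(\<Sum>i\<in>I. real (nat \<lfloor>- d i\<rfloor>) *\<^sub>R swapped j i) = (\<Sum>i\<in>I. (- d i) *\<^sub>R swapped j i)"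
   proof (rule sum.cong[OF HOL.refl])
    fix i assume i: "i : I"
    have "real (nat \<lfloor>- d i\<rfloor>) = - d i" using int[OF i] np i by (auto elim!: Ints_cases)
    then show "real (nat \<lfloor>- d i\<rfloor>) *\<^sub>R swapped j i = (- d i) *\<^sub>R swapped j i" by simp
   qed
   also have "\<dots> = - b" using bd by (simp add: sum_negf)
   finally show ?thesis by (intro exI[of _ "%i. nat \<lfloor>- d i\<rfloor>"]) simp
  qed
 qed
 then have "simple_roots \<Phi> n (swapped j)"
  unfolding simple_roots_def using inj indep roots by blast
 then show ?thesis using crystallographic reduced irreducible by (simp add: root_base_def)
qed

text \<open>Existence is transitivity on bases, uniqueness is that only the identity of the Weyl
  group preserves a base.\<close>

lemma v_elt_props:
 assumes j: "j : I" and mkj: "mk j = 1"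
 shows "v_elt \<Phi> n al j : W"
  "v_elt \<Phi> n al j ` al ` I = swapped j ` I"
proof -
 obtain w where w: "w : W" "w ` al ` I = swapped j ` I"
  using weyl_group_transitive_on_bases[OF base_axioms root_base_swapped[OF j mkj]] by blast
 have "v_elt \<Phi> n al j = w"
  unfolding v_elt_def swapped_image[OF j, symmetric]
 proof (rule the_equality)
  show "w : W & w ` al ` I = swapped j ` I" using w by blast
  fix v assume v: "v : W & v ` al ` I = swapped j ` I"
  obtain u where u: "u : W" "u o w = id" "w o u = id" using weyl_group_inverse[OF w(1)] by blast
  have "(u o v) ` al ` I = u ` v ` al ` I" by (simp only: image_comp comp_assoc)
  also have "\<dots> = u ` w ` al ` I" using v w(2) by simp
  also have "\<dots> = al ` I" unfolding image_comp comp_assoc[symmetric] u(2) by simp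
  finally have "u o v = id" using weyl_group_fixes_base[OF weyl_group_comp[OF u(1)]] v by blast
  then have "u (v x) = x" for x by (simp add: fun_eq_iff)
  then have "w (u (v x)) = w x" for x by simp
  then show "v = w" using u(3) by (simp add: fun_eq_iff)
 qed
 then show "v_elt \<Phi> n al j : W" "v_elt \<Phi> n al j ` al ` I = swapped j ` I"
  using w by simp_all
qed

text \<open>Shows that both bases have the same affine nodes, only with \<open>j\<close> in the role
  of 0. In coordinates it is a comparison for each value of the coefficient at
  \<open>j\<close>.\<close>

lemma highest_root_swapped:
 assumes j: "j : I" and mkj: "mk j = 1"
 shows "highest_root \<Phi> n (swapped j) = - al j"
proof -
 note s = root_base_swapped[OF j mkj]
 have cws: "fund_coweight n (swapped j) i \<bullet> v = (if i = j then - (cw j \<bullet> v) else cw i \<bullet> v - (cw j \<bullet> v) * mk i)"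
  if i: "i : I" for i v
  using root_base.coweight_sum[OF s i, of "%i. if i = j then - (cw j \<bullet> v) else cw i \<bullet> v - (cw j \<bullet> v) * mk i"]
  unfolding swapped_expansion[OF j mkj, of v, symmetric] .
 show ?thesis
 proof (rule root_base.highest_unique[OF s])
  show "- al j : \<Phi>" using minus_root simple_root j by blast
  fix b i assume b: "b : \<Phi>" and i: "i : I"
  have jal: "cw i \<bullet> - al j = (if i = j then - 1 else 0)" "cw j \<bullet> - al j = - 1"
   using coweight_simple[OF i j] coweight_simple[OF j j] by auto
  have le: "cw i \<bullet> b <= mk i" "- mk i <= cw i \<bullet> b" "mk i >= 1"
   using coeff_le_hr[OF b i] coeff_ge_minus_hr[OF b i] mk_simple[OF i] hr_coeff_ge_1[OF i] by simp_all
  have neg: "cw i \<bullet> b <= 0" if "cw j \<bullet> b = - 1"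
  proof -
   have "pos (- b)" using pos_if_coeff_pos[OF minus_root[OF b] j] that by simp
   then show ?thesis using i by (force simp: pos_def)
  qed
  show "fund_coweight n (swapped j) i \<bullet> b <= fund_coweight n (swapped j) i \<bullet> - al j"
   unfolding cws[OF i] jal using minuscule_coeff[OF j mkj b] le neg by (auto split: if_splits)
 qed
qed

text \<open>The element \<open>v_elt\<close> permutes the affine nodes and takes the node 0 to
  \<open>j\<close>; the alcove automorphism with this linear part therefore translates by
  \<open>vx j\<close>, which is the coweight since the mark is 1.\<close>

lemma omega_props:
 assumes j: "j : I" and mkj: "mk j = 1"
 shows "omega j : \<Omega>" "omega j 0 = cw j"
proof -
 define v where "v = v_elt \<Phi> n al j"
 have v: "v : W" "v ` al ` I = swapped j ` I"
  using v_elt_props[OF j mkj] by (simp_all add: v_def)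
 have orth: "orthogonal_transformation v" by (rule weyl_group_orthogonal[OF v(1)])
 note lin = orthogonal_transformation_linear[OF orth]
 have vr: "v : Aut_roots \<Phi>" using orth weyl_group_root_image[OF v(1)] by (simp add: Aut_roots_def)
 have "v hr = - al j"
  using highest_root_transport[OF base_axioms root_base_swapped[OF j mkj] vr v(2)] highest_root_swapped[OF j mkj] by simp
 then have vhr: "v (- hr) = al j" by (simp add: linear_neg[OF lin])
 have "v ` insert (- hr) (al ` I) = insert (al j) (insert (- hr) (al ` (I - {j})))"
  unfolding image_insert vhr v(2) swapped_image[OF j] ..
 also have "\<dots> = insert (- hr) (al ` I)" using j by blast
 finally have "v : AutAff" using vr by (simp add: Aut_affine_dynkin_def)
 then obtain sg where sg: "bij_betw sg {..n} {..n}" "v (nd 0) = nd (sg 0)"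
  "(%x. vx (sg 0) + v x) : Aut_region A"
  by (rule Aut_affine_cases) simp
 have "nd (sg 0) = nd j" using sg(2) vhr nd_simple[OF j] by (simp add: nd_0)
 moreover have "sg 0 : {..n}" using sg(1) by (auto simp: bij_betw_def)
 ultimately have "sg 0 = j" using inj_onD[OF inj_nd, of "sg 0" j] simple_index[OF j] by simp
 then have vx: "vx (sg 0) = cw j" using vx_simple[OF j] mkj by simp
 have om: "omega j = (%x. vx (sg 0) + v x)" by (simp add: omega_elt_def v_def vx)
 show "omega j : \<Omega>"
  unfolding om mem_fund_group using sg(3) v(1) linear_part_affine[OF lin] by simp
 show "omega j 0 = cw j" unfolding om by (simp add: linear_0[OF lin] vx)
qed

lemma Aut_alcove_0:
 assumes "ze : Aut_region A"
 shows "ze 0 = 0 | (EX j:I. mk j = 1 & ze 0 = cw j)"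
proof -
 obtain ph sg where 1: "orthogonal_transformation ph" "ze = (%x. vx (sg 0) + ph x)"
  "bij_betw sg {..n} {..n}" "mk (sg 0) = mk 0"
  using assms by (rule Aut_alcove_cases) simp
 have ze0: "ze 0 = vx (sg 0)" using 1(2) linear_0[OF orthogonal_transformation_linear[OF 1(1)]] by simp
 have "sg 0 : {..n}" using 1(3) by (auto simp: bij_betw_def)
 then show ?thesis
  using 1(4) by (cases rule: node_cases) (auto simp: ze0 vx_0 mk_0 vx_simple)
qed

theorem Aut_alcove_semidirect:
 "internal_semidirect (comp_group (Aut_region A)) \<Omega> (AutDyn)"
 unfolding internal_semidirect_def
proof (intro conjI fund_group_normal subgroup_Aut_dynkin)
 let ?G = "comp_group (Aut_region A)"
 interpret G: group ?G by (rule group_Aut_region)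
 interpret N: normal \<Omega> ?G by (rule fund_group_normal)
 have "ze = id" if "ze : \<Omega>" "ze : AutDyn" for ze
  using fund_group_fixes_0[OF that(1)] linear_0[OF orthogonal_transformation_linear[OF Aut_dynkin_D(1)[OF that(2)]]] by simp
 then show "\<Omega> \<inter> AutDyn = {\<one>\<^bsub>?G\<^esub>}"
  using N.one_closed subgroup.one_closed[OF subgroup_Aut_dynkin] by auto
 have "EX \<omega>:\<Omega>. EX ph:AutDyn. ze = \<omega> o ph" if ze: "ze : Aut_region A" for ze
 proof -
  have "EX \<omega>:\<Omega>. \<omega> 0 = ze 0"
  proof -
   consider "ze 0 = 0" | j where "j : I" "mk j = 1" "ze 0 = cw j"
    using Aut_alcove_0[OF ze] by blast
   then show ?thesis
   proof cases
    case 1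
    then show ?thesis using N.one_closed by (intro bexI[of _ id]) auto
   next
    case 2
    then show ?thesis using omega_props[OF 2(1,2)] by (intro bexI[of _ "omega j"]) auto
   qed
  qed
  then obtain \<omega> where \<omega>: "\<omega> : \<Omega>" "\<omega> 0 = ze 0" by blast
  then have \<omega>A: "\<omega> : Aut_region A" using mem_fund_group by blast
  obtain xi where xi: "xi : Aut_region A" "xi o \<omega> = id" "\<omega> o xi = id" using Aut_region_inverse[OF \<omega>A] by blast
  have "xi o ze : Aut_region A" using G.m_closed[of xi ze] xi(1) ze by simp
  moreover have "(xi o ze) 0 = 0" using fun_cong[OF xi(2), of 0] \<omega>(2) by simp
  ultimately have "xi o ze : AutDyn" by (rule Aut_alcove_fixes_0)
  moreover have "ze = \<omega> o (xi o ze)" using xi(3) by (simp add: comp_assoc[symmetric])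
  ultimately show ?thesis using \<omega>(1) by blast
 qed
 moreover have "\<omega> o ph : Aut_region A" if "\<omega> : \<Omega>" "ph : AutDyn" for \<omega> ph
  using G.m_closed[of \<omega> ph] that mem_fund_group Aut_dynkin_alcove by simp
 ultimately show "\<Omega> <#>\<^bsub>?G\<^esub> AutDyn = carrier ?G"
  unfolding set_mult_def comp_group_simps by blast
qed

end

section \<open>The coroot lattice\<close>

context root_base begin

text \<open>The coroot lattice. Roots are closed under negation, so sums of lists of coroots
  suffice, and the length of the list is the induction measure in
  \<open>Qv_large_inner\<close>.\<close>

definition Qv :: "'a set" where
 "Qv = {x. EX as. set as \<subseteq> \<Phi> & x = sum_list (map coroot as)}"

lemma Qv_0: "0 : Qv"
 unfolding Qv_def by (rule CollectI, rule exI[of _ "[]"]) simp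

lemma Qv_coroot: "a : \<Phi> ==> coroot a : Qv"
 unfolding Qv_def by (rule CollectI, rule exI[of _ "[a]"]) simp

lemma Qv_add: "x : Qv ==> y : Qv ==> x + y : Qv"
proof -
 assume "x : Qv" "y : Qv"
 then obtain as bs where "set as \<subseteq> \<Phi>" "x = sum_list (map coroot as)"
  "set bs \<subseteq> \<Phi>" "y = sum_list (map coroot bs)" unfolding Qv_def by blast
 then show ?thesis unfolding Qv_def by (intro CollectI exI[of _ "as @ bs"]) auto
qed

lemma Qv_minus: "x : Qv ==> - x : Qv"
proof -
 assume "x : Qv"
 then obtain as where as: "set as \<subseteq> \<Phi>" "x = sum_list (map coroot as)" unfolding Qv_def by blast
 have "- sum_list (map coroot xs) = sum_list (map coroot (map uminus xs))" for xs
  by (induction xs) auto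
 then show ?thesis unfolding Qv_def using as minus_root
  by (intro CollectI exI[of _ "map uminus as"]) auto
qed

lemma Qv_diff: "x : Qv ==> y : Qv ==> x - y : Qv"
 using Qv_add[OF _ Qv_minus, of x y] by simp

lemma Qv_nat_scale: "x : Qv ==> real m *\<^sub>R x : Qv"
 by (induction m) (simp_all add: Qv_0 Qv_add scaleR_left_distrib)

lemma Qv_Ints_scale: "x : Qv ==> c : \<int> ==> c *\<^sub>R x : Qv"
proof -
 assume x: "x : Qv" and "c : \<int>"
 then obtain z where z: "c = of_int z" by (auto elim: Ints_cases)
 show ?thesis
 proof (cases "z >= 0")
  case True
  then show ?thesis using Qv_nat_scale[OF x, of "nat z"] z by simp
 next
  case False
  then show ?thesis using Qv_minus[OF Qv_nat_scale[OF x, of "nat (- z)"]] z by simp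
 qed
qed

lemma Qv_sum: "(!!i. i : S ==> f i : Qv) ==> sum f S : Qv"
 by (induction S rule: infinite_finite_induct) (auto simp: Qv_0 Qv_add)

lemma coroot_lattice: "a : \<Phi> ==> coroot a : P"
 using cartan_Ints simple_root by (simp add: mem_coweight_lattice inner_commute[of "coroot a"])

lemma Qv_lattice: "x : Qv ==> x : P"
proof -
 have "sum_list (map coroot as) : P" if "set as \<subseteq> \<Phi>" for as
  using that by (induction as) (auto simp: lattice_0 lattice_add coroot_lattice)
 then show "x : Qv ==> x : P" unfolding Qv_def by blast
qed

text \<open>A reflection moves an element of the coweight lattice by an integral multiple of a
  coroot, so the Weyl group acts trivially on the quotient.\<close>

lemma weyl_group_mod_Qv:
 assumes "w : W" "x : P" shows "w x : P & w x - x : Qv"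
 using assms
proof (induction arbitrary: x rule: weyl_group_induct)
 case id
 then show ?case by (simp add: Qv_0)
next
 case (comp v w)
 have w: "w x : P" "w x - x : Qv" using comp by auto
 have v: "v (w x) : P" "v (w x) - w x : Qv" using comp(1)[OF w(1)] by auto
 show ?case using v(1) Qv_add[OF v(2) w(2)] by simp
next
 case (reflection a)
 have "- (x \<bullet> a) : \<int>" using lattice_root_Ints[OF reflection(2,1)] by simp
 then have "(- (x \<bullet> a)) *\<^sub>R coroot a : Qv" by (rule Qv_Ints_scale[OF Qv_coroot[OF reflection(1)]])
 moreover have "reflection a x - x = (- (x \<bullet> a)) *\<^sub>R coroot a" by (simp add: reflection_coroot')
 ultimately have q: "reflection a x - x : Qv" by simp
 show ?case using q lattice_add[OF Qv_lattice[OF q] reflection(2)] by simp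
qed

lemma coroot_reflection: "coroot (reflection a b) = coroot b - (coroot b \<bullet> a) *\<^sub>R coroot a"
 using coroot_orthogonal[OF orthogonal_reflection, of a b] by (simp add: reflection_coroot')

text \<open>The counterpart of \<open>root_diff\<close> for coroots: a Cartan integer -1 makes the
  sum the coroot of a reflected root.\<close>

lemma coroot_add:
 assumes a: "a : \<Phi>" and b: "b : \<Phi>" and "a \<bullet> b < 0" "a ~= - b"
 shows "EX c:\<Phi>. coroot a + coroot b = coroot c"
proof -
 have "a \<bullet> coroot (- b) = 1 | (- b) \<bullet> coroot a = 1"
  by (rule cartan_one(1)[OF a minus_root[OF b]]) (use assms in auto)
 then have "coroot b \<bullet> a = - 1 | coroot a \<bullet> b = - 1" by (auto simp: inner_commute)
 then show ?thesis
 proof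
  assume "coroot b \<bullet> a = - 1"
  then have "coroot a + coroot b = coroot (reflection a b)" by (simp add: coroot_reflection)
  then show ?thesis using reflection_root[OF a b] by blast
 next
  assume "coroot a \<bullet> b = - 1"
  then have "coroot a + coroot b = coroot (reflection b a)" by (simp add: coroot_reflection)
  then show ?thesis using reflection_root[OF b a] by blast
 qed
qed

text \<open>In a shortest expression as a sum of coroots no two coroots form an obtuse angle.\<close>

lemma Qv_large_inner:
 assumes "x : Qv" "x ~= 0" shows "EX b:\<Phi>. x \<bullet> b >= 2"
proof -
 have "EX b:\<Phi>. sum_list (map coroot as) \<bullet> b >= 2"
  if "set as \<subseteq> \<Phi>" "sum_list (map coroot as) ~= 0" for as
  using that
 proof (induction as rule: length_induct)
  case (1 as)
  then obtain a bs where as: "as = a # bs" by (cases as) auto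
  have a: "a : \<Phi>" and bs: "set bs \<subseteq> \<Phi>" using 1(2) as by auto
  have shorter: ?case if cs: "length cs < length as" "set cs \<subseteq> \<Phi>"
   "sum_list (map coroot cs) = sum_list (map coroot as)" for cs
  proof -
   have "sum_list (map coroot cs) ~= 0" unfolding cs(3) by (rule 1(3))
   then show ?thesis using 1(1)[rule_format, OF cs(1,2)] unfolding cs(3)[symmetric] by blast
  qed
  show ?case
  proof (cases "EX b:set bs. a \<bullet> b < 0")
   case True
   then obtain b where b: "b : set bs" "a \<bullet> b < 0" by blast
   obtain us vs where uv: "bs = us @ b # vs" using split_list[OF b(1)] by blast
   show ?thesis
   proof (cases "a = - b")
    case True
    show ?thesis
    proof (rule shorter)
     show "length (us @ vs) < length as" by (simp add: as uv)
     show "set (us @ vs) \<subseteq> \<Phi>" using bs by (simp add: uv)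
     show "sum_list (map coroot (us @ vs)) = sum_list (map coroot as)"
      unfolding as uv True by (simp add: algebra_simps)
    qed
   next
    case False
    have "b : \<Phi>" using b(1) bs by blast
    then obtain c where c: "c : \<Phi>" "coroot a + coroot b = coroot c"
     using coroot_add[OF a _ b(2) False] by blast
    show ?thesis
    proof (rule shorter)
     show "length (c # us @ vs) < length as" by (simp add: as uv)
     show "set (c # us @ vs) \<subseteq> \<Phi>" using bs c(1) by (simp add: uv)
     show "sum_list (map coroot (c # us @ vs)) = sum_list (map coroot as)"
      unfolding as uv by (simp add: c(2)[symmetric] algebra_simps)
    qed
   qed
  next
   case False
   \<comment> \<open>No coroot of the list is obtuse to \<open>a\<close>, so all contribute
     nonnegatively, while \<open>coroot a\<close> contributes 2.\<close>
   have "sum_list (map coroot cs) \<bullet> a >= 0" if "set cs \<subseteq> set bs" for cs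
    using that
   proof (induction cs rule: list.induct)
    case (Cons c cs)
    have "0 <= a \<bullet> c" using Cons.prems False by force
    then have "0 <= a \<bullet> coroot c" using coroot_sign(3)[of c a] Cons.prems bs by auto
    then show ?case using Cons by (simp add: inner_add_right inner_commute[of _ a])
   qed simp
   then have "sum_list (map coroot bs) \<bullet> a >= 0" by blast
   then have "sum_list (map coroot as) \<bullet> a >= 2"
    using coroot_self(2)[OF root_nonzero[OF a]] by (simp add: as inner_add_left)
   then show ?thesis using a by blast
  qed
 qed
 then show ?thesis using assms unfolding Qv_def by blast
qed

text \<open>A minuscule coweight pairs to at most 1 with every root, whereas a nonzero element of
  the coroot lattice pairs to at least 2 with some root.\<close>

lemma fund_group_Qv:
 assumes "ze : \<Omega>" "ze 0 : Qv" shows "ze = id"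
proof -
 have "ze : Aut_region A" using assms mem_fund_group by blast
 then consider "ze 0 = 0" | j where "j : I" "mk j = 1" "ze 0 = cw j"
  using Aut_alcove_0 by blast
 then show ?thesis
 proof cases
  case 1
  then show ?thesis using fund_group_fixes_0 assms(1) by blast
 next
  case 2
  then obtain b where b: "b : \<Phi>" "cw j \<bullet> b >= 2"
   using Qv_large_inner[OF assms(2)] coweight_nonzero[OF 2(1)] by auto
  then show ?thesis using coeff_le_hr[OF b(1) 2(1)] 2(2) mk_simple[OF 2(1)] by simp
 qed
qed

lemma fund_group_0_lattice: "ze : \<Omega> ==> ze 0 : P"
 using Aut_alcove_0[of ze] mem_fund_group[of ze] lattice_0 coweight_in_lattice by auto

text \<open>Makes evaluation at 0 a homomorphism from the fundamental group to coweights modulo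
  coroots; \<open>fund_group_unique\<close> is its injectivity.\<close>

lemma fund_group_mod_Qv:
 assumes "ze : \<Omega>" "x : P" shows "ze x - (ze 0 + x) : Qv"
proof -
 have "linear_part ze x - x : Qv" using weyl_group_mod_Qv assms mem_fund_group by blast
 moreover have "ze x - (ze 0 + x) = linear_part ze x - x" by (simp add: linear_part_def algebra_simps)
 ultimately show ?thesis by metis
qed

abbreviation "G \<equiv> comp_group (Aut_region A)"

lemma fund_group_closed: "ze : \<Omega> ==> xi : \<Omega> ==> ze o xi : \<Omega>"
 using subgroup.m_closed[OF normal_imp_subgroup[OF fund_group_normal], of ze xi] unfolding comp_group_simps .

lemma id_in_fund_group: "id : \<Omega>"
 using subgroup.one_closed[OF normal_imp_subgroup[OF fund_group_normal]] unfolding comp_group_simps .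

lemma fund_group_inverse:
 assumes "ze : \<Omega>" obtains xi where "xi : \<Omega>" "xi o ze = id" "ze o xi = id" "inv\<^bsub>G\<^esub> ze = xi"
proof -
 have "ze : Aut_region A" using assms mem_fund_group by blast
 then obtain xi where xi: "xi o ze = id" "ze o xi = id" "inv\<^bsub>G\<^esub> ze = xi" by (rule Aut_region_inverse)
 have "inv\<^bsub>G\<^esub> ze : \<Omega>"
  by (rule subgroup.m_inv_closed[OF normal_imp_subgroup[OF fund_group_normal] assms])
 then show thesis using that xi by metis
qed

lemma fund_group_comp_mod_Qv:
 "ze : \<Omega> ==> xi : \<Omega> ==> (ze o xi) 0 - (ze 0 + xi 0) : Qv"
 using fund_group_mod_Qv[OF _ fund_group_0_lattice, of ze xi] by simp

lemma fund_group_inverse_mod_Qv: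
 assumes "ze : \<Omega>" "xi : \<Omega>" "xi o ze = id" shows "xi 0 + ze 0 : Qv"
 using Qv_minus[OF fund_group_comp_mod_Qv[OF assms(2,1)]] unfolding assms(3) by (simp add: add.commute)

lemma fund_group_unique:
 assumes "ze : \<Omega>" "xi : \<Omega>" "ze 0 - xi 0 : Qv" shows "ze = xi"
proof -
 obtain \<kappa> where \<kappa>: "\<kappa> : \<Omega>" "\<kappa> o xi = id" "xi o \<kappa> = id" using fund_group_inverse[OF assms(2)] by metis
 have 1: "(\<kappa> o ze) 0 - (\<kappa> 0 + ze 0) : Qv" by (rule fund_group_comp_mod_Qv[OF \<kappa>(1) assms(1)])
 have 2: "\<kappa> 0 + xi 0 : Qv" by (rule fund_group_inverse_mod_Qv[OF assms(2) \<kappa>(1,2)])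
 have "(\<kappa> o ze) 0 : Qv" using Qv_add[OF Qv_add[OF 1 2] assms(3)] by (simp add: algebra_simps)
 then have "\<kappa> o ze = id" by (rule fund_group_Qv[OF fund_group_closed[OF \<kappa>(1) assms(1)]])
 then have "xi (\<kappa> (ze x)) = xi x" for x by (simp add: fun_eq_iff)
 then show ?thesis using \<kappa>(3) by (simp add: fun_eq_iff)
qed

section \<open>Minuscule representatives\<close>

text \<open>A Weyl-invariant form that, unlike the inner product, is integral on the coweight
  lattice whatever the scale of the roots.\<close>

definition kf :: "'a => 'a => real" where "kf x y = (\<Sum>b\<in>\<Phi>. (x \<bullet> b) * (y \<bullet> b))"

lemma kf_diff_left: "kf (x - y) z = kf x z - kf y z"
 and kf_diff_right: "kf z (x - y) = kf z x - kf z y"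
 and kf_scale_left: "kf (c *\<^sub>R x) z = c * kf x z"
 and kf_scale_right: "kf z (c *\<^sub>R x) = c * kf z x"
 and kf_commute: "kf x y = kf y x"
 by (simp_all add: kf_def inner_diff_left algebra_simps sum_subtractf sum_distrib_left)

lemma kf_reflection: assumes a: "a : \<Phi>" shows "kf (reflection a x) (reflection a y) = kf x y"
proof -
 have bij: "bij_betw (reflection a) \<Phi> \<Phi>"
  unfolding bij_betw_def
  using reflection_root_image[OF a] inj_on_subset[OF orthogonal_transformation_inj[OF orthogonal_reflection]] by blast
 have "reflection a z \<bullet> reflection a b = z \<bullet> b" for z b by (rule orthogonal_inner[OF orthogonal_reflection])
 then have "kf x y = (\<Sum>b\<in>\<Phi>. (reflection a x \<bullet> reflection a b) * (reflection a y \<bullet> reflection a b))"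
  by (simp add: kf_def)
 also have "\<dots> = kf (reflection a x) (reflection a y)"
  unfolding kf_def by (rule sum.reindex_bij_betw[OF bij])
 finally show ?thesis by simp
qed

text \<open>Invariance under the reflection in \<open>a\<close> alone forces this relation.\<close>

lemma kf_root: assumes a: "a : \<Phi>" shows "2 * kf x a = (x \<bullet> coroot a) * kf a a"
proof -
 have "kf x a = kf (reflection a x) (- a)" using kf_reflection[OF a, of x a] by (simp add: reflection_self)
 also have "\<dots> = - kf (reflection a x) a" using kf_scale_right[of "reflection a x" "-1" a] by simp
 also have "\<dots> = - (kf x a - (x \<bullet> coroot a) * kf a a)"
  by (simp add: reflection_coroot kf_diff_left kf_scale_left)
 finally show ?thesis by simp
qed

lemma kf_pos: assumes "a : \<Phi>" shows "kf a a > 0"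
 unfolding kf_def
proof (rule sum_pos2[of _ a])
 show "0 < (a \<bullet> a) * (a \<bullet> a)" using inner_root_pos[OF assms] by simp
qed (use assms in auto)

text \<open>The norm drops by a positive multiple of \<open>x \<bullet> a - 1\<close>.\<close>

lemma kf_diff_coroot:
 assumes a: "a : \<Phi>" and x: "x \<bullet> a >= 2"
 shows "kf (x - coroot a) (x - coroot a) < kf x x"
proof -
 define k where "k = 2 / (a \<bullet> a)"
 have k: "k > 0" using inner_root_pos[OF a] by (simp add: k_def)
 have cr: "coroot a = k *\<^sub>R a" by (simp add: coroot_def k_def)
 have "kf (x - coroot a) (x - coroot a) = kf x x - 2 * k * kf x a + k * k * kf a a"
  by (simp add: cr kf_diff_left kf_diff_right kf_scale_left kf_scale_right kf_commute[of a x] right_diff_distrib)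
 also have "2 * k * kf x a = k * k * (x \<bullet> a) * kf a a"
  using kf_root[OF a, of x] by (simp add: cr)
 finally have "kf (x - coroot a) (x - coroot a) = kf x x - (k * k * kf a a) * (x \<bullet> a - 1)"
  by (simp add: algebra_simps)
 moreover have "(k * k * kf a a) * (x \<bullet> a - 1) > 0" using k kf_pos[OF a] x by simp
 ultimately show ?thesis by simp
qed

text \<open>Subtract coroots of roots that pair to 2 or more; the integral norm given by
  \<open>kf\<close> decreases.\<close>

lemma small_representative:
 assumes "x : P" shows "EX y:P. y - x : Qv & (ALL b:\<Phi>. y \<bullet> b <= 1)"
 using assms
proof (induction "nat \<lfloor>kf x x\<rfloor>" arbitrary: x rule: less_induct)
 case less
 have int: "kf y y : \<int>" "kf y y >= 0" if "y : P" for y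
  using lattice_root_Ints[OF that] unfolding kf_def by (simp_all add: Ints_sum sum_nonneg)
 show ?case
 proof (cases "ALL b:\<Phi>. x \<bullet> b <= 1")
  case True
  then show ?thesis using less.prems Qv_0 by (intro bexI[of _ x]) auto
 next
  case False
  then obtain b where b: "b : \<Phi>" "x \<bullet> b > 1" by force
  have "x \<bullet> b : \<int>" by (rule lattice_root_Ints[OF less.prems b(1)])
  then have "x \<bullet> b >= 2" using b(2) by (auto elim!: Ints_cases)
  then have lt: "kf (x - coroot b) (x - coroot b) < kf x x" by (rule kf_diff_coroot[OF b(1)])
  have P: "x - coroot b : P" using lattice_diff less.prems coroot_lattice b(1) by blast
  have "nat \<lfloor>kf (x - coroot b) (x - coroot b)\<rfloor> < nat \<lfloor>kf x x\<rfloor>"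
   using lt int[OF P] int[OF less.prems] by (auto elim!: Ints_cases)
  from less.hyps[OF this P] obtain y where y: "y : P" "y - (x - coroot b) : Qv" "ALL b:\<Phi>. y \<bullet> b <= 1"
   by blast
  have "y - x : Qv" using Qv_diff[OF y(2) Qv_coroot[OF b(1)]] by simp
  then show ?thesis using y by blast
 qed
qed

text \<open>The usual ascent to the chamber: reflecting in a simple root with negative pairing
  reduces the number of positive roots that are negative on \<open>x\<close>.\<close>

lemma dominant_representative:
 assumes "x : P" "ALL b:\<Phi>. x \<bullet> b <= 1"
 shows "EX y:P. y - x : Qv & (ALL b:\<Phi>. y \<bullet> b <= 1) & (ALL i:I. 0 <= y \<bullet> al i)"
 using assms
proof (induction "card {b\<in>\<Phi>. pos b & x \<bullet> b < 0}" arbitrary: x rule: less_induct)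
 case less
 show ?case
 proof (cases "ALL i:I. 0 <= x \<bullet> al i")
  case True
  then show ?thesis using less.prems Qv_0 by (intro bexI[of _ x]) auto
 next
  case False
  then obtain i where i: "i : I" "x \<bullet> al i < 0" by force
  let ?s = "reflection (al i)"
  have ali: "al i : \<Phi>" by (rule simple_root[OF i(1)])
  have sP: "?s x : P & ?s x - x : Qv"
   by (rule weyl_group_mod_Qv[OF weyl_group_reflection[OF ali] less.prems(1)])
  have swap: "?s x \<bullet> b = x \<bullet> ?s b" for b
   using orthogonal_inner[OF orthogonal_reflection, of "al i" x "?s b"] by simp
  have "card (?s ` {b\<in>\<Phi>. pos b & ?s x \<bullet> b < 0}) <= card ({b\<in>\<Phi>. pos b & x \<bullet> b < 0} - {al i})"
  proof (rule card_mono)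
   show "?s ` {b\<in>\<Phi>. pos b & ?s x \<bullet> b < 0} \<subseteq> {b\<in>\<Phi>. pos b & x \<bullet> b < 0} - {al i}"
   proof (clarify, intro DiffI CollectI conjI)
    fix b assume b: "b : \<Phi>" "pos b" "?s x \<bullet> b < 0"
    have "b ~= al i" using b(3) i(2) by (auto simp: swap reflection_self)
    then show "pos (?s b)" using simple_reflection_pos[OF b(1,2) i(1)] by simp
    show "?s b : \<Phi>" by (rule reflection_root[OF ali b(1)])
    show "x \<bullet> ?s b < 0" using b(3) by (simp add: swap)
    show "?s b ~: {al i}"
    proof
     assume "?s b : {al i}"
     then have "?s (?s b) = ?s (al i)" by simp
     then have "b = - al i" by (simp add: reflection_self)
     then show False using b(2) not_pos_both[OF ali pos_simple[OF i(1)]] by simp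
    qed
   qed
  qed simp
  also have "\<dots> < card {b\<in>\<Phi>. pos b & x \<bullet> b < 0}"
   using ali i pos_simple by (intro card_Diff1_less) auto
  also have "card (?s ` {b\<in>\<Phi>. pos b & ?s x \<bullet> b < 0}) = card {b\<in>\<Phi>. pos b & ?s x \<bullet> b < 0}"
   by (rule card_image)
    (rule inj_on_subset[OF orthogonal_transformation_inj[OF orthogonal_reflection] subset_UNIV])
  finally have lt: "card {b\<in>\<Phi>. pos b & ?s x \<bullet> b < 0} < card {b\<in>\<Phi>. pos b & x \<bullet> b < 0}" .
  have "ALL b:\<Phi>. ?s x \<bullet> b <= 1" using less.prems(2) reflection_root[OF ali] by (simp add: swap)
  from less.hyps[OF lt _ this] sP obtain y where y: "y : P" "y - ?s x : Qv"
   "(ALL b:\<Phi>. y \<bullet> b <= 1) & (ALL i:I. 0 <= y \<bullet> al i)" by blast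
  have "y - x : Qv" using Qv_add[OF y(2)] sP by fastforce
  then show ?thesis using y by blast
 qed
qed

text \<open>For a dominant representative \<open>z\<close>, the pairing with \<open>hr\<close> is at
  most 1 and equals the sum of its simple pairings weighted by the marks. All these are nonnegative
  integers, so exactly one pairing is nonzero, and it and its mark are 1. This yields minuscule
  nodes where the bound by norms is too weak.\<close>

lemma minuscule_representative:
 assumes "x : P" "x ~: Qv"
 shows "EX j:I. mk j = 1 & cw j - x : Qv"
proof -
 obtain y where y: "y : P" "y - x : Qv" "ALL b:\<Phi>. y \<bullet> b <= 1"
  using small_representative[OF assms(1)] by blast
 obtain z where z: "z : P" "z - y : Qv" "ALL b:\<Phi>. z \<bullet> b <= 1" "!!i. i : I ==> 0 <= z \<bullet> al i"
  using dominant_representative[OF y(1,3)] by blast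
 have zx: "z - x : Qv" using Qv_add[OF z(2) y(2)] by simp
 have "z ~= 0"
 proof
  assume "z = 0"
  then have "x : Qv" using Qv_minus[OF zx] by simp
  then show False using assms(2) by simp
 qed
 then have "EX j:I. z \<bullet> al j ~= 0 \<bullet> al j" using eq_by_simple[of z 0] by blast
 then obtain j where j: "j : I" "z \<bullet> al j ~= 0" by auto
 have "z \<bullet> al j : \<int>" using z(1) j(1) by (simp add: mem_coweight_lattice)
 then have j1: "z \<bullet> al j >= 1" using z(4)[OF j(1)] j(2) by (auto elim!: Ints_cases)
 have mkj: "mk j >= 1" using mk_ge_1 simple_index[OF j(1)] by blast
 have "(\<Sum>i\<in>I. mk i * (z \<bullet> al i)) = z \<bullet> hr"
  unfolding inner_commute[of z hr] inner_expansion[of hr z]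
  by (rule sum.cong) (auto simp: mk_simple inner_commute)
 then have le1: "(\<Sum>i\<in>I. mk i * (z \<bullet> al i)) <= 1" using z(3) hr_root by simp
 have nn: "0 <= mk i * (z \<bullet> al i)" if "i : I" for i
  using mk_pos[of i] simple_index[OF that] z(4)[OF that] by simp
 have split: "(\<Sum>i\<in>I. mk i * (z \<bullet> al i)) = mk j * (z \<bullet> al j) + (\<Sum>i\<in>I - {j}. mk i * (z \<bullet> al i))"
  by (rule sum.remove) (use j in auto)
 have rest: "(\<Sum>i\<in>I - {j}. mk i * (z \<bullet> al i)) >= 0"
  by (rule sum_nonneg) (use nn in auto)
 have ge: "mk j * (z \<bullet> al j) >= 1 * 1" using mkj j1 by (intro mult_mono) auto
 then have eq: "mk j * (z \<bullet> al j) = 1" and "(\<Sum>i\<in>I - {j}. mk i * (z \<bullet> al i)) = 0"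
  using le1 split rest by linarith+
 then have rest0: "ALL i:I - {j}. mk i * (z \<bullet> al i) = 0"
  using nn by (subst (asm) sum_nonneg_eq_0_iff) auto
 have "mk j * 1 <= mk j * (z \<bullet> al j)" using j1 mkj by (intro mult_left_mono) auto
 then have mkj1: "mk j = 1" using eq mkj by simp
 have "z = cw j"
 proof (rule eq_by_simple)
  fix i assume i: "i : I"
  show "z \<bullet> al i = cw j \<bullet> al i"
   unfolding coweight_simple[OF j(1) i]
   using bspec[OF rest0, of i] i eq mkj1 mk_pos[of i] simple_index[OF i] by (cases "i = j") auto
 qed
 then show ?thesis using j(1) mkj1 zx by blast
qed

section \<open>Tools for the individual types\<close>

text \<open>The class of \<open>x\<close> modulo the coroot lattice is the image of 0 under some
  element of the fundamental group in \<open>H\<close>. For a subgroup \<open>H\<close> these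
  classes form a group, so reaching generators is enough.\<close>

definition reach :: "('a => 'a) set => 'a => bool" where
 "reach H x \<longleftrightarrow> (EX ze:\<Omega> \<inter> H. ze 0 - x : Qv)"

lemma reach_Qv:
 assumes "subgroup H G" "x : Qv" shows "reach H x"
 unfolding reach_def using subgroup.one_closed[OF assms(1)] id_in_fund_group Qv_minus[OF assms(2)]
 by (intro bexI[of _ id]) auto

lemma reach_cong: "reach H x ==> x - y : Qv ==> reach H y"
 unfolding reach_def using Qv_add by (metis add_diff_eq diff_add_cancel)

lemma reach_add:
 assumes H: "subgroup H G" and "reach H x" "reach H y" shows "reach H (x + y)"
proof -
 obtain ze xi where *: "ze : \<Omega>" "ze : H" "xi : \<Omega>" "xi : H" "ze 0 - x : Qv" "xi 0 - y : Qv"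
  using assms unfolding reach_def by blast
 have "(ze o xi) 0 - (x + y) : Qv"
  using Qv_add[OF fund_group_comp_mod_Qv[OF *(1,3)] Qv_add[OF *(5,6)]] by (simp add: algebra_simps)
 moreover have "ze o xi : \<Omega>" by (rule fund_group_closed[OF *(1,3)])
 moreover have "ze o xi : H" using subgroup.m_closed[OF H *(2,4)] unfolding comp_group_simps .
 ultimately show ?thesis unfolding reach_def by (intro bexI[of _ "ze o xi"] IntI)
qed

lemma reach_minus:
 assumes H: "subgroup H G" and "reach H x" shows "reach H (- x)"
proof -
 obtain ze where *: "ze : \<Omega>" "ze : H" "ze 0 - x : Qv" using assms unfolding reach_def by blast
 obtain xi where xi: "xi : \<Omega>" "xi o ze = id" "inv\<^bsub>G\<^esub> ze = xi" using fund_group_inverse[OF *(1)] by metis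
 have "xi : H" using subgroup.m_inv_closed[OF H *(2)] xi(3) by simp
 moreover have "xi 0 - (- x) : Qv"
  using Qv_diff[OF fund_group_inverse_mod_Qv[OF *(1) xi(1,2)] *(3)] by simp
 ultimately show ?thesis using xi(1) unfolding reach_def by (intro bexI[of _ xi] IntI)
qed

lemma reach_Ints_scale:
 assumes H: "subgroup H G" and x: "reach H x" and "c : \<int>" shows "reach H (c *\<^sub>R x)"
proof -
 have nat: "reach H (real m *\<^sub>R x)" for m
  by (induction m) (simp_all add: reach_Qv[OF H Qv_0] reach_add[OF H x] scaleR_left_distrib)
 obtain z where z: "c = of_int z" using \<open>c : \<int>\<close> by (auto elim: Ints_cases)
 show ?thesis
 proof (cases "z >= 0")
  case True
  then show ?thesis using nat[of "nat z"] z by simp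
 next
  case False
  then show ?thesis using reach_minus[OF H nat[of "nat (- z)"]] z by simp
 qed
qed

lemma reach_sum:
 assumes H: "subgroup H G" and "!!i. i : S ==> reach H (f i)" shows "reach H (sum f S)"
 using assms(2)
 by (induction S rule: infinite_finite_induct) (auto simp: reach_Qv[OF H Qv_0] reach_add[OF H])

lemma reach_omega:
 assumes "j : I" "mk j = 1" "omega j : H" shows "reach H (cw j)"
 unfolding reach_def using assms omega_props[OF assms(1,2)] Qv_0
 by (intro bexI[of _ "omega j"]) auto

lemma subgroup_full:
 assumes H: "subgroup H G" and AutD: "AutDyn \<subseteq> H"
  and r: "!!i. i : I ==> reach H (cw i)"
 shows "H = Aut_region A"
proof
 show "H \<subseteq> Aut_region A" using subgroup.subset[OF H] by simp
 have \<Omega>: "ze : H" if ze: "ze : \<Omega>" for ze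
 proof -
  have "reach H (\<Sum>i\<in>I. (ze 0 \<bullet> al i) *\<^sub>R cw i)"
   using fund_group_0_lattice[OF ze] r
   by (intro reach_sum[OF H] reach_Ints_scale[OF H]) (auto simp: mem_coweight_lattice)
  then have "reach H (ze 0)" using coweight_expansion[of "ze 0"] by simp
  then obtain xi where xi: "xi : \<Omega>" "xi : H" "xi 0 - ze 0 : Qv" unfolding reach_def by blast
  then show ?thesis using fund_group_unique[OF xi(1) ze xi(3)] by simp
 qed
 show "Aut_region A \<subseteq> H"
 proof
  fix ze assume "ze : Aut_region A"
  then have "ze : \<Omega> <#>\<^bsub>G\<^esub> AutDyn"
   using Aut_alcove_semidirect unfolding internal_semidirect_def by simp
  then obtain \<omega> ph where *: "\<omega> : \<Omega>" "ph : AutDyn" "ze = \<omega> o ph"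
   unfolding set_mult_def comp_group_simps by blast
  have "\<omega> \<otimes>\<^bsub>G\<^esub> ph : H" by (rule subgroup.m_closed[OF H \<Omega>[OF *(1)]]) (use AutD *(2) in blast)
  then show "ze : H" unfolding comp_group_simps *(3) .
 qed
qed

lemma generated_by_involutionsI:
 assumes R: "!!r. r : R ==> r : Aut_region A & r ~= id & r o r = id"
  and AutD: "AutDyn \<subseteq> generate G R"
  and r: "!!i. i : I ==> reach (generate G R) (cw i)"
 shows "generated_by_involutions G R"
proof -
 have "R \<subseteq> carrier G" using R by auto
 then have "subgroup (generate G R) G" by (rule group.generate_is_subgroup[OF group_Aut_region])
 then have "generate G R = Aut_region A" using subgroup_full AutD r by blast
 then show ?thesis unfolding generated_by_involutions_def comp_group_simps using R by blast
qed

lemma subgroup_generate: "R \<subseteq> Aut_region A ==> subgroup (generate G R) G"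
 by (rule group.generate_is_subgroup[OF group_Aut_region]) simp

lemma Aut_dynkin_fixes_0: "ph : AutDyn ==> ph 0 = 0"
 using linear_0[OF orthogonal_transformation_linear[OF Aut_dynkin_D(1)]] .

lemma Aut_dynkin_conj_fund:
 assumes "ph : AutDyn" "ph o ph = id" "ze : \<Omega>"
 shows "ph o ze o ph : \<Omega>" "(ph o ze o ph) 0 = ph (ze 0)"
proof -
 have ph: "ph : Aut_region A" by (rule Aut_dynkin_alcove[OF assms(1)])
 have "inv\<^bsub>G\<^esub> ph = ph" by (rule inv_comp_group[OF group_Aut_region ph ph assms(2)])
 moreover have "ph \<otimes>\<^bsub>G\<^esub> ze \<otimes>\<^bsub>G\<^esub> inv\<^bsub>G\<^esub> ph : \<Omega>"
  using fund_group_normal ph assms(3) unfolding group.normal_inv_iff[OF group_Aut_region] by simp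
 ultimately show "ph o ze o ph : \<Omega>" unfolding comp_group_simps by simp
 show "(ph o ze o ph) 0 = ph (ze 0)" using Aut_dynkin_fixes_0[OF assms(1)] by simp
qed

lemma omega_involution:
 assumes j: "j : I" "mk j = 1" and q: "2 *\<^sub>R cw j : Qv"
 defines "\<omega> \<equiv> omega j"
 shows "\<omega> : Aut_region A & \<omega> ~= id & \<omega> o \<omega> = id"
proof -
 have \<omega>: "\<omega> : \<Omega>" "\<omega> 0 = cw j" using omega_props[OF j] by (simp_all add: \<omega>_def)
 have "(\<omega> o \<omega>) 0 : Qv"
  using Qv_add[OF fund_group_comp_mod_Qv[OF \<omega>(1,1)] q] by (simp add: \<omega>(2) scaleR_2)
 then have "\<omega> o \<omega> = id" by (rule fund_group_Qv[OF fund_group_closed[OF \<omega>(1,1)]])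
 moreover have "\<omega> ~= id" using \<omega>(2) coweight_nonzero[OF j(1)] by auto
 moreover have "\<omega> : Aut_region A" using \<omega>(1) mem_fund_group by blast
 ultimately show ?thesis by blast
qed

text \<open>By normality \<open>ph o \<omega> o ph\<close> lies in the fundamental group, and it
  sends 0 to \<open>ph (cw j)\<close>. Its product with \<open>\<omega>\<close> thus has trivial
  class by \<open>q\<close>, so it is the identity.\<close>

lemma Aut_dynkin_omega_involution:
 assumes j: "j : I" "mk j = 1" and ph: "ph : AutDyn" "ph o ph = id"
  and q: "ph (cw j) + cw j : Qv"
 defines "\<omega> \<equiv> omega j"
 shows "ph o \<omega> : Aut_region A & ph o \<omega> ~= id & (ph o \<omega>) o (ph o \<omega>) = id"
  "\<omega> o ph : Aut_region A & \<omega> o ph ~= id & (\<omega> o ph) o (\<omega> o ph) = id"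
proof -
 have \<omega>: "\<omega> : \<Omega>" "\<omega> 0 = cw j" using omega_props[OF j] by (simp_all add: \<omega>_def)
 have phA: "ph : Aut_region A" by (rule Aut_dynkin_alcove[OF ph(1)])
 have \<omega>A: "\<omega> : Aut_region A" using \<omega>(1) mem_fund_group by blast
 note c = Aut_dynkin_conj_fund[OF ph \<omega>(1)]
 have "(ph o \<omega> o ph o \<omega>) 0 - (ph (cw j) + cw j) : Qv"
  using fund_group_comp_mod_Qv[OF c(1) \<omega>(1)] unfolding c(2) \<omega>(2) .
 then have "(ph o \<omega> o ph o \<omega>) 0 : Qv" using Qv_add[OF _ q] by force
 then have 1: "ph o \<omega> o ph o \<omega> = id" by (rule fund_group_Qv[OF fund_group_closed[OF c(1) \<omega>(1)]])
 have "(\<omega> o (ph o \<omega> o ph)) 0 - (cw j + ph (cw j)) : Qv"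
  using fund_group_comp_mod_Qv[OF \<omega>(1) c(1)] unfolding c(2) \<omega>(2) .
 then have "(\<omega> o (ph o \<omega> o ph)) 0 : Qv" using Qv_add[OF _ q] by (force simp: add.commute)
 then have 2: "\<omega> o (ph o \<omega> o ph) = id" by (rule fund_group_Qv[OF fund_group_closed[OF \<omega>(1) c(1)]])
 have "ph (cw j) ~= 0"
  using orthogonal_transformation_norm[OF Aut_dynkin_D(1)[OF ph(1)], of "cw j"] coweight_nonzero[OF j(1)]
  by auto
 have "ph o \<omega> ~= id"
 proof
  assume "ph o \<omega> = id"
  then have "(ph o \<omega>) 0 = id 0" by (rule fun_cong)
  then show False using \<open>ph (cw j) ~= 0\<close> \<omega>(2) by simp
 qed
 moreover have "\<omega> o ph ~= id"
 proof
  assume "\<omega> o ph = id"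
  then have "(\<omega> o ph) 0 = id 0" by (rule fun_cong)
  then show False using Aut_dynkin_fixes_0[OF ph(1)] \<omega>(2) coweight_nonzero[OF j(1)] by simp
 qed
 moreover have "ph o \<omega> : Aut_region A" "\<omega> o ph : Aut_region A"
  using group.is_monoid[OF group_Aut_region] monoid.m_closed[of G ph \<omega>] monoid.m_closed[of G \<omega> ph] phA \<omega>A
  unfolding comp_group_simps by blast+
 moreover have "(ph o \<omega>) o (ph o \<omega>) = id" "(\<omega> o ph) o (\<omega> o ph) = id"
  using 1 2 by (simp_all only: comp_assoc)
 ultimately show "ph o \<omega> : Aut_region A & ph o \<omega> ~= id & (ph o \<omega>) o (ph o \<omega>) = id"
  "\<omega> o ph : Aut_region A & \<omega> o ph ~= id & (\<omega> o ph) o (\<omega> o ph) = id" by blast+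
qed

text \<open>Conjugation by \<open>ph\<close> acts on classes through \<open>ph\<close>, which
  preserves the coroot lattice.\<close>

lemma reach_conj:
 assumes H: "subgroup H G" and ph: "ph : AutDyn" "ph o ph = id" "ph : H" and r: "reach H x"
 shows "reach H (ph x)"
proof -
 obtain ze where ze: "ze : \<Omega>" "ze : H" "ze 0 - x : Qv" using r unfolding reach_def by blast
 note c = Aut_dynkin_conj_fund[OF ph(1,2) ze(1)]
 have list: "ph (sum_list (map coroot as)) : Qv" if "set as \<subseteq> \<Phi>" for as
  using that
 proof (induction as rule: list.induct)
  case (Cons a as)
  have "ph (coroot a) = coroot (ph a)" by (rule coroot_orthogonal[OF Aut_dynkin_D(1)[OF ph(1)], symmetric])
  moreover have "a : \<Phi>" using Cons.prems by simp
  then have "ph a : \<Phi>" using Aut_dynkin_D(2)[OF ph(1)] by blast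
  moreover have "ph (sum_list (map coroot as)) : Qv" using Cons by simp
  ultimately show ?case
   using Qv_add[OF Qv_coroot, of "ph a" "ph (sum_list (map coroot as))"]
    linear_add[OF orthogonal_transformation_linear[OF Aut_dynkin_D(1)[OF ph(1)]]] by simp
 qed (simp add: Aut_dynkin_fixes_0[OF ph(1)] Qv_0)
 obtain as where as: "set as \<subseteq> \<Phi>" "ze 0 - x = sum_list (map coroot as)"
  using ze(3) unfolding Qv_def by blast
 have "ph (ze 0 - x) : Qv" unfolding as(2) by (rule list[OF as(1)])
 then have "(ph o ze o ph) 0 - ph x : Qv"
  unfolding c(2) using linear_diff[OF orthogonal_transformation_linear[OF Aut_dynkin_D(1)[OF ph(1)]]] by simp
 moreover have "ph o ze o ph : H"
  using subgroup.m_closed[OF H subgroup.m_closed[OF H ph(3) ze(2)] ph(3)] unfolding comp_group_simps .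
 ultimately show ?thesis using c(1) unfolding reach_def by (intro bexI[of _ "ph o ze o ph"] IntI)
qed

text \<open>Turns membership in the coroot lattice into an integral linear system whose matrix is
  the Cartan matrix.\<close>

lemma Qv_by_simple:
 assumes "!!i. i : I ==> x \<bullet> al i = (\<Sum>j\<in>I. (al i \<bullet> coroot (al j)) * of_int (k j))"
 shows "x : Qv"
proof -
 have "x = (\<Sum>j\<in>I. of_int (k j) *\<^sub>R coroot (al j))"
 proof (rule eq_by_simple)
  fix i assume i: "i : I"
  show "x \<bullet> al i = (\<Sum>j\<in>I. of_int (k j) *\<^sub>R coroot (al j)) \<bullet> al i"
   unfolding assms[OF i] inner_sum_left by (rule sum.cong) (simp_all add: inner_commute)
 qed
 also have "\<dots> : Qv" by (intro Qv_sum Qv_Ints_scale Qv_coroot simple_root) auto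
 finally show ?thesis .
qed

text \<open>Serves to show that a vector is outside the coroot lattice. Integrality on simple
  coroots spreads to all coroots because a simple reflection adds integral multiples of a simple
  coroot.\<close>

lemma character_Ints:
 assumes s: "!!i. i : I ==> \<mu> \<bullet> coroot (al i) : \<int>" and x: "x : Qv"
 shows "\<mu> \<bullet> x : \<int>"
proof -
 have word: "\<mu> \<bullet> coroot (wd xs (al i)) : \<int>" if "xs : lists I" "i : I" for xs i
  using that
 proof (induction xs rule: list.induct)
  case (Cons j xs)
  then have j: "j : I" and IH: "\<mu> \<bullet> coroot (wd xs (al i)) : \<int>" and xs: "xs : lists I" by simp_all
  have "coroot (wd xs (al i)) \<bullet> al j : \<int>"
   using cartan_Ints[OF wd_root[OF xs simple_root[OF Cons.prems(2)]] simple_root[OF j]] by (simp add: inner_commute)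
  then show ?case using IH s[OF j] by (simp add: coroot_reflection inner_diff_right)
 qed (simp add: s)
 have root: "\<mu> \<bullet> coroot b : \<int>" if b: "b : \<Phi>" for b
 proof -
  obtain xs i where *: "xs : lists I" "i : I" "b = wd xs (al i)"
   using root_conj_simple[OF b] by blast
  show ?thesis unfolding *(3) by (rule word[OF *(1,2)])
 qed
 have list: "\<mu> \<bullet> sum_list (map coroot as) : \<int>" if "set as \<subseteq> \<Phi>" for as
  using that by (induction as rule: list.induct) (auto simp: inner_add_right root)
 obtain as where as: "set as \<subseteq> \<Phi>" "x = sum_list (map coroot as)"
  using x unfolding Qv_def by blast
 show ?thesis unfolding as(2) by (rule list[OF as(1)])
qed

text \<open>The numbers \<open>k\<close> are the coordinates of \<open>cw j\<close> in simple
  coroots, so the squared norm of \<open>cw j\<close> is \<open>2 * k j\<close> divided by that of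
  \<open>al j\<close>. The highest root is conjugate to a simple root, hence not longer than
  \<open>al j\<close>, and Cauchy--Schwarz bounds the square of the mark by \<open>2 * k j\<close>,
  which is less than 4.\<close>

lemma minuscule_by_norm:
 assumes j: "j : I" and k: "k j < 2"
  and eq: "!!i. i : I ==> (if i = j then 1 else 0) = (\<Sum>l\<in>I. (al i \<bullet> coroot (al l)) * k l)"
  and long: "!!i. i : I ==> al i \<bullet> al i <= al j \<bullet> al j"
 shows "mk j = 1"
proof -
 have cwj: "cw j = (\<Sum>l\<in>I. k l *\<^sub>R coroot (al l))"
 proof (rule coweight_unique)
  fix i assume i: "i : I"
  have "(\<Sum>l\<in>I. k l *\<^sub>R coroot (al l)) \<bullet> al i = (\<Sum>l\<in>I. (al i \<bullet> coroot (al l)) * k l)"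
   unfolding inner_sum_left by (rule sum.cong) (simp_all add: inner_commute)
  then show "(\<Sum>l\<in>I. k l *\<^sub>R coroot (al l)) \<bullet> al i = (if j = i then 1 else 0)"
   using eq[OF i] by auto
 qed
 have jj: "al j \<bullet> al j > 0" by (rule inner_root_pos[OF simple_root[OF j]])
 have "cw j \<bullet> cw j = (\<Sum>l\<in>I. k l *\<^sub>R coroot (al l)) \<bullet> cw j" using cwj by simp
 also have "\<dots> = (\<Sum>l\<in>I. if l = j then k j * (2 / (al j \<bullet> al j)) else 0)"
  unfolding inner_sum_left
 proof (rule sum.cong[OF HOL.refl])
  fix l assume l: "l : I"
  show "(k l *\<^sub>R coroot (al l)) \<bullet> cw j = (if l = j then k j * (2 / (al j \<bullet> al j)) else 0)"
   using coweight_simple[OF j l] by (auto simp: coroot_def inner_commute)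
 qed
 finally have cc: "cw j \<bullet> cw j = k j * (2 / (al j \<bullet> al j))" using j by simp
 obtain xs i where *: "xs : lists I" "i : I" "hr = wd xs (al i)"
  using root_conj_simple[OF hr_root] by blast
 have hh: "hr \<bullet> hr <= al j \<bullet> al j" unfolding *(3) orthogonal_inner[OF wd_orthogonal] by (rule long[OF *(2)])
 have "(cw j \<bullet> hr)\<^sup>2 <= (cw j \<bullet> cw j) * (hr \<bullet> hr)" by (rule Cauchy_Schwarz_ineq)
 also have "\<dots> <= (cw j \<bullet> cw j) * (al j \<bullet> al j)" using hh by (intro mult_left_mono) auto
 also have "\<dots> = 2 * k j" using jj by (simp add: cc)
 also have "\<dots> < 2\<^sup>2" using k by simp
 finally have "cw j \<bullet> hr < 2" using hr_coeff_ge_1[OF j] by (intro power2_less_imp_less[of _ 2]) auto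
 moreover obtain m where "mk j = real m" "m > 0" using mk_nat[of j] simple_index[OF j] by blast
 ultimately show ?thesis using mk_simple[OF j] by simp
qed

lemma dynkin_aut_props:
 assumes sg: "!!i. i : I ==> sg i : I" "inj_on sg I"
  and gram: "!!i j. i : I ==> j : I ==> al (sg i) \<bullet> al (sg j) = al i \<bullet> al j"
 shows "dyn sg : AutDyn"
  "!!i. i : I ==> dyn sg (al i) = al (sg i)"
proof -
 define f where "f v = (\<Sum>i\<in>I. (cw i \<bullet> v) *\<^sub>R al (sg i))" for v
 have lin: "linear f"
  unfolding f_def by (rule linearI) (simp_all add: inner_add_right scaleR_left_distrib sum.distrib scaleR_sum_right)
 have fal: "f (al i) = al (sg i)" if i: "i : I" for i
 proof -
  have "f (al i) = (\<Sum>k\<in>I. if k = i then al (sg i) else 0)"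
   unfolding f_def by (rule sum.cong) (auto simp: coweight_simple i)
  then show ?thesis using i by simp
 qed
 have "f v \<bullet> f w = v \<bullet> w" for v w
 proof -
  have "f v \<bullet> f w = (\<Sum>i\<in>I. \<Sum>j\<in>I. (cw i \<bullet> v) * ((cw j \<bullet> w) * (al (sg i) \<bullet> al (sg j))))"
   by (simp only: f_def[of v] f_def[of w] inner_sum_left inner_sum_right inner_scaleR_left
     inner_scaleR_right sum_distrib_left) (subst sum.swap, simp add: mult.left_commute)
  also have "\<dots> = (\<Sum>i\<in>I. \<Sum>j\<in>I. (cw i \<bullet> v) * ((cw j \<bullet> w) * (al i \<bullet> al j)))"
   by (intro sum.cong) (auto simp: gram)
  also have "\<dots> = (\<Sum>i\<in>I. (cw i \<bullet> v) * (al i \<bullet> w))"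
  proof (rule sum.cong[OF HOL.refl])
   fix i
   have "al i \<bullet> w = (\<Sum>j\<in>I. (cw j \<bullet> w) * (al i \<bullet> al j))"
    using inner_expansion[of w "al i"] by (simp add: inner_commute)
   then show "(\<Sum>j\<in>I. (cw i \<bullet> v) * ((cw j \<bullet> w) * (al i \<bullet> al j))) = (cw i \<bullet> v) * (al i \<bullet> w)"
    by (simp add: sum_distrib_left)
  qed
  finally show ?thesis using inner_expansion[of v w] by simp
 qed
 then have orth: "orthogonal_transformation f" using lin by (simp add: orthogonal_transformation_def)
 have roots: "f ` \<Phi> = \<Phi>" by (rule orthogonal_root_image[OF orth]) (simp add: fal simple_root sg(1))
 have "sg ` I = I" by (rule endo_inj_surj[OF _ _ sg(2)]) (use sg(1) in auto)
 moreover have "f ` al ` I = al ` sg ` I"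
  unfolding image_image by (rule image_cong[OF HOL.refl]) (rule fal)
 ultimately have f: "f : AutDyn"
  using orth roots by (simp add: Aut_dynkin_def Aut_roots_def)
 have "dyn sg = f"
  unfolding dynkin_aut_def
 proof (rule the_equality)
  show "f : AutDyn & (ALL i:I. f (al i) = al (sg i))" using f fal by blast
  fix g assume g: "g : AutDyn & (ALL i:I. g (al i) = al (sg i))"
  have lg: "linear g" using g orthogonal_transformation_linear Aut_dynkin_D(1) by blast
  have "g v = f v" for v
  proof -
   have "g v = g (\<Sum>i\<in>I. (cw i \<bullet> v) *\<^sub>R al i)" using simple_expansion[of v] by simp
   also have "\<dots> = (\<Sum>i\<in>I. (cw i \<bullet> v) *\<^sub>R g (al i))" using lg by (simp add: linear_sum linear_scale)
   also have "\<dots> = f v" unfolding f_def using g by (intro sum.cong) auto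
   finally show ?thesis .
  qed
  then show "g = f" by (simp add: fun_eq_iff)
 qed
 then show "dyn sg : AutDyn"
  "!!i. i : I ==> dyn sg (al i) = al (sg i)"
  using f fal by simp_all
qed

lemma Aut_dynkin_eqI:
 assumes "ph : AutDyn" "ps : AutDyn" "!!i. i : I ==> ph (al i) = ps (al i)"
 shows "ph = ps"
proof
 fix v
 note l = orthogonal_transformation_linear[OF Aut_dynkin_D(1)[OF assms(1)]]
  orthogonal_transformation_linear[OF Aut_dynkin_D(1)[OF assms(2)]]
 have "ph v = (\<Sum>i\<in>I. (cw i \<bullet> v) *\<^sub>R ph (al i))"
  using arg_cong[OF simple_expansion[of v], of ph] by (simp add: linear_sum[OF l(1)] linear_scale[OF l(1)])
 also have "\<dots> = (\<Sum>i\<in>I. (cw i \<bullet> v) *\<^sub>R ps (al i))" by (rule sum.cong) (simp_all add: assms(3))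
 also have "\<dots> = ps v"
  using arg_cong[OF simple_expansion[of v], of ps] by (simp add: linear_sum[OF l(2)] linear_scale[OF l(2)])
 finally show "ph v = ps v" .
qed

lemma Aut_dynkin_coweight:
 assumes ph: "ph : AutDyn" and ta: "!!i. i : I ==> ph (al i) = al (ta i)"
  "bij_betw ta I I" and i: "i : I"
 shows "ph (cw i) = cw (ta i)"
proof (rule coweight_unique[symmetric])
 fix j assume j: "j : I"
 then obtain k where k: "k : I" "j = ta k" using ta(2) by (auto simp: bij_betw_def)
 have "ta i = ta k \<longleftrightarrow> i = k" using ta(2) i k(1) by (auto simp: bij_betw_def inj_on_eq_iff)
 then show "ph (cw i) \<bullet> al j = (if ta i = j then 1 else 0)"
  unfolding k(2) ta(1)[OF k(1), symmetric] orthogonal_inner[OF Aut_dynkin_D(1)[OF ph]] coweight_simple[OF i k(1)]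
  by simp
qed

lemma Aut_dynkin_perm:
 assumes ph: "ph : AutDyn"
 obtains ta where "bij_betw ta I I" "!!i. i : I ==> ph (al i) = al (ta i)"
  "!!i j. i : I ==> j : I ==> al (ta i) \<bullet> coroot (al (ta j)) = al i \<bullet> coroot (al j)"
proof -
 obtain ta where ta: "bij_betw ta I I" "!!i. i : I ==> ph (al i) = al (ta i)"
  using simple_roots_bij[OF Aut_dynkin_D(1,3)[OF ph] inj_simple] by blast
 have "al (ta i) \<bullet> coroot (al (ta j)) = al i \<bullet> coroot (al j)" if "i : I" "j : I" for i j
  unfolding ta(2)[OF that(1), symmetric] ta(2)[OF that(2), symmetric]
   coroot_orthogonal[OF Aut_dynkin_D(1)[OF ph]] orthogonal_inner[OF Aut_dynkin_D(1)[OF ph]] ..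
 from that[OF ta this] show thesis .
qed

text \<open>Adjacent simple roots with equal Cartan integers in both directions have equal length,
  and the diagram is connected.\<close>

lemma simply_laced_lengths:
 assumes sym: "!!i j. i : I ==> j : I ==> al i \<bullet> coroot (al j) = al j \<bullet> coroot (al i)"
  and ij: "i : I" "j : I"
 shows "al i \<bullet> al i = al j \<bullet> al j"
proof (rule ccontr)
 assume ne: "~ ?thesis"
 define S where "S = {k\<in>I. al k \<bullet> al k = al i \<bullet> al i}"
 have "EX k:S. EX l:I - S. al k \<bullet> al l ~= 0"
 proof (rule simple_connected)
  have "j ~: S" using ne by (simp add: S_def)
  then show "S ~= I" using ij by blast
  have "i : S" using ij by (simp add: S_def)
  then show "S ~= {}" by blast
 qed (simp add: S_def subset_iff)
 then obtain k l where kl: "k : I" "l : I" "al k \<bullet> al k = al i \<bullet> al i" "al l \<bullet> al l ~= al i \<bullet> al i" "al k \<bullet> al l ~= 0"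
  unfolding S_def by blast
 have "2 * (al k \<bullet> al l) / (al l \<bullet> al l) = 2 * (al k \<bullet> al l) / (al k \<bullet> al k)"
  using sym[OF kl(1,2)] by (simp add: inner_coroot inner_commute)
 then have "al l \<bullet> al l = al k \<bullet> al k"
  using kl(5) inner_root_pos[OF simple_root[OF kl(1)]] inner_root_pos[OF simple_root[OF kl(2)]] by (simp add: field_simps)
 then show False using kl by simp
qed

end

section \<open>Recognizing Coxeter groups\<close>

definition ev :: "('s => 'a => 'a) => 's list => 'a => 'a" where
 "ev g w = foldr (%s f. g s o f) w id"

lemma ev_Nil: "ev g [] = id"
 and ev_Cons: "ev g (s # w) = g s o ev g w"
 by (simp_all add: ev_def)

lemma ev_Cons_apply: "ev g (s # w) x = g s (ev g w x)"
 by (simp add: ev_Cons)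

lemma ev_append: "ev g (v @ w) = ev g v o ev g w"
 by (induction v) (simp_all add: ev_Nil ev_Cons comp_assoc)

lemma concat_replicate_lists: "s : S ==> t : S ==> concat (replicate k [s, t]) : lists S"
 by (induction k) auto

lemma replicate_1 [simp]: "replicate 1 x = [x]"
 by (simp add: One_nat_def)

lemma coxeter_eq_lists: "coxeter_eq S m u v ==> u : lists S & v : lists S"
 by (induction rule: coxeter_eq.induct) (auto simp: concat_replicate_lists simp del: in_listsD)

text \<open>Reduces the isomorphism to checks on words: relators act trivially, every element is the
  value of a word, and words with equal values are congruent. The isomorphism sends \<open>h\<close>
  to the set of words with value \<open>h\<close>, which is a full congruence class.\<close>

lemma is_coxeter_groupI:
 fixes H :: "('a => 'a) set" and S :: "nat set"
 assumes H: "group (comp_group H)" and S: "finite S" "coxeter_matrix S m"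
  and g: "!!s. s : S ==> g s : H"
  and rel: "!!s t. s : S ==> t : S ==> ev g (concat (replicate (m s t) [s, t])) = id"
  and surj: "!!h. h : H ==> EX w:lists S. ev g w = h"
  and inj: "!!u v. u : lists S ==> v : lists S ==> ev g u = ev g v ==> coxeter_eq S m u v"
 shows "is_coxeter_group (comp_group H)"
proof -
 have sound: "coxeter_eq S m u v ==> ev g u = ev g v" for u v
 proof (induction rule: coxeter_eq.induct)
  case (relator s t)
  then show ?case by (simp add: rel ev_Nil)
 qed (simp_all add: ev_append)
 have eq_iff: "coxeter_eq S m u v \<longleftrightarrow> u : lists S & v : lists S & ev g u = ev g v" for u v
  using coxeter_eq_lists[of S m u v] sound[of u v] inj[of u v] by blast
 define F where "F h = {w : lists S. ev g w = h}" for h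
 have cls: "coxeter_rel S m `` {u} = F (ev g u)" if "u : lists S" for u
  using that by (auto simp: coxeter_rel_def eq_iff F_def)
 have evH: "ev g w : H" if "w : lists S" for w
  using that
 proof (induction w rule: list.induct)
  case Nil
  show ?case using monoid.one_closed[OF group.is_monoid[OF H]] unfolding ev_Nil comp_group_simps .
 next
  case (Cons s w)
  then have "g s : H" "ev g w : H" using g by simp_all
  then show ?case using monoid.m_closed[OF group.is_monoid[OF H], of "g s" "ev g w"]
   unfolding ev_Cons comp_group_simps by blast
 qed
 have "F : iso (comp_group H) (coxeter_group S m)"
 proof (rule isoI)
  show "F : hom (comp_group H) (coxeter_group S m)"
   unfolding hom_def
  proof (intro CollectI conjI ballI Pi_I)
   fix h assume "h : carrier (comp_group H)"
   then obtain w where w: "w : lists S" "ev g w = h" using surj by auto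
   then have "F h = coxeter_rel S m `` {w}" using cls by simp
   then show "F h : carrier (coxeter_group S m)"
    using w(1) by (simp add: coxeter_group_def quotientI)
   fix k assume "k : carrier (comp_group H)"
   then obtain v where v: "v : lists S" "ev g v = k" using surj by auto
   have step: "coxeter_rel S m `` {a @ b} = F (h o k)" if "a : F h" "b : F k" for a b
   proof -
    have "a @ b : lists S" "ev g (a @ b) = h o k" using that by (auto simp: F_def ev_append)
    then show ?thesis using cls by simp
   qed
   have ne: "w : F h" "v : F k" using w v by (simp_all add: F_def)
   have "F h \<otimes>\<^bsub>coxeter_group S m\<^esub> F k = (\<Union>a\<in>F h. \<Union>b\<in>F k. coxeter_rel S m `` {a @ b})"
    by (simp add: coxeter_group_def)
   also have "\<dots> = F (h o k)"
   proof (intro equalityI subsetI)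
    fix x assume "x : (\<Union>a\<in>F h. \<Union>b\<in>F k. coxeter_rel S m `` {a @ b})"
    then obtain a b where ab: "a : F h" "b : F k" "x : coxeter_rel S m `` {a @ b}" by blast
    show "x : F (h o k)" using ab(3) unfolding step[OF ab(1,2)] .
   next
    fix x assume "x : F (h o k)"
    then have "x : coxeter_rel S m `` {w @ v}" unfolding step[OF ne] .
    then show "x : (\<Union>a\<in>F h. \<Union>b\<in>F k. coxeter_rel S m `` {a @ b})" using ne by blast
   qed
   finally show "F (h \<otimes>\<^bsub>comp_group H\<^esub> k) = F h \<otimes>\<^bsub>coxeter_group S m\<^esub> F k" by simp
  qed
  show "bij_betw F (carrier (comp_group H)) (carrier (coxeter_group S m))"
   unfolding bij_betw_def
  proof (intro conjI inj_onI equalityI subsetI)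
   fix h k assume hk: "h : carrier (comp_group H)" "F h = F k"
   then obtain w where "w : lists S" "ev g w = h" using surj by auto
   then have "w : F k" using hk(2) by (auto simp: F_def)
   then show "h = k" using \<open>ev g w = h\<close> by (simp add: F_def)
  next
   fix X assume "X : F ` carrier (comp_group H)"
   then obtain h where h: "h : H" "X = F h" by auto
   obtain w where w: "w : lists S" "ev g w = h" using surj[OF h(1)] by blast
   have "X = coxeter_rel S m `` {w}" unfolding h(2) cls[OF w(1)] w(2) ..
   then show "X : carrier (coxeter_group S m)" using w(1) by (simp add: coxeter_group_def quotientI)
  next
   fix X assume "X : carrier (coxeter_group S m)"
   then have "X : lists S // coxeter_rel S m" by (simp add: coxeter_group_def)
   then obtain u where u: "X = coxeter_rel S m `` {u}" "u : lists S" by (rule quotientE)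
   have "X = F (ev g u)" unfolding u(1) by (rule cls[OF u(2)])
   then show "X : F ` carrier (comp_group H)" using evH[OF u(2)] by simp
  qed
 qed
 then have "comp_group H \<cong> coxeter_group S m" by (auto simp: is_iso_def)
 then show ?thesis unfolding is_coxeter_group_def using S by blast
qed

lemma is_coxeter_group_iso:
 assumes "group G" "is_coxeter_group H" "f : iso G H" shows "is_coxeter_group G"
proof -
 obtain S :: "nat set" and m where *: "finite S" "coxeter_matrix S m" "H \<cong> coxeter_group S m"
  using assms(2) unfolding is_coxeter_group_def by blast
 have "G \<cong> H" using assms(3) by (auto simp: is_iso_def)
 then have "G \<cong> coxeter_group S m" using *(3) by (rule iso_trans)
 then show ?thesis using * unfolding is_coxeter_group_def by blast
qed

section \<open>Order at most 2, dihedral groups, and the symmetric group on four letters\<close>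

lemma is_coxeter_group_order_le_2:
 fixes H :: "('a => 'a) set"
 assumes H: "group (comp_group H)" and le: "H \<subseteq> {id, r}"
 shows "is_coxeter_group (comp_group H)"
proof -
 have id: "id : H" using monoid.one_closed[OF group.is_monoid[OF H]] by simp
 show ?thesis
 proof (cases "r : H & r ~= id")
  case False
  then have "H = {id}" using le id by blast
  then show ?thesis
   by (intro is_coxeter_groupI[where S = "{}" and m = "%_ _. 1" and g = "%_. id"] H)
    (auto simp: coxeter_matrix_def ev_Nil intro: coxeter_eq.refl)
 next
  case True
  have "r o r : H" using monoid.m_closed[OF group.is_monoid[OF H], of r r] True by simp
  moreover have "r o r ~= r"
  proof
   assume "r o r = r"
   then have "r = id" using group.l_cancel_one'[OF H, of r r] True by simp
   then show False using True by simp
  qed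
  ultimately have rr: "r o r = id" using le by blast
  have rr': "r (r x) = x" for x using fun_cong[OF rr, of x] by simp
  let ?S = "{0::nat}" and ?m = "%_ _. 1::nat" and ?g = "%_::nat. r"
  have S: "coxeter_eq ?S ?m [0, 0] []" using coxeter_eq.relator[of 0 ?S 0 ?m] by simp
  have nf: "coxeter_eq ?S ?m w [] | coxeter_eq ?S ?m w [0]" if "w : lists ?S" for w
   using that
  proof (induction w rule: list.induct)
   case (Cons s w)
   have s: "s = 0" using Cons.prems by simp
   have 0: "coxeter_eq ?S ?m [0] [0]" by (rule coxeter_eq.refl) simp
   have "coxeter_eq ?S ?m w [] | coxeter_eq ?S ?m w [0]" using Cons by simp
   then show ?case
   proof
    assume "coxeter_eq ?S ?m w []"
    from coxeter_eq.append[OF 0 this] show ?thesis using s by simp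
   next
    assume "coxeter_eq ?S ?m w [0]"
    from coxeter_eq.trans[OF coxeter_eq.append[OF 0 this]] S show ?thesis using s by simp
   qed
  qed (simp add: coxeter_eq.refl)
  have evs: "ev ?g [] = id" "ev ?g [0] = r" "ev ?g [0, 0] = id" by (simp_all add: ev_Nil ev_Cons rr)
  have sound: "coxeter_eq ?S ?m u v ==> ev ?g u = ev ?g v" for u v
  proof (induction rule: coxeter_eq.induct)
   case (relator s t)
   then show ?case using evs by simp
  qed (simp_all add: ev_append)
  show ?thesis
  proof (rule is_coxeter_groupI[where S = ?S and m = ?m and g = ?g])
   fix u v assume u: "u : lists ?S" and v: "v : lists ?S" and e: "ev ?g u = ev ?g v"
   have eqs: "ev ?g a = ev ?g b" if "coxeter_eq ?S ?m u a" "coxeter_eq ?S ?m v b" for a b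
    using sound[OF that(1)] sound[OF that(2)] e by simp
   have tr: "coxeter_eq ?S ?m u v" if "coxeter_eq ?S ?m u a" "coxeter_eq ?S ?m v a" for a
    by (rule coxeter_eq.trans[OF that(1) coxeter_eq.sym[OF that(2)]])
   show "coxeter_eq ?S ?m u v"
    using nf[OF u] nf[OF v] True evs eqs[of "[]" "[0]"] eqs[of "[0]" "[]"] tr[of "[]"] tr[of "[0]"] by auto
  next
   fix h assume "h : H"
   then have "h = id | h = r" using le by blast
   then show "EX w:lists ?S. ev ?g w = h"
   proof
    assume "h = id"
    then show ?thesis using evs(1) by (intro bexI[of _ "[]"]) simp_all
   next
    assume "h = r"
    then show ?thesis using evs(2) by (intro bexI[of _ "[0]"]) simp_all
   qed
  qed (use H True evs in \<open>auto simp: coxeter_matrix_def\<close>)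
 qed
qed

text \<open>The points \<open>u i\<close> are the vertices of a \<open>k\<close>-gon, on which
  \<open>H\<close> acts through the maps sending \<open>i\<close> to \<open>a + i\<close> or
  \<open>a - i\<close>. Normal forms are the powers of the rotation \<open>s o r\<close>, with or
  without a final \<open>r\<close>.\<close>

lemma is_coxeter_group_dihedral:
 fixes H :: "('a => 'a) set" and u :: "int => 'a" and k :: nat
 assumes H: "group (comp_group H)" and k: "k >= 3"
  and u: "!!i j. u i = u j \<longleftrightarrow> i mod int k = j mod int k"
  and r: "r : H" "!!i. r (u i) = u (- i)" and s: "s : H" "!!i. s (u i) = u (1 - i)"
  and dih: "!!h. h : H ==> EX a e. (e = 1 | e = - 1) & (ALL i. h (u i) = u (a + e * i))"
  and faithful: "!!h. h : H ==> h (u 0) = u 0 ==> h (u 1) = u 1 ==> h = id"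
 shows "is_coxeter_group (comp_group H)"
proof -
 let ?S = "{0, 1::nat}"
 define m where "m x y = (if x = y then 1 else k)" for x y :: nat
 define g where "g x = (if x = 0 then r else s)" for x :: nat
 \<comment> \<open>The word \<open>[1, 0]\<close> acts as the rotation by one step.\<close>
 let ?R = "%j. concat (replicate j [1, 0::nat])"
 let ?eq = "coxeter_eq ?S m"
 have eqI: "h = h'" if hh: "h : H" "h' : H" "h (u 0) = h' (u 0)" "h (u 1) = h' (u 1)" for h h'
 proof -
  have h': "h' : carrier (comp_group H)" using hh(2) by simp
  define q where "q = inv\<^bsub>comp_group H\<^esub> h'"
  have q: "q : H" "q o h' = id" "h' o q = id"
   using group.inv_closed[OF H h'] group.l_inv[OF H h'] group.r_inv[OF H h'] by (simp_all add: q_def)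
  have qh': "q (h' x) = x" "h' (q x) = x" for x using fun_cong[OF q(2), of x] fun_cong[OF q(3), of x] by simp_all
  have "q o h : H" using monoid.m_closed[OF group.is_monoid[OF H], of q h] q(1) hh(1) by simp
  then have "q o h = id" by (rule faithful) (simp_all add: hh(3,4) qh')
  then have "q (h x) = x" for x by (simp add: fun_eq_iff)
  then have "h' (q (h x)) = h' x" for x by simp
  then show ?thesis by (simp add: fun_eq_iff qh')
 qed
 have gH: "g x : H" for x using r s by (simp add: g_def)
 have id: "id : H" using monoid.one_closed[OF group.is_monoid[OF H]] by simp
 have evH: "ev g w : H" for w
 proof (induction w)
  case (Cons x w)
  then show ?case using monoid.m_closed[OF group.is_monoid[OF H], of "g x" "ev g w"] gH
   unfolding ev_Cons comp_group_simps by blast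
 next
  case Nil
  show ?case unfolding ev_Nil by (rule id)
 qed
 have evR: "ev g (?R j) (u i) = u (i + int j)" for i j
  by (induction j) (simp_all add: ev_Nil ev_Cons_apply g_def r s algebra_simps)
 have evR': "ev g (concat (replicate j [0, 1])) (u i) = u (i - int j)" for i j
  by (induction j) (simp_all add: ev_Nil ev_Cons_apply g_def r s algebra_simps)
 have evR0: "ev g (?R j @ [0]) (u i) = u (int j - i)" for i j
  by (simp add: ev_append ev_Cons_apply ev_Nil evR g_def r)
 have uk: "u (i + int k) = u i" "u (i - int k) = u i" for i by (simp_all add: u)
 have rel: "ev g (concat (replicate (m x y) [x, y])) = id" if "x : ?S" "y : ?S" for x y
 proof (rule eqI[OF evH id])
  have "ev g (concat (replicate (m x y) [x, y])) (u i) = u i" for i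
  proof -
   consider "x = y" | "x = 1" "y = 0" | "x = 0" "y = 1" using \<open>x : ?S\<close> \<open>y : ?S\<close> by auto
   then show ?thesis
   proof cases
    case 1
    then show ?thesis by (simp add: m_def ev_Nil ev_Cons_apply g_def r s)
   next
    case 2
    then show ?thesis using evR[of k i] uk by (simp add: m_def)
   next
    case 3
    then show ?thesis using evR'[of k i] uk by (simp add: m_def)
   qed
  qed
  then show "ev g (concat (replicate (m x y) [x, y])) (u 0) = id (u 0)"
   "ev g (concat (replicate (m x y) [x, y])) (u 1) = id (u 1)" by simp_all
 qed
 have Rl: "?R j : lists ?S" for j by (rule concat_replicate_lists) auto
 have ref: "?eq w w" if "w : lists ?S" for w using that by (rule coxeter_eq.refl)
 have app: "?eq (a @ x @ b) (a @ y @ b)" if "?eq x y" "a : lists ?S" "b : lists ?S" for a b x y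
  by (rule coxeter_eq.append[OF ref[OF that(2)] coxeter_eq.append[OF that(1) ref[OF that(3)]]])
 have c00: "?eq [0, 0] []" and c11: "?eq [1, 1] []"
  using coxeter_eq.relator[of 0 ?S 0 m] coxeter_eq.relator[of 1 ?S 1 m] by (simp_all add: m_def)
 have Rk: "?eq (?R k) []"
  using coxeter_eq.relator[of 1 ?S 0 m] by (simp add: m_def)
 have Radd: "?R (i + j) = ?R i @ ?R j" for i j by (simp add: replicate_add)
 have Rsuc: "?R (Suc j) = ?R j @ [1, 0]" for j unfolding Suc_eq_plus1 Radd by simp
 have Rper: "?eq (?R (j + k)) (?R j)" for j
  using app[OF Rk Rl[of j], of "[]"] by (simp add: Radd)
 have Rmod: "?eq (?R j) (?R (j mod k))" for j
 proof (induction j rule: less_induct)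
  case (less j)
  show ?case
  proof (cases "j < k")
   case True
   then show ?thesis using ref[OF Rl] by simp
  next
   case False
   then have 1: "?eq (?R j) (?R (j - k))" using Rper[of "j - k"] by simp
   have "?eq (?R (j - k)) (?R ((j - k) mod k))" by (rule less) (use False k in simp)
   from coxeter_eq.trans[OF 1 this] show ?thesis using False by (simp add: le_mod_geq)
  qed
 qed
 have Rcong: "?eq (?R i) (?R j)" if "i mod k = j mod k" for i j
 proof -
  have "?eq (?R i) (?R (j mod k))" using Rmod[of i] that by simp
  from coxeter_eq.trans[OF this coxeter_eq.sym[OF Rmod[of j]]] show ?thesis .
 qed
 have nf: "EX j. ?eq w (?R j) | ?eq w (?R j @ [0])" if "w : lists ?S" for w
  using that
 proof (induction w rule: rev_induct)
  case Nil
  show ?case by (rule exI[of _ 0]) (simp add: ref)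
 next
  case (snoc x w)
  have x: "x = 0 | x = 1" and w: "w : lists ?S" using snoc.prems by auto
  have x': "?eq [x] [x]" using x by (intro ref) auto
  obtain j where "?eq w (?R j) | ?eq w (?R j @ [0])" using snoc.IH[OF w] by blast
  then show ?case
  proof
   assume "?eq w (?R j)"
   then have e: "?eq (w @ [x]) (?R j @ [x])" by (rule coxeter_eq.append[OF _ x'])
   show ?thesis
   proof (cases "x = 0")
    case True
    then show ?thesis using e by blast
   next
    case False
    then have x1: "x = 1" using x by simp
    have "?R j @ [1] : lists ?S" "[] : lists ?S" using Rl[of j] by simp_all
    then have "?eq ((?R j @ [1]) @ [0, 0] @ []) ((?R j @ [1]) @ [] @ [])" by (rule app[OF c00])
    moreover have "?R (Suc j) @ [0] = (?R j @ [1]) @ [0, 0] @ []" unfolding Rsuc by simp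
    ultimately have "?eq (?R (Suc j) @ [0]) (?R j @ [1])" by simp
    from coxeter_eq.trans[OF e[unfolded x1] coxeter_eq.sym[OF this]] show ?thesis
     unfolding x1 by blast
   qed
  next
   assume "?eq w (?R j @ [0])"
   then have e: "?eq (w @ [x]) ((?R j @ [0]) @ [x])" by (rule coxeter_eq.append[OF _ x'])
   show ?thesis
   proof (cases "x = 0")
    case True
    have 1: "?eq (?R j @ [0, 0]) (?R j)" using app[OF c00 Rl[of j], of "[]"] by simp
    have "?eq (w @ [x]) (?R j @ [0, 0])" using e True by simp
    from coxeter_eq.trans[OF this 1] show ?thesis by blast
   next
    case False
    then have x1: "x = 1" using x by simp
    \<comment> \<open>Appending \<open>[0, 1]\<close> turns back by one step. Adding a full period
      first keeps the exponent a natural number when \<open>j\<close> is 0.\<close>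
    define i where "i = j + k - 1"
    have i: "Suc i = j + k" using k by (simp add: i_def)
    have l01: "[0, 1] : lists ?S" by simp
    have 1: "?eq (?R (j + k) @ [0, 1]) (?R j @ [0, 1])" by (rule coxeter_eq.append[OF Rper ref[OF l01]])
    have "?R i @ [1] : lists ?S" "[1] : lists ?S" using Rl[of i] by simp_all
    then have "?eq ((?R i @ [1]) @ [0, 0] @ [1]) ((?R i @ [1]) @ [] @ [1])" by (rule app[OF c00])
    moreover have "?R (j + k) @ [0, 1] = (?R i @ [1]) @ [0, 0] @ [1]" unfolding i[symmetric] Rsuc by simp
    ultimately have 2: "?eq (?R (j + k) @ [0, 1]) (?R i @ [1, 1])" by simp
    have 3: "?eq (?R i @ [1, 1]) (?R i)" using app[OF c11 Rl[of i], of "[]"] by simp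
    have "?eq (w @ [x]) (?R j @ [0, 1])" using e x1 by simp
    from coxeter_eq.trans[OF coxeter_eq.trans[OF this coxeter_eq.sym[OF 1]] coxeter_eq.trans[OF 2 3]]
    show ?thesis by blast
   qed
  qed
 qed
 have sound: "?eq v w ==> ev g v = ev g w" for v w
 proof (induction rule: coxeter_eq.induct)
  case (relator x y)
  then show ?case by (simp only: rel ev_Nil)
 qed (simp_all add: ev_append)
 have imod: "i mod k = j mod k" if "int i mod int k = int j mod int k" for i j :: nat
  using that unfolding of_nat_mod[symmetric] by (simp only: of_nat_eq_iff)
 have RR: "?eq (?R i) (?R j)" if "ev g (?R i) = ev g (?R j)" for i j
 proof -
  have "u (0 + int i) = u (0 + int j)" unfolding evR[symmetric] that ..
  then have "int i mod int k = int j mod int k" by (simp add: u)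
  then show ?thesis by (intro Rcong imod)
 qed
 have RR0: "?eq (?R i @ [0]) (?R j @ [0])" if "ev g (?R i @ [0]) = ev g (?R j @ [0])" for i j
 proof -
  have "u (int i - 0) = u (int j - 0)" unfolding evR0[symmetric] that ..
  then have "int i mod int k = int j mod int k" by (simp add: u)
  then have "?eq (?R i) (?R j)" by (intro Rcong imod)
  then show ?thesis by (rule coxeter_eq.append) (rule ref, simp)
 qed
 \<comment> \<open>A rotation agreeing with a reflection at both 0 and 1 would force
   \<open>k\<close> to divide 2.\<close>
 have RR1: False if "ev g (?R i) = ev g (?R j @ [0])" for i j
 proof -
  have "u (0 + int i) = u (int j - 0)" "u (1 + int i) = u (int j - 1)"
   unfolding evR[symmetric] evR0[symmetric] that by (rule HOL.refl)+
  then have "int k dvd int i - int j" "int k dvd (1 + int i) - (int j - 1)"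
   by (simp_all add: u mod_eq_dvd_iff)
  then have "int k dvd ((1 + int i) - (int j - 1)) - (int i - int j)" by (rule dvd_diff[rotated])
  then have "int k dvd 2" by simp
  then show False using k zdvd_imp_le by fastforce
 qed
 show ?thesis
 proof (rule is_coxeter_groupI[where S = ?S and m = m and g = g])
  fix v w assume v: "v : lists ?S" and w: "w : lists ?S" and e: "ev g v = ev g w"
  obtain i where i: "?eq v (?R i) | ?eq v (?R i @ [0])" using nf[OF v] by blast
  obtain j where j: "?eq w (?R j) | ?eq w (?R j @ [0])" using nf[OF w] by blast
  have "?eq a b" if ab: "?eq v a" "?eq w b" "a = ?R i | a = ?R i @ [0]" "b = ?R j | b = ?R j @ [0]" for a b
  proof -
   have "ev g a = ev g b" using sound[OF ab(1)] sound[OF ab(2)] e by simp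
   then show ?thesis using ab(3,4) RR[of i j] RR0[of i j] RR1[of i j] RR1[of j i] by auto
  qed
  note ab = this
  have "?eq v w" if "?eq v a" "?eq w b" "a = ?R i | a = ?R i @ [0]" "b = ?R j | b = ?R j @ [0]" for a b
   by (rule coxeter_eq.trans[OF coxeter_eq.trans[OF that(1) ab[OF that]] coxeter_eq.sym[OF that(2)]])
  then show "?eq v w" using i j by blast
 next
  fix h assume h: "h : H"
  then obtain a e where ae: "e = 1 | e = - 1" "!!i. h (u i) = u (a + e * i)" using dih by blast
  define j where "j = nat (a mod int k)"
  have j: "int j = a mod int k" using k by (simp add: j_def)
  show "EX w:lists ?S. ev g w = h"
  proof (cases "e = 1")
   case True
   have "ev g (?R j) (u i) = h (u i)" for i
    unfolding evR ae(2) u j True by (simp add: mod_simps add.commute)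
   then have "ev g (?R j) = h" by (intro eqI evH h) auto
   then show ?thesis using Rl by blast
  next
   case False
   have "ev g (?R j @ [0]) (u i) = h (u i)" for i
    unfolding evR0 ae(2) u j using False ae(1) by (simp add: mod_simps)
   then have "ev g (?R j @ [0]) = h" by (intro eqI evH h) auto
   moreover have "?R j @ [0] : lists ?S" using Rl by simp
   ultimately show ?thesis by blast
  qed
 qed (use H gH rel k in \<open>auto simp: coxeter_matrix_def m_def\<close>)
qed

text \<open>The letter \<open>s\<close> acts as the transposition of \<open>s\<close> and
  \<open>s + 1\<close>, the rightmost letter first as in \<open>ev\<close>.\<close>

fun sym4_act :: "nat list => nat => nat" where
 "sym4_act [] i = i"
| "sym4_act (s # w) i = (let j = sym4_act w i in if j = s then Suc s else if j = Suc s then s else j)"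

text \<open>The 24 normal forms, built from coset representatives along the chain of symmetric
  groups on 2, 3 and 4 letters.\<close>

definition sym4_words :: "nat list list" where
 "sym4_words = [x @ y @ z. x \<leftarrow> [[], [0]], y \<leftarrow> [[], [1], [1, 0]], z \<leftarrow> [[], [2], [2, 1], [2, 1, 0]]]"

lemma sym4_words_distinct: "distinct (map (%w. map (sym4_act w) [0,1,2,3]) sym4_words)"
 by code_simp

lemma comp_group_eqI:
 assumes H: "group (comp_group H)" and h: "h : H" "h' : H"
  and faithful: "!!h. h : H ==> (!!x. x : X ==> h x = x) ==> h = id"
  and eq: "!!x. x : X ==> h x = h' x"
 shows "h = h'"
proof -
 have h': "h' : carrier (comp_group H)" using h(2) by simp
 define q where "q = inv\<^bsub>comp_group H\<^esub> h'"
 have q: "q : H" "q o h' = id" "h' o q = id"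
  using group.inv_closed[OF H h'] group.l_inv[OF H h'] group.r_inv[OF H h'] by (simp_all add: q_def)
 have qh': "q (h' x) = x" "h' (q x) = x" for x using fun_cong[OF q(2), of x] fun_cong[OF q(3), of x] by simp_all
 have "q o h : H" using monoid.m_closed[OF group.is_monoid[OF H], of q h] q(1) h(1) by simp
 then have "q o h = id" by (rule faithful) (simp add: eq qh')
 then have "q (h x) = x" for x by (simp add: fun_eq_iff)
 then have "h' (q (h x)) = h' x" for x by simp
 then show ?thesis by (simp add: fun_eq_iff qh')
qed

definition sym4_matrix :: "nat => nat => nat" where
 "sym4_matrix x y = (if x = y then 1 else if x + 2 = y | y + 2 = x then 2 else 3)"

lemma sym4_relators:
 "list_all (%x. list_all (%y. map (sym4_act (concat (replicate (sym4_matrix x y) [x, y]))) [0,1,2,3] = [0,1,2,3])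
  [0,1,2]) [0,1,2]"
 by code_simp

lemma sym4_words_complete':
 "list_all (%a. list_all (%b. list_all (%c. list_all (%d. distinct [a, b, c, d] -->
  [a, b, c, d] : set (map (%w. map (sym4_act w) [0,1,2,3]) sym4_words))
  [0,1,2,3]) [0,1,2,3]) [0,1,2,3]) [0,1,2,3]"
 by code_simp

lemma sym4_act_less: "set w \<subseteq> {0,1,2} ==> i < 4 ==> sym4_act w i < 4"
 by (induction w) (auto simp: Let_def)

text \<open>A new letter on the right is pushed leftwards through the three factors: it passes
  \<open>z\<close> as 0 or 1 or disappears, then passes \<open>y\<close> as 0 or disappears, and is
  absorbed by \<open>x\<close>.\<close>

lemma sym4_normal_form:
 assumes "w : lists {0,1,2}"
 shows "EX l:set sym4_words. coxeter_eq {0,1,2} sym4_matrix w l"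
proof -
 let ?S = "{0,1,2::nat}" and ?m = sym4_matrix
 let ?eq = "coxeter_eq ?S ?m"
 let ?X = "{[], [0::nat]}" and ?Y = "{[], [1], [1, 0::nat]}" and ?Z = "{[], [2], [2, 1], [2, 1, 0::nat]}"
 have ref: "?eq w w" if "set w \<subseteq> ?S" for w using that by (intro coxeter_eq.refl) auto
 have app: "?eq (a @ x @ b) (a @ y @ b)" if "?eq x y" "set a \<subseteq> ?S" "set b \<subseteq> ?S" for a b x y
  by (rule coxeter_eq.append[OF ref[OF that(2)] coxeter_eq.append[OF that(1) ref[OF that(3)]]])
 have tr: "?eq a c" if "?eq a b" "?eq b c" for a b c by (rule coxeter_eq.trans[OF that])
 have sq: "?eq [s, s] []" if "s : ?S" for s
  using coxeter_eq.relator[OF that that, of ?m] by (simp add: sym4_matrix_def)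
 \<comment> \<open>Modulo the congruence both \<open>x\<close> and \<open>y'\<close> are inverse to
   \<open>y\<close>. This turns the relators of length 4 and 6 into the commutation and braid
   relations.\<close>
 have inv: "?eq x y'" if "?eq (x @ y) []" "?eq (y @ y') []" "set x \<subseteq> ?S" "set y' \<subseteq> ?S" for x y y'
 proof -
  have "?eq (x @ y @ y') (x @ [])" using app[OF that(2,3), of "[]"] by simp
  moreover have "?eq ((x @ y) @ y') ([] @ y')" by (rule coxeter_eq.append[OF that(1) ref[OF that(4)]])
  ultimately show ?thesis using coxeter_eq.trans[OF coxeter_eq.sym] by simp
 qed
 have pal: "?eq [a, b, b, a] []" if "a : ?S" "b : ?S" for a b
  using tr[OF _ sq[OF that(1)], of "[a, b, b, a]"] app[OF sq[OF that(2)], of "[a]" "[a]"] that by simp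
 have pal3: "?eq [a, b, a, a, b, a] []" if "a : ?S" "b : ?S" for a b
  using tr[OF _ pal[OF that], of "[a, b, a, a, b, a]"] app[OF sq[OF that(1)], of "[a, b]" "[b, a]"] that by simp
 have c: "?eq [2, 0] [0, 2]"
 proof (rule inv[where y = "[2, 0]"])
  show "?eq ([2, 0] @ [2, 0]) []"
   using coxeter_eq.relator[of 2 ?S 0 ?m] by (simp add: sym4_matrix_def numeral_2_eq_2)
  show "?eq ([2, 0] @ [0, 2]) []" using pal[of 2 0] by simp
 qed auto
 have braid: "?eq [a, b, a] [b, a, b]" if "a : ?S" "b : ?S" "?m a b = 3" for a b
 proof (rule inv[where y = "[b, a, b]"])
  show "?eq ([a, b, a] @ [b, a, b]) []"
   using coxeter_eq.relator[OF that(1,2), of ?m] by (simp add: that(3) numeral_3_eq_3)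
  show "?eq ([b, a, b] @ [b, a, b]) []" using pal3[OF that(2,1)] by simp
 qed (use that in auto)
 have b1: "?eq [1, 0, 1] [0, 1, 0]" and b2: "?eq [2, 1, 2] [1, 2, 1]"
  by (rule braid; simp add: sym4_matrix_def)+
 have z1: "?eq [2, 2] []" "?eq [2, 1, 1] [2]" "?eq [2, 1, 0, 0] [2, 1]"
  using sq[of 2] app[OF sq[of 1], of "[2]" "[]"] app[OF sq[of 0], of "[2, 1]" "[]"] by simp_all
 have z2: "?eq [2, 1, 0, 1] [0, 2, 1, 0]"
  using tr[OF app[OF b1, of "[2]" "[]"] ] app[OF c, of "[]" "[1, 0]"] by simp
 have z3: "?eq [2, 1, 0, 2] [1, 2, 1, 0]"
  using tr[OF app[OF coxeter_eq.sym[OF c], of "[2, 1]" "[]"]] app[OF b2, of "[]" "[0]"] by simp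
 have L1: "EX p:{[], [0], [1]}. EX z':?Z. ?eq (z @ [s]) (p @ z')" if "z : ?Z" "s : ?S" for z s
  using that ref[of "[0]"] ref[of "[1]"] ref[of "[2]"] ref[of "[2, 1]"] ref[of "[2, 1, 0]"] z1 z2 z3 b2 c
  by auto
 have y1: "?eq [1, 1] []" "?eq [1, 0, 0] [1]"
  using sq[of 1] app[OF sq[of 0], of "[1]" "[]"] by simp_all
 have L2: "EX q:?X. EX y':?Y. ?eq (y @ p) (q @ y')" if "y : ?Y" "p : {[], [0], [1]}" for y p
  using that ref[of "[]"] ref[of "[0]"] ref[of "[1]"] ref[of "[1, 0]"] y1 b1 by auto
 have L3: "EX x':?X. ?eq (x @ q) x'" if "x : ?X" "q : ?X" for x q
  using that ref[of "[]"] ref[of "[0]"] sq[of 0] by auto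

 have "EX x:?X. EX y:?Y. EX z:?Z. ?eq w (x @ y @ z)"
  using assms
 proof (induction w rule: rev_induct)
  case Nil
  show ?case using ref[of "[]"] by auto
 next
  case (snoc s w)
  have s: "s : ?S" and w: "w : lists ?S" using snoc.prems by simp_all
  obtain x y z where xyz: "x : ?X" "y : ?Y" "z : ?Z" "?eq w (x @ y @ z)"
   using snoc.IH[OF w] by (elim bexE) (rule that)
  obtain p z' where p: "p : {[], [0], [1]}" "z' : ?Z" "?eq (z @ [s]) (p @ z')"
   using L1[OF xyz(3) s] by (elim bexE) (rule that)
  obtain q y' where q: "q : ?X" "y' : ?Y" "?eq (y @ p) (q @ y')"
   using L2[OF xyz(2) p(1)] by (elim bexE) (rule that)
  obtain x' where x': "x' : ?X" "?eq (x @ q) x'"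
   using L3[OF xyz(1) q(1)] by (elim bexE) (rule that)
  have ss: "set [s] \<subseteq> ?S" using s by simp
  have "?eq (w @ [s]) ((x @ y @ z) @ [s])" by (rule coxeter_eq.append[OF xyz(4) ref[OF ss]])
  then have e1: "?eq (w @ [s]) (x @ y @ z @ [s])" by simp
  have sx: "set x \<subseteq> ?S" and sy: "set y \<subseteq> ?S" and sz: "set z' \<subseteq> ?S" and sy': "set y' \<subseteq> ?S"
   using xyz(1,2) p(2) q(2) by auto
  have "?eq ((x @ y) @ (z @ [s]) @ []) ((x @ y) @ (p @ z') @ [])"
   by (rule app[OF p(3)]) (use sx sy in simp_all)
  then have e2: "?eq (x @ y @ z @ [s]) (x @ y @ p @ z')" by simp
  have "?eq (x @ (y @ p) @ z') (x @ (q @ y') @ z')" by (rule app[OF q(3) sx sz])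
  then have e3: "?eq (x @ y @ p @ z') (x @ q @ y' @ z')" by simp
  have "?eq ([] @ (x @ q) @ (y' @ z')) ([] @ x' @ (y' @ z'))"
   by (rule app[OF x'(2)]) (use sy' sz in simp_all)
  then have e4: "?eq (x @ q @ y' @ z') (x' @ y' @ z')" by simp
  have "?eq (w @ [s]) (x' @ y' @ z')" by (rule tr[OF tr[OF tr[OF e1 e2] e3] e4])
  then show ?case by (rule bexI[OF bexI[OF bexI[OF _ p(2)] q(2)] x'(1)])
 qed
 then obtain x y z where *: "x : ?X" "y : ?Y" "z : ?Z" "?eq w (x @ y @ z)"
  by (elim bexE) (rule that)
 have "x @ y @ z : set sym4_words" using *(1-3) by (auto simp: sym4_words_def)
 then show ?thesis using *(4) by (rule bexI[rotated])
qed

lemma sym4_words_lists: "w : set sym4_words ==> w : lists {0,1,2}"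
 by (auto simp: sym4_words_def)

lemma is_coxeter_group_sym4:
 fixes H :: "('a => 'a) set" and u :: "nat => 'a"
 assumes H: "group (comp_group H)" and u: "inj_on u {..<4}"
  and g: "!!s. s < 3 ==> g s : H" "!!s i. s < 3 ==> i < 4 ==> g s (u i) = u (sym4_act [s] i)"
  and perm: "!!h i. h : H ==> i < 4 ==> EX j<4. h (u i) = u j" and inj: "!!h. h : H ==> inj h"
  and faithful: "!!h. h : H ==> (!!i. i < 4 ==> h (u i) = u i) ==> h = id"
 shows "is_coxeter_group (comp_group H)"
proof -
 let ?S = "{0,1,2::nat}" and ?m = sym4_matrix
 let ?eq = "coxeter_eq ?S ?m"
 have eqI: "h = h'" if "h : H" "h' : H" "!!i. i < 4 ==> h (u i) = h' (u i)" for h h'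
  by (rule comp_group_eqI[OF H that(1,2), of "u ` {..<4}"]) (use that(3) faithful in auto)
 have id: "id : H" using monoid.one_closed[OF group.is_monoid[OF H]] by simp
 have evH: "ev g w : H" if "w : lists ?S" for w
  using that
 proof (induction w rule: list.induct)
  case (Cons x w)
  then have "g x : H" "ev g w : H" using g(1)[of x] by auto
  then show ?case using monoid.m_closed[OF group.is_monoid[OF H], of "g x" "ev g w"]
   unfolding ev_Cons comp_group_simps by blast
 next
  case Nil
  show ?case unfolding ev_Nil by (rule id)
 qed
 have evu: "ev g w (u i) = u (sym4_act w i)" if "w : lists ?S" "i < 4" for w i
  using that(1)
 proof (induction w rule: list.induct)
  case (Cons x w)
  then have x: "x < 3" and w: "set w \<subseteq> ?S" and IH: "ev g w (u i) = u (sym4_act w i)" by auto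
  have "g x (u (sym4_act w i)) = u (sym4_act [x] (sym4_act w i))"
   by (rule g(2)[OF x sym4_act_less[OF w that(2)]])
  then show ?case by (simp add: ev_Cons_apply IH Let_def)
 qed (simp add: ev_Nil)
 have less4: "i = 0 | i = 1 | i = 2 | i = 3" if "i < 4" for i :: nat using that by linarith
 have rel: "ev g (concat (replicate (?m x y) [x, y])) = id" if "x : ?S" "y : ?S" for x y
 proof (rule eqI[OF evH[OF concat_replicate_lists[OF that]] id])
  fix i :: nat assume i: "i < 4"
  have "x : set [0,1,2]" "y : set [0,1,2]" using that by auto
  then have "map (sym4_act (concat (replicate (?m x y) [x, y]))) [0,1,2,3] = [0,1,2,3]"
   by (rule sym4_relators[unfolded list_all_iff, rule_format])
  then have "sym4_act (concat (replicate (?m x y) [x, y])) i = i" using less4[OF i] by auto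
  then show "ev g (concat (replicate (?m x y) [x, y])) (u i) = id (u i)"
   using evu[OF concat_replicate_lists[OF that] i] by simp
 qed
 have sound: "?eq v w ==> ev g v = ev g w" for v w
 proof (induction rule: coxeter_eq.induct)
  case (relator x y)
  then show ?case by (simp only: rel ev_Nil)
 qed (simp_all add: ev_append)
 have nf_inj: "v = w" if vw: "v : set sym4_words" "w : set sym4_words" "ev g v = ev g w" for v w
 proof -
  have l: "v : lists ?S" "w : lists ?S" using sym4_words_lists vw by blast+
  have l': "set v \<subseteq> ?S" "set w \<subseteq> ?S" using l by (auto simp: in_lists_conv_set)
  have "sym4_act v i = sym4_act w i" if i: "i < 4" for i
  proof -
   have "u (sym4_act v i) = u (sym4_act w i)"
    using evu[OF l(1) i] evu[OF l(2) i] vw(3) by simp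
   then show ?thesis
    by (rule inj_onD[OF u]) (simp_all add: sym4_act_less[OF l'(1) i] sym4_act_less[OF l'(2) i])
  qed
  then have m: "map (sym4_act v) [0,1,2,3] = map (sym4_act w) [0,1,2,3]" by simp
  have io: "inj_on (%w. map (sym4_act w) [0,1,2,3]) (set sym4_words)"
   using sym4_words_distinct by (simp only: distinct_map)
  show ?thesis by (rule inj_onD[OF io m vw(1,2)])
 qed
 show ?thesis
 proof (rule is_coxeter_groupI[where S = ?S and m = ?m and g = g])
  fix v w assume v: "v : lists ?S" and w: "w : lists ?S" and e: "ev g v = ev g w"
  obtain a where a: "a : set sym4_words" "?eq v a" using sym4_normal_form[OF v] by blast
  obtain b where b: "b : set sym4_words" "?eq w b" using sym4_normal_form[OF w] by blast
  have "a = b" using nf_inj[OF a(1) b(1)] sound[OF a(2)] sound[OF b(2)] e by simp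
  then show "?eq v w" using coxeter_eq.trans[OF a(2)] coxeter_eq.sym[OF b(2)] by simp
 next
  fix h assume h: "h : H"
  have "ALL i:{..<4}. EX j. j < 4 & h (u i) = u j" using perm[OF h] by blast
  from bchoice[OF this] obtain ta where ta: "ALL i:{..<4::nat}. ta i < 4 & h (u i) = u (ta i)" ..
  have inj_ta: "ta i ~= ta j" if "i < 4" "j < 4" "i ~= j" for i j
  proof
   assume "ta i = ta j"
   then have "h (u i) = h (u j)" using ta that by simp
   then have "u i = u j" using inj[OF h] by (simp add: inj_eq)
   then show False using inj_onD[OF u, of i j] that by simp
  qed
  have d: "distinct [ta 0, ta 1, ta 2, ta 3]"
   using inj_ta[of 0 1] inj_ta[of 0 2] inj_ta[of 0 3] inj_ta[of 1 2] inj_ta[of 1 3] inj_ta[of 2 3] by auto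
  have r: "ta i : set [0,1,2,3]" if "i < 4" for i using ta that less4[of "ta i"] by auto
  have r4: "ta 0 : set [0,1,2,3]" "ta 1 : set [0,1,2,3]" "ta 2 : set [0,1,2,3]" "ta 3 : set [0,1,2,3]"
   by (rule r; simp)+
  have "[ta 0, ta 1, ta 2, ta 3] : set (map (%w. map (sym4_act w) [0,1,2,3]) sym4_words)"
   by (rule sym4_words_complete'[unfolded list_all_iff, rule_format, OF r4 d])
  then obtain w where w: "[ta 0, ta 1, ta 2, ta 3] = map (sym4_act w) [0,1,2,3]" "w : set sym4_words"
   unfolding set_map by (rule imageE)
  note w = w(2,1)
  have "sym4_act w i = ta i" if "i < 4" for i using less4[OF that] w(2) by auto
  then have "ev g w = h"
   using evu[OF sym4_words_lists[OF w(1)]] ta by (intro eqI evH sym4_words_lists[OF w(1)] h) auto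
  then show "EX w:lists ?S. ev g w = h" using sym4_words_lists[OF w(1)] by blast
 qed (use H g rel in \<open>auto simp: coxeter_matrix_def sym4_matrix_def\<close>)
qed

section \<open>Diagram automorphisms of an affine diagram\<close>

text \<open>A weak form of the classification of affine diagrams, carried out on their nodes as vectors:
  a subdiagram supporting a weight that is at least half the sum of its neighbours' weights,
  taken at each node, must already be the whole diagram.\<close>

locale affine_nodes =
 fixes B :: "'a::euclidean_space set" and m :: "'a => real"
 assumes finite_B: "finite B" and zero_notin_B: "0 ~: B" and card_B: "card B >= 2"
  and m_pos: "!!x. x : B ==> m x > 0"
  and m_rel: "(\<Sum>x\<in>B. m x *\<^sub>R x) = 0"
  and m_unique: "!!d. (\<Sum>x\<in>B. d x *\<^sub>R x) = 0 ==> EX t. ALL x:B. d x = t * m x"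
  and nonpos: "!!x y. x : B ==> y : B ==> x ~= y ==> x \<bullet> y <= 0"
  and cartan: "!!x y. x : B ==> y : B ==> 2 * (x \<bullet> y) / (y \<bullet> y) : \<int>"
begin

definition adj :: "'a => 'a => bool" where
 "adj x y \<longleftrightarrow> x : B & y : B & x ~= y & x \<bullet> y ~= 0"

text \<open>Permutations of the nodes are extended by the identity, so that they form a group of
  maps of the whole space under composition.\<close>

definition Aut :: "('a => 'a) set" where
 "Aut = {p. bij_betw p B B & (ALL x. x ~: B --> p x = x) & (ALL x:B. ALL y:B. p x \<bullet> p y = x \<bullet> y)}"

lemma adj_commute: "adj x y \<longleftrightarrow> adj y x"
 by (auto simp: adj_def inner_commute)

lemma adj_in: "adj x y ==> x : B" "adj x y ==> y : B" "adj x y ==> x ~= y"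
 by (auto simp: adj_def)

lemma norm_pos: "x : B ==> norm x > 0" and inner_pos: "x : B ==> x \<bullet> x > 0"
 using zero_notin_B by (auto simp: inner_gt_zero_iff)

lemma AutD:
 assumes "p : Aut"
 shows "x : B ==> p x : B" "x : B ==> y : B ==> p x \<bullet> p y = x \<bullet> y" "x ~: B ==> p x = x" "inj p"
  "y : B ==> EX x:B. p x = y"
proof -
 have b: "bij_betw p B B" and out: "!!x. x ~: B ==> p x = x" using assms by (auto simp: Aut_def)
 show in_B: "x : B ==> p x : B" for x using b by (auto simp: bij_betw_def)
 show "x : B ==> y : B ==> p x \<bullet> p y = x \<bullet> y" using assms by (auto simp: Aut_def)
 show "x ~: B ==> p x = x" by (rule out)
 show "EX x:B. p x = y" if "y : B"
 proof -
  have "y : p ` B" using b that by (simp add: bij_betw_def)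
  then show ?thesis by blast
 qed
 show "inj p"
 proof (rule injI)
  fix x y assume e: "p x = p y"
  show "x = y"
  proof (cases "x : B & y : B")
   case True
   then show ?thesis using b e by (auto simp: bij_betw_def dest: inj_onD)
  next
   case False
   then show ?thesis using e out in_B by metis
  qed
 qed
qed

lemma adj_Aut: "p : Aut ==> x : B ==> y : B ==> adj (p x) (p y) \<longleftrightarrow> adj x y"
 using AutD[of p] by (auto simp: adj_def inj_eq)

lemma group_Aut: "group (comp_group Aut)"
proof (rule group_comp_group)
 show "id : Aut" by (simp add: Aut_def)
next
 fix p q assume p: "p : Aut" and q: "q : Aut"
 have "bij_betw (p o q) B B" using p q by (auto simp: Aut_def intro: bij_betw_trans)
 then show "p o q : Aut" using AutD[OF p] AutD[OF q] by (auto simp: Aut_def)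
next
 fix p assume p: "p : Aut"
 have b: "bij_betw p B B" using p by (simp add: Aut_def)
 define q where "q x = (if x : B then the_inv_into B p x else x)" for x
 have bq: "bij_betw (the_inv_into B p) B B" by (rule bij_betw_the_inv_into[OF b])
 then have bq': "bij_betw q B B" by (rule bij_betw_cong[THEN iffD1, rotated]) (simp add: q_def)
 have qp: "q (p x) = x" for x
 proof (cases "x : B")
  case True
  then show ?thesis using AutD(1)[OF p True] b by (simp add: q_def bij_betw_def the_inv_into_f_f)
 qed (simp add: q_def AutD(3)[OF p])
 have "q x \<bullet> q y = x \<bullet> y" if xy: "x : B" "y : B" for x y
 proof -
  obtain x' y' where "x' : B" "p x' = x" "y' : B" "p y' = y" using AutD(5)[OF p] xy by metis
  then show ?thesis using AutD(2)[OF p, of x' y'] qp by metis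
 qed
 then have "q : Aut" using bq' by (auto simp: Aut_def q_def)
 moreover have "q o p = id" by (simp add: fun_eq_iff qp)
 ultimately show "EX g:Aut. g o p = id" by blast
qed

text \<open>The two Cartan integers of adjacent nodes are at most -1, so their product, four times
  the squared cosine, is at least 1. If the bound is attained, both integers are -1.\<close>

lemma adj_inner:
 assumes "adj x y" shows "x \<bullet> y <= - (norm x * norm y) / 2"
  and "x \<bullet> y = - (norm x * norm y) / 2 ==> norm x = norm y"
proof -
 have xy: "x : B" "y : B" "x ~= y" "x \<bullet> y ~= 0" using assms by (auto simp: adj_def)
 have lt: "x \<bullet> y < 0" using nonpos[OF xy(1-3)] xy(4) by simp
 have nx: "norm x > 0" and ny: "norm y > 0" using xy norm_pos by auto
 have sq: "x \<bullet> x = norm x * norm x" "y \<bullet> y = norm y * norm y"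
  by (simp_all add: power2_norm_eq_inner[symmetric] power2_eq_square)
 obtain a where a: "2 * (x \<bullet> y) / (y \<bullet> y) = of_int a" using cartan[OF xy(1,2)] by (auto elim: Ints_cases)
 obtain b where b: "2 * (x \<bullet> y) / (x \<bullet> x) = of_int b"
  using cartan[OF xy(2,1)] by (auto elim: Ints_cases simp: inner_commute)
 have "of_int a < (0::real)" "of_int b < (0::real)"
  using lt inner_pos[OF xy(1)] inner_pos[OF xy(2)] by (simp_all add: a[symmetric] b[symmetric] divide_neg_pos)
 then have ab: "a <= - 1" "b <= - 1" by simp_all
 then have "1 * 1 <= (- a) * (- b)" by (intro mult_mono) auto
 then have "1 <= a * b" by simp
 then have "real_of_int 1 <= real_of_int (a * b)" by (simp only: of_int_le_iff)
 then have "1 <= real_of_int (a * b)" by (simp only: of_int_1)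
 also have "real_of_int (a * b) = (2 * (x \<bullet> y) / (norm x * norm y))\<^sup>2"
  by (simp add: a[symmetric] b[symmetric] sq power2_eq_square)
 finally have "1 <= \<bar>2 * (x \<bullet> y) / (norm x * norm y)\<bar>"
  using abs_square_less_1[of "2 * (x \<bullet> y) / (norm x * norm y)"] by linarith
 also have "\<dots> = - (2 * (x \<bullet> y)) / (norm x * norm y)"
  using lt nx ny by (simp add: abs_mult)
 finally have "1 * (norm x * norm y) <= - (2 * (x \<bullet> y))"
  unfolding pos_le_divide_eq[OF mult_pos_pos[OF nx ny]] .
 then show "x \<bullet> y <= - (norm x * norm y) / 2" by simp
 assume "x \<bullet> y = - (norm x * norm y) / 2"
 then have e: "2 * (x \<bullet> y) = - (norm x * norm y)" by simp
 have a': "real_of_int a = - (norm x / norm y)" and b': "real_of_int b = - (norm y / norm x)"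
  unfolding a[symmetric] b[symmetric] sq e using nx ny by simp_all
 have "norm x / norm y >= 1" using ab(1) a' by linarith
 moreover have "norm y / norm x >= 1" using ab(2) b' by linarith
 ultimately show "norm x = norm y" using nx ny by (simp add: le_divide_eq)
qed

text \<open>Without an edge from \<open>S\<close> to its complement the two partial sums of the
  relation would be orthogonal and opposite, hence zero; but a relation supported on a proper
  nonempty subset is not proportional to \<open>m\<close>.\<close>

lemma connected:
 assumes "S \<subseteq> B" "S ~= {}" "S ~= B"
 shows "EX x:S. EX y:B - S. adj x y"
proof (rule ccontr)
 assume "~ ?thesis"
 then have orth: "x \<bullet> y = 0" if "x : S" "y : B - S" for x y
  using that assms(1) by (auto simp: adj_def)
 define v where "v = (\<Sum>x\<in>S. m x *\<^sub>R x)"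
 have "v + (\<Sum>x\<in>B - S. m x *\<^sub>R x) = 0"
  using m_rel sum.subset_diff[OF assms(1) finite_B, of "%x. m x *\<^sub>R x"] by (simp add: v_def add.commute)
 then have v': "v = - (\<Sum>x\<in>B - S. m x *\<^sub>R x)" by (simp add: add_eq_0_iff2)
 have "v \<bullet> (\<Sum>x\<in>B - S. m x *\<^sub>R x) = 0"
  unfolding v_def inner_sum_left inner_sum_right by (intro sum.neutral ballI) (simp add: orth)
 then have "v \<bullet> v = 0" by (subst (2) v') simp
 then have "v = 0" by simp
 define d where "d x = (if x : S then m x else 0)" for x
 have "(\<Sum>x\<in>B. d x *\<^sub>R x) = (\<Sum>x\<in>S. d x *\<^sub>R x)"
  by (rule sum.mono_neutral_right[OF finite_B assms(1)]) (simp add: d_def)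
 also have "\<dots> = v" unfolding v_def by (rule sum.cong) (simp_all add: d_def)
 finally obtain t where t: "!!x. x : B ==> d x = t * m x" using m_unique[of d] \<open>v = 0\<close> by auto
 obtain x where x: "x : S" using assms(2) by blast
 obtain y where y: "y : B" "y ~: S" using assms(1,3) by blast
 have "t = 0" using t[OF y(1)] y m_pos[OF y(1)] by (simp add: d_def)
 then show False using t[of x] x assms(1) m_pos[of x] by (auto simp: d_def)
qed

text \<open>A priori \<open>N i\<close> is only some of the neighbours of \<open>f i\<close>. The
  sum \<open>v\<close> of normalized nodes weighted by \<open>c\<close> has norm at most 0, since an
  edge contributes a cosine of at most -1/2. So \<open>v\<close> is 0, all inequalities used are
  equalities, and the relation \<open>v = 0\<close> must involve every node.\<close>

lemma exact_subdiagram: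
 fixes f :: "nat => 'a" and c :: "nat => real"
 assumes inj: "inj_on f {..<k}" and fB: "f ` {..<k} \<subseteq> B" and k: "k > 0"
  and c: "!!i. i < k ==> c i > 0"
  and N: "!!i. i < k ==> N i \<subseteq> {..<k} - {i}" "!!i j. i < k ==> j : N i ==> adj (f i) (f j)"
  and w: "!!i. i < k ==> 2 * c i <= (\<Sum>j\<in>N i. c j)"
 shows "f ` {..<k} = B"
  and "!!i j. i < k ==> j < k ==> i ~= j ==>
   f i \<bullet> f j = (if j : N i then - (norm (f i) * norm (f j)) / 2 else 0)"
  and "!!i j. i < k ==> j < k ==> adj (f i) (f j) \<longleftrightarrow> j : N i"
proof -
 have fi: "f i : B" if "i < k" for i using that fB by auto
 have nf: "norm (f i) > 0" if "i < k" for i using norm_pos[OF fi[OF that]] .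
 define g where "g i j = f i \<bullet> f j / (norm (f i) * norm (f j))" for i j
 have gii: "g i i = 1" if "i < k" for i
  using nf[OF that] by (simp add: g_def power2_norm_eq_inner[symmetric] power2_eq_square)
 have gle: "g i j + (if j : N i then 1 / 2 else 0) <= 0" if ij: "i < k" "j < k" "i ~= j" for i j
 proof (cases "j : N i")
  case True
  have "f i \<bullet> f j <= (- 1 / 2) * (norm (f i) * norm (f j))"
   using adj_inner(1)[OF N(2)[OF ij(1) True]] by simp
  then have "g i j <= - 1 / 2"
   unfolding g_def pos_divide_le_eq[OF mult_pos_pos[OF nf[OF ij(1)] nf[OF ij(2)]]] .
  then show ?thesis using True by simp
 next
  case False
  have "f i ~= f j" using inj_onD[OF inj, of i j] ij by auto
  then show ?thesis
   using nonpos[OF fi[OF ij(1)] fi[OF ij(2)]] nf[OF ij(1)] nf[OF ij(2)] False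
   by (simp add: g_def divide_nonpos_pos)
 qed
 define v where "v = (\<Sum>i<k. (c i / norm (f i)) *\<^sub>R f i)"
 \<comment> \<open>\<open>D i\<close> is the pairing of \<open>v\<close> with the normalized node
   \<open>f i\<close>. It is split below into nonpositive excesses \<open>E i j\<close> and the
   defect in the hypothesis on \<open>c\<close>.\<close>
 define D where "D i = c i + (\<Sum>j\<in>{..<k} - {i}. c j * g i j)" for i
 have vv: "v \<bullet> v = (\<Sum>i<k. c i * D i)"
 proof -
  have "v \<bullet> v = (\<Sum>i<k. (c i / norm (f i)) * (f i \<bullet> v))"
   by (subst (1) v_def) (simp add: inner_sum_left)
  also have "\<dots> = (\<Sum>i<k. c i * D i)"
  proof (rule sum.cong[OF HOL.refl])
   fix i assume i: "i : {..<k}"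
   have "(1 / norm (f i)) * (f i \<bullet> v) = (\<Sum>j<k. c j * g i j)"
    unfolding v_def inner_sum_right sum_distrib_left by (rule sum.cong) (simp_all add: g_def)
   also have "\<dots> = c i * g i i + (\<Sum>j\<in>{..<k} - {i}. c j * g i j)"
    by (rule sum.remove) (use i in auto)
   also have "\<dots> = D i" using gii i by (simp add: D_def)
   finally have eq: "(1 / norm (f i)) * (f i \<bullet> v) = D i" .
   have "(c i / norm (f i)) * (f i \<bullet> v) = c i * ((1 / norm (f i)) * (f i \<bullet> v))" by simp
   then show "(c i / norm (f i)) * (f i \<bullet> v) = c i * D i" unfolding eq .
  qed
  finally show ?thesis .
 qed
 define E where "E i j = c j * (g i j + (if j : N i then 1 / 2 else 0))" for i j
 have Ele: "E i j <= 0" if "i < k" "j < k" "i ~= j" for i j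
  unfolding E_def using gle[OF that] c[OF that(2)] by (simp add: mult_nonneg_nonpos)
 have DE: "D i = (\<Sum>j\<in>{..<k} - {i}. E i j) + (c i - (\<Sum>j\<in>N i. c j) / 2)" if i: "i < k" for i
 proof -
  have "(\<Sum>j\<in>{..<k} - {i}. E i j) = (\<Sum>j\<in>{..<k} - {i}. c j * g i j) + (\<Sum>j\<in>{..<k} - {i}. if j : N i then c j / 2 else 0)"
   unfolding sum.distrib[symmetric] by (rule sum.cong) (simp_all add: E_def algebra_simps)
  also have "(\<Sum>j\<in>{..<k} - {i}. if j : N i then c j / 2 else 0) = (\<Sum>j\<in>N i. c j / 2)"
   by (rule sum.mono_neutral_cong_right) (use N(1)[OF i] in auto)
  also have "\<dots> = (\<Sum>j\<in>N i. c j) / 2" by (simp add: sum_divide_distrib)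
  finally show ?thesis by (simp add: D_def)
 qed
 have Ds: "(\<Sum>j\<in>{..<k} - {i}. E i j) <= 0" if i: "i < k" for i
  by (rule sum_nonpos) (use Ele[OF i] in auto)
 have Dle: "D i <= 0" if i: "i < k" for i using DE[OF i] Ds[OF i] w[OF i] by simp
 have cD: "c i * D i <= 0" if "i < k" for i
  by (rule mult_nonneg_nonpos) (use c[OF that] Dle[OF that] in simp_all)
 have "v \<bullet> v <= 0" unfolding vv
  by (rule sum_nonpos) (use cD in simp)
 then have vv0: "v \<bullet> v = 0" using inner_ge_zero[of v] by linarith
 then have v0: "v = 0" by simp
 have D0: "D i = 0" if i: "i < k" for i
 proof -
  have "(\<Sum>i<k. - (c i * D i)) = 0" using vv0 vv by (simp add: sum_negf)
  then have all0: "ALL i:{..<k}. - (c i * D i) = 0"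
  proof (subst (asm) sum_nonneg_eq_0_iff)
   fix i assume "i : {..<k}"
   then show "0 <= - (c i * D i)" using cD[of i] by simp
  qed simp
  have "- (c i * D i) = 0" by (rule bspec[OF all0]) (use i in simp)
  then show ?thesis using c[OF i] by simp
 qed
 have E0: "E i j = 0" if ij: "i < k" "j < k" "i ~= j" for i j
 proof -
  have "(\<Sum>j\<in>{..<k} - {i}. E i j) >= 0" using DE[OF ij(1)] D0[OF ij(1)] w[OF ij(1)] by simp
  then have "(\<Sum>j\<in>{..<k} - {i}. - E i j) = 0" using Ds[OF ij(1)] by (simp add: sum_negf)
  then have "ALL j:{..<k} - {i}. - E i j = 0"
   using Ele[OF ij(1)] by (subst (asm) sum_nonneg_eq_0_iff) auto
  then show ?thesis using ij by auto
 qed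
 show ip: "f i \<bullet> f j = (if j : N i then - (norm (f i) * norm (f j)) / 2 else 0)"
  if ij: "i < k" "j < k" "i ~= j" for i j
 proof -
  have "g i j = (if j : N i then - 1 / 2 else 0)" using E0[OF ij] c[OF ij(2)] by (auto simp: E_def split: if_splits)
  moreover have "f i \<bullet> f j = g i j * (norm (f i) * norm (f j))" using nf[OF ij(1)] nf[OF ij(2)] by (simp add: g_def)
  ultimately show ?thesis by auto
 qed
 show "f ` {..<k} = B"
 proof (rule ccontr)
  assume "f ` {..<k} ~= B"
  then obtain y where y: "y : B" "y ~: f ` {..<k}" using fB by blast
  \<comment> \<open>The coefficients of \<open>v\<close> extended by 0: a relation that vanishes at
    \<open>y\<close> but not at \<open>f 0\<close>.\<close>
  define d where "d x = (if x : f ` {..<k} then c (the_inv_into {..<k} f x) / norm x else 0)" for x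
  have "(\<Sum>x\<in>B. d x *\<^sub>R x) = (\<Sum>x\<in>f ` {..<k}. d x *\<^sub>R x)"
   by (rule sum.mono_neutral_right[OF finite_B fB]) (simp add: d_def)
  also have "\<dots> = (\<Sum>i<k. d (f i) *\<^sub>R f i)" by (simp add: sum.reindex[OF inj])
  also have "\<dots> = v" unfolding v_def
   by (rule sum.cong) (simp_all add: d_def the_inv_into_f_f[OF inj])
  finally obtain t where t: "!!x. x : B ==> d x = t * m x" using m_unique[of d] v0 by auto
  have "t = 0" using t[OF y(1)] y m_pos[OF y(1)] by (simp add: d_def)
  then have "d (f 0) = 0" using t[OF fi[OF k]] by simp
  moreover have "d (f 0) = c 0 / norm (f 0)" using k by (simp add: d_def the_inv_into_f_f[OF inj])
  ultimately show False using c[OF k] nf[OF k] by simp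
 qed
 show "adj (f i) (f j) \<longleftrightarrow> j : N i" if ij: "i < k" "j < k" for i j
 proof (cases "i = j")
  case True
  then show ?thesis using N(1)[OF ij(1)] by (auto simp: adj_def)
 next
  case False
  then have "f i ~= f j" using inj_onD[OF inj, of i j] ij by auto
  then show ?thesis using ip[OF ij False] nf[OF ij(1)] nf[OF ij(2)] fi ij by (auto simp: adj_def)
 qed
qed

lemma Aut_lift:
 assumes f: "bij_betw f {..<k} B" and sg: "!!i. i < k ==> sg i < k" "inj_on sg {..<k}"
  and gram: "!!i j. i < k ==> j < k ==> f (sg i) \<bullet> f (sg j) = f i \<bullet> f j"
 shows "EX p:Aut. ALL i<k. p (f i) = f (sg i)"
proof -
 have inj: "inj_on f {..<k}" and img: "f ` {..<k} = B" using f by (auto simp: bij_betw_def)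
 define p where "p x = (if x : B then f (sg (the_inv_into {..<k} f x)) else x)" for x
 have pf: "p (f i) = f (sg i)" if "i < k" for i
  using that img by (auto simp: p_def the_inv_into_f_f[OF inj])
 have B: "EX i<k. x = f i" if "x : B" for x using that img by auto
 have "p ` B \<subseteq> B"
 proof
  fix y assume "y : p ` B"
  then obtain x where x: "x : B" "y = p x" by blast
  then obtain i where "i < k" "x = f i" using B by blast
  then show "y : B" using x pf sg(1) img by auto
 qed
 moreover have "inj_on p B"
 proof (rule inj_onI)
  fix x y assume "x : B" "y : B" and e: "p x = p y"
  then obtain i j where ij: "i < k" "x = f i" "j < k" "y = f j" using B by blast
  then have "f (sg i) = f (sg j)" using e pf by simp
  then have "sg i = sg j" using inj_onD[OF inj, of "sg i" "sg j"] sg(1) ij by simp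
  then show "x = y" using inj_onD[OF sg(2), of i j] ij by simp
 qed
 ultimately have "bij_betw p B B" using endo_inj_surj[OF finite_B] by (simp add: bij_betw_def)
 moreover have "p x \<bullet> p y = x \<bullet> y" if "x : B" "y : B" for x y
 proof -
  obtain i j where ij: "i < k" "x = f i" "j < k" "y = f j" using B \<open>x : B\<close> \<open>y : B\<close> by blast
  then show ?thesis using pf gram by simp
 qed
 ultimately have "p : Aut" by (auto simp: Aut_def p_def)
 then show ?thesis using pf by blast
qed

lemma Aut_le_2:
 assumes "x : B" "!!p. p : Aut ==> p x = x | p x = y" "!!p. p : Aut ==> p x = x ==> p = id"
 shows "is_coxeter_group (comp_group Aut)"
proof -
 have "EX r. Aut \<subseteq> {id, r}"
 proof (cases "EX r:Aut. r x ~= x")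
  case True
  then obtain r where r: "r : Aut" "r x ~= x" by blast
  have "p = r" if p: "p : Aut" "p ~= id" for p
  proof (rule comp_group_eqI[OF group_Aut p(1) r(1), of "{x}"])
   show "p z = r z" if "z : {x}" for z using assms(2)[OF p(1)] assms(2)[OF r(1)] assms(3)[OF p(1)] p(2) r(2) that by auto
  qed (use assms(3) in auto)
  then show ?thesis by blast
 next
  case False
  then show ?thesis using assms(3) by blast
 qed
 then show ?thesis using is_coxeter_group_order_le_2[OF group_Aut] by blast
qed

lemma norms_eq:
 assumes "!!x y. adj x y ==> norm x = norm y" "x : B" "y : B" shows "norm x = norm y"
proof (rule ccontr)
 assume ne: "~ ?thesis"
 define S where "S = {z\<in>B. norm z = norm x}"
 have "EX a:S. EX b:B - S. adj a b"
 proof (rule connected)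
  have "x : S" using assms(2) by (simp add: S_def)
  then show "S ~= {}" by blast
  have "y ~: S" using ne by (simp add: S_def)
  then show "S ~= B" using assms(3) by blast
 qed (simp add: S_def subset_iff)
 then obtain a b where ab: "a : S" "b : B - S" "adj a b" by blast
 have "norm b = norm a" using assms(1)[OF ab(3)] by simp
 then show False using ab(1,2) by (simp add: S_def)
qed

text \<open>Equal lengths are included, so that adjacency determines the Gram matrix and every
  symmetry of the indices lifts to \<open>Aut\<close>.\<close>

definition diagram :: "(nat => 'a) => nat => (nat => nat set) => bool" where
 "diagram f k N \<longleftrightarrow> bij_betw f {..<k} B & (ALL i<k. ALL j<k. adj (f i) (f j) \<longleftrightarrow> j : N i) &
  (EX L. ALL i<k. ALL j<k. f i \<bullet> f j = L * (if i = j then 1 else if j : N i then - 1 / 2 else 0))"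

text \<open>In the equality case of \<open>adj_inner\<close> neighbours have equal lengths, and by
  connectedness all nodes do.\<close>

lemma diagramI:
 fixes c :: "nat => real"
 assumes inj: "inj_on f {..<k}" and fB: "f ` {..<k} \<subseteq> B" and k: "k > 0"
  and c: "!!i. i < k ==> c i > 0"
  and N: "!!i. i < k ==> N i \<subseteq> {..<k} - {i}" "!!i j. i < k ==> j : N i ==> adj (f i) (f j)"
  and w: "!!i. i < k ==> 2 * c i <= (\<Sum>j\<in>N i. c j)"
 shows "diagram f k N"
proof -
 have img: "f ` {..<k} = B" by (rule exact_subdiagram(1)[where c = c and N = N]) (fact inj fB k c N w)+
 have ex2: "f i \<bullet> f j = (if j : N i then - (norm (f i) * norm (f j)) / 2 else 0)"
  if "i < k" "j < k" "i ~= j" for i j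
  by (rule exact_subdiagram(2)[where c = c and N = N and k = k]) (fact inj fB k c N w that)+
 have ex3: "adj (f i) (f j) \<longleftrightarrow> j : N i" if "i < k" "j < k" for i j
  by (rule exact_subdiagram(3)[where c = c and N = N and k = k]) (fact inj fB k c N w that)+
 have "norm x = norm y" if a: "adj x y" for x y
 proof -
  have "x : f ` {..<k}" "y : f ` {..<k}" using adj_in[OF a] img by auto
  then obtain i j where ij: "i < k" "x = f i" "j < k" "y = f j" by auto
  then have "j : N i" "i ~= j" using a ex3[OF ij(1,3)] adj_in(3)[OF a] by auto
  then have "x \<bullet> y = - (norm x * norm y) / 2" using ex2[OF ij(1,3)] ij by simp
  then show ?thesis by (rule adj_inner(2)[OF a])
 qed
 then have nn: "norm (f i) = norm (f 0)" if "i < k" for i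
  by (rule norms_eq) (use img that k in auto)
 have "f i \<bullet> f j = (norm (f 0))\<^sup>2 * (if i = j then 1 else if j : N i then - 1 / 2 else 0)" if ij: "i < k" "j < k" for i j
 proof (cases "i = j")
  case True
  then show ?thesis using nn[OF ij(1)] by (simp add: power2_norm_eq_inner[symmetric])
 next
  case False
  then show ?thesis using ex2[OF ij False] nn[OF ij(1)] nn[OF ij(2)] by (simp add: power2_eq_square)
 qed
 then show ?thesis using inj img ex3 unfolding diagram_def bij_betw_def by blast
qed

lemma diagram_lift:
 assumes d: "diagram f k N" and sg: "!!i. i < k ==> sg i < k" "inj_on sg {..<k}"
  and pres: "!!i j. i < k ==> j < k ==> sg j : N (sg i) \<longleftrightarrow> j : N i"
 shows "EX p:Aut. ALL i<k. p (f i) = f (sg i)"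
proof -
 obtain L where L: "!!i j. i < k ==> j < k ==> f i \<bullet> f j = L * (if i = j then 1 else if j : N i then - 1 / 2 else 0)"
  using d unfolding diagram_def by blast
 have "f (sg i) \<bullet> f (sg j) = f i \<bullet> f j" if "i < k" "j < k" for i j
  using L[OF sg(1)[OF that(1)] sg(1)[OF that(2)]] L[OF that] pres[OF that] inj_on_eq_iff[OF sg(2), of i j] that by simp
 then show ?thesis using Aut_lift[of f k sg] sg d unfolding diagram_def by blast
qed

lemma Aut_eq_id:
 assumes "p : Aut" "!!x. x : B ==> p x = x" shows "p = id"
 using AutD(3)[OF assms(1)] assms(2) by (auto simp: fun_eq_iff)

section \<open>The affine diagrams with large symmetry: cycles, two forks, stars, E6\<close>

lemma small_multiple:
 fixes x :: int assumes "int k dvd x" "- int k <= x" "x < int k" shows "x = - int k | x = 0"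
proof (cases "x < 0")
 case True
 then have "int k <= - x" using assms(1) by (intro zdvd_imp_le) auto
 then show ?thesis using assms(2) by simp
next
 case False
 then show ?thesis using zdvd_imp_le[OF assms(1)] assms(3) by (cases "x = 0") auto
qed

lemma mod_affine: "(a + e * (z mod k)) mod k = (a + e * z) mod (k::int)"
 by (metis mod_add_right_eq mod_mult_right_eq)

text \<open>The affine diagram of type \<open>A\<close>, with all weights 1; its automorphisms are
  the symmetries of a polygon.\<close>

lemma Aut_cycle:
 assumes inj: "inj_on f {..<k}" and fB: "f ` {..<k} \<subseteq> B" and k: "k >= 3"
  and step: "!!t. Suc t < k ==> adj (f t) (f (Suc t))" and close: "adj (f (k - 1)) (f 0)"
 shows "is_coxeter_group (comp_group Aut)"
proof -
 define N where "N t = {if Suc t = k then 0 else Suc t, if t = 0 then k - 1 else t - 1}" for t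
 have d: "diagram f k N"
 proof (rule diagramI[OF inj fB, where c = "%_. 1"])
  show "N i \<subseteq> {..<k} - {i}" if "i < k" for i using that k by (auto simp: N_def)
  show "adj (f i) (f j)" if "i < k" "j : N i" for i j
   using that step[of i] step[of "i - 1"] close adj_commute by (auto simp: N_def split: if_splits)
  show "2 * 1 <= (\<Sum>j\<in>N i. 1::real)" if "i < k" for i
  proof -
   have "(if Suc i = k then 0 else Suc i) ~= (if i = 0 then k - 1 else i - 1)" using that k by auto
   then show ?thesis unfolding N_def by simp
  qed
 qed (use k in auto)
 have bij: "bij_betw f {..<k} B" using d by (simp add: diagram_def)
 let ?K = "int k"
 have kk: "?K > 0" using k by simp
 define u where "u z = f (nat (z mod ?K))" for z
 have idx: "nat (z mod ?K) < k" "int (nat (z mod ?K)) = z mod ?K" for z using kk by (simp_all add: nat_less_iff)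
 have uf: "u (int i) = f i" if "i < k" for i using that by (simp add: u_def)
 have u_eq: "u z = u w \<longleftrightarrow> z mod ?K = w mod ?K" for z w
 proof -
  have "u z = u w \<longleftrightarrow> nat (z mod ?K) = nat (w mod ?K)"
   unfolding u_def using inj_on_eq_iff[OF inj] idx(1) by simp
  also have "\<dots> \<longleftrightarrow> z mod ?K = w mod ?K" using idx(2)[of z] idx(2)[of w] by metis
  finally show ?thesis .
 qed
 have u_eqd: "u z = u w \<longleftrightarrow> ?K dvd (w - z)" for z w unfolding u_eq using mod_eq_dvd_iff[of w ?K z] by auto
 have uB: "EX z. x = u z" if "x : B" for x
 proof -
  have "x : f ` {..<k}" using that bij by (simp add: bij_betw_def)
  then obtain i where "i < k" "x = f i" by auto
  then have "x = u (int i)" using uf by simp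
  then show ?thesis by blast
 qed
 have u_in: "u z : B" for z unfolding u_def using fB idx(1) by auto
 have N_dvd: "j : N i \<longleftrightarrow> ?K dvd (int j - int i - 1) | ?K dvd (int j - int i + 1)" if ij: "i < k" "j < k" for i j
 proof
  assume "j : N i"
  then have "int j - int i - 1 = 0 | int j - int i - 1 = - ?K | int j - int i + 1 = 0 | int j - int i + 1 = ?K"
   using ij k by (auto simp: N_def of_nat_diff split: if_splits)
  then show "?K dvd (int j - int i - 1) | ?K dvd (int j - int i + 1)"
   by (elim disjE) simp_all
 next
  assume "?K dvd (int j - int i - 1) | ?K dvd (int j - int i + 1)"
  then show "j : N i"
  proof
   assume "?K dvd (int j - int i - 1)"
   then have "int j - int i - 1 = - ?K | int j - int i - 1 = 0" by (rule small_multiple) (use ij in auto)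
   then show ?thesis using ij by (auto simp: N_def)
  next
   assume "?K dvd (int j - int i + 1)"
   then have "?K dvd - (int j - int i + 1)" by (simp only: dvd_minus_iff)
   then have "- (int j - int i + 1) = - ?K | - (int j - int i + 1) = 0" by (rule small_multiple) (use ij in auto)
   then show ?thesis using ij by (auto simp: N_def)
  qed
 qed
 have dvd_mod: "?K dvd (w mod ?K - z mod ?K + c) \<longleftrightarrow> ?K dvd (w - z + c)" for w z c
  unfolding dvd_eq_mod_eq_0 by (metis mod_add_left_eq mod_diff_eq)
 have N_u: "nat (w mod ?K) : N (nat (z mod ?K)) \<longleftrightarrow> ?K dvd (w - z - 1) | ?K dvd (w - z + 1)" for z w
  unfolding N_dvd[OF idx(1) idx(1)] idx(2) using dvd_mod[of w z "-1"] dvd_mod[of w z 1] by simp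
 have adju: "adj (u z) (u w) \<longleftrightarrow> ?K dvd (w - z - 1) | ?K dvd (w - z + 1)" for z w
  using d idx(1) N_u[of w z] unfolding diagram_def u_def by blast
 obtain L where L: "!!i j. i < k ==> j < k ==> f i \<bullet> f j = L * (if i = j then 1 else if j : N i then - 1 / 2 else 0)"
  using d unfolding diagram_def by blast
 have gram: "u z \<bullet> u w = L * (if ?K dvd (w - z) then 1 else if ?K dvd (w - z - 1) | ?K dvd (w - z + 1) then - 1 / 2 else 0)" for z w
 proof -
  have "nat (z mod ?K) = nat (w mod ?K) \<longleftrightarrow> ?K dvd (w - z)"
   using u_eqd[of z w] inj_on_eq_iff[OF inj, of "nat (z mod ?K)" "nat (w mod ?K)"] idx(1) unfolding u_def by simp
  then show ?thesis using L[OF idx(1) idx(1), of z w] N_u[of w z] unfolding u_def by simp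
 qed
 have cong: "u (a + e * (z mod ?K)) = u (a + e * z)" for a e z unfolding u_eq by (rule mod_affine)
 have lift: "EX p:Aut. ALL z. p (u z) = u (a - z)" for a
 proof -
  define sg where "sg i = nat ((a - int i) mod ?K)" for i
  have fsg: "f (sg i) = u (a - int i)" for i by (simp add: sg_def u_def)
  have "EX p:Aut. ALL i<k. p (f i) = f (sg i)"
  proof (rule Aut_lift[OF bij])
   show "sg i < k" for i unfolding sg_def by (rule idx(1))
   show "inj_on sg {..<k}"
   proof (rule inj_onI)
    fix i j assume ij: "i : {..<k}" "j : {..<k}" "sg i = sg j"
    then have "u (a - int i) = u (a - int j)" using fsg by metis
    then have "?K dvd int i - int j" by (simp add: u_eqd)
    then have "int i - int j = - ?K | int i - int j = 0" by (rule small_multiple) (use ij in auto)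
    then show "i = j" using ij by auto
   qed
   show "f (sg i) \<bullet> f (sg j) = f i \<bullet> f j" if ij: "i < k" "j < k" for i j
   proof -
    have e: "?K dvd (int i - int j) \<longleftrightarrow> ?K dvd (int j - int i)"
     "?K dvd (int i - int j - 1) \<longleftrightarrow> ?K dvd (int j - int i + 1)"
     "?K dvd (int i - int j + 1) \<longleftrightarrow> ?K dvd (int j - int i - 1)"
     using dvd_minus_iff[of ?K "int i - int j"] dvd_minus_iff[of ?K "int i - int j - 1"]
      dvd_minus_iff[of ?K "int i - int j + 1"] by (simp_all add: algebra_simps)
    have "f i \<bullet> f j = u (int i) \<bullet> u (int j)" using uf ij by simp
    then show ?thesis unfolding fsg gram using e by auto
   qed
  qed
  then obtain p where p: "p : Aut" "!!i. i < k ==> p (f i) = u (a - int i)" using fsg by auto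
  have "p (u z) = u (a - z)" for z
   using p(2)[OF idx(1), of z] cong[of a "-1" z] unfolding u_def[of z] idx(2) by simp
  then show ?thesis using p(1) by blast
 qed
 obtain r where r: "r : Aut" "!!z. r (u z) = u (0 - z)" using lift[of 0] by blast
 obtain s where s: "s : Aut" "!!z. s (u z) = u (1 - z)" using lift[of 1] by blast
 have no2: "~ ?K dvd 2"
 proof
  assume "?K dvd 2"
  then have "?K <= 2" by (intro zdvd_imp_le) auto
  then show False using k by simp
 qed
 have dih: "EX a e. (e = 1 | e = - 1) & (ALL i. h (u i) = u (a + e * i))" if h: "h : Aut" for h
 proof -
  have hB: "EX c. h (u z) = u c" for z using uB[OF AutD(1)[OF h u_in]] .
  have hadj: "adj (h (u z)) (h (u (z + 1)))" for z
   using adj_Aut[OF h u_in u_in, of z "z + 1"] adju[of z "z + 1"] by simp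
  have next_: "h (u (z + 1)) = u (c + 1) | h (u (z + 1)) = u (c - 1)" if c: "h (u z) = u c" for z c
  proof -
   obtain b where b: "h (u (z + 1)) = u b" using hB by blast
   then have "?K dvd (b - c - 1) | ?K dvd (b - c + 1)" using hadj[of z] c adju[of c b] by simp
   then show ?thesis unfolding b u_eqd
    using dvd_minus_iff[of ?K "b - c - 1"] dvd_minus_iff[of ?K "b - c + 1"] by (auto simp: algebra_simps)
  qed
  obtain a where a: "h (u 0) = u a" using hB by blast
  obtain e :: int where e: "e = 1 | e = - 1" "h (u 1) = u (a + e)"
   using next_[OF a] by (elim disjE) (rule that[of 1], simp, simp, rule that[of "-1"], simp, simp)
  \<comment> \<open>Once the first step of the image has direction \<open>e\<close>, the image must
    go on in this direction: of the two neighbours the other one is already taken.\<close>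
  have "h (u (int n)) = u (a + e * int n) & h (u (int n + 1)) = u (a + e * (int n + 1))" for n
  proof (induction n)
   case 0
   then show ?case using a e by simp
  next
   case (Suc n)
   have "h (u (int n + 1 + 1)) = u (a + e * (int n + 1) + e)"
   proof (rule ccontr)
    assume "~ ?thesis"
    then have "h (u (int n + 1 + 1)) = u (a + e * (int n + 1) - e)"
     using next_[of "int n + 1" "a + e * (int n + 1)"] Suc e(1) by auto
    also have "\<dots> = h (u (int n))" using Suc by (simp add: algebra_simps)
    finally have "u (int n + 1 + 1) = u (int n)" using AutD(4)[OF h] by (simp add: inj_eq)
    then have "?K dvd - 2" by (simp add: u_eqd)
    then show False using no2 by (simp only: dvd_minus_iff)
   qed
   then show ?case using Suc by (simp add: algebra_simps)
  qed
  then have nat: "h (u (int n)) = u (a + e * int n)" for n by blast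
  have "h (u i) = u (a + e * i)" for i
  proof -
   have "u i = u (int (nat (i mod ?K)))" unfolding idx(2) u_eq by simp
   then have "h (u i) = u (a + e * (i mod ?K))" using nat[of "nat (i mod ?K)"] unfolding idx(2) by simp
   then show ?thesis unfolding cong .
  qed
  then show ?thesis using e(1) by blast
 qed
 show ?thesis
 proof (rule is_coxeter_group_dihedral[OF group_Aut k, of u r s])
  show "r (u i) = u (- i)" for i using r(2)[of i] by simp
  show "h = id" if h: "h : Aut" "h (u 0) = u 0" "h (u 1) = u 1" for h
  proof -
   obtain a e where ae: "e = 1 | e = - 1" "!!i. h (u i) = u (a + e * i)" using dih[OF h(1)] by blast
   have a0: "?K dvd - a" using ae(2)[of 0] h(2) u_eqd[of a 0] by simp
   have "?K dvd 1 - (a + e)" using ae(2)[of 1] h(3) u_eqd[of "a + e" 1] by simp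
   then have "?K dvd (1 - (a + e)) - - a" using a0 by (rule dvd_diff)
   then have "e = 1" using ae(1) no2 by auto
   then have "h (u i) = u i" for i using ae(2)[of i] a0 u_eqd[of "a + i" i] by simp
   then show ?thesis using Aut_eq_id[OF h(1)] uB by metis
  qed
 qed (use u_eq r s dih in auto)
qed

end

text \<open>Corners of a square: if \<open>b\<close> is neither \<open>a\<close> nor opposite to it,
  it is next to \<open>a\<close>, and this fixes the sense \<open>e\<close> in which the corners are
  traversed.\<close>

lemma cong4_cases:
 fixes a b :: int
 assumes "b mod 4 ~= a mod 4" "b mod 4 ~= (a + 2) mod 4"
 shows "EX e. (e = 1 | e = - 1) & b mod 4 = (a + e) mod 4 & (a + 2) mod 4 = (a + e * 2) mod 4 & (b + 2) mod 4 = (a + e * 3) mod 4"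
proof -
 define z where "z = b - a"
 have b: "b = a + z" by (simp add: z_def)
 have z: "~ 4 dvd z" "~ 4 dvd z - 2" using assms unfolding b mod_eq_dvd_iff by (simp_all add: algebra_simps)
 show ?thesis
 proof (cases "4 dvd z - 1")
  case True
  then show ?thesis unfolding b mod_eq_dvd_iff by (intro exI[of _ 1]) (simp add: algebra_simps)
 next
  case False
  then have "4 dvd z + 1" "4 dvd z + 5" using z by presburger+
  then show ?thesis unfolding b mod_eq_dvd_iff by (intro exI[of _ "- 1"]) (simp add: algebra_simps)
 qed
qed

text \<open>Three distinct residues modulo 3 always form a progression of step 1 or -1, so every
  permutation of three points is dihedral.\<close>

lemma cong3_cases:
 fixes a b d :: int
 assumes "b mod 3 ~= a mod 3" "d mod 3 ~= a mod 3" "d mod 3 ~= b mod 3"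
 shows "EX e. (e = 1 | e = - 1) & b mod 3 = (a + e * 1) mod 3 & d mod 3 = (a + e * 2) mod 3"
proof -
 define z w where "z = b - a" and "w = d - b"
 have b: "b = a + z" "d = a + z + w" by (simp_all add: z_def w_def)
 have z: "~ 3 dvd z" "~ 3 dvd z + w" "~ 3 dvd w" using assms unfolding b mod_eq_dvd_iff by (simp_all add: algebra_simps)
 show ?thesis
 proof (cases "3 dvd z - 1")
  case True
  then have "3 dvd w - 1" using z by presburger
  then have "3 dvd (z - 1) + (w - 1)" using True by (rule dvd_add[rotated])
  then show ?thesis using True unfolding b mod_eq_dvd_iff by (intro exI[of _ 1]) (simp add: algebra_simps)
 next
  case False
  then have z1: "3 dvd z + 1" using z by presburger
  then have "3 dvd w + 1" using z by presburger
  then have "3 dvd (z + 1) + (w + 1)" using z1 by (rule dvd_add[rotated])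
  then show ?thesis using z1 unfolding b mod_eq_dvd_iff by (intro exI[of _ "- 1"]) (simp add: algebra_simps)
 qed
qed

text \<open>The affine diagram of type \<open>E6\<close>, each edge in both directions: the centre
  is 0 and the arms are 1-4, 2-5 and 3-6.\<close>

definition E6_edges :: "(nat \<times> nat) list" where
 "E6_edges = [(0,1),(1,0),(0,2),(2,0),(0,3),(3,0),(1,4),(4,1),(2,5),(5,2),(3,6),(6,3)]"

text \<open>The two permutations exchange the second and third arm, and the first and second
  arm.\<close>

lemma E6_edges_perm:
 assumes "sg = [0,1,3,2,4,6,5] | sg = [0,2,1,3,5,4,6]" "i < 7" "j < 7"
 shows "sg ! i < 7" "sg ! (sg ! i) = i" "(sg ! i, sg ! j) : set E6_edges \<longleftrightarrow> (i, j) : set E6_edges"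
proof -
 have "list_all (%sg. list_all (%i. sg ! i < 7 & sg ! (sg ! i) = i &
   list_all (%j. (sg ! i, sg ! j) : set E6_edges \<longleftrightarrow> (i, j) : set E6_edges) [0,1,2,3,4,5,6])
   [0,1,2,3,4,5,6]) [[0,1,3,2,4,6,5], [0,2,1,3,5,4,6::nat]]"
  by code_simp
 moreover have "i : set [0,1,2,3,4,5,6]" "j : set [0,1,2,3,4,5,6]" using assms(2,3) by auto
 moreover have "sg : set [[0,1,3,2,4,6,5], [0,2,1,3,5,4,6]]" using assms(1) by auto
 ultimately show "sg ! i < 7" "sg ! (sg ! i) = i" "(sg ! i, sg ! j) : set E6_edges \<longleftrightarrow> (i, j) : set E6_edges"
  unfolding list_all_iff by blast+
qed

context affine_nodes
begin

definition leaf :: "'a => bool" where "leaf x \<longleftrightarrow> (ALL y z. adj x y --> adj x z --> y = z)"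

lemma leaf_Aut: assumes p: "p : Aut" and x: "x : B" shows "leaf (p x) \<longleftrightarrow> leaf x"
proof
 assume l: "leaf (p x)"
 show "leaf x" unfolding leaf_def
 proof (intro allI impI)
  fix y z assume yz: "adj x y" "adj x z"
  then have "adj (p x) (p y)" "adj (p x) (p z)" using adj_Aut[OF p x] adj_in by auto
  then have "p y = p z" using l by (simp add: leaf_def)
  then show "y = z" using AutD(4)[OF p] by (simp add: inj_eq)
 qed
next
 assume l: "leaf x"
 show "leaf (p x)" unfolding leaf_def
 proof (intro allI impI)
  fix y z assume yz: "adj (p x) y" "adj (p x) z"
  obtain y' where y': "y' : B" "p y' = y" using AutD(5)[OF p adj_in(2)[OF yz(1)]] by blast
  obtain z' where z': "z' : B" "p z' = z" using AutD(5)[OF p adj_in(2)[OF yz(2)]] by blast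
  have "adj x y'" "adj x z'" using yz adj_Aut[OF p x] y' z' by auto
  then show "y = z" using l y' z' by (auto simp: leaf_def)
 qed
qed

text \<open>The neighbours of a fixed node are permuted, so if all but one are fixed, the last one
  is too. Repeating this gives rigidity along chains.\<close>

lemma fix_next:
 assumes h: "h : Aut" "h x = x" and a: "adj x y" and other: "!!z. adj x z ==> z ~= y ==> h z = z"
 shows "h y = y"
proof (rule ccontr)
 assume ne: "h y ~= y"
 have "adj (h x) (h y)" using adj_Aut[OF h(1) adj_in(1)[OF a] adj_in(2)[OF a]] a by simp
 then have "h (h y) = h y" using other[of "h y"] ne h(2) by simp
 then show False using AutD(4)[OF h(1)] ne by (simp add: inj_eq)
qed

lemma Aut_nbr: "h : Aut ==> h x = x ==> adj x y ==> adj x (h y)"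
 using adj_Aut[of h x y] adj_in[of x y] by simp

text \<open>The affine diagram of type \<open>D\<close> on at least six nodes: leaves 0 and 1 at the
  node 2, leaves \<open>l + 2\<close> and \<open>l + 3\<close> at the node \<open>l + 1\<close>.
  Automorphisms respect the forks, so they act on the four leaves as the symmetries of a square on
  its corners.\<close>

lemma Aut_two_forks:
 assumes inj: "inj_on f {..<l + 4}" and fB: "f ` {..<l + 4} \<subseteq> B" and l: "l >= 2"
  and e0: "adj (f 0) (f 2)" and e1: "adj (f (l + 1)) (f (l + 3))"
  and step: "!!t. 1 <= t ==> t <= l + 1 ==> adj (f t) (f (Suc t))"
 shows "is_coxeter_group (comp_group Aut)"
proof -
 define D where "D t j \<longleftrightarrow> t = 0 & j = 2 | 1 <= t & t <= l + 1 & j = Suc t | t = l + 1 & j = l + 3" for t j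
 define E where "E t j \<longleftrightarrow> D t j | D j t" for t j
 define N where "N t = {j. j < l + 4 & E t j}" for t
 \<comment> \<open>The marks of this affine diagram: 1 at the leaves and 2 along the spine.\<close>
 define c where "c t = (if t <= 1 | t >= l + 2 then 1 else 2 :: real)" for t
 have E_sym: "E t j \<longleftrightarrow> E j t" for t j by (auto simp: E_def)
 have E0: "E 0 j \<longleftrightarrow> j = 2" for j using l by (auto simp: E_def D_def)
 have E1: "E 1 j \<longleftrightarrow> j = 2" for j using l by (auto simp: E_def D_def)
 have E2: "E (l + 2) j \<longleftrightarrow> j = l + 1" for j using l by (auto simp: E_def D_def)
 have E3: "E (l + 3) j \<longleftrightarrow> j = l + 1" for j using l by (auto simp: E_def D_def)
 have E4: "E t j \<longleftrightarrow> j = Suc t | Suc j = t | t = 2 & j = 0 | t = l + 1 & j = l + 3" if "2 <= t" "t <= l + 1" for t j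
  using l that by (auto simp: E_def D_def)
 have idx: "i = 0 | i = 1 | i = l + 2 | i = l + 3 | 2 <= i & i <= l + 1" if "i < l + 4" for i using that by linarith
 have D_adj: "adj (f t) (f j)" if "D t j" for t j
  using that step[of t] e0 e1 by (auto simp: D_def)
 have d: "diagram f (l + 4) N"
 proof (rule diagramI[OF inj fB, where c = c])
  show "N i \<subseteq> {..<l + 4} - {i}" if "i < l + 4" for i by (auto simp: N_def E_def D_def)
  show "adj (f i) (f j)" if "i < l + 4" "j : N i" for i j
   using that D_adj[of i j] D_adj[of j i] adj_commute by (auto simp: N_def E_def)
  show "2 * c i <= (\<Sum>j\<in>N i. c j)" if i: "i < l + 4" for i
   using idx[OF i]
  proof (elim disjE)
   assume "i = 0"
   then have "N i = {2}" unfolding N_def \<open>i = 0\<close> E0 by auto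
   then show ?thesis using \<open>i = 0\<close> l by (simp add: c_def)
  next
   assume "i = 1"
   then have "N i = {2}" unfolding N_def \<open>i = 1\<close> E1 by auto
   then show ?thesis using \<open>i = 1\<close> l by (simp add: c_def)
  next
   assume "i = l + 2"
   then have "N i = {l + 1}" unfolding N_def \<open>i = l + 2\<close> E2 by auto
   then show ?thesis using \<open>i = l + 2\<close> l by (simp add: c_def)
  next
   assume "i = l + 3"
   then have "N i = {l + 1}" unfolding N_def \<open>i = l + 3\<close> E3 by auto
   then show ?thesis using \<open>i = l + 3\<close> l by (simp add: c_def)
  next
   assume i2: "2 <= i & i <= l + 1"
   obtain i' where i': "i = Suc i'" using i2 by (cases i) auto
   have fin: "finite (N i)" by (simp add: N_def)
   have nn: "!!j. j : N i ==> 0 <= c j" by (simp add: c_def)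
   have ends: "{i', Suc i} \<subseteq> N i" using i2 i' by (auto simp: N_def E4)
   have "sum c (insert i' (insert (Suc i) ((if i = 2 then {0} else {}) \<union> (if i = l + 1 then {l + 3} else {})))) >= 4"
    using i2 i' l by (auto simp: c_def)
   also have "insert i' (insert (Suc i) ((if i = 2 then {0} else {}) \<union> (if i = l + 1 then {l + 3} else {}))) = N i"
    using i2 i' by (auto simp: N_def E4)
   finally show ?thesis using i2 by (simp add: c_def)
  qed
 qed (use l in \<open>auto simp: c_def\<close>)
 have bij: "bij_betw f {..<l + 4} B" and adjN: "!!i j. i < l + 4 ==> j < l + 4 ==> adj (f i) (f j) \<longleftrightarrow> E i j"
  using d by (auto simp: diagram_def N_def)
 have Bf: "EX i<l + 4. x = f i" if "x : B" for x using that bij by (auto simp: bij_betw_def)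
 have f_in: "f i : B" if "i < l + 4" for i using that fB by auto
 have f_eq: "f i = f j \<longleftrightarrow> i = j" if "i < l + 4" "j < l + 4" for i j using inj_on_eq_iff[OF inj] that by simp
 have nbrE: "EX i<l + 4. x = f i & E t i" if t: "t < l + 4" "adj (f t) x" for t x
 proof -
  obtain i where "i < l + 4" "x = f i" using Bf[OF adj_in(2)[OF t(2)]] by blast
  then show ?thesis using adjN[OF t(1)] t(2) by blast
 qed
 define swp where "swp t = (if t = l + 2 then l + 3 else if t = l + 3 then l + 2 else t)" for t
 have swp2: "swp (swp t) = t" for t by (simp add: swp_def)
 have D_swp: "E (swp i) (swp j)" if "D i j" for i j
 proof -
  have "i = 0 & j = 2 | 1 <= i & i <= l & j = Suc i | i = l + 1 & j = l + 2 | i = l + 1 & j = l + 3"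
   using that unfolding D_def by linarith
  then show ?thesis
   by (elim disjE conjE) (use l in \<open>simp_all add: E_def D_def swp_def\<close>)
 qed
 have E_swp: "E (swp i) (swp j)" if "E i j" for i j
  using that D_swp[of i j] D_swp[of j i] E_sym unfolding E_def[of i j] by blast
 have "EX p:Aut. ALL i<l + 4. p (f i) = f (swp i)"
 proof (rule diagram_lift[OF d])
  show sl: "swp i < l + 4" if "i < l + 4" for i using that by (simp add: swp_def)
  show "inj_on swp {..<l + 4}" by (rule inj_on_inverseI[of _ swp]) (rule swp2)
  show "swp j : N (swp i) \<longleftrightarrow> j : N i" if "i < l + 4" "j < l + 4" for i j
   using E_swp[of i j] E_swp[of "swp i" "swp j"] sl[OF that(2)] that unfolding N_def swp2 by blast
 qed
 then obtain r where r: "r : Aut" "!!i. i < l + 4 ==> r (f i) = f (swp i)" by blast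
 have D_rev: "E (l + 3 - i) (l + 3 - j)" if "D i j" for i j
  using that unfolding D_def
 proof (elim disjE conjE)
  assume "i = 0" "j = 2"
  then have "l + 3 - i = l + 3" "l + 3 - j = l + 1" by auto
  then show ?thesis by (simp only: E3)
 next
  assume ij: "1 <= i" "i <= l + 1" "j = Suc i"
  define a where "a = l + 2 - i"
  have "l + 3 - i = Suc a" "l + 3 - j = a" "1 <= a" "a <= l + 1" using ij by (auto simp: a_def)
  then show ?thesis by (simp add: E_def D_def)
 next
  assume "i = l + 1" "j = l + 3"
  then have "l + 3 - i = 2" "l + 3 - j = 0" by auto
  then show ?thesis by (simp add: E_def D_def)
 qed
 have E_rev: "E (l + 3 - i) (l + 3 - j)" if "E i j" for i j
  using that D_rev[of i j] D_rev[of j i] E_sym unfolding E_def[of i j] by blast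
 have "EX p:Aut. ALL i<l + 4. p (f i) = f (l + 3 - i)"
 proof (rule diagram_lift[OF d])
  show "l + 3 - i < l + 4" for i by simp
  show "inj_on (%i. l + 3 - i) {..<l + 4}" by (auto simp: inj_on_def)
  show "l + 3 - j : N (l + 3 - i) \<longleftrightarrow> j : N i" if "i < l + 4" "j < l + 4" for i j
  proof -
   have "l + 3 - (l + 3 - i) = i" "l + 3 - (l + 3 - j) = j" using that by auto
   then have "E (l + 3 - i) (l + 3 - j) \<longleftrightarrow> E i j" using E_rev[of i j] E_rev[of "l + 3 - i" "l + 3 - j"] by auto
   moreover have "l + 3 - j < l + 4" by simp
   ultimately show ?thesis using that unfolding N_def by blast
  qed
 qed
 then obtain s where s: "s : Aut" "!!i. i < l + 4 ==> s (f i) = f (l + 3 - i)" by blast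
 \<comment> \<open>A cyclic order of the leaves in which the two leaves of a fork are opposite
   corners. Then \<open>r\<close> fixes the corners 0 and 2, and \<open>s\<close> exchanges 0 with 1
   and 2 with 3.\<close>
 define ix where "ix z = (if z = 0 then 0 else if z = 1 then l + 3 else if z = 2 then 1 else l + 2)" for z :: int
 define u where "u z = f (ix (z mod 4))" for z :: int
 have ix: "ix z < l + 4" for z by (simp add: ix_def)
 have m4: "z mod 4 = 0 | z mod 4 = 1 | z mod 4 = 2 | z mod 4 = 3" for z :: int by presburger
 have u_eq: "u i = u j \<longleftrightarrow> i mod 4 = j mod 4" for i j
  unfolding u_def f_eq[OF ix ix] using m4[of i] m4[of j] by (elim disjE) (simp_all add: ix_def)
 have umod: "u (z mod 4) = u z" for z unfolding u_eq by simp
 have neg: "z mod 4 = 0 ==> (- z) mod 4 = 0" "z mod 4 = 1 ==> (- z) mod 4 = 3"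
  "z mod 4 = 2 ==> (- z) mod 4 = 2" "z mod 4 = 3 ==> (- z) mod 4 = 1"
  "z mod 4 = 0 ==> (1 - z) mod 4 = 1" "z mod 4 = 1 ==> (1 - z) mod 4 = 0"
  "z mod 4 = 2 ==> (1 - z) mod 4 = 3" "z mod 4 = 3 ==> (1 - z) mod 4 = 2" for z :: int by presburger+
 have ru: "r (u z) = u (- z)" for z
  unfolding u_def r(2)[OF ix] using m4[of z] by (elim disjE) (simp_all add: neg ix_def swp_def)
 have su: "s (u z) = u (1 - z)" for z
  unfolding u_def s(2)[OF ix] using m4[of z] by (elim disjE) (simp_all add: neg ix_def One_nat_def)
 have nbr_u: "(z mod 4 = 0 | z mod 4 = 2) & i = 2 | (z mod 4 = 1 | z mod 4 = 3) & i = l + 1"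
  if "E (ix (z mod 4)) i" for z i
  using m4[of z] that by (elim disjE) (simp_all add: ix_def E0 E1[unfolded One_nat_def] E1 E2[unfolded add_2_eq_Suc'] E2 E3)
 have leaf_ix: "i = 0 | i = 1 | i = l + 2 | i = l + 3" if i: "i < l + 4" "leaf (f i)" for i
 proof (rule ccontr)
  assume "~ ?thesis"
  then have i2: "2 <= i" "i <= l + 1" using idx[OF i(1)] by auto
  obtain i' where i': "i = Suc i'" using i2 by (cases i) auto
  have "adj (f i) (f i')" "adj (f i) (f (Suc i))"
   using i2 i' E4[of i] by (auto simp: adjN)
  then have "f i' = f (Suc i)" using i(2) unfolding leaf_def by blast
  then show False using f_eq[of i' "Suc i"] i2 i' by simp
 qed
 have leaf_u: "leaf (u z)" for z
  unfolding leaf_def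
 proof (intro allI impI)
  fix x y assume xy: "adj (u z) x" "adj (u z) y"
  obtain i where i: "i < l + 4" "x = f i" "E (ix (z mod 4)) i" using nbrE[OF ix] xy(1) unfolding u_def by blast
  obtain j where j: "j < l + 4" "y = f j" "E (ix (z mod 4)) j" using nbrE[OF ix] xy(2) unfolding u_def by blast
  have "i = j" using nbr_u[OF i(3)] nbr_u[OF j(3)] by linarith
  then show "x = y" using i j by simp
 qed
 have u_in: "u z : B" for z unfolding u_def by (rule f_in[OF ix])
 have uv: "u 0 = f 0" "u 1 = f (l + 3)" "u 2 = f 1" "u 3 = f (l + 2)" by (simp_all add: u_def ix_def)
 have leaf_u_ex: "EX z. x = u z" if "x : B" "leaf x" for x
 proof -
  obtain i where i: "i < l + 4" "x = f i" using Bf[OF \<open>x : B\<close>] by blast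
  have "i = 0 | i = 1 | i = l + 2 | i = l + 3" using leaf_ix[OF i(1)] i(2) \<open>leaf x\<close> by simp
  then have "x = u 0 | x = u 2 | x = u 3 | x = u 1" using i(2) unfolding uv by auto
  then show ?thesis by blast
 qed
 have sib: "x = u z | x = u (z + 2)" if x: "x : B" "leaf x" and w: "adj x w" "adj (u z) w" for x w z
 proof -
  obtain a where a: "x = u a" using leaf_u_ex[OF x] by blast
  obtain i where i: "i < l + 4" "w = f i" "E (ix (z mod 4)) i" using nbrE[OF ix] w(2) unfolding u_def by blast
  have "adj (f (ix (a mod 4))) (f i)" using w(1) i(2) a unfolding u_def by simp
  then have "E (ix (a mod 4)) i" using adjN[OF ix i(1)] by simp
  then have "(a mod 4 = 0 | a mod 4 = 2) & i = 2 | (a mod 4 = 1 | a mod 4 = 3) & i = l + 1" by (rule nbr_u)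
  moreover have "i = 2 ==> i ~= l + 1" using l by simp
  ultimately have "(a mod 4 = 0 | a mod 4 = 2) & (z mod 4 = 0 | z mod 4 = 2) |
    (a mod 4 = 1 | a mod 4 = 3) & (z mod 4 = 1 | z mod 4 = 3)" using nbr_u[OF i(3)] by auto
  moreover have "(z + 2) mod 4 = (z mod 4 + 2) mod 4" by (simp only: mod_add_left_eq)
  ultimately have "a mod 4 = z mod 4 | a mod 4 = (z + 2) mod 4" by auto
  then show ?thesis using a u_eq by auto
 qed
 have adj_u: "adj (u 0) (f 2)" "adj (u 2) (f 2)" "adj (u 1) (f (l + 1))" "adj (u 3) (f (l + 1))"
  unfolding uv using l E0 E1 E2 E3 by (auto simp: adjN)
 have par: "h (u 2) = u (a + 2)" "h (u 3) = u (b + 2)"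
  if h: "h : Aut" and ab: "h (u 0) = u a" "h (u 1) = u b" for h a b
 proof -
  have f2: "f 2 : B" "f (l + 1) : B" using f_in by auto
  have "adj (h (u 2)) (h (f 2))" "adj (h (u 0)) (h (f 2))" "adj (h (u 3)) (h (f (l + 1)))" "adj (h (u 1)) (h (f (l + 1)))"
   using adj_u adj_Aut[OF h u_in f2(1)] adj_Aut[OF h u_in f2(2)] by auto
  then have ad: "adj (h (u 2)) (h (f 2))" "adj (u a) (h (f 2))" "adj (h (u 3)) (h (f (l + 1)))" "adj (u b) (h (f (l + 1)))"
   unfolding ab by auto
  have lf: "leaf (h (u z))" "h (u z) : B" for z using leaf_Aut[OF h u_in] leaf_u AutD(1)[OF h u_in] by auto
  have "h (u 2) = u a | h (u 2) = u (a + 2)" by (rule sib[OF lf(2,1) ad(1,2)])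
  moreover have "h (u 3) = u b | h (u 3) = u (b + 2)" by (rule sib[OF lf(2,1) ad(3,4)])
  moreover have "h (u 2) ~= h (u 0)" "h (u 3) ~= h (u 1)"
   using AutD(4)[OF h] u_eq[of 2 0] u_eq[of 3 1] by (auto simp: inj_eq)
  ultimately show "h (u 2) = u (a + 2)" "h (u 3) = u (b + 2)" using ab by auto
 qed
 have dih: "EX a e. (e = 1 | e = - 1) & (ALL i. h (u i) = u (a + e * i))" if h: "h : Aut" for h
 proof -
  have ex: "EX a. h (u z) = u a" for z
   using leaf_u_ex[OF AutD(1)[OF h u_in]] leaf_Aut[OF h u_in] leaf_u by auto
  obtain a where a: "h (u 0) = u a" using ex by blast
  obtain b where b: "h (u 1) = u b" using ex by blast
  note p = par[OF h a b]
  have "h (u 1) ~= h (u 0)" "h (u 1) ~= h (u 2)"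
   using AutD(4)[OF h] u_eq[of 1 0] u_eq[of 1 2] by (auto simp: inj_eq)
  then have "b mod 4 ~= a mod 4" "b mod 4 ~= (a + 2) mod 4" using a b p u_eq by auto
  then obtain e :: int where e: "e = 1 | e = - 1" "b mod 4 = (a + e) mod 4"
    and e2: "(a + 2) mod 4 = (a + e * 2) mod 4" and e3: "(b + 2) mod 4 = (a + e * 3) mod 4"
   using cong4_cases by blast
  have "h (u i) = u (a + e * i)" for i
  proof -
   have "h (u (i mod 4)) = u (a + e * (i mod 4))"
    using m4[of i]
   proof (elim disjE)
    assume 0: "i mod 4 = 0" then show ?thesis using a by simp
   next
    assume 1: "i mod 4 = 1" then show ?thesis using b e(2) u_eq by simp
   next
    assume 2: "i mod 4 = 2" show ?thesis unfolding 2 p(1) u_eq by (rule e2)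
   next
    assume 3: "i mod 4 = 3" show ?thesis unfolding 3 p(2) u_eq by (rule e3)
   qed
   moreover have "u (a + e * (i mod 4)) = u (a + e * i)" unfolding u_eq by (rule mod_affine)
   ultimately show ?thesis using umod[of i] by simp
  qed
  then show ?thesis using e(1) by blast
 qed
 show ?thesis
 proof (rule is_coxeter_group_dihedral[OF group_Aut, of 4 u r s])
  show "h = id" if h: "h : Aut" "h (u 0) = u 0" "h (u 1) = u 1" for h
  proof -
   have 0: "h (f 0) = f 0" "h (f 1) = f 1" "h (f (l + 2)) = f (l + 2)" "h (f (l + 3)) = f (l + 3)"
    using h(2,3) par[OF h] unfolding uv by (simp_all add: uv)
   \<comment> \<open>Once the leaves are fixed, \<open>fix_next\<close> propagates along the spine
     from the node 1.\<close>
   have spine: "1 <= t --> t <= l + 2 --> h (f t) = f t" for t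
   proof (induction t rule: less_induct)
    case (less t)
    show ?case
    proof (intro impI)
     assume t: "1 <= t" "t <= l + 2"
     show "h (f t) = f t"
     proof (cases "t = 1")
      case False
      then obtain s where s: "t = Suc s" "1 <= s" using t by (cases t) auto
      have hs: "h (f s) = f s" using less[of s] s t by simp
      have slt: "s < l + 4" "t < l + 4" using s t by auto
      show ?thesis
      proof (rule fix_next[OF h(1) hs])
       show "adj (f s) (f t)" using adjN[OF slt] s t unfolding E_def D_def by simp
       fix z assume z: "adj (f s) z" "z ~= f t"
       obtain i where i: "i < l + 4" "z = f i" "E s i" using nbrE[OF slt(1) z(1)] by blast
       have "i = 2 & s = 1 | i = Suc s | Suc i = s & 2 <= s | i = 0 | i = l + 3"
        using E4[of s i] E1[of i] i(3) s t by (cases "s = 1") auto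
       then have "Suc i = s & 2 <= s | i = 0 | i = l + 3" using z(2) i(2) s(1) by (auto simp: numeral_2_eq_2 One_nat_def)
       then show "h z = z"
       proof (elim disjE)
        assume "Suc i = s & 2 <= s"
        then show ?thesis using less[of i] s t i(2) by simp
       qed (use 0 i(2) in auto)
      qed
     qed (use 0 in simp)
    qed
   qed
   have "h x = x" if x: "x : B" for x
   proof -
    obtain i where i: "i < l + 4" "x = f i" using Bf[OF x] by blast
    have "i = 0 | i = l + 3 | 1 <= i & i <= l + 2" using i(1) by linarith
    then show ?thesis using spine[of i] 0 i(2) by auto
   qed
   then show ?thesis by (rule Aut_eq_id[OF h(1)])
  qed
  show "u i = u j \<longleftrightarrow> i mod int 4 = j mod int 4" for i j using u_eq by simp
 qed (use r(1) s(1) ru su dih in auto)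
qed

text \<open>The affine diagram of type \<open>D\<close> on five nodes, with centre 4: every
  permutation of the four leaves is an automorphism.\<close>

lemma Aut_star4:
 fixes f :: "nat => 'a"
 assumes inj: "inj_on f {..<5}" and fB: "f ` {..<5} \<subseteq> B" and e: "!!i. i < 4 ==> adj (f 4) (f i)"
 shows "is_coxeter_group (comp_group Aut)"
proof -
 define N where "N i = (if i = 4 then {..<4} else {4::nat})" for i :: nat
 define c where "c i = (if i = 4 then 2 else 1 :: real)" for i :: nat
 have lt: "i < 4 | i = 4" if "i < 5" for i :: nat using that by linarith
 have d: "diagram f 5 N"
 proof (rule diagramI[OF inj fB, where c = c])
  show "N i \<subseteq> {..<5} - {i}" if "i < 5" for i using that by (auto simp: N_def)
  show "adj (f i) (f j)" if "i < 5" "j : N i" for i j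
   using lt[OF that(1)] that(2) e[of i] e[of j] adj_commute[of "f i"] by (auto simp: N_def split: if_splits)
  show "2 * c i <= (\<Sum>j\<in>N i. c j)" if "i < 5" for i
  proof (cases "i = 4")
   case True
   have "(\<Sum>j<4::nat. c j) = (\<Sum>j<4::nat. 1)" by (rule sum.cong) (auto simp: c_def)
   then show ?thesis using True by (simp add: N_def c_def)
  qed (simp add: N_def c_def)
 qed (auto simp: c_def)
 have bij: "bij_betw f {..<5} B" and adjN: "!!i j. i < 5 ==> j < 5 ==> adj (f i) (f j) \<longleftrightarrow> j : N i"
  using d by (auto simp: diagram_def)
 have Bf: "EX i<5. x = f i" if "x : B" for x using that bij by (auto simp: bij_betw_def)
 have f_in: "f i : B" if "i < 5" for i using that fB by auto
 have f_eq: "f i = f j \<longleftrightarrow> i = j" if "i < 5" "j < 5" for i j using inj_on_eq_iff[OF inj] that by simp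
 have leaf_f: "leaf (f i)" if "i < 4" for i
  unfolding leaf_def
 proof (intro allI impI)
  fix y z assume yz: "adj (f i) y" "adj (f i) z"
  obtain a where a: "a < 5" "y = f a" using Bf[OF adj_in(2)[OF yz(1)]] by blast
  obtain b where b: "b < 5" "z = f b" using Bf[OF adj_in(2)[OF yz(2)]] by blast
  have "a = 4" "b = 4" using yz adjN[of i a] adjN[of i b] a b that by (auto simp: N_def)
  then show "y = z" using a b by simp
 qed
 have nleaf: "~ leaf (f 4)"
 proof
  assume "leaf (f 4)"
  then have "f 0 = f 1" using e[of 0] e[of 1] unfolding leaf_def by auto
  then show False using f_eq[of 0 1] by simp
 qed
 have perm: "EX j<4. h (f i) = f j" if h: "h : Aut" and i: "i < 4" for h i
 proof -
  have fi: "f i : B" using f_in i by simp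
  obtain j where j: "j < 5" "h (f i) = f j" using Bf[OF AutD(1)[OF h fi]] by blast
  have "leaf (f j)" using leaf_Aut[OF h fi] leaf_f[OF i] j(2) by simp
  then have "j ~= 4" using nleaf by auto
  then show ?thesis using j lt by blast
 qed
 have "EX p:Aut. ALL i<4. p (f i) = f (sym4_act [s] i)" if s: "s < 3" for s
 proof -
  define sg where "sg i = (if i < 4 then sym4_act [s] i else i)" for i
  have a4: "sym4_act [s] i < 4" if "i < 4" for i by (rule sym4_act_less) (use s that in auto)
  have inv: "sg (sg i) = i" for i using s by (auto simp: sg_def Let_def)
  have lt4: "sg i < 4 \<longleftrightarrow> i < 4" for i using a4[of i] by (simp add: sg_def)
  have "EX p:Aut. ALL i<5. p (f i) = f (sg i)"
  proof (rule diagram_lift[OF d])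
   show "sg i < 5" if "i < 5" for i using that a4[of i] by (auto simp: sg_def)
   show "inj_on sg {..<5}" by (rule inj_on_inverseI[of _ sg]) (rule inv)
   show "sg j : N (sg i) \<longleftrightarrow> j : N i" if "i < 5" "j < 5" for i j
    using lt4[of i] lt4[of j] lt[OF that(1)] lt[OF that(2)] by (auto simp: N_def sg_def)
  qed
  then obtain p where "p : Aut" "!!i. i < 5 ==> p (f i) = f (sg i)" by blast
  then have "p : Aut" "ALL i<4. p (f i) = f (sym4_act [s] i)" by (auto simp: sg_def)
  then show ?thesis by blast
 qed
 then have "ALL s:{..<3}. EX p. p : Aut & (ALL i<4. p (f i) = f (sym4_act [s] i))" by blast
 then obtain g where g: "ALL s:{..<3}. g s : Aut & (ALL i<4. g s (f i) = f (sym4_act [s] i))"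
  unfolding bchoice_iff by blast
 show ?thesis
 proof (rule is_coxeter_group_sym4[OF group_Aut, of f g])
  show "inj_on f {..<4}" by (rule inj_on_subset[OF inj]) auto
  show "g s : Aut" if "s < 3" for s using g that by simp
  show "g s (f i) = f (sym4_act [s] i)" if "s < 3" "i < 4" for s i using g that by blast
  show "h = id" if h: "h : Aut" "!!i. i < 4 ==> h (f i) = f i" for h
  proof -
   have "h (f 4) = f 4"
   proof (rule fix_next[OF h(1) h(2)])
    show "adj (f 0) (f 4)" using e[of 0] adj_commute by simp
    show "h z = z" if "adj (f 0) z" "z ~= f 4" for z
     using leaf_f[of 0] that e[of 0] adj_commute unfolding leaf_def by simp
   qed simp
   then have "h x = x" if "x : B" for x using Bf[OF that] lt h(2) by metis
   then show ?thesis by (rule Aut_eq_id[OF h(1)])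
  qed
 qed (use perm AutD(4) in blast)+
qed

text \<open>An automorphism is determined by its action on the end nodes 4, 5 and 6 of the arms,
  where all permutations occur; the weights 3, 2, 1 are the marks.\<close>

lemma Aut_E6:
 assumes inj: "inj_on f {..<7}" and fB: "f ` {..<7} \<subseteq> B"
  and e: "!!i j. (i, j) : set E6_edges ==> adj (f i) (f j)"
 shows "is_coxeter_group (comp_group Aut)"
proof -
 define N where "N i = {j. (i, j) : set E6_edges}" for i
 define c where "c i = (if i = 0 then 3 else if i <= 3 then 2 else 1 :: real)" for i :: nat
 have Ns: "N 0 = {1,2,3}" "N 1 = {0,4}" "N (Suc 0) = {0,4}" "N 2 = {0,5}" "N 3 = {0,6}" "N 4 = {1}" "N 5 = {2}" "N 6 = {3}"
  by (auto simp: N_def E6_edges_def)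
 have lt: "i = 0 | i = 1 | i = 2 | i = 3 | i = 4 | i = 5 | i = 6" if "i < 7" for i :: nat using that by linarith
 have d: "diagram f 7 N"
 proof (rule diagramI[OF inj fB, where c = c])
  show "N i \<subseteq> {..<7} - {i}" if "i < 7" for i using lt[OF that] by (elim disjE) (simp_all add: Ns)
  show "adj (f i) (f j)" if "i < 7" "j : N i" for i j using that e by (simp add: N_def)
  show "2 * c i <= (\<Sum>j\<in>N i. c j)" if "i < 7" for i using lt[OF that] by (elim disjE) (simp_all add: Ns c_def)
 qed (auto simp: c_def)
 have bij: "bij_betw f {..<7} B" and adjN: "!!i j. i < 7 ==> j < 7 ==> adj (f i) (f j) \<longleftrightarrow> j : N i"
  using d by (auto simp: diagram_def)
 have Bf: "EX i<7. x = f i" if "x : B" for x using that bij by (auto simp: bij_betw_def)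
 have f_in: "f i : B" if "i < 7" for i using that fB by auto
 have f_eq: "f i = f j \<longleftrightarrow> i = j" if "i < 7" "j < 7" for i j using inj_on_eq_iff[OF inj] that by simp
 have nbrE: "EX i:N t. x = f i" if t: "t < 7" "adj (f t) x" for t x
 proof -
  obtain i where i: "i < 7" "x = f i" using Bf[OF adj_in(2)[OF t(2)]] by blast
  have "i : N t" using adjN[OF t(1) i(1)] t(2) i(2) by simp
  then show ?thesis using i(2) by blast
 qed
 have leaf_f: "leaf (f i)" if i: "4 <= i" "i < 7" for i
  unfolding leaf_def
 proof (intro allI impI)
  fix y z assume yz: "adj (f i) y" "adj (f i) z"
  obtain a where a: "a : N i" "y = f a" using nbrE[OF i(2) yz(1)] by blast
  obtain b where b: "b : N i" "z = f b" using nbrE[OF i(2) yz(2)] by blast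
  have "a = b" using a(1) b(1) lt[OF i(2)] i(1) by (elim disjE) (simp_all add: Ns)
  then show "y = z" using a b by simp
 qed
 have nleaf: "~ leaf (f i)" if "i < 4" for i
 proof
  assume l: "leaf (f i)"
  have "EX a b. a < 7 & b < 7 & a ~= b & a : N i & b : N i"
  proof -
   have "i = 0 | i = 1 | i = 2 | i = 3" using that by linarith
   then obtain a b where "a ~= b" "a < 7" "b < 7" "{a, b} \<subseteq> N i"
   proof (elim disjE)
    assume "i = 0" then show ?thesis using that[of 1 2] by (simp add: Ns)
   next
    assume "i = 1" then show ?thesis using that[of 0 4] by (simp add: Ns)
   next
    assume "i = 2" then show ?thesis using that[of 0 5] by (simp add: Ns)
   next
    assume "i = 3" then show ?thesis using that[of 0 6] by (simp add: Ns)
   qed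
   then show ?thesis by blast
  qed
  then obtain a b where ab: "a < 7" "b < 7" "a ~= b" "a : N i" "b : N i" by blast
  then have "adj (f i) (f a)" "adj (f i) (f b)" using adjN that by auto
  then have "f a = f b" using l unfolding leaf_def by blast
  then show False using f_eq ab by simp
 qed
 have lift: "EX p:Aut. ALL i<7. p (f i) = f (sg ! i)" if s: "sg = [0,1,3,2,4,6,5] | sg = [0,2,1,3,5,4,6]" for sg :: "nat list"
 proof (rule diagram_lift[OF d])
  show "sg ! i < 7" if "i < 7" for i by (rule E6_edges_perm(1)[OF s that that])
  show "inj_on (%i. sg ! i) {..<7}"
  proof (rule inj_on_inverseI[where g = "%i. sg ! i"])
   fix i :: nat assume "i : {..<7}"
   then show "sg ! (sg ! i) = i" using E6_edges_perm(2)[OF s, of i i] by simp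
  qed
  show "sg ! j : N (sg ! i) \<longleftrightarrow> j : N i" if "i < 7" "j < 7" for i j
   unfolding N_def mem_Collect_eq by (rule E6_edges_perm(3)[OF s that])
 qed
 obtain r where r: "r : Aut" "!!i. i < 7 ==> r (f i) = f ([0,1,3,2,4,6,5] ! i)" using lift by blast
 obtain s where s: "s : Aut" "!!i. i < 7 ==> s (f i) = f ([0,2,1,3,5,4,6] ! i)" using lift by blast
 define ix where "ix z = (if z = 0 then 4 else if z = 1 then 5 else 6 :: nat)" for z :: int
 define u where "u z = f (ix (z mod 3))" for z :: int
 have ix: "ix z < 7" "4 <= ix z" for z by (simp_all add: ix_def)
 have m3: "z mod 3 = 0 | z mod 3 = 1 | z mod 3 = 2" for z :: int by presburger
 have u_eq: "u i = u j \<longleftrightarrow> i mod 3 = j mod 3" for i j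
  unfolding u_def f_eq[OF ix(1) ix(1)] using m3[of i] m3[of j] by (elim disjE) (simp_all add: ix_def)
 have umod: "u (z mod 3) = u z" for z unfolding u_eq by simp
 have neg: "z mod 3 = 0 ==> (- z) mod 3 = 0" "z mod 3 = 1 ==> (- z) mod 3 = 2" "z mod 3 = 2 ==> (- z) mod 3 = 1"
  "z mod 3 = 0 ==> (1 - z) mod 3 = 1" "z mod 3 = 1 ==> (1 - z) mod 3 = 0" "z mod 3 = 2 ==> (1 - z) mod 3 = 2"
  for z :: int by presburger+
 have ru: "r (u z) = u (- z)" for z
  unfolding u_def r(2)[OF ix(1)] using m3[of z] by (elim disjE) (simp_all add: neg ix_def)
 have su: "s (u z) = u (1 - z)" for z
  unfolding u_def s(2)[OF ix(1)] using m3[of z] by (elim disjE) (simp_all add: neg ix_def)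
 have u_in: "u z : B" for z unfolding u_def by (rule f_in[OF ix(1)])
 have uv: "u 0 = f 4" "u 1 = f 5" "u 2 = f 6" by (simp_all add: u_def ix_def)
 have ex: "EX a. h (u z) = u a" if h: "h : Aut" for h z
 proof -
  obtain j where j: "j < 7" "h (u z) = f j" using Bf[OF AutD(1)[OF h u_in]] by blast
  have "leaf (u z)" unfolding u_def by (rule leaf_f[OF ix(2,1)])
  then have "leaf (f j)" using leaf_Aut[OF h u_in] j(2) by metis
  then have "j = 4 | j = 5 | j = 6" using lt[OF j(1)] nleaf[of j] by auto
  then have "h (u z) = u 0 | h (u z) = u 1 | h (u z) = u 2" using j(2) unfolding uv by auto
  then show ?thesis by blast
 qed
 have dih: "EX a e. (e = 1 | e = - 1) & (ALL i. h (u i) = u (a + e * i))" if h: "h : Aut" for h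
 proof -
  obtain a where a: "h (u 0) = u a" using ex[OF h] by blast
  obtain b where b: "h (u 1) = u b" using ex[OF h] by blast
  obtain d where d: "h (u 2) = u d" using ex[OF h] by blast
  have "h (u 1) ~= h (u 0)" "h (u 2) ~= h (u 0)" "h (u 2) ~= h (u 1)"
   using AutD(4)[OF h] u_eq[of 1 0] u_eq[of 2 0] u_eq[of 2 1] by (auto simp: inj_eq)
  then have ne: "b mod 3 ~= a mod 3" "d mod 3 ~= a mod 3" "d mod 3 ~= b mod 3" using a b d u_eq by auto
  have "EX e. (e = 1 | e = - 1) & b mod 3 = (a + e * 1) mod 3 & d mod 3 = (a + e * 2) mod 3"
   by (rule cong3_cases[OF ne])
  then obtain e where e: "e = 1 | e = - 1" "b mod 3 = (a + e * 1) mod 3" "d mod 3 = (a + e * 2) mod 3" by blast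
  have "h (u i) = u (a + e * i)" for i
  proof -
   have "h (u (i mod 3)) = u (a + e * (i mod 3))"
    using m3[of i]
   proof (elim disjE)
    assume "i mod 3 = 0" then show ?thesis using a by simp
   next
    assume 1: "i mod 3 = 1" show ?thesis unfolding 1 b u_eq by (rule e(2))
   next
    assume 2: "i mod 3 = 2" show ?thesis unfolding 2 d u_eq by (rule e(3))
   qed
   moreover have "u (a + e * (i mod 3)) = u (a + e * i)" unfolding u_eq by (rule mod_affine)
   ultimately show ?thesis using umod[of i] by simp
  qed
  then show ?thesis using e(1) by blast
 qed
 show ?thesis
 proof (rule is_coxeter_group_dihedral[OF group_Aut, of 3 u r s])
  show "h = id" if h: "h : Aut" "h (u 0) = u 0" "h (u 1) = u 1" for h
  proof -
   have nxt: "h (f j) = f j" if n: "i < 7" "j < 7" "h (f i) = f i" "j : N i" "!!k. k : N i ==> k ~= j ==> h (f k) = f k" for i j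
   proof (rule fix_next[OF h(1) n(3)])
    show "adj (f i) (f j)" using adjN[OF n(1,2)] n(4) by simp
    show "h z = z" if z: "adj (f i) z" "z ~= f j" for z
     using nbrE[OF n(1) z(1)] n(5) z(2) by auto
   qed
   have 4: "h (f 4) = f 4" "h (f 5) = f 5" using h(2,3) unfolding uv by auto
   have 1: "h (f 1) = f 1" by (rule nxt[of 4 1]) (use 4 in \<open>auto simp: Ns\<close>)
   have 2: "h (f 2) = f 2" by (rule nxt[of 5 2]) (use 4 in \<open>auto simp: Ns\<close>)
   have 0: "h (f 0) = f 0" by (rule nxt[of 1 0]) (use 4 1 in \<open>auto simp: Ns\<close>)
   have 3: "h (f 3) = f 3" by (rule nxt[of 0 3]) (use 0 1 2 in \<open>auto simp: Ns\<close>)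
   have 6: "h (f 6) = f 6" by (rule nxt[of 3 6]) (use 0 3 in \<open>auto simp: Ns\<close>)
   have "h x = x" if x: "x : B" for x
   proof -
    obtain i where i: "i < 7" "x = f i" using Bf[OF x] by blast
    then show ?thesis using lt[OF i(1)] 0 1 2 3 4 6 by auto
   qed
   then show ?thesis by (rule Aut_eq_id[OF h(1)])
  qed
  show "u i = u j \<longleftrightarrow> i mod int 3 = j mod int 3" for i j using u_eq by simp
 qed (use r(1) s(1) ru su dih in auto)
qed

section \<open>Branch nodes, chains, and the shape of the remaining diagrams\<close>

definition branch :: "'a => bool" where
 "branch x \<longleftrightarrow> (EX a b c. adj x a & adj x b & adj x c & a ~= b & a ~= c & b ~= c)"

lemma branch_Aut: assumes p: "p : Aut" and x: "x : B" shows "branch x ==> branch (p x)"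
proof -
 assume "branch x"
 then obtain a b c where abc: "adj x a" "adj x b" "adj x c" "a ~= b" "a ~= c" "b ~= c" unfolding branch_def by blast
 have "adj (p x) (p a)" "adj (p x) (p b)" "adj (p x) (p c)" using abc adj_Aut[OF p x] adj_in by auto
 moreover have "p a ~= p b" "p a ~= p c" "p b ~= p c" using abc AutD(4)[OF p] by (simp_all add: inj_eq)
 ultimately show "branch (p x)" unfolding branch_def by blast
qed

text \<open>Indexed from 0 to \<open>k\<close>, so \<open>k\<close> counts edges; further edges
  between the nodes are not excluded.\<close>

definition chain :: "(nat => 'a) => nat => bool" where
 "chain g k \<longleftrightarrow> inj_on g {..k} & g ` {..k} \<subseteq> B & (ALL i<k. adj (g i) (g (Suc i)))"

lemma chainD:
 assumes "chain g k"
 shows "i <= k ==> g i : B" "i <= k ==> j <= k ==> g i = g j \<longleftrightarrow> i = j" "i < k ==> adj (g i) (g (Suc i))"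
 using assms inj_on_eq_iff[of g "{..k}" i j] by (auto simp: chain_def)

lemma chainI:
 assumes "!!i. i <= k ==> g i : B" "!!i j. i <= k ==> j <= k ==> g i = g j ==> i = j"
  "!!i. i < k ==> adj (g i) (g (Suc i))"
 shows "chain g k"
 unfolding chain_def using assms by (auto intro!: inj_onI)

lemma chain_rev:
 assumes "chain g k" shows "chain (%i. g (k - i)) k"
proof (rule chainI)
 show "g (k - i) : B" for i by (rule chainD(1)[OF assms]) simp
 show "i = j" if "i <= k" "j <= k" "g (k - i) = g (k - j)" for i j
  using that chainD(2)[OF assms, of "k - i" "k - j"] by simp
 show "adj (g (k - i)) (g (k - Suc i))" if "i < k" for i
 proof -
  have "Suc (k - Suc i) = k - i" using that by simp
  then show ?thesis using chainD(3)[OF assms, of "k - Suc i"] adj_commute that by simp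
 qed
qed

lemma chain_Cons:
 assumes c: "chain g k" and q: "q : B" "!!i. i <= k ==> g i ~= q" "adj q (g 0)"
 shows "chain (case_nat q g) (Suc k)"
proof (rule chainI)
 show "case_nat q g i : B" if "i <= Suc k" for i using that chainD(1)[OF c] q(1) by (cases i) auto
 show "i = j" if "i <= Suc k" "j <= Suc k" "case_nat q g i = case_nat q g j" for i j
 proof (cases i; cases j)
  fix a assume "i = 0" "j = Suc a" then show ?thesis using that q(2)[of a] by auto
 next
  fix a assume "i = Suc a" "j = 0" then show ?thesis using that q(2)[of a] by auto
 next
  fix a b assume "i = Suc a" "j = Suc b" then show ?thesis using that chainD(2)[OF c, of a b] by auto
 qed simp
 show "adj (case_nat q g i) (case_nat q g (Suc i))" if "i < Suc k" for i
  using that chainD(3)[OF c] q(3) by (cases i) auto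
qed

lemma chain_sub:
 assumes c: "chain g k" and l: "i + l <= k" shows "chain (%t. g (i + t)) l"
proof (rule chainI)
 show "g (i + t) : B" if "t <= l" for t using chainD(1)[OF c] that l by simp
 show "a = b" if "a <= l" "b <= l" "g (i + a) = g (i + b)" for a b
  using chainD(2)[OF c, of "i + a" "i + b"] that l by simp
 show "adj (g (i + t)) (g (i + Suc t))" if "t < l" for t
  using chainD(3)[OF c, of "i + t"] that l by simp
qed

lemma chain_bound: assumes "chain g k" shows "k < card B"
proof -
 have "card (g ` {..k}) = Suc k" using assms by (simp add: chain_def card_image)
 moreover have "card (g ` {..k}) <= card B" using assms finite_B by (intro card_mono) (auto simp: chain_def)
 ultimately show ?thesis by simp
qed

lemma Aut_chain_cycle:
 assumes c: "chain g k" and k: "k >= 2" and cl: "adj (g k) (g 0)"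
 shows "is_coxeter_group (comp_group Aut)"
proof (rule Aut_cycle[of g "Suc k"])
 have "{..<Suc k} = {..k}" by auto
 then show "inj_on g {..<Suc k}" "g ` {..<Suc k} \<subseteq> B" using c by (simp_all add: chain_def)
 show "adj (g t) (g (Suc t))" if "Suc t < Suc k" for t using chainD(3)[OF c] that by simp
qed (use k cl in auto)

lemma inj_on_nth_list: "distinct xs ==> inj_on (%i. xs ! i) {..<length xs}"
 by (auto simp: inj_on_def nth_eq_iff_index_eq)

lemma image_nth_list: "(%i. xs ! i) ` {..<length xs} = set xs"
 by (auto simp: set_conv_nth)

text \<open>Fix a longest chain. Unless one of the diagrams treated above occurs, at most one node lies
  outside it, and that node is a leaf attached to an interior node.\<close>

theorem is_coxeter_group_Aut: "is_coxeter_group (comp_group Aut)"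
proof (rule ccontr)
 assume notc: "~ ?thesis"
 have cycle: False if "chain g k" "k >= 2" "adj (g k) (g 0)" for g k
  using notc Aut_chain_cycle[OF that] by blast
 have ex1: "EX g. chain g 1"
 proof -
  have "B ~= {}" using card_B by auto
  then obtain x where x: "x : B" by blast
  have "{x} ~= B" using card_B by auto
  then obtain y where y: "adj x y" using connected[of "{x}"] x by auto
  have "chain (case_nat x (%_. y)) (Suc 0)"
  proof (rule chain_Cons)
   show "chain (%_. y) 0" using adj_in(2)[OF y] by (simp add: chain_def)
  qed (use y adj_in[OF y] in auto)
  then have "chain (case_nat x (%_. y)) 1" by (simp add: One_nat_def)
  then show ?thesis by blast
 qed
 have "EX l. (EX g. chain g l) & (ALL k. (EX g. chain g k) --> k <= l)"
 proof (rule Nat.ex_has_greatest_nat[where P = "%k. EX g. chain g k" and k = 1 and b = "card B"])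
  show "EX g. chain g 1" by (rule ex1)
  show "ALL k. (EX g. chain g k) --> k <= card B" using chain_bound less_imp_le by blast
 qed
 then obtain l p where p: "chain p l" and max: "!!k g. chain g k ==> k <= l" by blast
 have l1: "l >= 1" using ex1 max by blast
 define P where "P = p ` {..l}"
 have PB: "P \<subseteq> B" using p by (simp add: P_def chain_def)
 have p_in: "p i : B" "p i : P" if "i <= l" for i using chainD(1)[OF p that] that by (auto simp: P_def)
 have p_eq: "p i = p j \<longleftrightarrow> i = j" if "i <= l" "j <= l" for i j using chainD(2)[OF p that] .
 have p_adj: "adj (p i) (p (Suc i))" if "i < l" for i using chainD(3)[OF p that] .
 have p_adj': "adj (p (Suc i)) (p i)" if "i < l" for i using p_adj[OF that] adj_commute by blast
 have PE: "EX i<=l. x = p i" if "x : P" for x using that by (auto simp: P_def)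
 \<comment> \<open>An edge between nonconsecutive nodes of the chain closes a cycle.\<close>
 have A0: False if "i <= l" "j <= l" "Suc i < j" "adj (p i) (p j)" for i j
 proof -
  have c: "chain (%t. p (i + t)) (j - i)" by (rule chain_sub[OF p]) (use that in simp)
  have a: "adj (p (i + (j - i))) (p (i + 0))" using that adj_commute by simp
  have "2 <= j - i" using that(3) by linarith
  then show False by (rule cycle[OF c _ a])
 qed
 have A1: "j = Suc i | i = Suc j" if "i <= l" "j <= l" "adj (p i) (p j)" for i j
 proof -
  have "i ~= j" using adj_in(3)[OF that(3)] by auto
  moreover have "~ Suc i < j" using A0[OF that(1,2)] that(3) by blast
  moreover have "~ Suc j < i" using A0[OF that(2,1)] that(3) adj_commute by blast
  ultimately show ?thesis by linarith
 qed
 \<comment> \<open>An outer node attached to an end would prolong the longest chain.\<close>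
 have A2: "0 < i & i < l" if q: "q : B" "q ~: P" "adj q (p i)" "i <= l" for q i
 proof -
  have "i ~= 0"
  proof
   assume "i = 0"
   then have "chain (case_nat q p) (Suc l)" by (intro chain_Cons[OF p]) (use q p_in in auto)
   then show False using max by fastforce
  qed
  moreover have "i ~= l"
  proof
   assume "i = l"
   then have "chain (case_nat q (%i. p (l - i))) (Suc l)"
    by (intro chain_Cons[OF chain_rev[OF p]]) (use q p_in in auto)
   then show False using max by fastforce
  qed
  ultimately show ?thesis using q(4) by simp
 qed
 \<comment> \<open>Two attachments of \<open>q\<close> to the chain would close a cycle through
   \<open>q\<close>.\<close>
 have A3': False if q: "q : B" "q ~: P" "adj q (p i)" "adj q (p j)" "i < j" "j <= l" for q i j
 proof -
  have c: "chain (%t. p (i + t)) (j - i)" by (rule chain_sub[OF p]) (use q in simp)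
  have c2: "chain (case_nat q (%t. p (i + t))) (Suc (j - i))"
   by (rule chain_Cons[OF c]) (use q p_in in auto)
  have a: "adj (case_nat q (%t. p (i + t)) (Suc (j - i))) (case_nat q (%t. p (i + t)) 0)"
   using q adj_commute by simp
  have "2 <= Suc (j - i)" using q(5) by linarith
  then show False by (rule cycle[OF c2 _ a])
 qed
 have A3: "i = j" if "q : B" "q ~: P" "adj q (p i)" "adj q (p j)" "i <= l" "j <= l" for q i j
  using A3'[OF that(1,2,3,4)] A3'[OF that(1,2,4,3)] that(5,6) by (meson linorder_neqE_nat)
 \<comment> \<open>Two outer nodes at the same place give the star with four leaves.\<close>
 have A4: "q = q'" if q: "q : B" "q ~: P" "adj q (p i)" "i <= l" and q': "q' : B" "q' ~: P" "adj q' (p i)" for q q' i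
 proof (rule ccontr)
  assume ne: "q ~= q'"
  obtain i' where i': "i = Suc i'" "Suc i < Suc l" using A2[OF q] by (cases i) auto
  have il: "i < l" using A2[OF q] by simp
  let ?xs = "[p i', p (Suc i), q, q', p i]"
  have notP: "p j ~= q" "p j ~= q'" "q ~= p j" "q' ~= p j" if "j <= l" for j using p_in(2)[OF that] q q' by auto
  have "p i' ~= p (Suc i)" "p i' ~= p i" "p (Suc i) ~= p i" using i' il p_eq by auto
  then have dist: "distinct ?xs" using ne notP[of i'] notP[of i] notP[of "Suc i"] i' il by auto
  have len: "length ?xs = 5" by simp
  have sub: "set ?xs \<subseteq> B" using p_in i' il q q' by auto
  have "is_coxeter_group (comp_group Aut)"
  proof (rule Aut_star4[of "%t. ?xs ! t"])
   show "inj_on (%t. ?xs ! t) {..<5}" using inj_on_nth_list[OF dist] unfolding len .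
   show "(%t. ?xs ! t) ` {..<5} \<subseteq> B" using image_nth_list[of ?xs] sub unfolding len by (simp only:)
   show "adj (?xs ! 4) (?xs ! t)" if "t < 4" for t
   proof -
    have ad: "adj (p i) (p i')" "adj (p i) (p (Suc i))" "adj (p i) q" "adj (p i) q'"
     using p_adj'[of i'] p_adj[OF il] i' il q(3) q'(3) adj_commute by auto
    have nth: "?xs ! 0 = p i'" "?xs ! 1 = p (Suc i)" "?xs ! 2 = q" "?xs ! 3 = q'" "?xs ! 4 = p i"
     by (simp_all add: One_nat_def)
    have "t = 0 | t = 1 | t = 2 | t = 3" using that by linarith
    then show ?thesis by (elim disjE) (simp_all only: nth ad)
   qed
  qed
  then show False using notc by simp
 qed
 \<comment> \<open>Two outer nodes at different places give two forks. As \<open>L\<close> counts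
   the nodes from \<open>p i\<close> to \<open>p j\<close>, the node 2 of the fork diagram is
   \<open>p i\<close> and the node \<open>L + 1\<close> is \<open>p j\<close>.\<close>
 have A5': False if q: "q : B" "q ~: P" "adj q (p i)" "i <= l" and q': "q' : B" "q' ~: P" "adj q' (p j)" "j <= l" and ij: "i < j" for q q' i j
 proof -
  have ne: "q ~= q'" using A3[OF q(1,2,3) _ q(4) q'(4)] q'(3) ij by auto
  obtain i' where i': "i = Suc i'" using A2[OF q] by (cases i) auto
  have jl: "j < l" using A2[OF q'] by simp
  define L where "L = j - i + 1"
  have L: "j = i' + L" "L >= 2" using ij i' by (auto simp: L_def)
  define f where "f t = (if t = 0 then p i' else if t = 1 then q else if t = L + 3 then q' else p (i' + (t - 1)))" for t
  have notP: "p j ~= q" "p j ~= q'" "q ~= p j" "q' ~= p j" if "j <= l" for j using p_in(2)[OF that] q q' by auto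
  have fs: "f 0 = p i'" "f 1 = q" "f (L + 3) = q'" "!!t. 2 <= t ==> t <= L + 2 ==> f t = p (i' + (t - 1))"
   by (auto simp: f_def)
  have idx: "t = 0 | t = 1 | t = L + 3 | 2 <= t & t <= L + 2" if "t < L + 4" for t using that by linarith
  have bnd: "i' <= l" "i' + (t - 1) <= l" if "t <= L + 2" for t using that L jl by auto
  have inj: "a = b" if ab: "a < L + 4" "b < L + 4" "f a = f b" for a b
   using idx[OF ab(1)] idx[OF ab(2)]
  proof (elim disjE)
   assume x: "2 <= a & a <= L + 2" "2 <= b & b <= L + 2"
   then have "p (i' + (a - 1)) = p (i' + (b - 1))" using ab(3) fs(4)[of a] fs(4)[of b] by metis
   then have "i' + (a - 1) = i' + (b - 1)" using p_eq[OF bnd(2) bnd(2), of a b] x by blast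
   then show ?thesis using x by linarith
  next
   assume x: "a = 0" "2 <= b & b <= L + 2"
   then have "p i' = p (i' + (b - 1))" using ab(3) fs(1) fs(4)[of b] by metis
   then have "i' = i' + (b - 1)" using p_eq[OF bnd(1) bnd(2), of b b] x by blast
   then show ?thesis using x by linarith
  next
   assume x: "b = 0" "2 <= a & a <= L + 2"
   then have "p i' = p (i' + (a - 1))" using ab(3) fs(1) fs(4)[of a] by metis
   then have "i' = i' + (a - 1)" using p_eq[OF bnd(1) bnd(2), of a a] x by blast
   then show ?thesis using x by linarith
  next
   assume x: "a = 1" "2 <= b & b <= L + 2"
   then show ?thesis using ab(3) notP[OF bnd(2), of b] fs(2) fs(4)[of b] by simp
  next
   assume x: "b = 1" "2 <= a & a <= L + 2"
   then show ?thesis using ab(3) notP[OF bnd(2), of a] fs(2) fs(4)[of a] by simp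
  next
   assume x: "a = L + 3" "2 <= b & b <= L + 2"
   then show ?thesis using ab(3) notP[OF bnd(2), of b] fs(3) fs(4)[of b] by simp
  next
   assume x: "b = L + 3" "2 <= a & a <= L + 2"
   then show ?thesis using ab(3) notP[OF bnd(2), of a] fs(3) fs(4)[of a] by simp
  next
   assume "a = 0" "b = 1" then show ?thesis using ab(3) notP[OF bnd(1)[of 0]] fs by simp
  next
   assume "a = 1" "b = 0" then show ?thesis using ab(3) notP[OF bnd(1)[of 0]] fs by simp
  next
   assume "a = 0" "b = L + 3" then show ?thesis using ab(3) notP[OF bnd(1)[of 0]] fs by simp
  next
   assume "a = L + 3" "b = 0" then show ?thesis using ab(3) notP[OF bnd(1)[of 0]] fs by simp
  next
   assume "a = 1" "b = L + 3" then show ?thesis using ab(3) ne fs by simp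
  next
   assume "a = L + 3" "b = 1" then show ?thesis using ab(3) ne fs by simp
  qed simp_all
  have "is_coxeter_group (comp_group Aut)"
  proof (rule Aut_two_forks[of f L])
   show "inj_on f {..<L + 4}" using inj by (auto intro!: inj_onI)
   show "f ` {..<L + 4} \<subseteq> B"
   proof
    fix x assume "x : f ` {..<L + 4}"
    then obtain t where t: "t < L + 4" "x = f t" by auto
    show "x : B" using idx[OF t(1)]
    proof (elim disjE)
     assume "2 <= t & t <= L + 2" then show ?thesis using fs(4)[of t] t(2) p_in(1)[OF bnd(2), of t] by simp
    qed (use fs t(2) p_in(1)[OF bnd(1)[of 0]] q q' in auto)
   qed
   have f2: "f 2 = p i" using fs(4)[of 2] i' L by simp
   show "adj (f 0) (f 2)" unfolding f2 fs(1) using p_adj[of i'] i' jl ij by simp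
   have fl: "f (L + 1) = p j" using fs(4)[of "L + 1"] L by simp
   show "adj (f (L + 1)) (f (L + 3))" unfolding fl fs(3) using q'(3) adj_commute by blast
   show "adj (f t) (f (Suc t))" if t: "1 <= t" "t <= L + 1" for t
   proof (cases "t = 1")
    case True
    then show ?thesis using fs(2) f2 q(3) by (simp add: numeral_2_eq_2 One_nat_def)
   next
    case False
    then obtain s where s: "t = Suc s" "1 <= s" using t by (cases t) auto
    have "f t = p (i' + s)" "f (Suc t) = p (Suc (i' + s))" using fs(4)[of t] fs(4)[of "Suc t"] s t by simp_all
    moreover have "i' + s < l" using s t L jl by simp
    ultimately show ?thesis using p_adj[of "i' + s"] by simp
   qed
  qed (use L in simp)
  then show False using notc by simp
 qed
 have A5: "q = q'" if q: "q : B" "q ~: P" "adj q (p i)" "i <= l" and q': "q' : B" "q' ~: P" "adj q' (p j)" "j <= l" for q q' i j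
 proof (cases i j rule: linorder_cases)
  case less then show ?thesis using A5'[OF q q'] by blast
 next
  case greater then show ?thesis using A5'[OF q' q] by blast
 next
  case equal then show ?thesis using A4[OF q q'(1,2)] q'(3) by blast
 qed
 \<comment> \<open>Replacing the part of the chain before \<open>g i\<close> by \<open>r\<close>,
   \<open>q\<close> gives a chain with \<open>l - i + 2\<close> edges, which is at most
   \<open>l\<close> by maximality.\<close>
 have A6': "i >= 2" if g: "chain g l" "g ` {..l} = P" and q: "q : B" "q ~: P" "adj q (g i)" "i <= l" and r: "r : B" "r ~: P" "adj q r" for q r i g
 proof -
  have c: "chain (%t. g (i + t)) (l - i)" by (rule chain_sub[OF g(1)]) (use q in simp)
  have gP: "g j : P" if "j <= l" for j using g(2) that by auto
  have c2: "chain (case_nat q (%t. g (i + t))) (Suc (l - i))"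
   by (rule chain_Cons[OF c]) (use q gP in auto)
  have "chain (case_nat r (case_nat q (%t. g (i + t)))) (Suc (Suc (l - i)))"
  proof (rule chain_Cons[OF c2])
   show "case_nat q (%t. g (i + t)) j ~= r" if "j <= Suc (l - i)" for j
    using that adj_in(3)[OF r(3)] r(2) gP q(4) by (cases j) auto
   show "adj r (case_nat q (%t. g (i + t)) 0)" using r(3) adj_commute by simp
  qed (rule r(1))
  then have "Suc (Suc (l - i)) <= l" by (rule max)
  then show ?thesis using q(4) by simp
 qed
 have rev_img: "(%i. p (l - i)) ` {..l} = P"
 proof -
  have "(%i. l - i) ` {..l} = {..l}"
  proof
   show "{..l} \<subseteq> (%i. l - i) ` {..l}"
   proof
    fix i assume "i : {..l}"
    then have "i = l - (l - i)" "l - i : {..l}" by auto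
    then show "i : (%i. l - i) ` {..l}" by blast
   qed
  qed auto
  then have "p ` ((%i. l - i) ` {..l}) = P" unfolding P_def by simp
  then show ?thesis by (simp only: image_image)
 qed
 \<comment> \<open>By the previous bound at both ends, the chain has at least two nodes on either
   side of \<open>p i\<close>; with the arm \<open>q\<close>, \<open>r\<close> this contains the
   affine diagram of type \<open>E6\<close>.\<close>
 have A6: False if q: "q : B" "q ~: P" "adj q (p i)" "i <= l" and r: "r : B" "r ~: P" "adj q r" for q r i
 proof -
  have i2: "i >= 2" by (rule A6'[OF p P_def[symmetric] q r])
  have "l - i >= 2"
   by (rule A6'[OF chain_rev[OF p] rev_img q(1,2) _ _ r]) (use q in auto)
  then have il: "i + 2 <= l" by simp
  obtain b where b: "i = Suc (Suc b)" using i2 by (metis add_2_eq_Suc le_Suc_ex)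
  let ?xs = "[p i, p (Suc b), p (Suc i), q, p b, p (Suc (Suc i)), r]"
  have notP: "p j ~= q" "p j ~= r" "q ~= p j" "r ~= p j" if "j <= l" for j using p_in(2)[OF that] q r by auto
  have "distinct (map p [i, Suc b, Suc i, b, Suc (Suc i)])"
   unfolding distinct_map using b il p_eq by (auto intro!: inj_onI)
  then have dist: "distinct ?xs"
   using adj_in(3)[OF r(3)] notP[of i] notP[of b] notP[of "Suc b"] notP[of "Suc i"] notP[of "Suc (Suc i)"] b il by auto
  have len: "length ?xs = 7" by simp
  have sub: "set ?xs \<subseteq> B" using p_in b il q r by auto
  have "is_coxeter_group (comp_group Aut)"
  proof (rule Aut_E6[of "%t. ?xs ! t"])
   show "inj_on (%t. ?xs ! t) {..<7}" using inj_on_nth_list[OF dist] unfolding len .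
   show "(%t. ?xs ! t) ` {..<7} \<subseteq> B" using image_nth_list[of ?xs] sub unfolding len by (simp only:)
   have ad: "adj (p i) (p (Suc b))" "adj (p (Suc b)) (p i)" "adj (p i) (p (Suc i))" "adj (p (Suc i)) (p i)" "adj (p i) q" "adj q (p i)"
    "adj (p (Suc b)) (p b)" "adj (p b) (p (Suc b))" "adj (p (Suc i)) (p (Suc (Suc i)))" "adj (p (Suc (Suc i))) (p (Suc i))" "adj q r" "adj r q"
    using p_adj'[of "Suc b"] p_adj[of "Suc b"] p_adj'[of i] p_adj[of i] p_adj'[of b] p_adj[of b] p_adj'[of "Suc i"] p_adj[of "Suc i"] b il q(3) r(3) adj_commute by auto
   show "adj (?xs ! s) (?xs ! t)" if "(s, t) : set E6_edges" for s t
    using that ad unfolding E6_edges_def by (auto simp: eval_nat_numeral One_nat_def)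
  qed
  then show False using notc by simp
 qed
 show False
 proof (cases "P = B")
  case True
  have nbr: "x = p (Suc i) & i < l | (EX i'. i = Suc i' & x = p i')" if x: "adj (p i) x" "i <= l" for x i
  proof -
   obtain j where j: "j <= l" "x = p j" using PE adj_in(2)[OF x(1)] True by blast
   then show ?thesis using A1[OF x(2) j(1)] x(1) by auto
  qed
  have leaf_p: "i = 0 | i = l" if i: "i <= l" "leaf (p i)" for i
  proof (rule ccontr)
   assume "~ ?thesis"
   then obtain i' where i': "i = Suc i'" "i < l" using i by (cases i) auto
   have "p i' = p (Suc i)" using i(2) p_adj[of i] p_adj'[of i'] i' unfolding leaf_def by auto
   then show False using p_eq[of i' "Suc i"] i' by simp
  qed
  have leaf0: "leaf (p 0)" unfolding leaf_def using nbr[of 0] by auto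
  \<comment> \<open>The diagram is a path, and an automorphism is determined by the end to which it
    sends \<open>p 0\<close>.\<close>
  have "is_coxeter_group (comp_group Aut)"
  proof (rule Aut_le_2[of "p 0" "p l"])
   show "p 0 : B" using p_in by simp
   show "h (p 0) = p 0 | h (p 0) = p l" if h: "h : Aut" for h
   proof -
    have b: "p 0 : B" using p_in by simp
    obtain j where j: "j <= l" "h (p 0) = p j" using PE AutD(1)[OF h b] True by blast
    have "leaf (p j)" using leaf_Aut[OF h b] leaf0 j(2) by simp
    then show ?thesis using leaf_p[OF j(1)] j(2) by auto
   qed
   show "h = id" if h: "h : Aut" "h (p 0) = p 0" for h
   proof -
    have "i <= l --> h (p i) = p i" for i
    proof (induction i rule: less_induct)
     case (less i)
     show ?case
     proof (cases i)
      case 0 then show ?thesis using h by simp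
     next
      case (Suc s)
      show ?thesis
      proof
       assume il: "i <= l"
       show "h (p i) = p i"
       proof (rule fix_next[OF h(1)])
        show "h (p s) = p s" using less[of s] Suc il by simp
        show "adj (p s) (p i)" using p_adj[of s] Suc il by simp
        show "h z = z" if z: "adj (p s) z" "z ~= p i" for z
        proof -
         obtain s' where "s = Suc s'" "z = p s'" using nbr[OF z(1)] z(2) Suc il by auto
         then show ?thesis using less[of s'] Suc il by simp
        qed
       qed
      qed
     qed
    qed
    then have "h x = x" if "x : B" for x using PE that True by blast
    then show ?thesis by (rule Aut_eq_id[OF h(1)])
   qed
  qed
  then show False using notc by simp
 next
  case False
  have "P ~= {}" by (auto simp: P_def)
  then obtain x q where xq: "x : P" "q : B - P" "adj x q" using connected[OF PB _ False] by blast
  obtain i where i: "i <= l" "x = p i" using PE[OF xq(1)] by blast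
  have q: "q : B" "q ~: P" "adj q (p i)" using xq i adj_commute by auto
  \<comment> \<open>A further node would be attached to \<open>q\<close> or to the chain, which
    \<open>A6\<close> and \<open>A5\<close> exclude.\<close>
  have Bq: "B = P \<union> {q}"
  proof (rule ccontr)
   assume "B ~= P \<union> {q}"
   then have "P \<union> {q} ~= B" "P \<union> {q} \<subseteq> B" "P \<union> {q} ~= {}" using PB q by auto
   then obtain y r where yr: "y : P \<union> {q}" "r : B - (P \<union> {q})" "adj y r" using connected[of "P \<union> {q}"] by blast
   show False
   proof (cases "y = q")
    case True
    then show False using A6[OF q i(1), of r] yr by auto
   next
    case False
    then obtain j where j: "j <= l" "y = p j" using PE yr(1) by blast
    have "adj r (p j)" using yr(3) j(2) adj_commute by simp
    then show False using A5[OF q i(1), of r j] yr(2) j(1) by auto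
   qed
  qed
  have il: "0 < i" "i < l" using A2[OF q i(1)] by auto
  obtain i' where i': "i = Suc i'" using il by (cases i) auto
  define a b where "a = p i'" and "b = p (Suc i)"
  have nbr_q: "x = p i" if "adj q x" for x
  proof -
   have "x : P" using adj_in[OF that] Bq by auto
   then obtain j where "j <= l" "x = p j" using PE by blast
   then show ?thesis using A3[OF q(1,2) q(3), of j] that i(1) by simp
  qed
  have nbr: "x = p (Suc j) & j < l | (EX j'. j = Suc j' & x = p j') | x = q & j = i" if x: "adj (p j) x" "j <= l" for x j
  proof (cases "x = q")
   case True
   then have "p j = p i" using nbr_q[of "p j"] x(1) adj_commute by simp
   then show ?thesis using True p_eq[OF x(2) i(1)] by simp
  next
   case False
   then have "x : P" using adj_in(2)[OF x(1)] Bq by auto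
   then obtain k where k: "k <= l" "x = p k" using PE by blast
   then show ?thesis using A1[OF x(2) k(1)] x(1) by auto
  qed
  have aT: "adj (p i) a" "adj (p i) b" "adj (p i) q"
   using p_adj'[of i'] p_adj[of i] i' il q(3) adj_commute by (auto simp: a_def b_def)
  have inB: "a : B" "b : B" "q : B" "p i : B" using adj_in aT by blast+
  have dT: "a ~= b" "a ~= q" "b ~= q"
   using p_eq[of i' "Suc i"] p_in(2)[of i'] p_in(2)[of "Suc i"] i' il q(2) by (auto simp: a_def b_def)
  have T: "x = a | x = b | x = q" if "adj (p i) x" for x
   using nbr[OF that i(1)] i' by (auto simp: a_def b_def)
  have br: "branch (p i)" unfolding branch_def using aT dT by blast
  \<comment> \<open>Makes \<open>p i\<close> a fixed point of every automorphism.\<close>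
  have br_only: "x = p i" if bx: "branch x" for x
  proof -
   obtain u v w where uvw: "adj x u" "adj x v" "adj x w" "u ~= v" "u ~= w" "v ~= w" using bx unfolding branch_def by blast
   have "x ~= q" using uvw nbr_q by metis
   then have "x : P" using adj_in(1)[OF uvw(1)] Bq by auto
   then obtain j where j: "j <= l" "x = p j" using PE by blast
   have "j = i"
   proof (rule ccontr)
    assume "j ~= i"
    then have "y = p (Suc j) | (EX j'. j = Suc j' & y = p j')" if "adj x y" for y
     using nbr[of j y] that j by auto
    then show False using uvw by (metis Suc_inject)
   qed
   then show ?thesis using j by simp
  qed
  have fix_i: "h (p i) = p i" if "h : Aut" for h
   using br_only branch_Aut[OF that inB(4) br] by blast
  have perm: "h x = a | h x = b | h x = q" if "h : Aut" "adj (p i) x" for h x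
   using T[OF Aut_nbr[OF that(1) fix_i[OF that(1)] that(2)]] .
  have all: "h = id" if h: "h : Aut" "h a = a" "h b = b" "h q = q" for h
  proof -
   have "t + i <= l --> h (p (t + i)) = p (t + i)" for t
   proof (induction t rule: less_induct)
    case (less t)
    show ?case
    proof (intro impI)
     assume tl: "t + i <= l"
     show "h (p (t + i)) = p (t + i)"
     proof (cases "t <= 1")
      case True
      then have "t = 0 | t = 1" by linarith
      then show ?thesis using fix_i[OF h(1)] h(3) by (auto simp: b_def One_nat_def)
     next
      case False
      then obtain s where s: "t = Suc (Suc s)" by (metis Suc_le_D not_less_eq_eq One_nat_def)
      show ?thesis
      proof (rule fix_next[OF h(1)])
       show "h (p (Suc s + i)) = p (Suc s + i)" using less[of "Suc s"] s tl by simp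
       show "adj (p (Suc s + i)) (p (t + i))" using p_adj[of "Suc s + i"] s tl by simp
       show "h z = z" if z: "adj (p (Suc s + i)) z" "z ~= p (t + i)" for z
       proof -
        have "z = p (s + i)" using nbr[OF z(1)] z(2) s tl by auto
        then show ?thesis using less[of s] s tl by simp
       qed
      qed
     qed
    qed
   qed
   then have up: "h (p j) = p j" if "i <= j" "j <= l" for j
    using that by (metis le_add_diff_inverse2)
   have "t <= i --> h (p (i - t)) = p (i - t)" for t
   proof (induction t rule: less_induct)
    case (less t)
    show ?case
    proof (intro impI)
     assume tl: "t <= i"
     show "h (p (i - t)) = p (i - t)"
     proof (cases "t <= 1")
      case True
      then have "t = 0 | t = 1" by linarith
      then show ?thesis using fix_i[OF h(1)] h(2) i' by (auto simp: a_def)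
     next
      case False
      then obtain s where s: "t = Suc (Suc s)" by (metis Suc_le_D not_less_eq_eq One_nat_def)
      define j where "j = i - t"
      have j: "i - Suc s = Suc j" "i - s = Suc (Suc j)" "Suc j ~= i" "Suc j <= l" "j < l" using s tl il by (auto simp: j_def)
      show ?thesis unfolding j_def[symmetric]
      proof (rule fix_next[OF h(1)])
       show "h (p (Suc j)) = p (Suc j)" using less[of "Suc s"] s tl j by simp
       show "adj (p (Suc j)) (p j)" by (rule p_adj'[OF j(5)])
       show "h z = z" if z: "adj (p (Suc j)) z" "z ~= p j" for z
       proof -
        have "z = p (Suc (Suc j))" using nbr[OF z(1)] z(2) j by auto
        then show ?thesis using less[of s] s tl j by simp
       qed
      qed
     qed
    qed
   qed
   then have down: "h (p j) = p j" if "j <= i" for j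
    using that by (metis diff_diff_cancel diff_le_self)
   have "h x = x" if "x : B" for x
   proof (cases "x = q")
    case True then show ?thesis using h by simp
   next
    case False
    then obtain j where j: "j <= l" "x = p j" using PE Bq \<open>x : B\<close> by blast
    then show ?thesis using up[of j] down[of j] by (cases "i <= j") auto
   qed
   then show ?thesis by (rule Aut_eq_id[OF h(1)])
  qed
  \<comment> \<open>If one neighbour \<open>z\<close> of \<open>p i\<close> is always fixed, only
    the other two can be exchanged, and the group has order at most 2.\<close>
  have fin: False
   if zxy: "{z, x, y} = {a, b, q}" "x ~= z" "y ~= z" and fz: "!!h. h : Aut ==> h z = z" for z x y
  proof -
   have xin: "x = a | x = b | x = q" "y = a | y = b | y = q" using zxy(1) by blast+
   have xT: "adj (p i) x" "adj (p i) y" using xin aT by auto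
   have "is_coxeter_group (comp_group Aut)"
   proof (rule Aut_le_2[of x y])
    show "x : B" by (rule adj_in(2)[OF xT(1)])
    have hx: "h w = x | h w = y" if h: "h : Aut" and w: "adj (p i) w" "w ~= z" for h w
    proof -
     have "h w : {a, b, q}" using perm[OF h w(1)] by blast
     then have "h w : {z, x, y}" unfolding zxy(1) .
     moreover have "h w ~= z" using fz[OF h] AutD(4)[OF h] w(2) by (metis injD)
     ultimately show ?thesis by blast
    qed
    show "h x = x | h x = y" if "h : Aut" for h by (rule hx[OF that xT(1) zxy(2)])
    show "h = id" if h: "h : Aut" "h x = x" for h
    proof -
     have hz: "h z = z" by (rule fz[OF h(1)])
     have "x ~= y"
     proof
      assume "x = y"
      then have "card {a, b, q} <= 2" unfolding zxy(1)[symmetric] using zxy(2) by simp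
      then show False using dT by simp
     qed
     have "h y ~= x" using h(2) AutD(4)[OF h(1)] \<open>x ~= y\<close> by (metis injD)
     then have hy: "h y = y" using hx[OF h(1) xT(2) zxy(3)] by blast
     have "ALL w:{z, x, y}. h w = w" using h(2) hy hz by simp
     then have "ALL w:{a, b, q}. h w = w" unfolding zxy(1) .
     then show ?thesis using all[OF h(1)] by simp
    qed
   qed
   then show False using notc by simp
  qed
  have leaf_inv: "leaf (h x) \<longleftrightarrow> leaf x" if "h : Aut" "adj (p i) x" for h x
   using leaf_Aut[OF that(1) adj_in(2)[OF that(2)]] .
  have leaf_q: "leaf q" unfolding leaf_def using nbr_q by blast
  have nleaf_p: "~ leaf (p j)" if j: "0 < j" "j < l" for j
  proof
   assume lf: "leaf (p j)"
   obtain j' where j': "j = Suc j'" using j by (cases j) auto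
   have "p j' = p (Suc j)" using lf p_adj[of j] p_adj'[of j'] j' j unfolding leaf_def by auto
   then show False using p_eq[of j' "Suc j"] j' j by simp
  qed
  have leaf_0: "leaf (p 0)" unfolding leaf_def using nbr[of 0] il by auto
  have leaf_l: "leaf (p l)"
   unfolding leaf_def
  proof (intro allI impI)
   fix y z assume "adj (p l) y" "adj (p l) z"
   then show "y = z" using nbr[of l y] nbr[of l z] il by auto
  qed
  \<comment> \<open>A neighbour that alone is a leaf, or alone is not, is always fixed. As
    \<open>q\<close> is a leaf, it follows that all three are.\<close>
  have odd_one: False
   if zxy: "{z, x, y} = {a, b, q}" "leaf x \<longleftrightarrow> ~ leaf z" "leaf y \<longleftrightarrow> ~ leaf z" for z x y
  proof (rule fin[OF zxy(1)])
   show "x ~= z" "y ~= z" using zxy by auto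
   fix h assume h: "h : Aut"
   have z: "z = a | z = b | z = q" using zxy(1) by blast
   then have zT: "adj (p i) z" using aT by auto
   have "h z : {z, x, y}" unfolding zxy(1) using perm[OF h zT] by blast
   then show "h z = z" using leaf_inv[OF h zT] zxy(2,3) by auto
  qed
  have leaf_a: "leaf a \<longleftrightarrow> i' = 0" using nleaf_p[of i'] leaf_0 i' il by (cases "i' = 0") (auto simp: a_def)
  have leaf_b: "leaf b \<longleftrightarrow> Suc i = l" using nleaf_p[of "Suc i"] leaf_l i' il by (cases "Suc i = l") (auto simp: b_def)
  have la: "leaf a"
  proof (rule ccontr)
   assume na: "~ leaf a"
   show False
   proof (cases "leaf b")
    case True
    show False by (rule odd_one[of a b q]) (use na True leaf_q in auto)
   next
    case nb: False
    show False by (rule odd_one[of q a b]) (use na nb leaf_q in auto)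
   qed
  qed
  have lb: "leaf b"
  proof (rule ccontr)
   assume nb: "~ leaf b"
   show False by (rule odd_one[of b a q]) (use la nb leaf_q in auto)
  qed
  have i'0: "i' = 0" "l = 2" "i = 1" using la lb leaf_a leaf_b i' by auto
  define c where "c = p i"
  have Bset: "B = {c, a, b, q}"
  proof -
   have "{..l} = {0, 1, 2}" unfolding i'0(2) by auto
   then have "P = {p 0, p 1, p 2}" unfolding P_def by simp
   moreover have "p 0 = a" "p 1 = c" "p 2 = b" using i'0 by (auto simp: a_def b_def c_def numeral_2_eq_2 One_nat_def)
   ultimately show ?thesis unfolding Bq by auto
  qed
  have cd: "c ~= a" "c ~= b" "c ~= q" using adj_in(3)[OF aT(1)] adj_in(3)[OF aT(2)] adj_in(3)[OF aT(3)] by (auto simp: c_def)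
  have orth: "x \<bullet> y = 0" if xy: "x : {a, b, q}" "y : {a, b, q}" "x ~= y" for x y
  proof (rule ccontr)
   assume "x \<bullet> y ~= 0"
   then have "adj x y" unfolding adj_def using xy inB by auto
   moreover have "adj x (p i)" "leaf x" using xy(1) aT la lb leaf_q adj_commute by auto
   ultimately have "y = p i" unfolding leaf_def by blast
   then show False using cd xy(2) by (auto simp: c_def)
  qed
  have rel: "m c *\<^sub>R c + m a *\<^sub>R a + m b *\<^sub>R b + m q *\<^sub>R q = 0"
   using m_rel unfolding Bset using cd dT by (simp add: add.assoc)
  have mc: "m c > 0" using m_pos inB by (simp add: c_def)
  have leafrel: "m x * (x \<bullet> x) = - (m c * (c \<bullet> x))" if x: "x : {a, b, q}" for x
  proof -
   have "(m c *\<^sub>R c + m a *\<^sub>R a + m b *\<^sub>R b + m q *\<^sub>R q) \<bullet> x = 0" unfolding rel by simp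
   then have "m c * (c \<bullet> x) + m a * (a \<bullet> x) + m b * (b \<bullet> x) + m q * (q \<bullet> x) = 0" by (simp add: inner_add_left)
   then show ?thesis using x orth[of a b] orth[of a q] orth[of b q] orth[of b a] orth[of q a] orth[of q b] dT by auto
  qed
  have crel: "m c * (c \<bullet> c) + m a * (c \<bullet> a) + m b * (c \<bullet> b) + m q * (c \<bullet> q) = 0"
  proof -
   have "c \<bullet> (m c *\<^sub>R c + m a *\<^sub>R a + m b *\<^sub>R b + m q *\<^sub>R q) = 0" unfolding rel by simp
   then show ?thesis by (simp add: inner_add_right)
  qed
  define val where "val x = (c \<bullet> x, x \<bullet> x)" for x
  \<comment> \<open>A leaf with no companion of the same length and the same inner product with
    \<open>c\<close> would be fixed by all automorphisms. With three leaves, all of them then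
    agree.\<close>
  have val_eq: "EX w:{a, b, q}. w ~= z & val w = val z" if z: "z : {a, b, q}" for z
  proof (rule ccontr)
   assume no: "~ ?thesis"
   have zT: "adj (p i) z" using z aT by auto
   have fz: "h z = z" if h: "h : Aut" for h
   proof -
    have "h z : {a, b, q}" using perm[OF h zT] by blast
    moreover have "val (h z) = val z"
    proof -
     have "h (p i) \<bullet> h z = p i \<bullet> z" "h z \<bullet> h z = z \<bullet> z" using AutD(2)[OF h] inB adj_in(2)[OF zT] by blast+
     then show ?thesis using fix_i[OF h] by (simp add: val_def c_def)
    qed
    ultimately show ?thesis using no by blast
   qed
   have "z = a | z = b | z = q" using z by blast
   then show False
   proof (elim disjE)
    assume "z = a" then show False using fin[of z b q] fz dT by auto
   next
    assume "z = b" then show False using fin[of z a q] fz dT by (auto simp: insert_commute)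
   next
    assume "z = q" then show False using fin[of z a b] fz dT by (auto simp: insert_commute)
   qed
  qed
  have "val b = val a | val q = val a" using val_eq[of a] by auto
  moreover have "val a = val b | val q = val b" using val_eq[of b] by auto
  moreover have "val a = val q | val b = val q" using val_eq[of q] by auto
  ultimately have "val a = val q" "val b = val q" by metis+
  then have v: "c \<bullet> a = c \<bullet> q" "a \<bullet> a = q \<bullet> q" "c \<bullet> b = c \<bullet> q" "b \<bullet> b = q \<bullet> q" by (auto simp: val_def)
  have qq: "q \<bullet> q > 0" "c \<bullet> c > 0" using inner_pos inB by (auto simp: c_def)
  have "m a * (q \<bullet> q) = - (m c * (c \<bullet> q))" "m b * (q \<bullet> q) = - (m c * (c \<bullet> q))" "m q * (q \<bullet> q) = - (m c * (c \<bullet> q))"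
   using leafrel[of a] leafrel[of b] leafrel[of q] v by auto
  moreover have "(q \<bullet> q) * (m c * (c \<bullet> c)) + (m a * (q \<bullet> q)) * (c \<bullet> q) + (m b * (q \<bullet> q)) * (c \<bullet> q) + (m q * (q \<bullet> q)) * (c \<bullet> q) = 0"
  proof -
   have "(q \<bullet> q) * (m c * (c \<bullet> c) + m a * (c \<bullet> a) + m b * (c \<bullet> b) + m q * (c \<bullet> q)) = 0" unfolding crel by simp
   then show ?thesis unfolding v by (simp add: algebra_simps)
  qed
  ultimately have "m c * ((q \<bullet> q) * (c \<bullet> c) - 3 * ((c \<bullet> q) * (c \<bullet> q))) = 0" by (simp add: algebra_simps)
  \<comment> \<open>The relation among the nodes gives the squared cosine 1/3 at each edge, so the
    product of the two Cartan integers would be 4/3.\<close>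
  then have key: "3 * ((c \<bullet> q) * (c \<bullet> q)) = (q \<bullet> q) * (c \<bullet> c)" using mc by simp
  obtain s where s: "2 * (c \<bullet> q) / (q \<bullet> q) = of_int s" using cartan[of c q] inB by (auto elim: Ints_cases simp: c_def)
  obtain t where t: "2 * (c \<bullet> q) / (c \<bullet> c) = of_int t" using cartan[of q c] inB by (auto elim: Ints_cases simp: c_def inner_commute)
  have "2 * (c \<bullet> q) = of_int s * (q \<bullet> q)" "2 * (c \<bullet> q) = of_int t * (c \<bullet> c)"
   using s t qq by (simp_all add: field_simps)
  then have "(2 * (c \<bullet> q)) * (2 * (c \<bullet> q)) = (of_int s * (q \<bullet> q)) * (of_int t * (c \<bullet> c))" by simp
  then have "4 * (3 * ((c \<bullet> q) * (c \<bullet> q))) = 3 * (of_int (s * t) * ((q \<bullet> q) * (c \<bullet> c)))" by (simp add: algebra_simps)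
  then have "4 * ((q \<bullet> q) * (c \<bullet> c)) = 3 * (of_int (s * t) * ((q \<bullet> q) * (c \<bullet> c)))" unfolding key .
  then have "(4 - 3 * real_of_int (s * t)) * ((q \<bullet> q) * (c \<bullet> c)) = 0" by (simp add: algebra_simps)
  then have "4 - 3 * real_of_int (s * t) = 0" using qq by simp
  then have "real_of_int 4 = real_of_int (3 * (s * t))" by simp
  then have "4 = 3 * (s * t)" by (simp only: of_int_eq_iff)
  then show False by presburger
 qed
qed

end

section \<open>From the affine diagram back to the alcove\<close>

context root_base
begin

text \<open>Reflecting in \<open>al i\<close> cannot raise the coefficient of the highest root at
  \<open>i\<close>.\<close>

lemma simple_hr_nonneg: assumes i: "i : I" shows "0 <= hr \<bullet> al i"
proof -
 have "reflection (al i) hr : \<Phi>" using wd_root[of "[i]" hr] hr_root i by simp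
 then have "cw i \<bullet> reflection (al i) hr <= cw i \<bullet> hr" by (rule coeff_le_hr[OF _ i])
 then have "0 <= 2 * (hr \<bullet> al i) / (al i \<bullet> al i)"
  using coweight_simple[OF i i] by (simp add: reflection_def inner_diff_right)
 moreover have "0 < al i \<bullet> al i"
  using coweight_simple[OF i i] by (auto simp: inner_gt_zero_iff)
 ultimately show ?thesis by (simp add: zero_le_divide_iff)
qed

lemma rank_pos: "n >= 1"
proof (rule ccontr)
 assume "~ ?thesis"
 then have n0: "{..n} = {0}" by auto
 have "mk 0 *\<^sub>R nd 0 = 0" using mk_nd_relation unfolding n0 by simp
 then have "hr = 0" by (simp add: mk_0 nd_0)
 then show False using root_nonzero[OF hr_root] by simp
qed

lemma affine_nodes_base: "affine_nodes (nd ` {..n}) (%x. mk (the_inv_into {..n} nd x))"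
proof
 have inv: "the_inv_into {..n} nd (nd i) = i" if "i : {..n}" for i
  by (rule the_inv_into_f_f[OF inj_nd that])
 show "finite (nd ` {..n})" by simp
 show "0 ~: nd ` {..n}"
 proof
  assume "0 : nd ` {..n}"
  then obtain i where "i : {..n}" "0 = nd i" by blast
  then show False using root_nonzero[OF nd_root] by metis
 qed
 show "2 <= card (nd ` {..n})" using rank_pos by (simp add: card_image[OF inj_nd])
 show "0 < mk (the_inv_into {..n} nd x)" if "x : nd ` {..n}" for x using that inv mk_pos by auto
 have reindex: "(\<Sum>x\<in>nd ` {..n}. d x *\<^sub>R x) = (\<Sum>i\<in>{..n}. d (nd i) *\<^sub>R nd i)" for d
  by (simp add: sum.reindex[OF inj_nd])
 show "(\<Sum>x\<in>nd ` {..n}. mk (the_inv_into {..n} nd x) *\<^sub>R x) = 0"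
 proof -
  have "(\<Sum>i\<in>{..n}. mk (the_inv_into {..n} nd (nd i)) *\<^sub>R nd i) = (\<Sum>i\<in>{..n}. mk i *\<^sub>R nd i)"
   by (rule sum.cong) (simp_all add: inv)
  then show ?thesis unfolding reindex by (simp add: mk_nd_relation)
 qed
 show "EX t. ALL x:nd ` {..n}. d x = t * mk (the_inv_into {..n} nd x)"
  if "(\<Sum>x\<in>nd ` {..n}. d x *\<^sub>R x) = 0" for d
 proof -
  have z: "(\<Sum>i\<in>{..n}. d (nd i) *\<^sub>R nd i) = 0" using that unfolding reindex .
  have "d x = d (nd 0) * mk (the_inv_into {..n} nd x)" if x: "x : nd ` {..n}" for x
  proof -
   obtain i where i: "i : {..n}" "x = nd i" using x by blast
   show ?thesis unfolding i(2) inv[OF i(1)] by (rule nd_relation_unique[OF z i(1)])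
  qed
  then show ?thesis by blast
 qed
 show "x \<bullet> y <= 0" if xy: "x : nd ` {..n}" "y : nd ` {..n}" "x ~= y" for x y
 proof -
  obtain i j where ij: "i : {..n}" "x = nd i" "j : {..n}" "y = nd j" using xy by blast
  then have ne: "i ~= j" using xy(3) by blast
  have "i = 0 | i : I" "j = 0 | j : I" using ij(1,3) unfolding nodes_split by blast+
  then show ?thesis
  proof (elim disjE)
   assume "i = 0" "j = 0" then show ?thesis using ne by simp
  next
   assume "i = 0" "j : I" then show ?thesis using ij simple_hr_nonneg by (simp add: nd_0 nd_simple)
  next
   assume "i : I" "j = 0"
   then show ?thesis using ij simple_hr_nonneg by (simp add: nd_0 nd_simple inner_commute)
  next
   assume "i : I" "j : I"
   then show ?thesis using ij ne simple_inner_nonpos by (simp add: nd_simple)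
  qed
 qed
 show "2 * (x \<bullet> y) / (y \<bullet> y) : \<int>" if "x : nd ` {..n}" "y : nd ` {..n}" for x y
 proof -
  have "x : \<Phi>" "y : \<Phi>" using that nd_root by auto
  then show ?thesis using cartan_Ints[of y x] by (simp only: inner_coroot)
 qed
qed

text \<open>Restriction to the affine nodes identifies \<open>AutAff\<close> with the diagram
  automorphisms; a permutation of the nodes preserving inner products extends linearly because the
  simple roots form a basis.\<close>

theorem is_coxeter_group_Aut_alcove: "is_coxeter_group (comp_group (Aut_region A))"
proof -
 let ?B = "nd ` {..n}" and ?m = "%x. mk (the_inv_into {..n} nd x)"
 interpret N: affine_nodes ?B ?m by (rule affine_nodes_base)
 let ?AD = "AutAff"
 have AD: "ph : ?AD \<longleftrightarrow> orthogonal_transformation ph & ph ` \<Phi> = \<Phi> & ph ` ?B = ?B" for ph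
  unfolding Aut_affine_dynkin_def Aut_roots_def nd_image by simp
 define \<rho> where "\<rho> ph x = (if x : ?B then ph x else x)" for ph :: "'a => 'a" and x
 have simple_B: "al i : ?B" if "i : I" for i
 proof -
  have "nd i : ?B" using simple_index[OF that] by blast
  then show ?thesis using nd_simple[OF that] by simp
 qed
 have \<rho>_in: "\<rho> ph : N.Aut" if ph: "ph : ?AD" for ph
 proof -
  have o: "orthogonal_transformation ph" "ph ` ?B = ?B" using ph AD by auto
  have "inj ph" by (rule orthogonal_transformation_inj[OF o(1)])
  then have "bij_betw ph ?B ?B" using o(2) by (auto simp: bij_betw_def intro: inj_on_subset)
  then have "bij_betw (\<rho> ph) ?B ?B" by (rule bij_betw_cong[THEN iffD1, rotated]) (simp add: \<rho>_def)
  then show ?thesis using o(1) by (simp add: N.Aut_def \<rho>_def orthogonal_transformation_def)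
 qed
 have hom: "\<rho> (ph o ps) = \<rho> ph o \<rho> ps" if "ps : ?AD" for ph ps
  using that unfolding AD by (auto simp: \<rho>_def fun_eq_iff)
 have inj: "ph = ps" if ph: "ph : ?AD" and ps: "ps : ?AD" and eq: "\<rho> ph = \<rho> ps" for ph ps
 proof -
  have lin: "linear ph" "linear ps" using ph ps AD orthogonal_transformation_linear by auto
  have "ph x = ps x" if "x : al ` I" for x
   using that fun_cong[OF eq, of x] simple_B by (auto simp: \<rho>_def)
  then have "ph x = ps x" for x
   using linear_eq_on_span[OF lin, of "al ` I" x] span_simple by simp
  then show ?thesis by blast
 qed
 have surj: "EX ph:?AD. \<rho> ph = p" if p: "p : N.Aut" for p
 proof -
  define ph where "ph v = (\<Sum>i\<in>I. (cw i \<bullet> v) *\<^sub>R p (al i))" for v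
  have lin: "linear ph"
   unfolding ph_def by (rule linearI) (simp_all add: inner_add_right scaleR_add_left sum.distrib scaleR_sum_right)
  have simp: "ph (al j) = p (al j)" if j: "j : I" for j
  proof -
   have "ph (al j) = (\<Sum>i\<in>I. if i = j then p (al i) else 0)"
    unfolding ph_def by (rule sum.cong) (simp_all add: coweight_simple j)
   then show ?thesis using j by simp
  qed
  have pp: "p x \<bullet> p y = x \<bullet> y" if "x : ?B" "y : ?B" for x y using N.AutD(2)[OF p that] .
  have ip: "ph v \<bullet> x = (\<Sum>i\<in>I. (cw i \<bullet> v) * (p (al i) \<bullet> x))" for v x
   unfolding ph_def inner_sum_left by simp
  have ip': "p (al i) \<bullet> ph w = al i \<bullet> w" if i: "i : I" for i w
  proof -
   have "ph w \<bullet> p (al i) = (\<Sum>j\<in>I. (cw j \<bullet> w) * (al j \<bullet> al i))"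
    unfolding ip by (rule sum.cong) (simp_all add: pp simple_B i)
   also have "\<dots> = w \<bullet> al i" by (rule inner_expansion[symmetric])
   finally show ?thesis by (simp only: inner_commute)
  qed
  have "ph v \<bullet> ph w = v \<bullet> w" for v w
  proof -
   have "ph v \<bullet> ph w = (\<Sum>i\<in>I. (cw i \<bullet> v) * (al i \<bullet> w))"
    unfolding ip[of v] by (rule sum.cong) (simp_all add: ip')
   also have "\<dots> = v \<bullet> w" by (rule inner_expansion[symmetric])
   finally show ?thesis .
  qed
  then have orth: "orthogonal_transformation ph" using lin by (simp add: orthogonal_transformation_def)
  \<comment> \<open>The extension is built from the simple roots only. That it is right at the node
    0 follows by transporting the relation: its image \<open>s\<close> is orthogonal to the images
    of all nodes, hence to itself.\<close>
  define s where "s = (\<Sum>x\<in>?B. ?m x *\<^sub>R p x)"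
  have ps: "p x \<bullet> s = 0" if x: "x : ?B" for x
  proof -
   have "p x \<bullet> s = (\<Sum>y\<in>?B. ?m y * (p x \<bullet> p y))" unfolding s_def inner_sum_right by simp
   also have "\<dots> = (\<Sum>y\<in>?B. ?m y * (x \<bullet> y))" by (rule sum.cong) (simp_all only: pp[OF x])
   also have "\<dots> = x \<bullet> (\<Sum>y\<in>?B. ?m y *\<^sub>R y)" unfolding inner_sum_right by simp
   finally show ?thesis unfolding N.m_rel by simp
  qed
  have "s \<bullet> s = (\<Sum>x\<in>?B. ?m x * (p x \<bullet> s))"
   by (subst (1) s_def) (simp only: inner_sum_left inner_scaleR_left)
  also have "\<dots> = 0" by (intro sum.neutral ballI) (simp only: ps mult_zero_right)
  finally have "s = 0" by simp
  moreover have "s = (\<Sum>i\<in>{..n}. mk i *\<^sub>R p (nd i))"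
   unfolding s_def by (subst sum.reindex[OF inj_nd], rule sum.cong) (simp_all add: the_inv_into_f_f[OF inj_nd])
  ultimately have "p (nd 0) + (\<Sum>i\<in>I. mk i *\<^sub>R p (nd i)) = 0" by (simp add: sum_nodes mk_0)
  moreover have "(\<Sum>i\<in>I. mk i *\<^sub>R p (nd i)) = ph hr"
   unfolding ph_def by (rule sum.cong) (simp_all add: mk_simple nd_simple)
  ultimately have "p (nd 0) = - ph hr" by (simp add: add_eq_0_iff2)
  then have "ph (nd 0) = p (nd 0)" by (simp add: nd_0 linear_neg[OF lin])
  then have eqB: "ph x = p x" if "x : ?B" for x
   using that simp by (auto simp: nd_def ivl_iff)
  have "ph ` \<Phi> = \<Phi>"
  proof (rule orthogonal_root_image[OF orth])
   fix i assume i: "i : I"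
   have "p (al i) : ?B" by (rule N.AutD(1)[OF p simple_B[OF i]])
   then show "ph (al i) : \<Phi>" unfolding simp[OF i] using nd_root by auto
  qed
  moreover have "ph ` ?B = ?B"
  proof -
   have "ph ` ?B = p ` ?B" by (rule image_cong) (simp_all only: eqB)
   then show ?thesis using p by (simp add: N.Aut_def bij_betw_def)
  qed
  ultimately have "ph : ?AD" using orth AD by blast
  moreover have "\<rho> ph = p"
  proof (rule ext)
   show "\<rho> ph x = p x" for x using eqB[of x] N.AutD(3)[OF p, of x] by (simp add: \<rho>_def)
  qed
  ultimately show ?thesis by blast
 qed
 have "\<rho> : iso (comp_group ?AD) (comp_group N.Aut)"
  unfolding iso_def hom_def mem_Collect_eq comp_group_simps
 proof (intro conjI)
  show "\<rho> : ?AD \<rightarrow> N.Aut" using \<rho>_in by blast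
  show "ALL ph:?AD. ALL ps:?AD. \<rho> (ph o ps) = \<rho> ph o \<rho> ps" using hom by blast
  have "inj_on \<rho> ?AD" by (rule inj_onI) (rule inj)
  moreover have "\<rho> ` ?AD = N.Aut" using \<rho>_in surj by (auto simp: image_iff)
  ultimately show "bij_betw \<rho> ?AD N.Aut" by (simp add: bij_betw_def)
 qed
 then have "is_coxeter_group (comp_group ?AD)"
  by (rule is_coxeter_group_iso[OF group_Aut_affine N.is_coxeter_group_Aut])
 then show ?thesis by (rule is_coxeter_group_iso[OF group_Aut_region _ linear_part_iso])
qed

end

section \<open>Cartan matrices and their integral equations\<close>

lemma nbr_sum:
 fixes g :: "nat => 'b::comm_monoid_add"
 assumes S: "finite S" "insert i N \<subseteq> S" and i: "i ~: N" and z: "!!j. j : S ==> j ~: insert i N ==> g j = 0"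
 shows "(\<Sum>j\<in>S. g j) = g i + sum g N"
proof -
 have f: "finite N" using finite_subset[OF S(2,1)] by simp
 have "(\<Sum>j\<in>S. g j) = (\<Sum>j\<in>insert i N. g j)"
  by (rule sum.mono_neutral_right[OF S]) (use z in blast)
 then show ?thesis using f i by simp
qed

text \<open>Consecutive indices stay consecutive, and by injectivity the direction of the first step
  persists.\<close>

lemma path_perm:
 fixes ta :: "nat => nat"
 assumes b: "bij_betw ta {1..n} {1..n}"
  and st: "!!i. 1 <= i ==> i < n ==> ta (Suc i) = Suc (ta i) | ta i = Suc (ta (Suc i))"
 shows "(ALL i:{1..n}. ta i = i) | (ALL i:{1..n}. ta i = n + 1 - i)"
proof -
 have rng: "1 <= ta i & ta i <= n" if "1 <= i" "i <= n" for i
 proof -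
  have "ta i : {1..n}" using bij_betwE[OF b] that by (simp add: ivl_iff)
  then show ?thesis by (simp add: ivl_iff)
 qed
 have inj: "i = j" if "1 <= i" "i <= n" "1 <= j" "j <= n" "ta i = ta j" for i j
  using b that by (auto simp: bij_betw_def ivl_iff dest: inj_onD)
 show ?thesis
 proof (cases "n <= 1")
  case True
  have "ta i = i" if i: "i : {1..n}" for i
  proof -
   have "1 <= i" "i <= n" using i by (auto simp: ivl_iff)
   then show ?thesis using rng[of i] True by linarith
  qed
  then show ?thesis by blast
 next
  case n2: False
  show ?thesis
  proof (cases "ta 2 = Suc (ta 1)")
   case True
   have up: "Suc (Suc t) <= n --> ta (Suc (Suc t)) = Suc (ta (Suc t))" for t
   proof (induction t)
    case 0 then show ?case using True by (simp add: numeral_2_eq_2 One_nat_def)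
   next
    case (Suc t)
    show ?case
    proof
     assume le: "Suc (Suc (Suc t)) <= n"
     then have e: "ta (Suc (Suc t)) = Suc (ta (Suc t))" using Suc by simp
     have "ta (Suc (Suc (Suc t))) ~= ta (Suc t)" using inj[of "Suc (Suc (Suc t))" "Suc t"] le by auto
     then show "ta (Suc (Suc (Suc t))) = Suc (ta (Suc (Suc t)))"
      using st[of "Suc (Suc t)"] le e by auto
    qed
   qed
   have val: "Suc t <= n --> ta (Suc t) = ta 1 + t" for t
   proof (induction t)
    case 0 then show ?case by (simp add: One_nat_def)
   next
    case (Suc t) then show ?case using up[of t] by simp
   qed
   have "ta 1 + (n - 1) <= n" using val[of "n - 1"] rng[of n] n2 by simp
   then have "ta 1 = 1" using rng[of 1] n2 by linarith
   then have "ta i = i" if "i : {1..n}" for i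
    using val[of "i - 1"] that by (simp add: ivl_iff)
   then show ?thesis by blast
  next
   case False
   have d0: "ta 1 = Suc (ta 2)" using st[of 1] False n2 by (auto simp: numeral_2_eq_2 One_nat_def)
   have dn: "Suc (Suc t) <= n --> ta (Suc t) = Suc (ta (Suc (Suc t)))" for t
   proof (induction t)
    case 0 then show ?case using d0 by (simp add: numeral_2_eq_2 One_nat_def)
   next
    case (Suc t)
    show ?case
    proof
     assume le: "Suc (Suc (Suc t)) <= n"
     then have e: "ta (Suc t) = Suc (ta (Suc (Suc t)))" using Suc by simp
     have "ta (Suc (Suc (Suc t))) ~= ta (Suc t)" using inj[of "Suc (Suc (Suc t))" "Suc t"] le by auto
     then show "ta (Suc (Suc t)) = Suc (ta (Suc (Suc (Suc t))))"
      using st[of "Suc (Suc t)"] le e by auto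
    qed
   qed
   have val: "Suc t <= n --> ta (Suc t) + t = ta 1" for t
   proof (induction t)
    case 0 then show ?case by (simp add: One_nat_def)
   next
    case (Suc t)
    show ?case
    proof
     assume le: "Suc (Suc t) <= n"
     have "ta (Suc t) + t = ta 1" using Suc le by simp
     moreover have "ta (Suc t) = Suc (ta (Suc (Suc t)))" using dn[of t] le by simp
     ultimately show "ta (Suc (Suc t)) + Suc t = ta 1" by linarith
    qed
   qed
   obtain q where q: "n = Suc q" using n2 by (cases n) auto
   have "ta (Suc q) + q = ta 1" using val[of q] q by simp
   moreover have "1 <= ta (Suc q)" using rng[of n] n2 q by simp
   ultimately have "n <= ta 1" using q by linarith
   then have t1: "ta 1 = n" using rng[of 1] n2 by linarith
   have "ta i = n + 1 - i" if i: "i : {1..n}" for i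
   proof -
    have "1 <= i" "i <= n" using i by (auto simp: ivl_iff)
    then show ?thesis using val[of "i - 1"] t1 by simp
   qed
   then show ?thesis by blast
  qed
 qed
qed

lemma cartan_A:
 assumes "i : {1..n}" "j : {1..n}"
 shows "cartan_entry Type_A n i j = (if i = j then 2 else if j = Suc i | i = Suc j then - 1 else 0)"
 using assms by (auto simp: cartan_entry_def ivl_iff)

lemma cartan_B:
 assumes "i : {1..n}" "j : {1..n}" "n >= 3"
 shows "cartan_entry Type_B n i j =
  (if i = j then 2 else if j = Suc i then (if j = n then - 2 else - 1) else if i = Suc j then - 1 else 0)"
 using assms by (auto simp: cartan_entry_def ivl_iff)

lemma cartan_B2:
 assumes "i : {1..2}" "j : {1..2}"
 shows "cartan_entry Type_B 2 i j = (if i = j then 2 else if j = Suc i then - 1 else - 2)"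
proof -
 have "i = 1 | i = 2" "j = 1 | j = 2" using assms by (auto simp: ivl_iff)
 then show ?thesis by (elim disjE) (simp_all add: cartan_entry_def One_nat_def numeral_2_eq_2)
qed

lemma cartan_C:
 assumes "i : {1..n}" "j : {1..n}" "n >= 3"
 shows "cartan_entry Type_C n i j =
  (if i = j then 2 else if j = Suc i then - 1 else if i = Suc j then (if i = n then - 2 else - 1) else 0)"
 using assms by (auto simp: cartan_entry_def ivl_iff)

text \<open>Adjacency in type \<open>D\<close> of rank \<open>p + 2\<close>: the branch node is
  \<open>p\<close>, followed by the end nodes \<open>p + 1\<close> and \<open>p + 2\<close>. Writing
  the rank this way avoids subtraction.\<close>

definition D_adj :: "nat => nat => nat => bool" where
 "D_adj p i j \<longleftrightarrow> j = Suc i & j <= Suc p | i = Suc j & i <= Suc p | i = p & j = p + 2 | j = p & i = p + 2"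

lemma cartan_D:
 assumes "i : {1..n}" "j : {1..n}" "n = p + 2" "p >= 2"
 shows "cartan_entry Type_D n i j = (if i = j then 2 else if D_adj p i j then - 1 else 0)"
 using assms by (auto simp: cartan_entry_def D_adj_def ivl_iff)

text \<open>The exceptional Cartan matrices get formulas that do not mention the rank, so that
  closed instances can be evaluated.\<close>

definition E_entry :: "nat => nat => int" where
 "E_entry i j = (if i = j then 2
  else if i = 1 & j = 3 | i = 3 & j = 1 | i = 2 & j = 4 | i = 4 & j = 2 | 3 <= i & j = Suc i | 3 <= j & i = Suc j
  then - 1 else 0)"

lemma cartan_E:
 assumes "i : {1..n}" "j : {1..n}"
 shows "cartan_entry Type_E n i j = E_entry i j"
 using assms by (auto simp: cartan_entry_def E_entry_def ivl_iff)

definition F_entry :: "nat => nat => int" where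
 "F_entry i j = (if i = j then 2 else if i = 2 & j = 3 then - 2 else if j = Suc i | i = Suc j then - 1 else 0)"

lemma cartan_F:
 assumes "i : {1..n}" "j : {1..n}"
 shows "cartan_entry Type_F n i j = F_entry i j"
 using assms by (auto simp: cartan_entry_def F_entry_def ivl_iff)

definition G_entry :: "nat => nat => int" where
 "G_entry i j = (if i = j then 2 else if i = 2 & j = 1 then - 3 else if j = Suc i | i = Suc j then - 1 else 0)"

lemma cartan_G:
 assumes "i : {1..n}" "j : {1..n}"
 shows "cartan_entry Type_G n i j = G_entry i j"
 using assms by (auto simp: cartan_entry_def G_entry_def ivl_iff)

lemma cartan_laced_commute:
 "X = Type_A | X = Type_D | X = Type_E ==> cartan_entry X n i j = cartan_entry X n j i"
 by (auto simp: cartan_entry_def)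

text \<open>A linear system with solution \<open>k\<close>, stated over lists of integers so that
  evaluation decides it. Roots are numbered from 1 and list entries from 0, whence the
  shift.\<close>

definition matrix_eq :: "(nat => nat => int) => nat list => int list => (nat => int) => bool" where
 "matrix_eq c ns k e \<longleftrightarrow> list_all (%i. sum_list (map (%j. c i j * k ! (j - 1)) ns) = e i) ns"

lemma matrix_eqD:
 assumes "matrix_eq c ns k e" "ns = [1..<Suc n]" "i : {1..n}"
 shows "(\<Sum>j\<in>{1..n}. c i j * k ! (j - 1)) = e i"
proof -
 have s: "set ns = {1..n}"
  unfolding assms(2) set_upt by (rule atLeastLessThanSuc_atLeastAtMost)
 have d: "distinct ns" unfolding assms(2) by (rule distinct_upt)
 show ?thesis
  using assms(1,3) s sum_list_distinct_conv_sum_set[OF d, of "%j. c i j * k ! (j - 1)"]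
  by (simp add: matrix_eq_def list_all_iff)
qed

text \<open>Row \<open>r\<close> of such a table expresses \<open>\<varpi>\<^sub>r - e\<^sub>r \<varpi>\<^sub>j\<close> by simple coroots.\<close>

definition coweight_table :: "(nat => nat => int) => nat list => nat => int list list => int list => bool" where
 "coweight_table c ns j T e \<longleftrightarrow>
  list_all (%r. matrix_eq c ns (T ! (r - 1)) (%i. (if r = i then 1 else 0) - (if i = j then e ! (r - 1) else 0))) ns"

text \<open>In types \<open>E8\<close>, \<open>F4\<close> and \<open>G2\<close> the table is the
  inverse Cartan matrix up to transposition. It is integral, so all coweights lie in the coroot
  lattice and \<open>e\<close> vanishes.\<close>

lemma E8_table: "coweight_table E_entry [1..<9] 8
 [[4, 5, 7, 10, 8, 6, 4, 2],
  [5, 8, 10, 15, 12, 9, 6, 3],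
  [7, 10, 14, 20, 16, 12, 8, 4],
  [10, 15, 20, 30, 24, 18, 12, 6],
  [8, 12, 16, 24, 20, 15, 10, 5],
  [6, 9, 12, 18, 15, 12, 8, 4],
  [4, 6, 8, 12, 10, 8, 6, 3],
  [2, 3, 4, 6, 5, 4, 3, 2]] [0,0,0,0,0,0,0,0]"
 by code_simp

lemma F4_table: "coweight_table F_entry [1..<5] 4
 [[2, 3, 2, 1],
  [3, 6, 4, 2],
  [4, 8, 6, 3],
  [2, 4, 3, 2]] [0,0,0,0]"
 by code_simp

lemma G2_table: "coweight_table G_entry [1..<3] 2
 [[2, 3],
  [1, 2]] [0,0]"
 by code_simp

text \<open>Here \<open>e\<close> lists the classes of the coweights as multiples of the class of
  \<open>cw 7\<close>, which has order 2. For \<open>E6\<close> below they are multiples of the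
  class of \<open>cw 6\<close>, which has order 3.\<close>

lemma E7_table: "coweight_table E_entry [1..<8] 7
 [[2, 2, 3, 4, 3, 2, 1],
  [1, 2, 2, 3, 2, 1, 0],
  [3, 4, 6, 8, 6, 4, 2],
  [4, 6, 8, 12, 9, 6, 3],
  [2, 3, 4, 6, 5, 3, 1],
  [2, 3, 4, 6, 5, 4, 2],
  [0, 0, 0, 0, 0, 0, 0]] [0, 1, 0, 0, 1, 0, 1]"
 by code_simp

lemma E6_table: "coweight_table E_entry [1..<7] 6
 [[0, - 1, - 1, - 2, - 2, - 2],
  [1, 2, 2, 3, 2, 1],
  [1, 1, 2, 2, 1, 0],
  [2, 3, 4, 6, 4, 2],
  [0, 0, 0, 0, 0, - 1],
  [0, 0, 0, 0, 0, 0]] [2, 0, 1, 0, 2, 1]"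
 by code_simp

text \<open>Coroot coordinates of \<open>3 cw 6\<close> and \<open>cw 1 + cw 6\<close> in
  \<open>E6\<close>, of \<open>2 cw 7\<close> in \<open>E7\<close>, and of twice the dual Weyl
  vector in \<open>E6\<close>, \<open>E7\<close> and \<open>E8\<close>. The latter pairs to 2 with
  all simple roots, so diagram automorphisms fix it and can only exchange indices with equal
  coordinates.\<close>

lemma E_equations:
 "matrix_eq E_entry [1..<7] [2, 3, 4, 6, 5, 4] (%i. if i = 6 then 3 else 0)"
 "matrix_eq E_entry [1..<7] [2, 2, 3, 4, 3, 2] (%i. if i = 1 | i = 6 then 1 else 0)"
 "matrix_eq E_entry [1..<8] [2, 3, 4, 6, 5, 4, 3] (%i. if i = 7 then 2 else 0)"
 "matrix_eq E_entry [1..<7] [16, 22, 30, 42, 30, 16] (%i. 2)"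
 "matrix_eq E_entry [1..<8] [34, 49, 66, 96, 75, 52, 27] (%i. 2)"
 "matrix_eq E_entry [1..<9] [92, 136, 182, 270, 220, 168, 114, 58] (%i. 2)"
 by code_simp+

definition cartan_is :: "dynkin_family => nat => (nat => nat => int) => bool" where
 "cartan_is X n c \<longleftrightarrow> (ALL i:{1..n}. ALL j:{1..n}. cartan_entry X n i j = c i j)"

lemma cartan_isD: "cartan_is X n c ==> i : {1..n} ==> j : {1..n} ==> cartan_entry X n i j = c i j"
 by (simp add: cartan_is_def)

lemma cartan_is_exceptional:
 "cartan_is Type_E n E_entry" "cartan_is Type_F n F_entry" "cartan_is Type_G n G_entry"
 by (simp_all add: cartan_is_def cartan_E cartan_F cartan_G)

definition diagram_symmetry :: "dynkin_family => nat => (nat => nat) => bool" where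
 "diagram_symmetry X n sg \<longleftrightarrow> (ALL i:{1..n}. sg i : {1..n} & sg (sg i) = i) &
  (ALL i:{1..n}. ALL j:{1..n}. cartan_entry X n (sg i) (sg j) = cartan_entry X n i j)"

text \<open>Only the first \<open>m\<close> nodes are tested; for type \<open>D\<close> these form
  the path ending at the branch node.\<close>

definition tridiagonal :: "nat => nat => dynkin_family => bool" where
 "tridiagonal m n X \<longleftrightarrow> (ALL i:{1..m}. ALL j:{1..m}.
  i ~= j --> j ~= Suc i --> i ~= Suc j --> cartan_entry X n i j = 0)"

lemma tridiagonalD:
 "tridiagonal m n X ==> i : {1..m} ==> j : {1..m} ==> i ~= j ==> j ~= Suc i ==> i ~= Suc j ==>
  cartan_entry X n i j = 0"
 by (simp add: tridiagonal_def)

lemma tridiagonal_classical: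
 "tridiagonal n n Type_A" "n >= 3 ==> tridiagonal n n Type_B" "n >= 3 ==> tridiagonal n n Type_C"
 by (simp_all add: tridiagonal_def cartan_A cartan_B cartan_C)

section \<open>Common arguments for the generators of the individual types\<close>

context root_base
begin

text \<open>Keeps the three conditions on a generator folded during case splits over the set of
  generators.\<close>

definition involution :: "('a => 'a) => bool" where
 "involution r \<longleftrightarrow> r : Aut_region A & r ~= id & r o r = id"

lemma type_cartan:
 "has_type n al X ==> i : I ==> j : I ==> al i \<bullet> coroot (al j) = of_int (cartan X i j)"
 by (simp add: has_type_def inner_coroot)

lemma gen_comp: "x : generate G R ==> y : generate G R ==> x o y : generate G R"
 using generate.eng[of x G R y] by simp

lemma gen_id: "id : generate G R"
 using generate.one[of G R] by simp

lemma id_Aut_dynkin: "id : AutDyn"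
proof -
 have "orthogonal_transformation (id :: 'a => 'a)"
  unfolding orthogonal_transformation_def using linear_id by simp
 then show ?thesis by (simp add: Aut_dynkin_def Aut_roots_def)
qed

lemma Aut_dynkin_comp:
 assumes "ph : AutDyn" "ps : AutDyn" shows "ph o ps : AutDyn"
 using subgroup.m_closed[OF subgroup_Aut_dynkin assms] by simp

lemma perm_type:
 assumes t: "has_type n al X" and ph: "ph : AutDyn"
 obtains ta where "bij_betw ta I I" "!!i. i : I ==> ta i : I"
  "!!i. i : I ==> ph (al i) = al (ta i)"
  "!!i j. i : I ==> j : I ==> cartan X (ta i) (ta j) = cartan X i j"
  "!!i j. i : I ==> j : I ==> ta i = ta j ==> i = j"
proof -
 obtain ta where ta: "bij_betw ta I I" "!!i. i : I ==> ph (al i) = al (ta i)"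
  "!!i j. i : I ==> j : I ==> al (ta i) \<bullet> coroot (al (ta j)) = al i \<bullet> coroot (al j)"
  using Aut_dynkin_perm[OF ph] by blast
 have r: "ta i : I" if "i : I" for i using bij_betwE[OF ta(1)] that by blast
 have c: "cartan X (ta i) (ta j) = cartan X i j" if "i : I" "j : I" for i j
 proof -
  have "real_of_int (cartan X (ta i) (ta j)) = real_of_int (cartan X i j)"
   using ta(3)[OF that] by (simp only: type_cartan[OF t] that r)
  then show ?thesis by (simp only: of_int_eq_iff)
 qed
 have "i = j" if "i : I" "j : I" "ta i = ta j" for i j
  using ta(1) that by (auto simp: bij_betw_def dest: inj_onD)
 then show thesis using that[OF ta(1) r ta(2) c] by blast
qed

lemma Aut_dynkin_idI: "ph : AutDyn ==> (!!i. i : I ==> ph (al i) = al i) ==> ph = id"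
 by (rule Aut_dynkin_eqI[OF _ id_Aut_dynkin]) auto

text \<open>The automorphisms of a path are the identity and the reversal. The second alternative
  also records the symmetry of the Cartan matrix that a reversal entails, which a multiple bond can
  violate.\<close>

lemma Aut_dynkin_path:
 assumes t: "has_type n al X"
  and tri: "tridiagonal n n X"
  and nz: "!!i. 1 <= i ==> i < n ==> cartan X i (Suc i) ~= 0"
  and ph: "ph : AutDyn"
 shows "ph = id | (ALL i:I. ph (al i) = al (n + 1 - i)) &
  (ALL i:I. ALL j:I. cartan X (n + 1 - i) (n + 1 - j) = cartan X i j)"
proof -
 obtain ta where ta: "bij_betw ta I I" "!!i. i : I ==> ta i : I"
  "!!i. i : I ==> ph (al i) = al (ta i)"
  "!!i j. i : I ==> j : I ==> cartan X (ta i) (ta j) = cartan X i j"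
  "!!i j. i : I ==> j : I ==> ta i = ta j ==> i = j"
  using perm_type[OF t ph] by blast
 have "(ALL i:I. ta i = i) | (ALL i:I. ta i = n + 1 - i)"
 proof (rule path_perm[OF ta(1)])
  fix i assume i: "1 <= i" "i < n"
  then have m: "i : I" "Suc i : I" by (auto simp: ivl_iff)
  have "cartan X (ta i) (ta (Suc i)) ~= 0" using ta(4)[OF m] nz[OF i] by simp
  moreover have "ta i ~= ta (Suc i)" using ta(5)[OF m] by auto
  ultimately show "ta (Suc i) = Suc (ta i) | ta i = Suc (ta (Suc i))"
   using tridiagonalD[OF tri ta(2)[OF m(1)] ta(2)[OF m(2)]] by blast
 qed
 then show ?thesis
 proof
  assume "ALL i:I. ta i = i"
  then have "ph = id" using Aut_dynkin_idI[OF ph] ta(3) by simp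
  then show ?thesis ..
 next
  assume r: "ALL i:I. ta i = n + 1 - i"
  then have "ALL i:I. ph (al i) = al (n + 1 - i)" using ta(3) by simp
  moreover have "ALL i:I. ALL j:I. cartan X (n + 1 - i) (n + 1 - j) = cartan X i j"
   using ta(4) r by simp
  ultimately show ?thesis by blast
 qed
qed

text \<open>In the simply laced types all simple roots have equal length, so preserving Cartan
  integers preserves inner products.\<close>

lemma diagram_involution:
 assumes t: "has_type n al X" and X: "X = Type_A | X = Type_D | X = Type_E"
  and sym: "diagram_symmetry X n sg" and i0: "i0 : I" "sg i0 ~= i0"
 shows "dyn sg : AutDyn"
  "!!i. i : I ==> dyn sg (al i) = al (sg i)"
  "dyn sg o dyn sg = id" "dyn sg ~= id"
  "!!i. i : I ==> dyn sg (cw i) = cw (sg i)"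
  "dyn sg : Aut_region A"
proof -
 let ?ph = "dyn sg"
 have sg: "!!i. i : I ==> sg i : I" "!!i. i : I ==> sg (sg i) = i"
  and c: "!!i j. i : I ==> j : I ==> cartan X (sg i) (sg j) = cartan X i j"
  using sym by (auto simp: diagram_symmetry_def)
 have inj: "inj_on sg I" by (rule inj_on_inverseI[of _ sg]) (rule sg(2))
 have len: "al i \<bullet> al i = al j \<bullet> al j" if "i : I" "j : I" for i j
  by (rule simply_laced_lengths[OF _ that]) (simp add: type_cartan[OF t] cartan_laced_commute[OF X])
 have ip: "al i \<bullet> al j = of_int (cartan X i j) * (al j \<bullet> al j) / 2" if "i : I" "j : I" for i j
 proof -
  have "al j \<bullet> al j ~= 0" using root_nonzero[OF simple_root[OF that(2)]] by simp
  moreover have "2 * (al i \<bullet> al j) / (al j \<bullet> al j) = of_int (cartan X i j)"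
   using type_cartan[OF t that] by (simp add: inner_coroot)
  ultimately show ?thesis by (simp add: field_simps)
 qed
 have gram: "al (sg i) \<bullet> al (sg j) = al i \<bullet> al j" if ij: "i : I" "j : I" for i j
  unfolding ip[OF sg(1)[OF ij(1)] sg(1)[OF ij(2)]] ip[OF ij] c[OF ij] len[OF sg(1)[OF ij(2)] ij(2)] ..
 show ph: "?ph : AutDyn" by (rule dynkin_aut_props(1)[OF sg(1) inj gram])
 show a: "?ph (al i) = al (sg i)" if "i : I" for i by (rule dynkin_aut_props(2)[OF sg(1) inj gram that])
 show "?ph o ?ph = id"
  by (rule Aut_dynkin_idI[OF Aut_dynkin_comp[OF ph ph]]) (simp add: a sg)
 show "?ph ~= id"
 proof
  assume "?ph = id"
  then have "al i0 = al (sg i0)" using a[OF i0(1)] by simp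
  then show False using inj_onD[OF inj_simple _ i0(1) sg(1)[OF i0(1)]] i0(2) by simp
 qed
 have "sg ` I = I"
 proof
  show "sg ` I \<subseteq> I" using sg(1) by blast
  show "I \<subseteq> sg ` I"
  proof
   fix i assume i: "i : I"
   show "i : sg ` I" by (rule image_eqI[of _ _ "sg i"]) (use sg[OF i] in auto)
  qed
 qed
 then have bij: "bij_betw sg I I" using inj by (simp add: bij_betw_def)
 show "?ph (cw i) = cw (sg i)" if "i : I" for i by (rule Aut_dynkin_coweight[OF ph a bij that])
 show "?ph : Aut_region A" by (rule Aut_dynkin_alcove[OF ph])
qed

text \<open>Column \<open>j\<close> of the Cartan matrix writes the coroot of \<open>al j\<close> in
  fundamental coweights. This combination has trivial class, so the coweight at one neighbour of
  \<open>j\<close> is determined by those at \<open>j\<close> and its other neighbours.\<close>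

lemma reach_nbr:
 assumes H: "subgroup H G" and t: "has_type n al X" and j: "j : I" and k: "k : I"
  and c: "cartan X k j = - 1" and rj: "reach H (cw j)"
  and rest: "!!i. i : I ==> i ~= j ==> i ~= k ==> cartan X i j ~= 0 ==> reach H (cw i)"
 shows "reach H (cw k)"
proof -
 define x where "x = (\<Sum>i\<in>I. of_int (cartan X i j) *\<^sub>R cw i)"
 define y where "y = (\<Sum>i\<in>I - {k}. of_int (cartan X i j) *\<^sub>R cw i)"
 have "x \<bullet> al l = coroot (al j) \<bullet> al l" if l: "l : I" for l
 proof -
  have "x \<bullet> al l = (\<Sum>i\<in>I. if i = l then of_int (cartan X i j) else 0)"
   unfolding x_def inner_sum_left by (rule sum.cong) (simp_all add: coweight_simple l)
  then show ?thesis using l type_cartan[OF t l j] by (simp add: inner_commute)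
 qed
 then have "x = coroot (al j)" by (rule eq_by_simple)
 then have xQ: "x : Qv" using Qv_coroot simple_root[OF j] by simp
 have "x = of_int (cartan X k j) *\<^sub>R cw k + y"
  unfolding x_def y_def by (rule sum.remove) (use k in auto)
 then have yx: "y - cw k = x" using c by simp
 have "reach H y"
  unfolding y_def
 proof (rule reach_sum[OF H])
  fix i assume "i : I - {k}"
  then have i: "i : I" "i ~= k" by auto
  show "reach H (of_int (cartan X i j) *\<^sub>R cw i)"
  proof (cases "cartan X i j = 0")
   case True
   then show ?thesis using reach_Qv[OF H Qv_0] by simp
  next
   case False
   have "reach H (cw i)" using rj rest[OF i(1) _ i(2) False] by (cases "i = j") auto
   then show ?thesis by (rule reach_Ints_scale[OF H]) simp
  qed
 qed
 then show ?thesis by (rule reach_cong) (simp add: yx xQ)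
qed

lemma reach_up:
 assumes H: "subgroup H G" and t: "has_type n al X"
  and tri: "tridiagonal n n X"
  and c: "!!i. 1 <= i ==> i < n ==> cartan X (Suc i) i = - 1"
  and r: "reach H (cw 1)" and i: "i : I"
 shows "reach H (cw i)"
proof -
 have "1 <= i --> i <= n --> reach H (cw i)" for i
 proof (induction i rule: less_induct)
  case (less i)
  show ?case
  proof (intro impI)
   assume i: "1 <= i" "i <= n"
   show "reach H (cw i)"
   proof (cases "i = 1")
    case False
    then obtain j where j: "i = Suc j" "1 <= j" using i by (cases i) auto
    have jm: "j : I" "i : I" using i j by (auto simp: ivl_iff)
    show ?thesis
    proof (rule reach_nbr[OF H t jm])
     show "cartan X i j = - 1" using c[of j] i j by simp
     show "reach H (cw j)" using less[of j] i j by simp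
     show "reach H (cw l)" if l: "l : I" "l ~= j" "l ~= i" "cartan X l j ~= 0" for l
     proof -
      have "j = Suc l" using tridiagonalD[OF tri l(1) jm(1)] l j by blast
      moreover have "1 <= l" using l(1) by (simp add: ivl_iff)
      ultimately show ?thesis using less[of l] i j by simp
     qed
    qed
   qed (use r in simp)
  qed
 qed
 then show ?thesis using i by (simp add: ivl_iff)
qed

text \<open>With the nodes beyond \<open>m\<close> already reached, this serves both a full path and
  the path of type \<open>D\<close> that ends at the branch node.\<close>

lemma reach_down:
 assumes H: "subgroup H G" and t: "has_type n al X" and m: "m <= n"
  and tri: "tridiagonal m n X"
  and c: "!!i. 1 <= i ==> i < m ==> cartan X i (Suc i) = - 1"
  and r: "reach H (cw m)" "!!i. m < i ==> i <= n ==> reach H (cw i)" and i: "i : I"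
 shows "reach H (cw i)"
proof -
 have "t < m --> reach H (cw (m - t))" for t
 proof (induction t rule: less_induct)
  case (less t)
  show ?case
  proof
   assume tm: "t < m"
   show "reach H (cw (m - t))"
   proof (cases t)
    case 0 then show ?thesis using r(1) by simp
   next
    case (Suc s)
    define k where "k = m - t"
    have k: "1 <= k" "k < m" "m - s = Suc k" using tm Suc by (auto simp: k_def)
    have km: "Suc k : I" "k : I" "Suc k : {1..m}" using k m by (auto simp: ivl_iff)
    show ?thesis unfolding k_def[symmetric]
    proof (rule reach_nbr[OF H t km(1,2)])
     show "cartan X k (Suc k) = - 1" using c k by simp
     show rk: "reach H (cw (Suc k))" using less[of s] Suc tm k(3) by simp
     show "reach H (cw l)" if l: "l : I" "l ~= Suc k" "l ~= k" "cartan X l (Suc k) ~= 0" for l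
     proof (cases "m < l")
      case True
      then show ?thesis using r(2) l(1) by (simp add: ivl_iff)
     next
      case False
      then have lm: "l : {1..m}" using l(1) by (simp add: ivl_iff)
      have "l = Suc (Suc k)" using tridiagonalD[OF tri lm km(3)] l by blast
      then have "l = m - (t - 2)" "2 <= t" using False k Suc by (auto simp: k_def)
      then show ?thesis using less[of "t - 2"] tm by simp
     qed
    qed
   qed
  qed
 qed
 from this[of "m - i"] show ?thesis
  using i r(2)[of i] by (cases "m < i") (auto simp: ivl_iff)
qed

lemma tri_row:
 fixes k :: "nat => real"
 assumes t: "has_type n al X"
  and tri: "tridiagonal n n X"
  and i: "i : I"
 shows "(\<Sum>j\<in>I. (al i \<bullet> coroot (al j)) * k j) = 2 * k i
  + (if i = 1 then 0 else of_int (cartan X i (i - 1)) * k (i - 1))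
  + (if i = n then 0 else of_int (cartan X i (Suc i)) * k (Suc i))"
proof -
 let ?g = "%j. real_of_int (cartan X i j) * k j"
 let ?N = "(if i = 1 then {} else {i - 1}) \<union> (if i = n then {} else {Suc i})"
 have ib: "1 <= i" "i <= n" using i by (auto simp: ivl_iff)
 have "(\<Sum>j\<in>I. (al i \<bullet> coroot (al j)) * k j) = (\<Sum>j\<in>I. ?g j)"
  by (rule sum.cong) (simp_all add: type_cartan[OF t i])
 also have "\<dots> = ?g i + sum ?g ?N"
 proof (rule nbr_sum)
  show "insert i ?N \<subseteq> I" using ib by (auto simp: ivl_iff)
  show "?g j = 0" if j: "j : I" "j ~: insert i ?N" for j
  proof -
   have "1 <= j" "j <= n" using j(1) by (auto simp: ivl_iff)
   then have "i ~= j" "j ~= Suc i" "i ~= Suc j" using j(2) by (auto split: if_splits)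
   then show ?thesis using tridiagonalD[OF tri i j(1)] by simp
  qed
 qed (use ib in auto)
 also have "sum ?g ?N = (if i = 1 then 0 else ?g (i - 1)) + (if i = n then 0 else ?g (Suc i))"
 proof -
  have "i - 1 ~= Suc i" by simp
  then show ?thesis by simp
 qed
 also have "?g i = 2 * k i" by (simp add: cartan_entry_def)
 finally show ?thesis by simp
qed

lemma Qv_by_type:
 assumes "!!i. i : I ==> x \<bullet> al i = (\<Sum>j\<in>I. (al i \<bullet> coroot (al j)) * k j)"
  "!!j. j : I ==> k j : \<int>"
 shows "x : Qv"
proof (rule Qv_by_simple[of x "%j. \<lfloor>k j\<rfloor>"])
 fix i assume "i : I"
 then have "x \<bullet> al i = (\<Sum>j\<in>I. (al i \<bullet> coroot (al j)) * k j)" by (rule assms(1))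
 also have "\<dots> = (\<Sum>j\<in>I. (al i \<bullet> coroot (al j)) * of_int \<lfloor>k j\<rfloor>)"
  by (rule sum.cong) (simp_all add: assms(2))
 finally show "x \<bullet> al i = (\<Sum>j\<in>I. (al i \<bullet> coroot (al j)) * of_int \<lfloor>k j\<rfloor>)" .
qed

lemma matrix_row:
 assumes t: "has_type n al X" and c: "cartan_is X n c"
  and m: "matrix_eq c ns k e" and ns: "ns = [1..<Suc n]" and i: "i : I"
 shows "(\<Sum>j\<in>I. (al i \<bullet> coroot (al j)) * of_int (k ! (j - 1))) = of_int (e i)"
proof -
 have "(\<Sum>j\<in>I. (al i \<bullet> coroot (al j)) * of_int (k ! (j - 1))) = of_int (\<Sum>j\<in>I. c i j * k ! (j - 1))"
  unfolding of_int_sum by (rule sum.cong) (simp_all add: type_cartan[OF t i] cartan_isD[OF c i])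
 then show ?thesis unfolding matrix_eqD[OF m ns i] .
qed

lemma matrix_Qv:
 assumes t: "has_type n al X" and c: "cartan_is X n c"
  and m: "matrix_eq c ns k e" and ns: "ns = [1..<Suc n]"
  and x: "!!i. i : I ==> x \<bullet> al i = of_int (e i)"
 shows "x : Qv"
 by (rule Qv_by_type[where k = "%j. of_int (k ! (j - 1))"]) (simp_all add: x matrix_row[OF t c m ns])

lemma table_Qv:
 assumes t: "has_type n al X" and c: "cartan_is X n c"
  and T: "coweight_table c ns j T e" and ns: "ns = [1..<Suc n]" and j: "j : I" and r: "r : I"
 shows "cw r - of_int (e ! (r - 1)) *\<^sub>R cw j : Qv"
proof (rule matrix_Qv[OF t c _ ns])
 have "r : set ns" unfolding ns set_upt atLeastLessThanSuc_atLeastAtMost by (rule r)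
 then show "matrix_eq c ns (T ! (r - 1)) (%i. (if r = i then 1 else 0) - (if i = j then e ! (r - 1) else 0))"
  using T by (simp add: coweight_table_def list_all_iff)
 show "(cw r - of_int (e ! (r - 1)) *\<^sub>R cw j) \<bullet> al i =
   of_int ((if r = i then 1 else 0) - (if i = j then e ! (r - 1) else 0))" if "i : I" for i
  using coweight_simple[OF r that] coweight_simple[OF j that] by (auto simp: inner_diff_left)
qed

text \<open>The vector with coroot coordinates \<open>r\<close> pairs to 2 with each simple root, so
  diagram automorphisms fix it; the coordinates at \<open>j\<close> and \<open>ta j\<close> agree
  because the two roots have the same length.\<close>

lemma perm_weight:
 assumes r: "!!i. i : I ==> (\<Sum>j\<in>I. (al i \<bullet> coroot (al j)) * r j) = 2"
  and ph: "ph : AutDyn" and ta: "bij_betw ta I I" "!!i. i : I ==> ph (al i) = al (ta i)"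
  and j: "j : I"
 shows "r (ta j) = r j"
proof -
 define x where "x = (\<Sum>j\<in>I. r j *\<^sub>R coroot (al j))"
 have orth: "ph v \<bullet> ph w = v \<bullet> w" for v w using Aut_dynkin_D(1)[OF ph] by (simp add: orthogonal_transformation_def)
 have x2: "x \<bullet> al i = 2" if "i : I" for i
  using r[OF that] by (simp add: x_def inner_sum_left inner_sum_right inner_commute mult.commute)
 have rng: "ta i : I" if "i : I" for i using bij_betwE[OF ta(1)] that by blast
 have "ph x \<bullet> al k = x \<bullet> al k" if k: "k : I" for k
 proof -
  have "k : ta ` I" using ta(1) k by (simp add: bij_betw_def)
  then obtain i where i: "i : I" "k = ta i" by blast
  have "ph x \<bullet> al k = ph x \<bullet> ph (al i)" using ta(2)[OF i(1)] i(2) by simp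
  then show ?thesis using orth x2[OF i(1)] x2[OF k] by simp
 qed
 then have fx: "ph x = x" by (rule eq_by_simple)
 have cwx: "cw i \<bullet> x = r i * (2 / (al i \<bullet> al i))" if i: "i : I" for i
 proof -
  have "cw i \<bullet> x = (\<Sum>l\<in>I. if l = i then r i * (2 / (al i \<bullet> al i)) else 0)"
   unfolding x_def inner_sum_right by (rule sum.cong) (auto simp: inner_coroot coweight_simple i)
  then show ?thesis using i by simp
 qed
 have "cw (ta j) \<bullet> x = ph (cw j) \<bullet> ph x" using Aut_dynkin_coweight[OF ph ta(2,1) j] fx by simp
 then have e: "r (ta j) * (2 / (al (ta j) \<bullet> al (ta j))) = r j * (2 / (al j \<bullet> al j))"
  using orth cwx[OF j] cwx[OF rng[OF j]] by simp
 have "al (ta j) \<bullet> al (ta j) = al j \<bullet> al j" using orth[of "al j" "al j"] ta(2)[OF j] by simp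
 moreover have "al j \<bullet> al j ~= 0" using root_nonzero[OF simple_root[OF j]] by simp
 ultimately show ?thesis using e by simp
qed

text \<open>The character is integral on the coroot lattice, so its value modulo 1 depends only on
  the class. The minuscule coweight in the class of \<open>cw j\<close> has a value that is 1/2
  modulo 1, in particular not 0.\<close>

lemma minuscule_by_character:
 assumes \<mu>: "!!i. i : I ==> \<mu> \<bullet> coroot (al i) : \<int>" and j: "j : I" "\<mu> \<bullet> cw j = 1 / 2"
 shows "EX i:I. mk i = 1 & \<mu> \<bullet> cw i ~= 0"
proof -
 have half: "(1 / 2 :: real) ~: \<int>" "(- 1 / 2 :: real) ~: \<int>"
 proof -
  have no: False if z: "(z::real) = 1 / 2 | z = - 1 / 2" "z : \<int>" for z
  proof -
   obtain k where "z = of_int k" using z(2) by (auto elim: Ints_cases)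
   then have "real_of_int (2 * k) = real_of_int 1 | real_of_int (2 * k) = real_of_int (- 1)" using z(1) by auto
   then have "2 * k = 1 | 2 * k = - 1" by (simp only: of_int_eq_iff)
   then show False by presburger
  qed
  show "(1 / 2 :: real) ~: \<int>" "(- 1 / 2 :: real) ~: \<int>" using no by blast+
 qed
 have "cw j ~: Qv" using character_Ints[OF \<mu>, of "cw j"] j(2) half(1) by auto
 then obtain i where i: "i : I" "mk i = 1" "cw i - cw j : Qv"
  using minuscule_representative[OF coweight_in_lattice[OF j(1)]] by blast
 have "\<mu> \<bullet> cw i - 1 / 2 : \<int>" using character_Ints[OF \<mu> i(3)] j(2) by (simp add: inner_diff_right)
 then have "\<mu> \<bullet> cw i ~= 0" using half(2) by auto
 then show ?thesis using i by blast
qed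

subsection \<open>Types A, B and C\<close>

lemma A_row:
 fixes k :: "nat => real"
 assumes t: "has_type n al Type_A" and i: "i : I"
 shows "(\<Sum>j\<in>I. (al i \<bullet> coroot (al j)) * k j) =
  2 * k i - (if i = 1 then 0 else k (i - 1)) - (if i = n then 0 else k (Suc i))"
proof -
 have ib: "1 <= i" "i <= n" using i by (auto simp: ivl_iff)
 have p: "cartan Type_A i (i - 1) = - 1" if "i ~= 1"
 proof -
  obtain j where "i = Suc j" "1 <= j" using ib \<open>i ~= 1\<close> by (cases i) auto
  then show ?thesis using cartan_A[of i n j] ib by (simp add: ivl_iff)
 qed
 have s: "cartan Type_A i (Suc i) = - 1" if "i ~= n"
  using cartan_A[of i n "Suc i"] ib that by (simp add: ivl_iff)
 show ?thesis unfolding tri_row[OF t tridiagonal_classical(1) i]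
  by (cases "i = 1"; cases "i = n") (use p s in auto)
qed

lemma A_minuscule:
 assumes t: "has_type n al Type_A" shows "mk 1 = 1"
proof (rule minuscule_by_norm)
 \<comment> \<open>The first column of the inverse Cartan matrix of type \<open>A\<close>.\<close>
 let ?k = "%l. 1 - real l / (real n + 1)"
 show "1 : I" using rank_pos by (simp add: ivl_iff)
 have "0 < real 1 / (real n + 1)" by simp
 then show "?k 1 < 2" by linarith
 show "(if i = 1 then 1 else 0) = (\<Sum>l\<in>I. (al i \<bullet> coroot (al l)) * ?k l)" if i: "i : I" for i
 proof -
  have ib: "1 <= i" "i <= n" using i by (auto simp: ivl_iff)
  define N where "N = real n + 1"
  have N: "N > 0" by (simp add: N_def)
  have rn: "real n / N = 1 - 1 / N" using N by (simp add: N_def field_simps)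
  have a: "i ~= 1 ==> real (i - 1) / N = real i / N - 1 / N" using ib by (simp add: of_nat_diff diff_divide_distrib)
  have b: "real (Suc i) / N = real i / N + 1 / N" by (simp add: add_divide_distrib)
  show ?thesis unfolding A_row[OF t i] N_def[symmetric] using a b rn by auto
 qed
 show "al i \<bullet> al i <= al 1 \<bullet> al 1" if "i : I" for i
 proof -
  have "1 : I" using rank_pos by (simp add: ivl_iff)
  then have "al i \<bullet> al i = al 1 \<bullet> al 1"
   by (intro simply_laced_lengths[OF _ that]) (simp_all add: type_cartan[OF t] cartan_laced_commute)
  then show ?thesis by simp
 qed
qed

text \<open>The sum of all simple coroots pairs to 1 with the two end roots and to 0 with the
  others; in rank 1 it pairs to 2.\<close>

lemma A_relation:
 assumes t: "has_type n al Type_A" shows "cw n + cw 1 : Qv"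
proof (rule Qv_by_type[where k = "%_. 1"])
 fix i assume i: "i : I"
 have m: "1 : I" "n : I" using rank_pos by (auto simp: ivl_iff)
 show "(cw n + cw 1) \<bullet> al i = (\<Sum>j\<in>I. (al i \<bullet> coroot (al j)) * 1)"
  unfolding A_row[OF t i] using coweight_simple[OF m(1) i] coweight_simple[OF m(2) i] by (auto simp: inner_add_left)
qed simp

lemma A_reach:
 assumes "has_type n al Type_A" "subgroup H G" "reach H (cw 1)" "i : I" shows "reach H (cw i)"
proof (rule reach_up[OF assms(2,1) tridiagonal_classical(1) _ assms(3,4)])
 show "cartan Type_A (Suc j) j = - 1" if "1 <= j" "j < n" for j
  using that by (subst cartan_A) (auto simp: ivl_iff)
qed

lemma A_dynkin:
 assumes t: "has_type n al Type_A" and ph: "ph : AutDyn"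
 shows "ph = id | (ALL i:I. ph (al i) = al (n + 1 - i))"
proof -
 have "cartan Type_A i (Suc i) ~= 0" if "1 <= i" "i < n" for i
  using that by (subst cartan_A) (auto simp: ivl_iff)
 then show ?thesis using Aut_dynkin_path[OF t tridiagonal_classical(1) _ ph] by blast
qed

text \<open>The pattern of the types with one generator: no diagram automorphism except the
  identity, and the class of \<open>cw j\<close> generates all classes.\<close>

lemma omega_generates:
 assumes j: "j : I" "mk j = 1" and q: "2 *\<^sub>R cw j : Qv" and triv: "!!ph. ph : AutDyn ==> ph = id"
  and reach: "!!H i. subgroup H G ==> reach H (cw j) ==> i : I ==> reach H (cw i)"
 shows "generated_by_involutions G {omega j}"
proof (rule generated_by_involutionsI)
 let ?R = "{omega j}"
 have inv: "omega j : Aut_region A & omega j ~= id & omega j o omega j = id"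
  by (rule omega_involution[OF j q])
 then show "r : Aut_region A & r ~= id & r o r = id" if "r : ?R" for r
  using that unfolding involution_def[symmetric] by simp
 show "AutDyn \<subseteq> generate G ?R" using triv gen_id by blast
 have H: "subgroup (generate G ?R) G" by (rule subgroup_generate) (use inv in blast)
 have "reach (generate G ?R) (cw j)" by (rule reach_omega[OF j generate.incl]) simp
 then show "reach (generate G ?R) (cw i)" if "i : I" for i by (rule reach[OF H _ that])
qed

lemma type_A1: assumes t: "has_type n al Type_A" and n: "n = 1" shows "generated_by_involutions G {omega 1}"
proof (rule omega_generates)
 show m: "1 : I" using n by (simp add: ivl_iff)
 show "mk 1 = 1" by (rule A_minuscule[OF t])
 show "2 *\<^sub>R cw 1 : Qv" using A_relation[OF t] n by (simp add: scaleR_2)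
 show "ph = id" if ph: "ph : AutDyn" for ph
 proof (rule Aut_dynkin_idI[OF ph])
  fix i assume i: "i : I"
  have e: "n + 1 - i = i" using i n by (simp add: ivl_iff)
  show "ph (al i) = al i" using A_dynkin[OF t ph]
  proof
   assume "ALL i:I. ph (al i) = al (n + 1 - i)"
   from bspec[OF this i] show ?thesis unfolding e .
  qed simp
 qed
qed (rule A_reach[OF t])

lemma type_A:
 assumes t: "has_type n al Type_A" and n: "n >= 2"
 defines "ph0 \<equiv> dyn (%i. n + 1 - i)"
 shows "generated_by_involutions G {ph0, omega 1 o ph0}"
proof (rule generated_by_involutionsI)
 let ?sg = "%i. n + 1 - i" and ?\<omega> = "omega 1"
 let ?R = "{ph0, ?\<omega> o ph0}"
 have m: "1 : I" "n : I" using n by (auto simp: ivl_iff)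
 have s: "?sg i : I" "?sg (?sg i) = i" if "i : I" for i using that by (auto simp: ivl_iff)
 have c: "cartan Type_A (?sg i) (?sg j) = cartan Type_A i j" if ij: "i : I" "j : I" for i j
 proof -
  have "1 <= i" "i <= n" "1 <= j" "j <= n" using ij by (auto simp: ivl_iff)
  then have "?sg i = ?sg j \<longleftrightarrow> i = j" "?sg j = Suc (?sg i) \<longleftrightarrow> i = Suc j" "?sg i = Suc (?sg j) \<longleftrightarrow> j = Suc i" by linarith+
  then show ?thesis unfolding cartan_A[OF ij] cartan_A[OF s(1)[OF ij(1)] s(1)[OF ij(2)]] by auto
 qed
 have sym: "diagram_symmetry Type_A n ?sg" unfolding diagram_symmetry_def using s c by blast
 have "?sg 1 ~= 1" using n by simp
 note p = diagram_involution[OF t disjI1[OF HOL.refl] sym m(1) this, folded ph0_def, simplified]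
 have mk1: "mk 1 = 1" by (rule A_minuscule[OF t])
 have q: "ph0 (cw 1) + cw 1 : Qv" using p(5)[OF m(1)] A_relation[OF t] by simp
 have w: "?\<omega> o ph0 : Aut_region A & ?\<omega> o ph0 ~= id & (?\<omega> o ph0) o (?\<omega> o ph0) = id"
  by (rule Aut_dynkin_omega_involution(2)[OF m(1) mk1 p(1,3) q])
 show R: "r : Aut_region A & r ~= id & r o r = id" if "r : ?R" for r
 proof -
  have "involution ph0" "involution (?\<omega> o ph0)" unfolding involution_def by (intro conjI p(6) p(4) p(3)) (rule w)
  then show ?thesis using that unfolding involution_def[symmetric] by auto
 qed
 have H: "subgroup (generate G ?R) G" by (rule subgroup_generate) (use R in blast)
 have in_H: "ph0 : generate G ?R" "?\<omega> o ph0 : generate G ?R" by (rule generate.incl, simp)+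
 show "AutDyn \<subseteq> generate G ?R"
 proof
  fix ph assume ph: "ph : AutDyn"
  have "ph = id | ph = ph0" using A_dynkin[OF t ph] Aut_dynkin_eqI[OF ph p(1)] p(2) by auto
  then show "ph : generate G ?R" using in_H gen_id by blast
 qed
 have "(?\<omega> o ph0) o ph0 = ?\<omega>" by (simp only: o_assoc[symmetric] p(3) comp_id)
 then have "?\<omega> : generate G ?R" using gen_comp[OF in_H(2,1)] by simp
 then show "reach (generate G ?R) (cw i)" if "i : I" for i
  by (rule A_reach[OF t H reach_omega[OF m(1) mk1] that])
qed

lemma B_row:
 fixes k :: "nat => real"
 assumes t: "has_type n al Type_B" and n: "n >= 3" and i: "i : I"
 shows "(\<Sum>j\<in>I. (al i \<bullet> coroot (al j)) * k j) =
  2 * k i - (if i = 1 then 0 else k (i - 1)) - (if i = n then 0 else if Suc i = n then 2 * k n else k (Suc i))"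
proof -
 have ib: "1 <= i" "i <= n" using i by (auto simp: ivl_iff)
 have p: "cartan Type_B i (i - 1) = - 1" if "i ~= 1"
 proof -
  obtain j where "i = Suc j" "1 <= j" using ib \<open>i ~= 1\<close> by (cases i) auto
  then show ?thesis using cartan_B[of i n j] ib n by (simp add: ivl_iff)
 qed
 have s: "cartan Type_B i (Suc i) = (if Suc i = n then - 2 else - 1)" if "i ~= n"
  using cartan_B[of i n "Suc i"] ib n that by (simp add: ivl_iff)
 show ?thesis unfolding tri_row[OF t tridiagonal_classical(2)[OF n] i]
  by (cases "i = 1"; cases "i = n"; cases "Suc i = n") (use p s n in auto)
qed

lemma type_B: assumes t: "has_type n al Type_B" and n: "n >= 3" shows "generated_by_involutions G {omega 1}"
proof (rule omega_generates)
 show m: "1 : I" using n by (simp add: ivl_iff)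
 \<comment> \<open>The coordinates of \<open>cw 1\<close> in simple coroots, with 1/2 at the short
   root \<open>al n\<close>.\<close>
 let ?k = "%l. if l = n then 1 / 2 else 1 :: real"
 have len: "1 <= i --> i < n --> al i \<bullet> al i = al 1 \<bullet> al 1" for i
 proof (induction i)
  case (Suc i)
  show ?case
  proof (intro impI)
   assume i: "1 <= Suc i" "Suc i < n"
   show "al (Suc i) \<bullet> al (Suc i) = al 1 \<bullet> al 1"
   proof (cases "i = 0")
    case False
    have im: "i : I" "Suc i : I" using i False by (auto simp: ivl_iff)
    have "2 * (al i \<bullet> al (Suc i)) / (al (Suc i) \<bullet> al (Suc i)) = - 1" "2 * (al (Suc i) \<bullet> al i) / (al i \<bullet> al i) = - 1"
     unfolding inner_coroot[symmetric] type_cartan[OF t im] type_cartan[OF t im(2,1)] cartan_B[OF im n] cartan_B[OF im(2,1) n] using i by auto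
    moreover have "al i \<bullet> al i ~= 0" "al (Suc i) \<bullet> al (Suc i) ~= 0"
     using root_nonzero[OF simple_root] im by auto
    ultimately have "2 * (al i \<bullet> al (Suc i)) = - (al (Suc i) \<bullet> al (Suc i))" "2 * (al i \<bullet> al (Suc i)) = - (al i \<bullet> al i)"
     by (simp_all add: field_simps inner_commute[of "al (Suc i)" "al i"])
    then show ?thesis using Suc i False by simp
   qed (simp add: One_nat_def)
  qed
 qed simp
 show "mk 1 = 1"
 proof (rule minuscule_by_norm[OF m])
  show "?k 1 < 2" by simp
  show "(if i = 1 then 1 else 0) = (\<Sum>l\<in>I. (al i \<bullet> coroot (al l)) * ?k l)" if i: "i : I" for i
  proof -
   have "1 <= i" "i <= n" using i by (auto simp: ivl_iff)
   then show ?thesis unfolding B_row[OF t n i] using n by auto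
  qed
  show "al i \<bullet> al i <= al 1 \<bullet> al 1" if i: "i : I" for i
  proof (cases "i = n")
   case False
   then show ?thesis using len[of i] i by (simp add: ivl_iff)
  next
   case True
   obtain j where j: "n = Suc j" using n by (cases n) auto
   have jm: "j : I" "n : I" using n j by (auto simp: ivl_iff)
   have "2 * (al j \<bullet> al n) / (al n \<bullet> al n) = - 2"
    unfolding inner_coroot[symmetric] type_cartan[OF t jm] cartan_B[OF jm n] using j by auto
   moreover have "2 * (al n \<bullet> al j) / (al j \<bullet> al j) = - 1"
    unfolding inner_coroot[symmetric] type_cartan[OF t jm(2,1)] cartan_B[OF jm(2,1) n] using j by auto
   moreover have p: "al j \<bullet> al j > 0" "al n \<bullet> al n > 0"
    using root_nonzero[OF simple_root] jm by (auto simp: inner_gt_zero_iff)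
   ultimately have "2 * (al j \<bullet> al n) = - 2 * (al n \<bullet> al n)" "2 * (al j \<bullet> al n) = - (al j \<bullet> al j)"
    by (simp_all add: field_simps inner_commute[of "al n" "al j"])
   then have "al n \<bullet> al n <= al j \<bullet> al j" using p by simp
   also have "\<dots> = al 1 \<bullet> al 1" using len[of j] j n by simp
   finally show ?thesis using True by simp
  qed
 qed
 show "2 *\<^sub>R cw 1 : Qv"
 proof (rule Qv_by_type[where k = "%l. 2 * ?k l"])
  fix i assume i: "i : I"
  then have "1 <= i" "i <= n" by (auto simp: ivl_iff)
  then show "(2 *\<^sub>R cw 1) \<bullet> al i = (\<Sum>l\<in>I. (al i \<bullet> coroot (al l)) * (2 * ?k l))"
   unfolding B_row[OF t n i] using n coweight_simple[OF m i] by auto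
 qed simp
 show "ph = id" if ph: "ph : AutDyn" for ph
 proof -
  have nz: "cartan Type_B i (Suc i) ~= 0" if "1 <= i" "i < n" for i
   using that n by (subst cartan_B) (auto simp: ivl_iff)
  \<comment> \<open>A reversal would put the double bond at the other end.\<close>
  have no: False if r: "ALL i:I. ALL j:I. cartan Type_B (n + 1 - i) (n + 1 - j) = cartan Type_B i j"
  proof -
   have m': "n - 1 : I" "n : I" using n by (auto simp: ivl_iff)
   have e: "n + 1 - (n - 1) = 2" "n + 1 - n = 1" using n by auto
   have "cartan Type_B (n + 1 - (n - 1)) (n + 1 - n) = cartan Type_B (n - 1) n" using r m' by blast
   then have "cartan Type_B 2 1 = cartan Type_B (n - 1) n" unfolding e .
   moreover have "cartan Type_B 2 1 = - 1" "cartan Type_B (n - 1) n = - 2"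
    using n by (auto simp: cartan_entry_def)
   ultimately show False by simp
  qed
  show ?thesis using Aut_dynkin_path[OF t tridiagonal_classical(2)[OF n] nz ph] no by blast
 qed
 show "reach H (cw i)" if H: "subgroup H G" "reach H (cw 1)" "i : I" for H i
 proof (rule reach_up[OF H(1) t tridiagonal_classical(2)[OF n] _ H(2,3)])
  show "cartan Type_B (Suc j) j = - 1" if "1 <= j" "j < n" for j
   using that n by (subst cartan_B) (auto simp: ivl_iff)
 qed
qed

text \<open>Treats \<open>B2\<close> and \<open>C\<close> together: a path whose last root is long,
  with all Cartan integers of \<open>al n\<close> against the simple coroots even. Half of
  \<open>al n\<close> is therefore an integral character, and it vanishes on every fundamental
  coweight but \<open>cw n\<close>.\<close>

lemma last_omega_generates:
 assumes t: "has_type n al X" and n: "n >= 2"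
  and tri: "tridiagonal n n X"
  and up: "!!i. 1 <= i ==> i < n ==> cartan X i (Suc i) = - 1"
  and down: "!!i. 1 <= i ==> Suc i < n ==> cartan X (Suc i) i = - 1"
  and last: "cartan X n (n - 1) = - 2"
  and irrev: "~ (ALL i:I. ALL j:I. cartan X (n + 1 - i) (n + 1 - j) = cartan X i j)"
 shows "generated_by_involutions G {omega n}"
proof (rule omega_generates)
 show m: "n : I" using n by (simp add: ivl_iff)
 have col: "cartan X n i = (if i = n then 2 else if Suc i = n then - 2 else 0)" if i: "i : I" for i
 proof -
  have "i <= n" using i by (simp add: ivl_iff)
  then have "i = n | Suc i = n | n ~= i & i ~= Suc n & n ~= Suc i" by auto
  then show ?thesis using last tridiagonalD[OF tri m i] by (auto simp: cartan_entry_def[of X n n n])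
 qed
 show "mk n = 1"
 proof -
  have "EX i:I. mk i = 1 & ((1 / 2) *\<^sub>R al n) \<bullet> cw i ~= 0"
  proof (rule minuscule_by_character[OF _ m])
   show "((1 / 2) *\<^sub>R al n) \<bullet> coroot (al i) : \<int>" if i: "i : I" for i
    using type_cartan[OF t m i] col[OF i] by auto
   show "((1 / 2) *\<^sub>R al n) \<bullet> cw n = 1 / 2" using coweight_simple[OF m m] by (simp add: inner_commute)
  qed
  then obtain i where i: "i : I" "mk i = 1" "((1 / 2) *\<^sub>R al n) \<bullet> cw i ~= 0" by blast
  have "i = n" using i(3) coweight_simple[OF i(1) m] by (auto simp: inner_commute split: if_splits)
  then show ?thesis using i(2) by simp
 qed
 show "2 *\<^sub>R cw n : Qv"
 \<comment> \<open>Twice \<open>cw n\<close> is the sum of the simple coroots weighted by their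
   indices.\<close>
 proof (rule Qv_by_type[where k = real])
  fix i assume i: "i : I"
  then have ib: "1 <= i" "i <= n" by (auto simp: ivl_iff)
  have prev: "cartan X i (i - 1) = (if i = n then - 2 else - 1)" if "i ~= 1"
   using down[of "i - 1"] last that ib by auto
  have nxt: "cartan X i (Suc i) = - 1" if "i ~= n" using up[of i] that ib by simp
  have "(2 *\<^sub>R cw n) \<bullet> al i = (if i = n then 2 else 0)" using coweight_simple[OF m i] by simp
  also have "\<dots> = 2 * real i + (if i = 1 then 0 else of_int (cartan X i (i - 1)) * real (i - 1))
    + (if i = n then 0 else of_int (cartan X i (Suc i)) * real (Suc i))"
   using prev nxt ib n by (auto simp: of_nat_diff)
  finally show "(2 *\<^sub>R cw n) \<bullet> al i = (\<Sum>j\<in>I. (al i \<bullet> coroot (al j)) * real j)"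
   unfolding tri_row[OF t tri i] .
 qed simp
 show "ph = id" if ph: "ph : AutDyn" for ph
 proof -
  have nz: "cartan X i (Suc i) ~= 0" if "1 <= i" "i < n" for i using up[OF that] by simp
  show ?thesis using Aut_dynkin_path[OF t tri nz ph] irrev by blast
 qed
 show "reach H (cw i)" if H: "subgroup H G" "reach H (cw n)" "i : I" for H i
 proof (rule reach_down[OF H(1) t order_refl tri _ H(2) _ H(3)])
  show "cartan X i (Suc i) = - 1" if "1 <= i" "i < n" for i by (rule up[OF that])
  show "reach H (cw l)" if "n < l" "l <= n" for l using that by simp
 qed
qed

lemma type_B2: assumes t: "has_type n al Type_B" and n: "n = 2" shows "generated_by_involutions G {omega 2}"
proof -
 have c: "cartan Type_B i j = (if i = j then 2 else if j = Suc i then - 1 else - 2)" if "i : I" "j : I" for i j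
  using cartan_B2[of i j] that n by simp
 have m: "1 : I" "2 : I" using n by (auto simp: ivl_iff)
 have "generated_by_involutions G {omega n}"
 proof (rule last_omega_generates[OF t])
  show "tridiagonal n n Type_B" using n by (auto simp: tridiagonal_def ivl_iff)
  show "cartan Type_B i (Suc i) = - 1" if "1 <= i" "i < n" for i
   using that by (subst c) (auto simp: ivl_iff)
  show "cartan Type_B n (n - 1) = - 2" using n by (subst c) (auto simp: ivl_iff)
  show "~ (ALL i:I. ALL j:I. cartan Type_B (n + 1 - i) (n + 1 - j) = cartan Type_B i j)"
  proof
   assume "ALL i:I. ALL j:I. cartan Type_B (n + 1 - i) (n + 1 - j) = cartan Type_B i j"
   then have "cartan Type_B (n + 1 - 1) (n + 1 - 2) = cartan Type_B 1 2" using m by blast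
   moreover have "n + 1 - 1 = 2" "n + 1 - 2 = 1" using n by auto
   ultimately have "cartan Type_B 2 1 = cartan Type_B 1 2" by (simp only:)
   then show False unfolding c[OF m] c[OF m(2,1)] by (simp add: numeral_2_eq_2 One_nat_def)
  qed
 qed (use n in auto)
 then show ?thesis using n by simp
qed

lemma type_C: assumes t: "has_type n al Type_C" and n: "n >= 3" shows "generated_by_involutions G {omega n}"
proof (rule last_omega_generates[OF t])
 show "tridiagonal n n Type_C" by (rule tridiagonal_classical(3)[OF n])
 show "cartan Type_C i (Suc i) = - 1" if "1 <= i" "i < n" for i
  using that n by (subst cartan_C) (auto simp: ivl_iff)
 show "cartan Type_C (Suc i) i = - 1" if "1 <= i" "Suc i < n" for i
  using that n by (subst cartan_C) (auto simp: ivl_iff)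
 show "cartan Type_C n (n - 1) = - 2" using n by (auto simp: cartan_entry_def)
 show "~ (ALL i:I. ALL j:I. cartan Type_C (n + 1 - i) (n + 1 - j) = cartan Type_C i j)"
 proof
  assume r: "ALL i:I. ALL j:I. cartan Type_C (n + 1 - i) (n + 1 - j) = cartan Type_C i j"
  have m: "n - 1 : I" "n : I" using n by (auto simp: ivl_iff)
  have e: "n + 1 - (n - 1) = 2" "n + 1 - n = 1" using n by auto
  have "cartan Type_C (n + 1 - n) (n + 1 - (n - 1)) = cartan Type_C n (n - 1)" using r m by blast
  then have "cartan Type_C 1 2 = cartan Type_C n (n - 1)" unfolding e .
  moreover have "cartan Type_C 1 2 = - 1" "cartan Type_C n (n - 1) = - 2"
   using n by (auto simp: cartan_entry_def)
  ultimately show False by simp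
 qed
qed (use n in auto)

lemma mk_dynkin:
 assumes ph: "ph : AutDyn" and ij: "i : I" "j : I" "ph (cw i) = cw j" shows "mk i = mk j"
proof -
 have "ph (cw i) \<bullet> ph hr = cw i \<bullet> hr" using Aut_dynkin_D(1)[OF ph] by (simp add: orthogonal_transformation_def)
 then show ?thesis using ij Aut_dynkin_hr[OF ph] by (simp add: mk_simple)
qed

lemma no_generators:
 assumes Q: "!!i. i : I ==> cw i : Qv" and triv: "!!ph. ph : AutDyn ==> ph = id"
 shows "generated_by_involutions G {}"
proof (rule generated_by_involutionsI)
 show "AutDyn \<subseteq> generate G {}" using triv gen_id by blast
 have H: "subgroup (generate G {}) G" by (rule subgroup_generate) simp
 show "reach (generate G {}) (cw i)" if "i : I" for i by (rule reach_Qv[OF H Q[OF that]])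
qed simp

lemma weight_perm:
 assumes t: "has_type n al X" and c: "cartan_is X n c"
  and m: "matrix_eq c ns k (%i. 2)" and ns: "ns = [1..<Suc n]"
  and ph: "ph : AutDyn" and ta: "bij_betw ta I I" "!!i. i : I ==> ph (al i) = al (ta i)"
  and j: "j : I"
 shows "k ! (ta j - 1) = k ! (j - 1)"
proof -
 have "real_of_int (k ! (ta j - 1)) = real_of_int (k ! (j - 1))"
 proof (rule perm_weight[of "%j. of_int (k ! (j - 1))", OF _ ph ta j])
  show "(\<Sum>j\<in>I. (al i \<bullet> coroot (al j)) * of_int (k ! (j - 1))) = 2" if "i : I" for i
   using matrix_row[OF t c m ns that] by simp
 qed
 then show ?thesis by (simp only: of_int_eq_iff)
qed

text \<open>When the fixed vector has distinct coordinates, no index can move.\<close>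

lemma trivial_by_weight:
 assumes t: "has_type n al X" and c: "cartan_is X n c"
  and m: "matrix_eq c ns k (%i. 2)" and ns: "ns = [1..<Suc n]" and k: "length k = n" "distinct k"
  and ph: "ph : AutDyn"
 shows "ph = id"
proof -
 obtain ta where ta: "bij_betw ta I I" "!!i. i : I ==> ta i : I"
  "!!i. i : I ==> ph (al i) = al (ta i)"
  "!!i j. i : I ==> j : I ==> cartan X (ta i) (ta j) = cartan X i j"
  "!!i j. i : I ==> j : I ==> ta i = ta j ==> i = j"
  using perm_type[OF t ph] by blast
 have "ta i = i" if i: "i : I" for i
 proof -
  have b: "1 <= i" "i <= n" "1 <= ta i" "ta i <= n" using i ta(2)[OF i] by (auto simp: ivl_iff)
  have "k ! (ta i - 1) = k ! (i - 1)" by (rule weight_perm[OF t c m ns ph ta(1,3) i])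
  then have "ta i - 1 = i - 1" using nth_eq_iff_index_eq[OF k(2), of "ta i - 1" "i - 1"] k(1) b by simp
  then show ?thesis using b by linarith
 qed
 then show ?thesis using Aut_dynkin_idI[OF ph] ta(3) by simp
qed

text \<open>An instance of \<open>minuscule_by_norm\<close> with common denominator
  \<open>d\<close>, which keeps the data integral.\<close>

lemma minuscule_by_matrix:
 assumes t: "has_type n al Type_E" and m: "matrix_eq E_entry ns k (%i. if i = j then d else 0)" and ns: "ns = [1..<Suc n]"
  and d: "d > 0" "k ! (j - 1) < 2 * d" and j: "j : I"
 shows "mk j = 1"
proof (rule minuscule_by_norm[OF j])
 have d0: "real_of_int d > 0" using d(1) by simp
 have "real_of_int (k ! (j - 1)) < real_of_int (2 * d)" using d(2) by (simp only: of_int_less_iff)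
 then show "of_int (k ! (j - 1)) / real_of_int d < 2" using d0 by (simp add: pos_divide_less_eq)
 show "(if i = j then 1 else 0) = (\<Sum>l\<in>I. (al i \<bullet> coroot (al l)) * (of_int (k ! (l - 1)) / real_of_int d))"
  if i: "i : I" for i
 proof -
  have "(\<Sum>l\<in>I. (al i \<bullet> coroot (al l)) * (of_int (k ! (l - 1)) / real_of_int d)) =
    (\<Sum>l\<in>I. (al i \<bullet> coroot (al l)) * of_int (k ! (l - 1))) / of_int d"
   by (simp add: sum_divide_distrib)
  also have "\<dots> = of_int (if i = j then d else 0) / of_int d" unfolding matrix_row[OF t cartan_is_exceptional(1) m ns i] ..
  finally show ?thesis using d0 by simp
 qed
 show "al i \<bullet> al i <= al j \<bullet> al j" if "i : I" for i
 proof -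
  have "al i \<bullet> al i = al j \<bullet> al j"
   by (rule simply_laced_lengths[OF _ that j]) (simp add: type_cartan[OF t] cartan_laced_commute)
  then show ?thesis by simp
 qed
qed

lemma table_reach:
 assumes t: "has_type n al X" and c: "cartan_is X n c"
  and T: "coweight_table c ns j T e" and ns: "ns = [1..<Suc n]" and j: "j : I"
  and H: "subgroup H G" "reach H (cw j)" and r: "r : I"
 shows "reach H (cw r)"
proof -
 have "reach H (of_int (e ! (r - 1)) *\<^sub>R cw j)" by (rule reach_Ints_scale[OF H]) simp
 moreover have "of_int (e ! (r - 1)) *\<^sub>R cw j - cw r : Qv"
  using Qv_minus[OF table_Qv[OF t c T ns j r]] by simp
 ultimately show ?thesis by (rule reach_cong)
qed

subsection \<open>Exceptional types\<close>

lemma type_E8: assumes t: "has_type n al Type_E" and n: "n = 8" shows "generated_by_involutions G {}"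
proof (rule no_generators)
 have ns: "[1..<9] = [1..<Suc n]" using n by simp
 have m8: "8 : I" using n by (simp add: ivl_iff)
 show "cw i : Qv" if i: "i : I" for i
 proof -
  have "1 <= i" "i <= 8" using i n by (auto simp: ivl_iff)
  then have "[0,0,0,0,0,0,0,0::int] ! (i - 1) = 0" by (simp add: nth_Cons' )
  then show ?thesis using table_Qv[OF t cartan_is_exceptional(1) E8_table ns m8 i] by simp
 qed
 show "ph = id" if "ph : AutDyn" for ph
  by (rule trivial_by_weight[OF t cartan_is_exceptional(1) E_equations(6) ns _ _ that]) (simp_all add: n)
qed

lemma type_F4: assumes t: "has_type n al Type_F" and n: "n = 4" shows "generated_by_involutions G {}"
proof (rule no_generators)
 have ns: "[1..<5] = [1..<Suc n]" using n by simp
 have m: "4 : I" "2 : I" "3 : I" using n by (auto simp: ivl_iff)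
 show "cw i : Qv" if i: "i : I" for i
 proof -
  have "1 <= i" "i <= 4" using i n by (auto simp: ivl_iff)
  then have "[0,0,0,0::int] ! (i - 1) = 0" by (simp add: nth_Cons')
  then show ?thesis using table_Qv[OF t cartan_is_exceptional(2) F4_table ns m(1) i] by simp
 qed
 show "ph = id" if ph: "ph : AutDyn" for ph
 proof -
  have tri: "tridiagonal n n Type_F" by (auto simp: tridiagonal_def cartan_F F_entry_def)
  have nz: "cartan Type_F i (Suc i) ~= 0" if "1 <= i" "i < n" for i
  proof -
   have "i : I" "Suc i : I" using that by (auto simp: ivl_iff)
   then show ?thesis unfolding cartan_F[OF \<open>i : I\<close> \<open>Suc i : I\<close>] by (simp add: F_entry_def)
  qed
  have no: False if r: "ALL i:I. ALL j:I. cartan Type_F (n + 1 - i) (n + 1 - j) = cartan Type_F i j"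
  proof -
   have "cartan Type_F (n + 1 - 2) (n + 1 - 3) = cartan Type_F 2 3" using r m by blast
   moreover have "n + 1 - 2 = 3" "n + 1 - 3 = 2" using n by auto
   ultimately have "F_entry 3 2 = F_entry 2 3" using cartan_F m by metis
   then show False by (simp add: F_entry_def)
  qed
  show ?thesis using Aut_dynkin_path[OF t tri nz ph] no by blast
 qed
qed

lemma type_G2: assumes t: "has_type n al Type_G" and n: "n = 2" shows "generated_by_involutions G {}"
proof (rule no_generators)
 have ns: "[1..<3] = [1..<Suc n]" using n by simp
 have m: "2 : I" "1 : I" using n by (auto simp: ivl_iff)
 show "cw i : Qv" if i: "i : I" for i
 proof -
  have "1 <= i" "i <= 2" using i n by (auto simp: ivl_iff)
  then have "[0,0::int] ! (i - 1) = 0" by (simp add: nth_Cons')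
  then show ?thesis using table_Qv[OF t cartan_is_exceptional(3) G2_table ns m(1) i] by simp
 qed
 show "ph = id" if ph: "ph : AutDyn" for ph
 proof -
  have tri: "tridiagonal n n Type_G" by (auto simp: tridiagonal_def cartan_G G_entry_def)
  have nz: "cartan Type_G i (Suc i) ~= 0" if "1 <= i" "i < n" for i
  proof -
   have "i : I" "Suc i : I" using that by (auto simp: ivl_iff)
   then show ?thesis unfolding cartan_G[OF \<open>i : I\<close> \<open>Suc i : I\<close>] by (simp add: G_entry_def)
  qed
  have no: False if r: "ALL i:I. ALL j:I. cartan Type_G (n + 1 - i) (n + 1 - j) = cartan Type_G i j"
  proof -
   have "cartan Type_G (n + 1 - 2) (n + 1 - 1) = cartan Type_G 2 1" using r m by blast
   moreover have "n + 1 - 2 = 1" "n + 1 - 1 = 2" using n by auto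
   ultimately have "G_entry 1 2 = G_entry 2 1" using cartan_G m by metis
   then show False by (simp add: G_entry_def)
  qed
  show ?thesis using Aut_dynkin_path[OF t tri nz ph] no by blast
 qed
qed

lemma type_E7: assumes t: "has_type n al Type_E" and n: "n = 7" shows "generated_by_involutions G {omega 7}"
proof (rule omega_generates)
 have ns: "[1..<8] = [1..<Suc n]" using n by simp
 show m: "7 : I" using n by (simp add: ivl_iff)
 show "mk 7 = 1" by (rule minuscule_by_matrix[OF t E_equations(3) ns _ _ m]) simp_all
 show "2 *\<^sub>R cw 7 : Qv"
 proof (rule matrix_Qv[OF t cartan_is_exceptional(1) E_equations(3) ns])
  show "(2 *\<^sub>R cw 7) \<bullet> al i = of_int (if i = 7 then 2 else 0)" if "i : I" for i
   using coweight_simple[OF m that] by auto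
 qed
 show "ph = id" if "ph : AutDyn" for ph
  by (rule trivial_by_weight[OF t cartan_is_exceptional(1) E_equations(5) ns _ _ that]) (simp_all add: n)
 show "reach H (cw i)" if "subgroup H G" "reach H (cw 7)" "i : I" for H i
  by (rule table_reach[OF t cartan_is_exceptional(1) E7_table ns m that])
qed

lemma type_E6:
 assumes t: "has_type n al Type_E" and n: "n = 6"
 defines "ph0 \<equiv> dyn (id(1 := 6, 6 := 1, 3 := 5, 5 := 3))"
 shows "generated_by_involutions G {ph0, ph0 o omega 6}"
proof (rule generated_by_involutionsI)
 let ?sg = "id(1 := 6, 6 := 1, 3 := 5, 5 := 3) :: nat => nat" and ?\<omega> = "omega 6"
 let ?R = "{ph0, ph0 o ?\<omega>}"
 have ns: "[1..<7] = [1..<Suc n]" using n by simp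
 have idx: "i = 1 | i = 2 | i = 3 | i = 4 | i = 5 | i = 6" if "i : I" for i
  using that n by (simp add: ivl_iff) linarith
 have mem: "1 : I" "2 : I" "3 : I" "4 : I" "5 : I" "6 : I"
  using n by (auto simp: ivl_iff)
 have s: "?sg i : I" "?sg (?sg i) = i" if "i : I" for i
  using idx[OF that] mem by (elim disjE; simp)+
 have sE: "list_all (%i. list_all (%j. E_entry ((id(1 := 6, 6 := 1, 3 := 5, 5 := 3)) i) ((id(1 := 6, 6 := 1, 3 := 5, 5 := 3)) j)
   = E_entry i j) [1,2,3,4,5,6]) [1,2,3,4,5,6]"
  by code_simp
 have c: "cartan Type_E (?sg i) (?sg j) = cartan Type_E i j" if ij: "i : I" "j : I" for i j
 proof -
  have "i : set [1,2,3,4,5,6]" "j : set [1,2,3,4,5,6]" using idx[OF ij(1)] idx[OF ij(2)] by auto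
  then show ?thesis
   unfolding cartan_E[OF ij] cartan_E[OF s(1)[OF ij(1)] s(1)[OF ij(2)]] using sE unfolding list_all_iff by blast
 qed
 have sym: "diagram_symmetry Type_E n ?sg" unfolding diagram_symmetry_def using s c by blast
 have "?sg 1 ~= 1" by simp
 note p = diagram_involution[OF t disjI2[OF disjI2[OF HOL.refl]] sym mem(1) this, folded ph0_def]
 have s6: "?sg 6 = 1" by simp
 have mk6: "mk 6 = 1" by (rule minuscule_by_matrix[OF t E_equations(1) ns _ _ mem(6)]) simp_all
 have q: "ph0 (cw 6) + cw 6 : Qv"
  unfolding p(5)[OF mem(6)] s6
 proof (rule matrix_Qv[OF t cartan_is_exceptional(1) E_equations(2) ns])
  show "(cw 1 + cw 6) \<bullet> al i = of_int (if i = 1 | i = 6 then 1 else 0)" if "i : I" for i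
   using coweight_simple[OF mem(1) that] coweight_simple[OF mem(6) that] by (auto simp: inner_add_left)
 qed
 have w: "ph0 o ?\<omega> : Aut_region A & ph0 o ?\<omega> ~= id & (ph0 o ?\<omega>) o (ph0 o ?\<omega>) = id"
  by (rule Aut_dynkin_omega_involution(1)[OF mem(6) mk6 p(1,3) q])
 show R: "r : Aut_region A & r ~= id & r o r = id" if "r : ?R" for r
 proof -
  have "involution ph0" "involution (ph0 o ?\<omega>)"
   unfolding involution_def by (intro conjI p(6) p(4) p(3)) (rule w)
  then show ?thesis using that unfolding involution_def[symmetric] by auto
 qed
 have H: "subgroup (generate G ?R) G" by (rule subgroup_generate) (use R in blast)
 have in_H: "ph0 : generate G ?R" "ph0 o ?\<omega> : generate G ?R" by (rule generate.incl, simp)+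
 show "AutDyn \<subseteq> generate G ?R"
 proof
  fix ph assume ph: "ph : AutDyn"
  obtain ta where ta: "bij_betw ta I I" "!!i. i : I ==> ta i : I"
   "!!i. i : I ==> ph (al i) = al (ta i)"
   "!!i j. i : I ==> j : I ==> cartan Type_E (ta i) (ta j) = cartan Type_E i j"
   "!!i j. i : I ==> j : I ==> ta i = ta j ==> i = j"
   using perm_type[OF t ph] by blast
  \<comment> \<open>These coordinates separate all nodes except 1 from 6 and 3 from 5; the edge
    between 1 and 3 couples the two exchanges.\<close>
  have w: "[16, 22, 30, 42, 30, 16::int] ! (ta i - 1) = [16, 22, 30, 42, 30, 16] ! (i - 1)" if "i : I" for i
   by (rule weight_perm[OF t cartan_is_exceptional(1) E_equations(4) ns ph ta(1,3) that])
  have t1: "ta 1 = 1 | ta 1 = 6" using w[OF mem(1)] idx[OF ta(2)[OF mem(1)]] by (elim disjE) simp_all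
  have t6: "ta 6 = 1 | ta 6 = 6" using w[OF mem(6)] idx[OF ta(2)[OF mem(6)]] by (elim disjE) simp_all
  have t2: "ta 2 = 2" using w[OF mem(2)] idx[OF ta(2)[OF mem(2)]] by (elim disjE) simp_all
  have t4: "ta 4 = 4" using w[OF mem(4)] idx[OF ta(2)[OF mem(4)]] by (elim disjE) simp_all
  have t3: "ta 3 = 3 | ta 3 = 5" using w[OF mem(3)] idx[OF ta(2)[OF mem(3)]] by (elim disjE) simp_all
  have t5: "ta 5 = 3 | ta 5 = 5" using w[OF mem(5)] idx[OF ta(2)[OF mem(5)]] by (elim disjE) simp_all
  have ne: "ta 1 ~= ta 6" "ta 3 ~= ta 5" using ta(5)[OF mem(1,6)] ta(5)[OF mem(3,5)] by auto
  have "E_entry (ta 1) (ta 3) = E_entry 1 3"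
   using ta(4)[OF mem(1,3)] cartan_E[OF mem(1,3)] cartan_E[OF ta(2)[OF mem(1)] ta(2)[OF mem(3)]] by simp
  then have a: "~ (ta 1 = 1 & ta 3 = 5)" "~ (ta 1 = 6 & ta 3 = 3)" by (auto simp: E_entry_def)
  have "ph = id | ph = ph0"
  proof (cases "ta 1 = 1")
   case True
   then have v: "ta 1 = 1" "ta 6 = 6" "ta 3 = 3" "ta 5 = 5" using t1 t6 t3 t5 ne a by auto
   have "ph (al i) = al i" if i: "i : I" for i
    unfolding ta(3)[OF i] using idx[OF i] v t2 t4 by (elim disjE) simp_all
   then have "ph = id" by (rule Aut_dynkin_idI[OF ph])
   then show ?thesis ..
  next
   case False
   then have v: "ta 1 = 6" "ta 6 = 1" "ta 3 = 5" "ta 5 = 3" using t1 t6 t3 t5 ne a by auto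
   have "ph (al i) = ph0 (al i)" if i: "i : I" for i
    unfolding ta(3)[OF i] p(2)[OF i] using idx[OF i] v t2 t4 by (elim disjE) simp_all
   then have "ph = ph0" by (rule Aut_dynkin_eqI[OF ph p(1)])
   then show ?thesis ..
  qed
  then show "ph : generate G ?R" using in_H gen_id by blast
 qed
 have "ph0 o (ph0 o ?\<omega>) = ?\<omega>" by (simp only: o_assoc p(3) id_comp)
 then have "?\<omega> : generate G ?R" using gen_comp[OF in_H] by simp
 then have "reach (generate G ?R) (cw 6)" by (rule reach_omega[OF mem(6) mk6])
 then show "reach (generate G ?R) (cw i)" if "i : I" for i
  by (rule table_reach[OF t cartan_is_exceptional(1) E6_table ns mem(6) H _ that])
qed

subsection \<open>Type D\<close>

text \<open>The first subtracted term is the lower neighbour, which is \<open>p\<close> for both end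
  nodes; the second collects the upper ones, two of them at the branch node.\<close>

lemma D_row:
 fixes k :: "nat => real"
 assumes t: "has_type n al Type_D" and n: "n = p + 2" "p >= 2" and i: "i : I"
 shows "(\<Sum>j\<in>I. (al i \<bullet> coroot (al j)) * k j) = 2 * k i
  - (if i = 1 then 0 else if i <= p + 1 then k (i - 1) else k p)
  - (if i < p then k (Suc i) else if i = p then k (p + 1) + k (p + 2) else 0)"
proof -
 let ?g = "%j. real_of_int (cartan Type_D i j) * k j"
 let ?N1 = "if i = 1 then {} else if i <= p + 1 then {i - 1} else {p}"
 let ?N2 = "if i < p then {Suc i} else if i = p then {p + 1, p + 2} else {}"
 have ib: "1 <= i" "i <= p + 2" using i n by (auto simp: ivl_iff)
 have adj: "j : ?N1 \<union> ?N2 \<longleftrightarrow> D_adj p i j" if "1 <= j" "j <= p + 2" for j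
 proof -
  have "i = 1 & i < p | 1 < i & i < p | i = p & 1 < i | i = p + 1 | i = p + 2" using ib n(2) by linarith
  then show ?thesis using that n(2) by (elim disjE conjE; simp add: D_adj_def; presburger?)
 qed
 have disj: "?N1 \<inter> ?N2 = {}" using ib by auto
 have inN: "1 <= j" "j <= p + 2" "j ~= i" if "j : ?N1 \<union> ?N2" for j
  using that ib n(2) by (auto split: if_splits)
 have "(\<Sum>j\<in>I. (al i \<bullet> coroot (al j)) * k j) = (\<Sum>j\<in>I. ?g j)"
  by (rule sum.cong) (simp_all add: type_cartan[OF t i])
 also have "\<dots> = ?g i + sum ?g (?N1 \<union> ?N2)"
 proof (rule nbr_sum)
  show "insert i (?N1 \<union> ?N2) \<subseteq> I"
  proof
   fix j assume "j : insert i (?N1 \<union> ?N2)"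
   then have "1 <= j & j <= p + 2" using inN(1,2)[of j] ib by blast
   then show "j : I" using n(1) by (simp add: ivl_iff)
  qed
  show "i ~: ?N1 \<union> ?N2" using inN(3) by blast
  show "?g j = 0" if j: "j : I" "j ~: insert i (?N1 \<union> ?N2)" for j
  proof -
   have "~ D_adj p i j" using adj[of j] j n(1) by (auto simp: ivl_iff)
   then show ?thesis using cartan_D[OF i j(1) n] j(2) by simp
  qed
 qed simp
 also have "sum ?g (?N1 \<union> ?N2) = - sum k (?N1 \<union> ?N2)"
  unfolding sum_negf[symmetric]
 proof (rule sum.cong[OF HOL.refl])
  fix j assume j: "j : ?N1 \<union> ?N2"
  have jm: "j : I" using inN[OF j] n(1) by (simp add: ivl_iff)
  have "D_adj p i j" using adj[of j] inN[OF j] j by blast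
  then show "?g j = - k j" using cartan_D[OF i jm n] inN(3)[OF j] by simp
 qed
 also have "sum k (?N1 \<union> ?N2) = sum k ?N1 + sum k ?N2"
  by (rule sum.union_disjoint) (use disj in auto)
 also have "?g i = 2 * k i" by (simp add: cartan_entry_def)
 finally show ?thesis by simp
qed

text \<open>A combination of coroots with coefficients \<open>j\<close> along the path and
  \<open>a\<close>, \<open>b\<close> at the end nodes; the condition on \<open>a + b\<close> makes
  its pairing with the branch root vanish. For even \<open>p\<close> it is used with
  \<open>a = b + 1\<close> and gives \<open>2 cw (p + 1)\<close>, for odd \<open>p\<close> with
  \<open>a = b\<close> and gives \<open>cw (p + 1) + cw (p + 2)\<close>.\<close>

lemma D_relation:
 assumes t: "has_type n al Type_D" and n: "n = p + 2" "p >= 2" and ab: "a : \<int>" "b : \<int>" "a + b = real p + 1"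
 shows "(2 * a - real p) *\<^sub>R cw (p + 1) + (2 * b - real p) *\<^sub>R cw (p + 2) : Qv"
proof (rule Qv_by_type[where k = "%j. if j <= p then real j else if j = p + 1 then a else b"])
 have m: "p + 1 : I" "p + 2 : I" using n by (auto simp: ivl_iff)
 fix i assume i: "i : I"
 then have ib: "1 <= i" "i <= p + 2" using n by (auto simp: ivl_iff)
 then have "i < p | i = p | i = p + 1 | i = p + 2" by linarith
 then show "((2 * a - real p) *\<^sub>R cw (p + 1) + (2 * b - real p) *\<^sub>R cw (p + 2)) \<bullet> al i =
   (\<Sum>j\<in>I. (al i \<bullet> coroot (al j)) * (if j <= p then real j else if j = p + 1 then a else b))"
  unfolding D_row[OF t n i] inner_add_left inner_scaleR_left coweight_simple[OF m(1) i] coweight_simple[OF m(2) i]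
  using ib n(2) ab(3) by (elim disjE) (auto simp: of_nat_diff)
qed (use ab in auto)

lemma D_reach:
 assumes t: "has_type n al Type_D" and n: "n = p + 2" "p >= 2" and H: "subgroup H G"
  and r: "reach H (cw (p + 1))" "reach H (cw (p + 2))" and i: "i : I"
 shows "reach H (cw i)"
proof -
 have m: "p + 1 : I" "p : I" using n by (auto simp: ivl_iff)
 have rp: "reach H (cw p)"
 proof (rule reach_nbr[OF H t m _ r(1)])
  show "cartan Type_D p (p + 1) = - 1" unfolding cartan_D[OF m(2,1) n] by (simp add: D_adj_def)
  show "reach H (cw l)" if l: "l : I" "l ~= p + 1" "l ~= p" "cartan Type_D l (p + 1) ~= 0" for l
  proof -
   have "D_adj p l (p + 1)" using l(4) cartan_D[OF l(1) m(1) n] l(2) by (auto split: if_splits)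
   then show ?thesis using l(2,3) by (auto simp: D_adj_def)
  qed
 qed
 show ?thesis
 proof (rule reach_down[OF H t _ _ _ rp _ i])
  show "p <= n" using n by simp
  show "tridiagonal p n Type_D" unfolding tridiagonal_def
  proof (intro ballI impI)
   fix i j assume ij: "i : {1..p}" "j : {1..p}" "i ~= j" "j ~= Suc i" "i ~= Suc j"
   have "i : I" "j : I" "i <= p" "j <= p" using ij(1,2) n by (auto simp: ivl_iff)
   then show "cartan Type_D i j = 0"
    using cartan_D[OF \<open>i : I\<close> \<open>j : I\<close> n] ij by (auto simp: D_adj_def)
  qed
  show "cartan Type_D i (Suc i) = - 1" if "1 <= i" "i < p" for i
  proof -
   have "i : I" "Suc i : I" using that n by (auto simp: ivl_iff)
   then show ?thesis using cartan_D[OF \<open>i : I\<close> \<open>Suc i : I\<close> n] that by (auto simp: D_adj_def)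
  qed
  show "reach H (cw l)" if "p < l" "l <= n" for l
  proof -
   have "l = p + 1 | l = p + 2" using that n by linarith
   then show ?thesis using r by blast
  qed
 qed
qed

lemma D_swap:
 assumes t: "has_type n al Type_D" and n: "n = p + 2" "p >= 2"
 defines "ph0 \<equiv> dyn (id(n - 1 := n, n := n - 1))"
 shows "ph0 : AutDyn" "ph0 o ph0 = id" "ph0 ~= id" "ph0 : Aut_region A"
  "!!i. 1 <= i ==> i <= p ==> ph0 (al i) = al i" "ph0 (al (p + 1)) = al (p + 2)" "ph0 (al (p + 2)) = al (p + 1)"
  "ph0 (cw (p + 1)) = cw (p + 2)" "ph0 (cw (p + 2)) = cw (p + 1)"
proof -
 let ?sg = "id(n - 1 := n, n := n - 1) :: nat => nat"
 have sv: "?sg (p + 1) = p + 2" "?sg (p + 2) = p + 1" "!!i. i <= p ==> ?sg i = i" using n by auto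
 have m: "p + 1 : I" "p + 2 : I" using n by (auto simp: ivl_iff)
 have idx: "1 <= i & i <= p | i = p + 1 | i = p + 2" if "i : I" for i
  using that n by (simp add: ivl_iff) linarith
 have s: "?sg i : I" "?sg (?sg i) = i" if i: "i : I" for i
  using idx[OF i] sv m i by (elim disjE conjE; simp only: sv)+
 have inj: "?sg i = ?sg j \<longleftrightarrow> i = j" if "i : I" "j : I" for i j using s(2)[OF that(1)] s(2)[OF that(2)] by metis
 have adj: "D_adj p (?sg i) (?sg j) \<longleftrightarrow> D_adj p i j" if ij: "i : I" "j : I" for i j
  using idx[OF ij(1)] idx[OF ij(2)]
  by (elim disjE conjE; hypsubst?; simp only: sv; simp add: D_adj_def; linarith?)
 have c: "cartan Type_D (?sg i) (?sg j) = cartan Type_D i j" if ij: "i : I" "j : I" for i j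
  unfolding cartan_D[OF ij n] cartan_D[OF s(1)[OF ij(1)] s(1)[OF ij(2)] n] inj[OF ij] adj[OF ij] ..
 have sym: "diagram_symmetry Type_D n ?sg" unfolding diagram_symmetry_def using s c by blast
 have "?sg (p + 1) ~= p + 1" unfolding sv by simp
 note d = diagram_involution[OF t disjI2[OF disjI1[OF HOL.refl]] sym m(1) this, folded ph0_def]
 show "ph0 : AutDyn" "ph0 o ph0 = id" "ph0 ~= id" "ph0 : Aut_region A" by (rule d(1) d(3) d(4) d(6))+
 show "ph0 (al i) = al i" if "1 <= i" "i <= p" for i
 proof -
  have im: "i : I" using that n by (simp add: ivl_iff)
  show ?thesis unfolding d(2)[OF im] sv(3)[OF that(2)] by (rule HOL.refl)
 qed
 show "ph0 (al (p + 1)) = al (p + 2)" "ph0 (al (p + 2)) = al (p + 1)"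
  "ph0 (cw (p + 1)) = cw (p + 2)" "ph0 (cw (p + 2)) = cw (p + 1)"
  unfolding d(2)[OF m(1)] d(2)[OF m(2)] d(5)[OF m(1)] d(5)[OF m(2)] sv by (rule HOL.refl)+
qed

text \<open>Half the sum of the last two simple roots is an integral character, as their Cartan
  integers with each simple coroot have equal parity. Among fundamental coweights it is nonzero only
  at the two end nodes, and \<open>D_swap\<close> shows that their marks agree.\<close>

lemma D_minuscule:
 assumes t: "has_type n al Type_D" and n: "n = p + 2" "p >= 2"
 shows "mk (p + 1) = 1" "mk (p + 2) = 1"
proof -
 have m: "p + 1 : I" "p + 2 : I" using n by (auto simp: ivl_iff)
 define \<mu> where "\<mu> = (1 / 2) *\<^sub>R (al (p + 1) + al (p + 2))"
 have \<mu>cw: "\<mu> \<bullet> cw i = (if i = p + 1 | i = p + 2 then 1 / 2 else 0)" if i: "i : I" for i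
 proof -
  have "\<mu> \<bullet> cw i = (cw i \<bullet> al (p + 1) + cw i \<bullet> al (p + 2)) / 2"
   by (simp add: \<mu>_def inner_add_left inner_add_right inner_commute)
  then show ?thesis unfolding coweight_simple[OF i m(1)] coweight_simple[OF i m(2)] by auto
 qed
 have "EX i:I. mk i = 1 & \<mu> \<bullet> cw i ~= 0"
 proof (rule minuscule_by_character[OF _ m(1)])
  show "\<mu> \<bullet> coroot (al i) : \<int>" if i: "i : I" for i
  proof -
   have ib: "1 <= i" "i <= p + 2" using i n by (auto simp: ivl_iff)
   have eq: "\<mu> \<bullet> coroot (al i) = (of_int (cartan Type_D (p + 1) i) + of_int (cartan Type_D (p + 2) i)) / 2"
    using type_cartan[OF t m(1) i] type_cartan[OF t m(2) i] by (simp add: \<mu>_def inner_add_left)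
   have "i < p | i = p | i = p + 1 | i = p + 2" using ib by linarith
   then have "\<mu> \<bullet> coroot (al i) = 0 | \<mu> \<bullet> coroot (al i) = - 1 | \<mu> \<bullet> coroot (al i) = 1"
    unfolding eq cartan_D[OF m(1) i n] cartan_D[OF m(2) i n] by (elim disjE) (simp_all add: D_adj_def)
   then show ?thesis by auto
  qed
  show "\<mu> \<bullet> cw (p + 1) = 1 / 2" using \<mu>cw[OF m(1)] by simp
 qed
 then obtain i where i: "i : I" "mk i = 1" "\<mu> \<bullet> cw i ~= 0" by blast
 then have "i = p + 1 | i = p + 2" using \<mu>cw by (auto split: if_splits)
 moreover have "mk (p + 1) = mk (p + 2)" by (rule mk_dynkin[OF D_swap(1)[OF t n] m D_swap(8)[OF t n]])
 ultimately show "mk (p + 1) = 1" "mk (p + 2) = 1" using i(2) by auto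
qed

text \<open>The sum of row \<open>i\<close> of the Cartan matrix is 2 minus the number of neighbours
  and is preserved by the automorphism. Only the branch node has sum -1, and only the three leaves
  have sum 1.\<close>

lemma D_dynkin_branch:
 assumes t: "has_type n al Type_D" and n: "n = p + 2" "p >= 2" and ph: "ph : AutDyn"
 obtains ta where "bij_betw ta I I" "!!i. i : I ==> ta i : I"
  "!!i. i : I ==> ph (al i) = al (ta i)"
  "!!i j. i : I ==> j : I ==> D_adj p i j ==> D_adj p (ta i) (ta j)"
  "!!i j. i : I ==> j : I ==> ta i = ta j ==> i = j" "ta p = p"
  "!!i. i : {p + 1, p + 2} ==> ta i = 1 | ta i = p + 1 | ta i = p + 2"
proof -
 obtain ta where ta: "bij_betw ta I I" "!!i. i : I ==> ta i : I"
  "!!i. i : I ==> ph (al i) = al (ta i)"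
  "!!i j. i : I ==> j : I ==> cartan Type_D (ta i) (ta j) = cartan Type_D i j"
  "!!i j. i : I ==> j : I ==> ta i = ta j ==> i = j"
  using perm_type[OF t ph] by blast
 have adj: "D_adj p (ta i) (ta j)" if ij: "i : I" "j : I" "D_adj p i j" for i j
 proof -
  have "i ~= j" using ij(3) by (auto simp: D_adj_def)
  then have "cartan Type_D i j = - 1" using cartan_D[OF ij(1,2) n] ij(3) by simp
  then have "cartan Type_D (ta i) (ta j) = - 1" using ta(4)[OF ij(1,2)] by simp
  then show ?thesis using cartan_D[OF ta(2)[OF ij(1)] ta(2)[OF ij(2)] n] by (auto split: if_splits)
 qed
 define s where "s i = (\<Sum>j\<in>I. (al i \<bullet> coroot (al j)) * 1)" for i
 have sinv: "s (ta i) = s i" if i: "i : I" for i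
 proof -
  have "s (ta i) = (\<Sum>j\<in>I. al (ta i) \<bullet> coroot (al (ta j)))"
   unfolding s_def using sum.reindex_bij_betw[OF ta(1), of "%j. al (ta i) \<bullet> coroot (al j)"] by simp
  also have "\<dots> = s i"
   unfolding s_def
  proof (rule sum.cong[OF HOL.refl])
   show "al (ta i) \<bullet> coroot (al (ta j)) = (al i \<bullet> coroot (al j)) * 1" if j: "j : I" for j
    using ta(4)[OF i j] type_cartan[OF t i j] type_cartan[OF t ta(2)[OF i] ta(2)[OF j]] by simp
  qed
  finally show ?thesis .
 qed
 have sval: "s i = 2 - (if i = 1 then 0 else 1) - (if i < p then 1 else if i = p then 2 else 0)" if "i : I" for i
  unfolding s_def D_row[OF t n that] by simp
 have m: "p : I" "p + 1 : I" "p + 2 : I" using n by (auto simp: ivl_iff)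
 have "ta p = p"
  using sinv[OF m(1)] sval[OF m(1)] sval[OF ta(2)[OF m(1)]] n(2) by (auto split: if_splits)
 moreover have "ta i = 1 | ta i = p + 1 | ta i = p + 2" if "i : {p + 1, p + 2}" for i
 proof -
  have im: "i : I" using that m by auto
  have "1 <= ta i" "ta i <= p + 2" using ta(2)[OF im] n by (auto simp: ivl_iff)
  moreover have "s (ta i) = 1" using sinv[OF im] sval[OF im] that n(2) by auto
  ultimately show ?thesis using sval[OF ta(2)[OF im]] n(2) by (auto split: if_splits)
 qed
 ultimately show thesis using that[OF ta(1,2,3) adj ta(5)] by blast
qed

text \<open>For \<open>p\<close> at least 3 the leaf 1 is not adjacent to the branch node, so the
  other two leaves are preserved as a pair, and the path is fixed node by node from the branch node
  down.\<close>

lemma D_dynkin: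
 assumes t: "has_type n al Type_D" and n: "n = p + 2" "p >= 3" and ph: "ph : AutDyn"
 shows "ph = id | ph = dyn (id(n - 1 := n, n := n - 1))"
proof -
 have p2: "p >= 2" using n(2) by simp
 obtain ta where ta: "bij_betw ta I I" "!!i. i : I ==> ta i : I"
  "!!i. i : I ==> ph (al i) = al (ta i)"
  "!!i j. i : I ==> j : I ==> D_adj p i j ==> D_adj p (ta i) (ta j)"
  "!!i j. i : I ==> j : I ==> ta i = ta j ==> i = j" "ta p = p"
  "!!i. i : {p + 1, p + 2} ==> ta i = 1 | ta i = p + 1 | ta i = p + 2"
  using D_dynkin_branch[OF t n(1) p2 ph] by blast
 have m: "p : I" "p + 1 : I" "p + 2 : I" using n by (auto simp: ivl_iff)
 have leaf: "ta i = p + 1 | ta i = p + 2" if i: "i : {p + 1, p + 2}" for i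
 proof -
  have im: "i : I" using i m by auto
  have "D_adj p i p" using i by (auto simp: D_adj_def)
  then have "D_adj p (ta i) p" using ta(4)[OF im m(1)] ta(6) by simp
  then have "ta i ~= 1" using n(2) by (auto simp: D_adj_def)
  then show ?thesis using ta(7)[OF i] by blast
 qed
 have ne: "ta (p + 1) ~= ta (p + 2)" using ta(5)[OF m(2,3)] by auto
 have down: "u < p --> ta (p - u) = p - u" for u
 proof (induction u rule: less_induct)
  case (less u)
  show ?case
  proof
   assume up: "u < p"
   show "ta (p - u) = p - u"
   proof (cases u)
    case 0 then show ?thesis using ta(6) by simp
   next
    case (Suc v)
    define k where "k = p - u"
    have k: "1 <= k" "p - v = Suc k" "Suc k <= p" using Suc up by (auto simp: k_def)
    have km: "k : I" "Suc k : I" using k n by (auto simp: ivl_iff)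
    have fs: "ta (Suc k) = Suc k" using less[of v] Suc up k(2) by simp
    have "D_adj p k (Suc k)" using k by (simp add: D_adj_def)
    then have a: "D_adj p (ta k) (Suc k)" using ta(4)[OF km] fs by simp
    have "ta k ~= p + 1" "ta k ~= p + 2"
     using ta(5)[OF km(1) m(2)] ta(5)[OF km(1) m(3)] leaf[of "p + 1"] leaf[of "p + 2"] ne k by auto
    moreover have "ta k ~= Suc (Suc k)"
    proof (cases "Suc k = p")
     case True
     then show ?thesis using \<open>ta k ~= p + 1\<close> by simp
    next
     case False
     then have "p - (u - 2) = Suc (Suc k)" "u - 2 < u" "u - 2 < p" using k Suc up by (auto simp: k_def)
     then have "ta (Suc (Suc k)) = Suc (Suc k)" using less[of "u - 2"] by simp
     moreover have "Suc (Suc k) : I" using k n by (auto simp: ivl_iff)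
     ultimately show ?thesis using ta(5)[OF km(1), of "Suc (Suc k)"] by auto
    qed
    ultimately have "ta k = k" using a k by (auto simp: D_adj_def)
    then show ?thesis by (simp add: k_def)
   qed
  qed
 qed
 have low: "ph (al i) = al i" if "1 <= i" "i <= p" for i
 proof -
  have "i : I" using that n by (simp add: ivl_iff)
  then show ?thesis using ta(3)[of i] down[of "p - i"] that by simp
 qed
 have idx: "1 <= i & i <= p | i = p + 1 | i = p + 2" if "i : I" for i
  using that n(1) by (simp add: ivl_iff) linarith
 show ?thesis
 proof (cases "ta (p + 1) = p + 1")
  case True
  then have "ta (p + 2) = p + 2" using leaf[of "p + 2"] ne by auto
  then have "ph (al i) = al i" if "i : I" for i
   using idx[OF that] low True ta(3)[OF m(2)] ta(3)[OF m(3)] by (elim disjE) simp_all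
  then have "ph = id" by (rule Aut_dynkin_idI[OF ph])
  then show ?thesis ..
 next
  case False
  then have v: "ta (p + 1) = p + 2" "ta (p + 2) = p + 1" using leaf[of "p + 1"] leaf[of "p + 2"] ne by auto
  note w = D_swap[OF t n(1) p2]
  have "ph (al i) = dyn (id(n - 1 := n, n := n - 1)) (al i)" if "i : I" for i
   using idx[OF that] low v ta(3)[OF m(2)] ta(3)[OF m(3)] w(5,6,7) by (elim disjE) simp_all
  then have "ph = dyn (id(n - 1 := n, n := n - 1))" by (rule Aut_dynkin_eqI[OF ph w(1)])
  then show ?thesis ..
 qed
qed

lemma type_D_even:
 assumes t: "has_type n al Type_D" and n: "even n" "n > 4"
 defines "ph0 \<equiv> dyn (id(n - 1 := n, n := n - 1))"
 shows "generated_by_involutions G {ph0, omega (n - 1)}"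
proof (rule generated_by_involutionsI)
 obtain p where p: "n = p + 2" "p >= 3"
 proof
  show "n = (n - 2) + 2" "n - 2 >= 3" using n(2) by auto
 qed
 have p2: "p >= 2" and n1: "n - 1 = p + 1" using p by auto
 note w = D_swap[OF t p(1) p2, folded ph0_def]
 let ?\<omega> = "omega (n - 1)"
 let ?R = "{ph0, ?\<omega>}"
 have m: "p + 1 : I" using p by (auto simp: ivl_iff)
 have mk1: "mk (p + 1) = 1" by (rule D_minuscule(1)[OF t p(1) p2])
 obtain q where q: "p = 2 * q" using n(1) p(1) by auto
 have "(2 * real (q + 1) - real p) *\<^sub>R cw (p + 1) + (2 * real q - real p) *\<^sub>R cw (p + 2) : Qv"
  by (rule D_relation[OF t p(1) p2]) (simp_all add: q)
 then have Q: "2 *\<^sub>R cw (p + 1) : Qv" by (simp add: q)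
 have o: "?\<omega> : Aut_region A & ?\<omega> ~= id & ?\<omega> o ?\<omega> = id" unfolding n1 by (rule omega_involution[OF m mk1 Q])
 show R: "r : Aut_region A & r ~= id & r o r = id" if "r : ?R" for r
 proof -
  have "involution ph0" "involution ?\<omega>"
   unfolding involution_def by (intro conjI w(4) w(3) w(2)) (rule o)
  then show ?thesis using that unfolding involution_def[symmetric] by auto
 qed
 have H: "subgroup (generate G ?R) G" by (rule subgroup_generate) (use R in blast)
 have in_H: "ph0 : generate G ?R" "?\<omega> : generate G ?R" by (rule generate.incl, simp)+
 show "AutDyn \<subseteq> generate G ?R"
  using D_dynkin[OF t p, folded ph0_def] in_H gen_id by blast
 have r1: "reach (generate G ?R) (cw (p + 1))" by (rule reach_omega[OF m mk1]) (use in_H n1 in simp)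
 have r2: "reach (generate G ?R) (cw (p + 2))" using reach_conj[OF H w(1,2) in_H(1) r1] w(8) by simp
 show "reach (generate G ?R) (cw i)" if "i : I" for i by (rule D_reach[OF t p(1) p2 H r1 r2 that])
qed

lemma type_D_odd:
 assumes t: "has_type n al Type_D" and n: "odd n" "n >= 5"
 defines "ph0 \<equiv> dyn (id(n - 1 := n, n := n - 1))"
 shows "generated_by_involutions G {ph0, ph0 o omega n}"
proof (rule generated_by_involutionsI)
 obtain p where p: "n = p + 2" "p >= 3"
 proof
  show "n = (n - 2) + 2" "n - 2 >= 3" using n(2) by auto
 qed
 have p2: "p >= 2" using p by auto
 note w = D_swap[OF t p(1) p2, folded ph0_def]
 let ?\<omega> = "omega n"
 let ?R = "{ph0, ph0 o ?\<omega>}"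
 have m: "p + 2 : I" using p by (auto simp: ivl_iff)
 have mk1: "mk (p + 2) = 1" by (rule D_minuscule(2)[OF t p(1) p2])
 obtain q where q: "p = 2 * q + 1" using n(1) p(1) by (auto elim!: oddE)
 have "(2 * real (q + 1) - real p) *\<^sub>R cw (p + 1) + (2 * real (q + 1) - real p) *\<^sub>R cw (p + 2) : Qv"
  by (rule D_relation[OF t p(1) p2]) (simp_all add: q)
 then have Q: "ph0 (cw (p + 2)) + cw (p + 2) : Qv" unfolding w(9) by (simp add: q)
 have o: "ph0 o ?\<omega> : Aut_region A & ph0 o ?\<omega> ~= id & (ph0 o ?\<omega>) o (ph0 o ?\<omega>) = id"
  using Aut_dynkin_omega_involution(1)[OF m mk1 w(1,2) Q] unfolding p(1)[symmetric] .
 show R: "r : Aut_region A & r ~= id & r o r = id" if "r : ?R" for r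
 proof -
  have "involution ph0" "involution (ph0 o ?\<omega>)"
   unfolding involution_def by (intro conjI w(4) w(3) w(2)) (rule o)
  then show ?thesis using that unfolding involution_def[symmetric] by auto
 qed
 have H: "subgroup (generate G ?R) G" by (rule subgroup_generate) (use R in blast)
 have in_H: "ph0 : generate G ?R" "ph0 o ?\<omega> : generate G ?R" by (rule generate.incl, simp)+
 show "AutDyn \<subseteq> generate G ?R"
  using D_dynkin[OF t p, folded ph0_def] in_H gen_id by blast
 have "ph0 o (ph0 o ?\<omega>) = ?\<omega>" by (simp only: o_assoc w(2) id_comp)
 then have "?\<omega> : generate G ?R" using gen_comp[OF in_H] by simp
 then have r2: "reach (generate G ?R) (cw (p + 2))" by (intro reach_omega[OF m mk1]) (simp only: p(1)[symmetric])
 have r1: "reach (generate G ?R) (cw (p + 1))" using reach_conj[OF H w(1,2) in_H(1) r2] w(9) by simp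
 show "reach (generate G ?R) (cw i)" if "i : I" for i by (rule D_reach[OF t p(1) p2 H r1 r2 that])
qed

text \<open>The leaves 1, 3 and 4 are equivalent, and \<open>ph0\<close> and \<open>ph1\<close>
  generate their permutations. Automorphisms fixing \<open>al 1\<close> are listed in
  \<open>fix1\<close>; the others are reduced to these by composing with \<open>ph1\<close>, and
  with \<open>ph0\<close> before if \<open>al 1\<close> goes to \<open>al 4\<close>.\<close>

lemma type_D4:
 assumes t: "has_type n al Type_D" and n: "n = 4"
 defines "ph0 \<equiv> dyn (id(3 := 4, 4 := 3))" and "ph1 \<equiv> dyn (id(1 := 3, 3 := 1))"
 shows "generated_by_involutions G {ph0, ph1, omega 1}"
proof (rule generated_by_involutionsI)
 have p: "n = 2 + 2" "(2::nat) >= 2" using n by auto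
 let ?sg = "id(1 := 3, 3 := 1) :: nat => nat" and ?\<omega> = "omega 1"
 let ?R = "{ph0, ph1, ?\<omega>}"
 have "n - 1 = 3" using n by simp
 then have phi0: "ph0 = dyn (id(n - 1 := n, n := n - 1))" unfolding ph0_def using n by simp
 have num: "(2::nat) + 1 = 3" "(2::nat) + 2 = 4" by simp_all
 note w = D_swap[OF t p, folded phi0, unfolded num]
 have idx: "i = 1 | i = 2 | i = 3 | i = 4" if "i : I" for i
  using that n by (simp add: ivl_iff) linarith
 have mem: "1 : I" "2 : I" "3 : I" "4 : I" using n by (auto simp: ivl_iff)
 have s: "?sg i : I" "?sg (?sg i) = i" if "i : I" for i
  using idx[OF that] mem by (elim disjE; simp)+
 have sE: "list_all (%i. list_all (%j. D_adj 2 ((id(1 := 3, 3 := 1)) i) ((id(1 := 3, 3 := 1)) j)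
   = D_adj 2 i j & ((id(1 := 3, 3 := 1)) i = (id(1 := 3, 3 := 1)) j) = (i = j)) [1,2,3,4]) [1,2,3,4::nat]"
  by code_simp
 have c: "cartan Type_D (?sg i) (?sg j) = cartan Type_D i j" if ij: "i : I" "j : I" for i j
 proof -
  have "i : set [1,2,3,4]" "j : set [1,2,3,4]" using idx[OF ij(1)] idx[OF ij(2)] by auto
  then have "D_adj 2 (?sg i) (?sg j) = D_adj 2 i j & (?sg i = ?sg j) = (i = j)" using sE unfolding list_all_iff by blast
  then show ?thesis
   unfolding cartan_D[OF ij p] cartan_D[OF s(1)[OF ij(1)] s(1)[OF ij(2)] p] by simp
 qed
 have sym: "diagram_symmetry Type_D n ?sg" unfolding diagram_symmetry_def using s c by blast
 have "?sg 1 ~= 1" by simp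
 note d = diagram_involution[OF t disjI2[OF disjI1[OF HOL.refl]] sym mem(1) this, folded ph1_def]
 have sv: "?sg 1 = 3" "?sg 3 = 1" "?sg 2 = 2" "?sg 4 = 4" by simp_all
 have p1: "ph1 (al 1) = al 3" "ph1 (al 3) = al 1" "ph1 (al 2) = al 2" "ph1 (al 4) = al 4" "ph1 (cw 1) = cw 3" "ph1 (cw 3) = cw 1"
  unfolding d(2)[OF mem(1)] d(2)[OF mem(2)] d(2)[OF mem(3)] d(2)[OF mem(4)] d(5)[OF mem(1)] d(5)[OF mem(3)] sv by (rule HOL.refl)+
 have p0: "ph0 (al 1) = al 1" "ph0 (al 2) = al 2" "ph0 (al 3) = al 4" "ph0 (al 4) = al 3"
  using w(5)[of 1] w(5)[of 2] w(6,7) by simp_all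
 have mk1: "mk 1 = 1" using mk_dynkin[OF d(1) mem(1,3) p1(5)] D_minuscule(1)[OF t p] by simp
 have Q: "2 *\<^sub>R cw 1 : Qv"
 \<comment> \<open>The coroot coordinates of \<open>2 cw 1\<close>.\<close>
 proof (rule Qv_by_type[where k = "%j. if j <= 2 then 2 else 1"])
  fix i assume i: "i : I"
  show "(2 *\<^sub>R cw 1) \<bullet> al i = (\<Sum>j\<in>I. (al i \<bullet> coroot (al j)) * (if j <= 2 then 2 else 1))"
   unfolding D_row[OF t p i] inner_scaleR_left coweight_simple[OF mem(1) i]
   using idx[OF i] by (elim disjE) simp_all
 qed simp
 have o: "?\<omega> : Aut_region A & ?\<omega> ~= id & ?\<omega> o ?\<omega> = id" by (rule omega_involution[OF mem(1) mk1 Q])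
 show R: "r : Aut_region A & r ~= id & r o r = id" if "r : ?R" for r
 proof -
  have "involution ph0" "involution ph1" "involution ?\<omega>"
   unfolding involution_def by (intro conjI w(4) w(3) w(2), intro conjI d(6) d(4) d(3), rule o)
  then show ?thesis using that unfolding involution_def[symmetric] by auto
 qed
 let ?H = "generate G ?R"
 have H: "subgroup ?H G" by (rule subgroup_generate) (use R in blast)
 have in_H: "ph0 : ?H" "ph1 : ?H" "?\<omega> : ?H" by (rule generate.incl, simp)+
 have fix1: "ph : ?H" if ph: "ph : AutDyn" "ph (al 1) = al 1" for ph
 proof -
  obtain ta where ta: "bij_betw ta I I" "!!i. i : I ==> ta i : I"
   "!!i. i : I ==> ph (al i) = al (ta i)"
   "!!i j. i : I ==> j : I ==> D_adj 2 i j ==> D_adj 2 (ta i) (ta j)"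
   "!!i j. i : I ==> j : I ==> ta i = ta j ==> i = j" "ta 2 = 2"
   "!!i. i : {2 + 1, 2 + 2} ==> ta i = 1 | ta i = 2 + 1 | ta i = 2 + 2"
   using D_dynkin_branch[OF t p ph(1)] by blast
  have "ta 1 = 1"
   using inj_onD[OF inj_simple _ ta(2)[OF mem(1)] mem(1)] ta(3)[OF mem(1)] ph(2) by simp
  then have t3: "ta 3 = 3 | ta 3 = 4" and t4: "ta 4 = 3 | ta 4 = 4" and ne: "ta 3 ~= ta 4"
   using idx[OF ta(2)[OF mem(3)]] idx[OF ta(2)[OF mem(4)]] ta(5)[OF mem(3,1)] ta(5)[OF mem(3,2)]
    ta(5)[OF mem(4,1)] ta(5)[OF mem(4,2)] ta(5)[OF mem(3,4)] ta(6) by auto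
  show ?thesis
  proof (cases "ta 3 = 3")
   case True
   then have "ta 4 = 4" using t4 ne by auto
   then have "ph (al i) = al i" if i: "i : I" for i
    unfolding ta(3)[OF i] using idx[OF i] True \<open>ta 1 = 1\<close> ta(6) by (elim disjE) simp_all
   then have "ph = id" by (rule Aut_dynkin_idI[OF ph(1)])
   then show ?thesis using gen_id by simp
  next
   case False
   then have "ta 3 = 4" "ta 4 = 3" using t3 t4 ne by auto
   then have "ph (al i) = ph0 (al i)" if i: "i : I" for i
    unfolding ta(3)[OF i] using idx[OF i] p0 \<open>ta 1 = 1\<close> ta(6) by (elim disjE) simp_all
   then have "ph = ph0" by (rule Aut_dynkin_eqI[OF ph(1) w(1)])
   then show ?thesis using in_H by simp
  qed
 qed
 have fix3: "ph : ?H" if ph: "ph : AutDyn" "ph (al 1) = al 3" for ph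
 proof -
  have "ph1 o ph : ?H" by (rule fix1[OF Aut_dynkin_comp[OF d(1) ph(1)]]) (simp add: ph(2) p1)
  then have "ph1 o (ph1 o ph) : ?H" by (rule gen_comp[OF in_H(2)])
  moreover have "ph1 o (ph1 o ph) = ph" by (simp only: o_assoc d(3) id_comp)
  ultimately show ?thesis by simp
 qed
 show "AutDyn \<subseteq> ?H"
 proof
  fix ph assume ph: "ph : AutDyn"
  obtain ta where ta: "bij_betw ta I I" "!!i. i : I ==> ta i : I"
   "!!i. i : I ==> ph (al i) = al (ta i)"
   "!!i j. i : I ==> j : I ==> D_adj 2 i j ==> D_adj 2 (ta i) (ta j)"
   "!!i j. i : I ==> j : I ==> ta i = ta j ==> i = j" "ta 2 = 2"
   "!!i. i : {2 + 1, 2 + 2} ==> ta i = 1 | ta i = 2 + 1 | ta i = 2 + 2"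
   using D_dynkin_branch[OF t p ph] by blast
  have "ta 1 = 1 | ta 1 = 3 | ta 1 = 4" using idx[OF ta(2)[OF mem(1)]] ta(5)[OF mem(1,2)] ta(6) by auto
  then have "ph (al 1) = al 1 | ph (al 1) = al 3 | ph (al 1) = al 4" using ta(3)[OF mem(1)] by auto
  then show "ph : ?H"
  proof (elim disjE)
   assume "ph (al 1) = al 4"
   then have "ph0 o ph : ?H" by (intro fix3 Aut_dynkin_comp[OF w(1) ph]) (simp add: p0)
   then have "ph0 o (ph0 o ph) : ?H" by (rule gen_comp[OF in_H(1)])
   moreover have "ph0 o (ph0 o ph) = ph" by (simp only: o_assoc w(2) id_comp)
   ultimately show ?thesis by simp
  qed (use fix1[OF ph] fix3[OF ph] in simp_all)
 qed
 have r1: "reach ?H (cw 1)" by (rule reach_omega[OF mem(1) mk1 in_H(3)])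
 have r3: "reach ?H (cw (2 + 1))" using reach_conj[OF H d(1,3) in_H(2) r1] p1(5) by simp
 have r4: "reach ?H (cw (2 + 2))" using reach_conj[OF H w(1,2) in_H(1) r3] w(8) by simp
 show "reach ?H (cw i)" if "i : I" for i by (rule D_reach[OF t p H r3 r4 that])
qed

end

theorem theoremA:
  fixes \<Phi> :: "'a::euclidean_space set" and n :: nat and \<alpha> :: "nat \<Rightarrow> 'a"
  assumes "crystallographic_root_system \<Phi>" and "reduced_system \<Phi>" and "irreducible_system \<Phi>"
    and "simple_roots \<Phi> n \<alpha>"
  shows
    "let AutA = Aut_region (fund_alcove \<Phi> n \<alpha>);
         G = comp_group AutA;
         \<omega> = omega_elt \<Phi> n \<alpha>;
         \<phi> = dynkin_aut \<Phi> n \<alpha>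
     in
       \<comment> \<open>(i)\<close>
       Aut_region (weyl_chamber n \<alpha>) = Aut_coxeter_diagram n \<alpha> \<and>
       \<comment> \<open>(ii)\<close>
       group G \<and> group (comp_group (Aut_affine_dynkin \<Phi> n \<alpha>)) \<and>
       linear_part \<in> iso G (comp_group (Aut_affine_dynkin \<Phi> n \<alpha>)) \<and>
       Aut_dynkin \<Phi> n \<alpha> \<subseteq> AutA \<and>
       (\<forall>\<psi>\<in>Aut_dynkin \<Phi> n \<alpha>. linear_part \<psi> = \<psi>) \<and>
       \<comment> \<open>(iii)\<close>
       internal_semidirect G (fund_group \<Phi> n \<alpha>) (Aut_dynkin \<Phi> n \<alpha>) \<and>
       \<comment> \<open>(iv)\<close>
       is_coxeter_group G \<and>
       (has_type n \<alpha> Type_A \<and> n = 1 \<longrightarrow> generated_by_involutions G {\<omega> 1}) \<and>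
       (has_type n \<alpha> Type_A \<and> n \<ge> 2 \<longrightarrow>
          (let \<phi>0 = \<phi> (\<lambda>i. n + 1 - i) in generated_by_involutions G {\<phi>0, \<omega> 1 \<circ> \<phi>0})) \<and>
       (has_type n \<alpha> Type_B \<and> n = 2 \<longrightarrow> generated_by_involutions G {\<omega> 2}) \<and>
       (has_type n \<alpha> Type_B \<and> n \<ge> 3 \<longrightarrow> generated_by_involutions G {\<omega> 1}) \<and>
       (has_type n \<alpha> Type_C \<and> n \<ge> 3 \<longrightarrow> generated_by_involutions G {\<omega> n}) \<and>
       (has_type n \<alpha> Type_D \<and> n = 4 \<longrightarrow>
          (let \<phi>0 = \<phi> (id(3 := 4, 4 := 3)); \<phi>1 = \<phi> (id(1 := 3, 3 := 1))
           in generated_by_involutions G {\<phi>0, \<phi>1, \<omega> 1})) \<and>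
       (has_type n \<alpha> Type_D \<and> even n \<and> n > 4 \<longrightarrow>
          (let \<phi>0 = \<phi> (id(n - 1 := n, n := n - 1))
           in generated_by_involutions G {\<phi>0, \<omega> (n - 1)})) \<and>
       (has_type n \<alpha> Type_D \<and> odd n \<and> n \<ge> 5 \<longrightarrow>
          (let \<phi>0 = \<phi> (id(n - 1 := n, n := n - 1))
           in generated_by_involutions G {\<phi>0, \<phi>0 \<circ> \<omega> n})) \<and>
       (has_type n \<alpha> Type_E \<and> n = 6 \<longrightarrow>
          (let \<phi>0 = \<phi> (id(1 := 6, 6 := 1, 3 := 5, 5 := 3))
           in generated_by_involutions G {\<phi>0, \<phi>0 \<circ> \<omega> 6})) \<and>
       (has_type n \<alpha> Type_E \<and> n = 7 \<longrightarrow> generated_by_involutions G {\<omega> 7}) \<and>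
       (has_type n \<alpha> Type_E \<and> n = 8 \<or> has_type n \<alpha> Type_F \<and> n = 4 \<or>
        has_type n \<alpha> Type_G \<and> n = 2 \<longrightarrow> generated_by_involutions G {})"
proof -
  interpret root_base \<Phi> n \<alpha> by unfold_locales (fact assms)+
  show ?thesis
    unfolding Let_def
    using Aut_chamber group_Aut_region[of A] group_Aut_affine linear_part_iso Aut_dynkin_alcove linear_part_dynkin
      Aut_alcove_semidirect is_coxeter_group_Aut_alcove
    by (intro conjI impI)
      (blast, assumption, assumption, assumption, blast, blast, assumption, assumption,
        (elim conjE disjE; (rule type_A1 type_A type_B2 type_B type_C type_D4 type_D_even type_D_odd
          type_E6 type_E7 type_E8 type_F4 type_G2; assumption))+)
qed

end
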